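(* For $\varepsilon>0$ small enough, there exists a constant $C>0$, independent of $\varepsilon$, such that for all $\gamma>-2$, $$\Big\|\big(\tfrac{1}{\varepsilon^\gamma}\mathcal{A}_\varepsilon+I\big)^{-1}-\big(\tfrac{1}{\varepsilon^\gamma}\mathcal{A}^{\rm hom}+I\big)^{-1}\Xi_\varepsilon\Big\|_{L^2(\mathbb{R}^3;\mathbb{R}^3)\to L^2(\mathbb{R}^3;\mathbb{R}^3)}\le C\varepsilon^{\frac{\gamma+2}{2}}.$$
   Context: $Y=[0,1)^3$, $Y'=[-\pi,\pi)^3$. The tensor $\mathbb{A}:\mathbb{R}^3\to\mathbb{R}^{3\times3\times3\times3}$ is $\mathbb{Z}^3$-periodic with $L^\infty$ entries, satisfies $\mathbb{A}^{ik}_{jl}=\mathbb{A}^{jk}_{il}=\mathbb{A}^{ki}_{lj}$ and $\nu|\xi|^2\le\mathbb{A}(y)\xi:\xi\le\nu^{-1}|\xi|^2$ for real symmetric $\xi$ ($(\mathbb{A}B)^i_j=\sum_{k,l}\mathbb{A}^{ik}_{jl}B^k_l$, $A:\bar B=\sum A^i_j\overline{B^i_j}$). $\mathcal{A}_\varepsilon$ is the nonnegative self-adjoint operator on $L^2(\mathbb{R}^3;\mathbb{C}^3)$ of the form $\int\mathbb{A}(x/\varepsilon)\operatorname{sym}\nabla u:\overline{\operatorname{sym}\nabla v}$ on $H^1(\mathbb{R}^3;\mathbb{C}^3)$; operators are restricted to real-valued functions. Homogenized tensor: for real symmetric $\xi$, let $u^\xi$ be the mean-zero periodic $H^1(Y;\mathbb{R}^3)$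 solution of $\int_Y\mathbb{A}(\xi+\operatorname{sym}\nabla u^\xi):\operatorname{sym}\nabla v=0$ for all real periodic $v\in H^1$; $\mathbb{A}^{\rm hom}\xi:\zeta=\int_Y\mathbb{A}(\xi+\operatorname{sym}\nabla u^\xi):\zeta$. $\mathcal{A}^{\rm hom}=(\operatorname{sym}\nabla)^*\mathbb{A}^{\rm hom}\operatorname{sym}\nabla$ with domain $H^2(\mathbb{R}^3;\mathbb{C}^3)$. $\mathcal{G}_\varepsilon$ is the unitary scaled Gelfand transform $(\mathcal{G}_\varepsilon u)(y,\chi)=(\varepsilon/2\pi)^{3/2}\sum_{n\in\mathbb{Z}^3}e^{-i\chi\cdot(y+n)}u(\varepsilon(y+n))$ onto $L^2(Y';L^2(Y;\mathbb{C}^3))$; $S u=\int_Yu$ (a constant function); the smoothing operator is $\Xi_\varepsilon=\mathcal{G}_\varepsilon^*(\int^\oplus_{Y'}S\,d\chi)\mathcal{G}_\varepsilon$ (equivalently, the Fourier multiplier by the indicator of $(2\pi\varepsilon)^{-1}Y'$); it maps real-valued functions to real-valued functions. *)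

theory Defs
  imports "HOL-Analysis.Analysis"
begin

type_synonym vec3 = "real^3"
type_synonym mat3 = "real^3^3"
(* A fourth order tensor; T i k j l denotes the component A^{ik}_{jl}. *)
type_synonym tensor4 = "3 \<Rightarrow> 3 \<Rightarrow> 3 \<Rightarrow> 3 \<Rightarrow> real"

definition tapply :: "tensor4 \<Rightarrow> mat3 \<Rightarrow> mat3" where
  "tapply T B = (\<chi> i j. \<Sum>k\<in>UNIV. \<Sum>l\<in>UNIV. T i k j l * B $ k $ l)"

definition frob :: "mat3 \<Rightarrow> mat3 \<Rightarrow> real" where
  "frob A B = (\<Sum>i\<in>UNIV. \<Sum>j\<in>UNIV. A $ i $ j * B $ i $ j)"

definition symm :: "mat3 \<Rightarrow> mat3" where
  "symm M = (1/2) *\<^sub>R (M + transpose M)"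

definition lattice :: "vec3 set" where
  "lattice = {n. \<forall>i. n $ i \<in> \<int>}"

definition cellY :: "vec3 set" where
  "cellY = {y. \<forall>i. 0 \<le> y $ i \<and> y $ i < 1}"

definition freq_box :: "real \<Rightarrow> vec3 set" where
  "freq_box \<epsilon> = {\<xi>. \<forall>i. - pi / \<epsilon> \<le> \<xi> $ i \<and> \<xi> $ i < pi / \<epsilon>}"

fun dpart :: "3 list \<Rightarrow> (vec3 \<Rightarrow> real) \<Rightarrow> vec3 \<Rightarrow> real" where
  "dpart [] \<phi> = \<phi>"
| "dpart (j # js) \<phi> = (\<lambda>x. frechet_derivative (dpart js \<phi>) (at x) (axis j 1))"

definition test_fun :: "(vec3 \<Rightarrow> real) \<Rightarrow> bool" where
  "test_fun \<phi> \<longleftrightarrow> (\<forall>js x. dpart js \<phi> differentiable (at x))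
      \<and> compact (closure {x. \<phi> x \<noteq> 0})"

definition loc_int :: "(vec3 \<Rightarrow> real) \<Rightarrow> bool" where
  "loc_int g \<longleftrightarrow> (\<forall>K. compact K \<longrightarrow> set_integrable lborel K g)"

definition weak_grad :: "(vec3 \<Rightarrow> vec3) \<Rightarrow> (vec3 \<Rightarrow> mat3) \<Rightarrow> bool" where
  "weak_grad u G \<longleftrightarrow>
     (\<forall>i. loc_int (\<lambda>x. u x $ i)) \<and> (\<forall>i j. loc_int (\<lambda>x. G x $ i $ j)) \<and>
     (\<forall>\<phi> i j. test_fun \<phi> \<longrightarrow>
        (\<integral>x. u x $ i * dpart [j] \<phi> x \<partial>lborel) = - (\<integral>x. G x $ i $ j * \<phi> x \<partial>lborel))"

definition L2 :: "(vec3 \<Rightarrow> 'b::euclidean_space) \<Rightarrow> bool" where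
  "L2 g \<longleftrightarrow> g \<in> borel_measurable lborel \<and> integrable lborel (\<lambda>x. (norm (g x))\<^sup>2)"

definition L2_on :: "vec3 set \<Rightarrow> (vec3 \<Rightarrow> 'b::euclidean_space) \<Rightarrow> bool" where
  "L2_on S g \<longleftrightarrow> g \<in> borel_measurable lborel \<and> set_integrable lborel S (\<lambda>x. (norm (g x))\<^sup>2)"

definition H1 :: "(vec3 \<Rightarrow> vec3) \<Rightarrow> (vec3 \<Rightarrow> mat3) \<Rightarrow> bool" where
  "H1 u G \<longleftrightarrow> L2 u \<and> L2 G \<and> weak_grad u G"

definition periodic :: "(vec3 \<Rightarrow> 'b) \<Rightarrow> bool" where
  "periodic g \<longleftrightarrow> (\<forall>x n. n \<in> lattice \<longrightarrow> g (x + n) = g x)"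

definition H1per :: "(vec3 \<Rightarrow> vec3) \<Rightarrow> (vec3 \<Rightarrow> mat3) \<Rightarrow> bool" where
  "H1per u G \<longleftrightarrow> periodic u \<and> periodic G \<and> L2_on cellY u \<and> L2_on cellY G \<and> weak_grad u G"

definition corrector :: "(vec3 \<Rightarrow> tensor4) \<Rightarrow> mat3 \<Rightarrow> (vec3 \<Rightarrow> vec3) \<times> (vec3 \<Rightarrow> mat3)" where
  "corrector A \<xi> = (SOME (u, G). H1per u G \<and> set_lebesgue_integral lborel cellY u = 0 \<and>
      (\<forall>v H. H1per v H \<longrightarrow>
         (LINT y:cellY|lborel. frob (tapply (A y) (\<xi> + symm (G y))) (symm (H y))) = 0))"

(* bilinear form  A^hom xi : zeta  (for symmetric xi, zeta) *)
definition Ahom :: "(vec3 \<Rightarrow> tensor4) \<Rightarrow> mat3 \<Rightarrow> mat3 \<Rightarrow> real" where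
  "Ahom A \<xi> \<zeta> = (LINT y:cellY|lborel.
      frob (tapply (A y) (\<xi> + symm (snd (corrector A \<xi>) y))) \<zeta>)"

section \<open>Resolvents (defined through the closed forms, restricted to real functions)\<close>

definition res_eps :: "(vec3 \<Rightarrow> tensor4) \<Rightarrow> real \<Rightarrow> real \<Rightarrow> (vec3 \<Rightarrow> vec3) \<Rightarrow> vec3 \<Rightarrow> vec3" where
  "res_eps A \<epsilon> \<gamma> f = fst (SOME (u, G). H1 u G \<and>
     (\<forall>v H. H1 v H \<longrightarrow>
        \<epsilon> powr (-\<gamma>) * (\<integral>x. frob (tapply (A ((1/\<epsilon>) *\<^sub>R x)) (symm (G x))) (symm (H x)) \<partial>lborel)
        + (\<integral>x. u x \<bullet> v x \<partial>lborel) = (\<integral>x. f x \<bullet> v x \<partial>lborel)))"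

definition res_hom :: "(vec3 \<Rightarrow> tensor4) \<Rightarrow> real \<Rightarrow> real \<Rightarrow> (vec3 \<Rightarrow> vec3) \<Rightarrow> vec3 \<Rightarrow> vec3" where
  "res_hom A \<epsilon> \<gamma> f = fst (SOME (u, G). H1 u G \<and>
     (\<forall>v H. H1 v H \<longrightarrow>
        \<epsilon> powr (-\<gamma>) * (\<integral>x. Ahom A (symm (G x)) (symm (H x)) \<partial>lborel)
        + (\<integral>x. u x \<bullet> v x \<partial>lborel) = (\<integral>x. f x \<bullet> v x \<partial>lborel)))"

(* kernel of the Fourier multiplier by the indicator of (2 pi eps)^{-1} Y'
   (angular frequencies in (1/eps) Y'):  K(z) = (2 pi)^{-3} int_{(1/eps)Y'} e^{i xi.z} d xi *)
definition Xi_kernel :: "real \<Rightarrow> vec3 \<Rightarrow> real" where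
  "Xi_kernel \<epsilon> z = (1 / (2 * pi) ^ 3) * (LINT \<xi>:freq_box \<epsilon>|lborel. cos (\<xi> \<bullet> z))"

definition Xi :: "real \<Rightarrow> (vec3 \<Rightarrow> vec3) \<Rightarrow> vec3 \<Rightarrow> vec3" where
  "Xi \<epsilon> f x = (\<integral>w. Xi_kernel \<epsilon> (x - w) *\<^sub>R f w \<partial>lborel)"

end

theory Submission imports Defs "HOL-Probability.Probability" begin

text \<open>Rescaling by \<open>\<epsilon>\<close> turns the claim into an estimate of order \<open>1 / sqrt \<tau>\<close> for the problems
  \<open>u - \<tau> div(A sym grad u) = f\<close> with the unscaled periodic tensor, where \<open>\<tau> = \<epsilon> powr (-\<gamma> - 2)\<close>; the smoothing
  operator becomes the Fourier projection onto \<open>[-\<pi>, \<pi>)\<^sup>3\<close>. That projection differs from the identity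
  by an operator bounded from \<open>H\<^sup>1\<close> to \<open>L\<^sup>2\<close>, so it may be replaced by the identity at the right order.

  The homogenized solution \<open>u\<^sub>0\<close> is compared with \<open>u\<close> through a two-scale expansion whose corrector term is
  multiplied by a local average of \<open>sym grad u\<^sub>0\<close>. Its residual is the pairing of the averaged
  gradient with a mean-zero divergence-free periodic flux; it is controlled by the translation modulus of \<open>grad u\<^sub>0\<close>,
  which is of order \<open>1 / \<tau>\<close> by the translation form of \<open>H\<^sup>2\<close> regularity. Weak derivatives are
  characterised by averaged difference quotients, and Parseval's identity follows from Gaussian
  regularisation of correlations.\<close>

section \<open>Square integrable functions\<close>

text \<open>The corrector gradient and the flux are only square integrable over a cell, so their
  product with a general L2 factor need not lie in L2. The factor is therefore a Steklov average
  over a full cell: integrating over the shift first decouples it from the periodic function, and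
  the norm of the product is bounded by the product of the norms. A cell average of an L2 function
  need not be C1, while integration by parts is carried out against C1 factors; hence a smooth
  convolution is applied before the cell average. No skew-symmetric flux potential is built.
  Solenoidality moves the derivative onto the smoothed factor, and the zero mean of the flux turns
  the test function into an increment, which costs one gradient norm. Powers of \<tau>: the equation
  multiplies the residual by \<tau>, which cancels the 1/\<tau> of the modulus, while the corrector
  term itself is of size 1/sqrt \<tau> in L2. Absorbing both into the energy leaves 1/sqrt \<tau>.
  Since weak derivatives appear as averaged difference quotients, Korn's inequality and the
  translation bounds are proved once for the whole space and the torus.\<close>

lemmas bi_integrable_add = Bochner_Integration.integrable_add
  and bi_integrable_bound = Bochner_Integration.integrable_bound
  and bi_integrable_cong = Bochner_Integration.integrable_cong
  and bi_integrable_diff = Bochner_Integration.integrable_diff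
  and bi_integrable_sum = Bochner_Integration.integrable_sum
  and bi_integral_add = Bochner_Integration.integral_add
  and bi_integral_cong = Bochner_Integration.integral_cong
  and bi_integral_diff = Bochner_Integration.integral_diff
  and bi_integral_nonneg = Bochner_Integration.integral_nonneg
  and bi_integral_sum = Bochner_Integration.integral_sum

definition sqi :: "'a measure \<Rightarrow> ('a \<Rightarrow> 'b::euclidean_space) \<Rightarrow> bool" where
  "sqi M f \<longleftrightarrow> f \<in> borel_measurable M \<and> integrable M (\<lambda>x. (norm (f x))\<^sup>2)"

abbreviation bmeas :: "('a::topological_space \<Rightarrow> 'b::topological_space) set" where "bmeas \<equiv> borel_measurable borel"

definition l2n :: "'a measure \<Rightarrow> ('a \<Rightarrow> 'b::euclidean_space) \<Rightarrow> real" where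
  "l2n M f = sqrt (\<integral>x. (norm (f x))\<^sup>2 \<partial>M)"

abbreviation nl2 :: "('a::euclidean_space \<Rightarrow> 'b::euclidean_space) \<Rightarrow> real" where "nl2 \<equiv> l2n lborel"

abbreviation sq2 :: "('a::euclidean_space \<Rightarrow> 'b::euclidean_space) \<Rightarrow> bool" where "sq2 \<equiv> sqi lborel"

abbreviation iball :: "real \<Rightarrow> vec3 \<Rightarrow> 'a::zero_neq_one" where "iball r \<equiv> indicator (cball 0 r)"

lemma l2n_nonneg [simp]: "0 \<le> l2n M f"
  by (simp add: l2n_def)

lemma l2n_sq: "(l2n M f)\<^sup>2 = (\<integral>x. (norm (f x))\<^sup>2 \<partial>M)"
  by (simp add: l2n_def)

lemma sqi_measurable [dest, measurable_dest]: "sqi M f \<Longrightarrow> f \<in> borel_measurable M"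
  by (simp add: sqi_def)

lemma sqi_integrable_sq: "sqi M f \<Longrightarrow> integrable M (\<lambda>x. (norm (f x))\<^sup>2)"
  by (simp add: sqi_def)

lemma nn_sqi: "sqi M f \<Longrightarrow> (\<integral>\<^sup>+x. ennreal ((norm (f x))\<^sup>2) \<partial>M) = ennreal ((l2n M f)\<^sup>2)"
  unfolding l2n_sq by (rule nn_integral_eq_integral) (auto simp: sqi_def)

text \<open>Membership and norm bound come from one nonnegative integral, where Tonelli applies
  without integrability side conditions. Many of the L2 estimates below end with this rule.\<close>

lemma sqi_nnI:
  assumes "f \<in> borel_measurable M" "(\<integral>\<^sup>+x. ennreal ((norm (f x))\<^sup>2) \<partial>M) \<le> ennreal (c\<^sup>2)" "0 \<le> c"
  shows "sqi M f" "l2n M f \<le> c"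
proof -
  show s: "sqi M f"
    unfolding sqi_def using assms(1,2)
    by (auto intro!: integrableI_bounded simp: le_less_trans[OF _ ennreal_less_top])
  have "ennreal ((l2n M f)\<^sup>2) \<le> ennreal (c\<^sup>2)"
    using assms(2) nn_sqi[OF s] by simp
  then have "(l2n M f)\<^sup>2 \<le> c\<^sup>2" by simp
  then show "l2n M f \<le> c" using assms(3) by (rule power2_le_imp_le)
qed

lemma l2n_dominated:
  fixes u :: "nat \<Rightarrow> 'a \<Rightarrow> 'b::euclidean_space" and w :: "'a \<Rightarrow> 'c::euclidean_space"
  assumes w: "sqi M w" and [measurable]: "\<And>n. u n \<in> borel_measurable M"
    and b: "\<And>n. AE x in M. norm (u n x) \<le> norm (w x)" and l: "AE x in M. (\<lambda>n. u n x) \<longlonglongrightarrow> 0"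
  shows "(\<lambda>n. l2n M (u n)) \<longlonglongrightarrow> 0"
proof -
  have "(\<lambda>n. \<integral>x. (norm (u n x))\<^sup>2 \<partial>M) \<longlonglongrightarrow> (\<integral>x. 0 \<partial>M)"
  proof (rule integral_dominated_convergence[where w="\<lambda>x. (norm (w x))\<^sup>2"])
    show "AE x in M. (\<lambda>n. (norm (u n x))\<^sup>2) \<longlonglongrightarrow> 0"
      using l
    proof eventually_elim
      case (elim x) from tendsto_power[OF tendsto_norm[OF elim], of 2] show ?case by simp
    qed
    show "AE x in M. norm ((norm (u n x))\<^sup>2) \<le> (norm (w x))\<^sup>2" for n
      using b[of n]
    proof eventually_elim
      case (elim x) from power_mono[OF elim, of 2] show ?case by simp
    qed
  qed (use sqi_integrable_sq[OF w] in simp_all)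
  from tendsto_real_sqrt[OF this] show ?thesis by (simp add: l2n_def)
qed

lemma sqi_bound:
  assumes f: "f \<in> borel_measurable M" and g: "sqi M g"
    and le: "AE x in M. norm (f x) \<le> C * norm (g x)" and C: "0 \<le> C"
  shows "sqi M f" "l2n M f \<le> C * l2n M g"
proof -
  have "(\<integral>\<^sup>+x. ennreal ((norm (f x))\<^sup>2) \<partial>M) \<le> (\<integral>\<^sup>+x. ennreal (C\<^sup>2) * ennreal ((norm (g x))\<^sup>2) \<partial>M)"
  proof (rule nn_integral_mono_AE)
    show "AE x in M. ennreal ((norm (f x))\<^sup>2) \<le> ennreal (C\<^sup>2) * ennreal ((norm (g x))\<^sup>2)"
      using le
    proof eventually_elim
      case (elim x)
      then have "(norm (f x))\<^sup>2 \<le> (C * norm (g x))\<^sup>2" by (intro power_mono) auto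
      then show ?case by (simp add: ennreal_mult[symmetric] power_mult_distrib)
    qed
  qed
  also have "\<dots> = ennreal ((C * l2n M g)\<^sup>2)"
    using g by (subst nn_integral_cmult) (auto simp: nn_sqi ennreal_mult[symmetric] power_mult_distrib sqi_def)
  finally have *: "(\<integral>\<^sup>+x. ennreal ((norm (f x))\<^sup>2) \<partial>M) \<le> ennreal ((C * l2n M g)\<^sup>2)" .
  show "sqi M f" "l2n M f \<le> C * l2n M g"
    using sqi_nnI[OF f *] C by auto
qed

lemma sqi_scaleR [intro]: "sqi M f \<Longrightarrow> sqi M (\<lambda>x. c *\<^sub>R f x)"
  by (auto simp: sqi_def power_mult_distrib)

lemma sqi_cmult [intro]: "sqi M f \<Longrightarrow> sqi M (\<lambda>x. c * f x)" for f :: "_ \<Rightarrow> real"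
  using sqi_scaleR[of M f c] by simp

lemma l2n_scaleR: "l2n M (\<lambda>x. c *\<^sub>R f x) = \<bar>c\<bar> * l2n M f"
  by (simp add: l2n_def power_mult_distrib real_sqrt_mult)

lemma sqi_add [intro]:
  assumes "sqi M f" "sqi M g" shows "sqi M (\<lambda>x. f x + g x)"
  unfolding sqi_def
proof
  show "(\<lambda>x. f x + g x) \<in> borel_measurable M" using assms by auto
  have *: "(norm (f x + g x))\<^sup>2 \<le> 2 * (norm (f x))\<^sup>2 + 2 * (norm (g x))\<^sup>2" for x
  proof -
    have "(norm (f x + g x))\<^sup>2 \<le> (norm (f x) + norm (g x))\<^sup>2"
      by (intro power_mono norm_triangle_ineq) auto
    also have "\<dots> \<le> 2 * (norm (f x))\<^sup>2 + 2 * (norm (g x))\<^sup>2"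
      using sum_squares_bound[of "norm (f x)" "norm (g x)"] by (simp add: power2_sum)
    finally show ?thesis .
  qed
  show "integrable M (\<lambda>x. (norm (f x + g x))\<^sup>2)"
    by (rule bi_integrable_bound[of _ "\<lambda>x. 2 * (norm (f x))\<^sup>2 + 2 * (norm (g x))\<^sup>2"])
      (use assms * in \<open>auto simp: sqi_def\<close>)
qed

lemma sqi_zero [simp, intro]: "sqi M (\<lambda>x. 0)"
  by (simp add: sqi_def)

lemma sqi_minus [intro]: "sqi M f \<Longrightarrow> sqi M (\<lambda>x. - f x)"
  by (auto simp: sqi_def)

lemma sqi_diff [intro]: "sqi M f \<Longrightarrow> sqi M g \<Longrightarrow> sqi M (\<lambda>x. f x - g x)"
  using sqi_add[of M f "\<lambda>x. - g x"] by auto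

lemma sqi_sum [intro]: "(\<And>i. i \<in> I \<Longrightarrow> sqi M (f i)) \<Longrightarrow> sqi M (\<lambda>x. \<Sum>i\<in>I. f i x)"
  by (induction I rule: infinite_finite_induct) auto

lemma sqi_linear:
  assumes "bounded_linear L" "sqi M f" shows "sqi M (\<lambda>x. L (f x))"
proof -
  obtain K where K: "0 < K" "\<And>x. norm (L x) \<le> K * norm x"
    using bounded_linear.pos_bounded[OF assms(1)] by (auto simp: mult.commute)
  show ?thesis
    by (rule sqi_bound[of _ _ f K])
      (use assms K in \<open>auto intro: borel_measurable_continuous_on linear_continuous_on\<close>)
qed

lemma sqi_nth [intro]: "sqi M f \<Longrightarrow> sqi M (\<lambda>x. f x $ i)"
  by (rule sqi_linear[OF bounded_linear_vec_nth])

lemma l2n_nth: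
  assumes "sqi M f" shows "l2n M (\<lambda>x. f x $ i) \<le> l2n M f"
  using sqi_bound(2)[OF _ assms, of "\<lambda>x. f x $ i" 1] sqi_nth[OF assms]
  by (auto simp: Finite_Cartesian_Product.norm_nth_le)

lemma sqi_integrable_inner:
  assumes "sqi M f" "sqi M g" shows "integrable M (\<lambda>x. f x \<bullet> g x)"
proof (rule bi_integrable_bound[of _ "\<lambda>x. (norm (f x))\<^sup>2 + (norm (g x))\<^sup>2"])
  show "AE x in M. norm (f x \<bullet> g x) \<le> norm ((norm (f x))\<^sup>2 + (norm (g x))\<^sup>2)"
  proof (intro AE_I2)
    fix x
    have "\<bar>f x \<bullet> g x\<bar> \<le> norm (f x) * norm (g x)" by (rule Cauchy_Schwarz_ineq2)
    also have "\<dots> \<le> (norm (f x))\<^sup>2 + (norm (g x))\<^sup>2"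
      using sum_squares_bound[of "norm (f x)" "norm (g x)"]
        mult_nonneg_nonneg[OF norm_ge_zero[of "f x"] norm_ge_zero[of "g x"]] by linarith
    finally show "norm (f x \<bullet> g x) \<le> norm ((norm (f x))\<^sup>2 + (norm (g x))\<^sup>2)" by simp
  qed
qed (use assms in \<open>auto simp: sqi_def\<close>)

lemma sqi_integrable_mult:
  fixes f g :: "_ \<Rightarrow> real"
  assumes "sqi M f" "sqi M g" shows "integrable M (\<lambda>x. f x * g x)"
  using sqi_integrable_inner[OF assms] by simp

lemma l2_quadratic:
  assumes "sqi M f" "sqi M g"
  shows "(l2n M (\<lambda>x. f x + t *\<^sub>R g x))\<^sup>2 = (l2n M f)\<^sup>2 + 2 * t * (\<integral>x. f x \<bullet> g x \<partial>M) + t\<^sup>2 * (l2n M g)\<^sup>2"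
proof -
  note i = sqi_integrable_inner[OF assms] sqi_integrable_sq[OF assms(1)] sqi_integrable_sq[OF assms(2)]
  have "(norm (f x + t *\<^sub>R g x))\<^sup>2 = (norm (f x))\<^sup>2 + (2 * t) * (f x \<bullet> g x) + t\<^sup>2 * (norm (g x))\<^sup>2" for x
    unfolding power2_norm_eq_inner by (simp add: algebra_simps inner_commute power2_eq_square)
  then show ?thesis unfolding l2n_sq using i by simp
qed

lemma quadratic_nonneg_discriminant:
  fixes a b c :: real
  assumes q: "\<And>t. 0 \<le> a + 2 * t * b + t\<^sup>2 * c" and c: "0 \<le> c"
  shows "b\<^sup>2 \<le> a * c"
proof (cases "c = 0")
  case True
  have "b = 0"
  proof (rule ccontr)
    assume "b \<noteq> 0"
    \<comment> \<open>At this t the affine function a + 2tb takes the value -1.\<close>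
    then show False using q[of "-(a+1)/(2*b)"] True by (simp add: field_simps)
  qed
  then show ?thesis using True by simp
next
  case False
  with c have "c > 0" by simp
  then show ?thesis using q[of "-b/c"] by (simp add: field_simps power2_eq_square)
qed

lemma l2_Cauchy_Schwarz:
  assumes "sqi M f" "sqi M g"
  shows "\<bar>\<integral>x. f x \<bullet> g x \<partial>M\<bar> \<le> l2n M f * l2n M g"
proof -
  define a b c where "a = (l2n M f)\<^sup>2" and "b = (\<integral>x. f x \<bullet> g x \<partial>M)" and "c = (l2n M g)\<^sup>2"
  have q: "0 \<le> a + 2 * t * b + t\<^sup>2 * c" for t
    unfolding a_def b_def c_def l2_quadratic[OF assms, symmetric] by simp
  have "b\<^sup>2 \<le> a * c" by (rule quadratic_nonneg_discriminant[OF q]) (simp add: c_def)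
  then have "b\<^sup>2 \<le> (l2n M f * l2n M g)\<^sup>2" by (simp add: a_def c_def power_mult_distrib)
  then show ?thesis unfolding b_def[symmetric]
    using abs_le_square_iff[of b "l2n M f * l2n M g"] by simp
qed

lemma l2n_triangle:
  assumes "sqi M f" "sqi M g"
  shows "l2n M (\<lambda>x. f x + g x) \<le> l2n M f + l2n M g"
proof (rule power2_le_imp_le)
  show "(l2n M (\<lambda>x. f x + g x))\<^sup>2 \<le> (l2n M f + l2n M g)\<^sup>2"
    using l2_quadratic[OF assms, of 1] l2_Cauchy_Schwarz[OF assms] by (simp add: power2_sum)
qed auto

lemma l2n_minus: "l2n M (\<lambda>x. - f x) = l2n M f"
  by (simp add: l2n_def)

lemma l2n_commute: "l2n M (\<lambda>x. f x - g x) = l2n M (\<lambda>x. g x - f x)"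
  by (simp add: l2n_def norm_minus_commute)

lemma l2n_triangle_diff:
  assumes "sqi M f" "sqi M g"
  shows "l2n M (\<lambda>x. f x - g x) \<le> l2n M f + l2n M g"
  using l2n_triangle[of M f "\<lambda>x. - g x"] assms by (auto simp: l2n_minus)

lemma l2n_triangle3:
  assumes "sqi M f" "sqi M g" "sqi M h"
  shows "l2n M (\<lambda>x. f x - h x) \<le> l2n M (\<lambda>x. f x - g x) + l2n M (\<lambda>x. g x - h x)"
  using l2n_triangle[of M "\<lambda>x. f x - g x" "\<lambda>x. g x - h x"] assms by auto

lemma l2n_diff_ge:
  assumes "sqi M f" "sqi M g"
  shows "\<bar>l2n M f - l2n M g\<bar> \<le> l2n M (\<lambda>x. f x - g x)"
  using l2n_triangle[of M g "\<lambda>x. f x - g x"] l2n_triangle[of M f "\<lambda>x. g x - f x"] assms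
    l2n_commute[of M f g] sqi_diff[of M f g] sqi_diff[of M g f]
  by auto

lemma l2n_sum:
  assumes "finite I" "\<And>i. i \<in> I \<Longrightarrow> sqi M (f i)"
  shows "l2n M (\<lambda>x. \<Sum>i\<in>I. f i x) \<le> (\<Sum>i\<in>I. l2n M (f i))"
  using assms
proof (induction I)
  case empty then show ?case by (simp add: l2n_def)
next
  case (insert j I)
  then show ?case
    using l2n_triangle[of M "f j" "\<lambda>x. \<Sum>i\<in>I. f i x"] by (fastforce intro: sqi_sum)
qed

lemma l2n_cong_AE: "(AE x in M. f x = g x) \<Longrightarrow> f \<in> borel_measurable M \<Longrightarrow> g \<in> borel_measurable M \<Longrightarrow> l2n M f = l2n M g"
  unfolding l2n_def by (intro arg_cong[of _ _ sqrt] integral_cong_AE) auto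

lemma l2_inner_tendsto:
  assumes f: "\<And>n. sqi M (f n)" "sqi M f'" "(\<lambda>n. l2n M (\<lambda>x. f n x - f' x)) \<longlonglongrightarrow> 0"
    and g: "\<And>n. sqi M (g n)" "sqi M g'" "(\<lambda>n. l2n M (\<lambda>x. g n x - g' x)) \<longlonglongrightarrow> 0"
  shows "(\<lambda>n. \<integral>x. f n x \<bullet> g n x \<partial>M) \<longlonglongrightarrow> (\<integral>x. f' x \<bullet> g' x \<partial>M)"
proof (rule Lim_transform2[OF tendsto_const], rule Lim_null_comparison)
  let ?e = "\<lambda>n. l2n M (\<lambda>x. f n x - f' x)" and ?d = "\<lambda>n. l2n M (\<lambda>x. g n x - g' x)"
  show "\<forall>\<^sub>F n in sequentially. norm ((\<integral>x. f' x \<bullet> g' x \<partial>M) - (\<integral>x. f n x \<bullet> g n x \<partial>M))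
      \<le> ?e n * (l2n M g' + ?d n) + l2n M f' * ?d n"
  proof (rule always_eventually, rule allI)
    fix n
    have g_le: "l2n M (g n) \<le> l2n M g' + ?d n"
      using l2n_diff_ge[OF g(1)[of n] g(2)] by auto
    have "(\<integral>x. f n x \<bullet> g n x \<partial>M) - (\<integral>x. f' x \<bullet> g' x \<partial>M)
       = (\<integral>x. (f n x - f' x) \<bullet> g n x \<partial>M) + (\<integral>x. f' x \<bullet> (g n x - g' x) \<partial>M)"
      using f g by (simp add: inner_diff_left inner_diff_right sqi_integrable_inner)
    moreover have "\<bar>\<integral>x. (f n x - f' x) \<bullet> g n x \<partial>M\<bar> \<le> ?e n * l2n M (g n)"
      by (rule l2_Cauchy_Schwarz) (use f g in auto)
    moreover have "?e n * l2n M (g n) \<le> ?e n * (l2n M g' + ?d n)"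
      by (intro mult_left_mono g_le) auto
    moreover have "\<bar>\<integral>x. f' x \<bullet> (g n x - g' x) \<partial>M\<bar> \<le> l2n M f' * ?d n"
      by (rule l2_Cauchy_Schwarz) (use f g in auto)
    ultimately show "norm ((\<integral>x. f' x \<bullet> g' x \<partial>M) - (\<integral>x. f n x \<bullet> g n x \<partial>M))
      \<le> ?e n * (l2n M g' + ?d n) + l2n M f' * ?d n" unfolding real_norm_def by linarith
  qed
  show "(\<lambda>n. ?e n * (l2n M g' + ?d n) + l2n M f' * ?d n) \<longlonglongrightarrow> 0"
    using f(3) g(3) by (auto intro!: tendsto_eq_intros)
qed

text \<open>Fatou's lemma, read as lower semicontinuity of the L2 norm under pointwise convergence.
  It also delivers membership of the limit, so it serves wherever a cut-off or a weight is
  removed.\<close>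

lemma sqi_fatou:
  fixes g :: "'a \<Rightarrow> 'b::euclidean_space"
  assumes s: "\<And>n. sqi M (f n)" and b: "\<And>n. l2n M (f n) \<le> c" and l: "AE x in M. (\<lambda>n. f n x) \<longlonglongrightarrow> g x"
    and [measurable]: "g \<in> borel_measurable M"
  shows "sqi M g" "l2n M g \<le> c"
proof -
  have [measurable]: "f n \<in> borel_measurable M" for n using s by blast
  have c: "0 \<le> c" using order_trans[OF l2n_nonneg b] .
  have e: "AE x in M. ennreal ((norm (g x))\<^sup>2) = liminf (\<lambda>n. ennreal ((norm (f n x))\<^sup>2))"
    using l
  proof eventually_elim
    case (elim x)
    then have "(\<lambda>n. ennreal ((norm (f n x))\<^sup>2)) \<longlonglongrightarrow> ennreal ((norm (g x))\<^sup>2)" by (intro tendsto_intros)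
    then show ?case by (rule lim_imp_Liminf[OF trivial_limit_sequentially, symmetric])
  qed
  have "(\<integral>\<^sup>+x. ennreal ((norm (g x))\<^sup>2) \<partial>M) = (\<integral>\<^sup>+x. liminf (\<lambda>n. ennreal ((norm (f n x))\<^sup>2)) \<partial>M)"
    by (rule nn_integral_cong_AE[OF e])
  also have "\<dots> \<le> liminf (\<lambda>n. \<integral>\<^sup>+x. ennreal ((norm (f n x))\<^sup>2) \<partial>M)"
    by (rule nn_integral_liminf) measurable
  also have "\<dots> \<le> ennreal (c\<^sup>2)"
  proof (rule Liminf_le)
    show "\<forall>\<^sub>F n in sequentially. (\<integral>\<^sup>+x. ennreal ((norm (f n x))\<^sup>2) \<partial>M) \<le> ennreal (c\<^sup>2)"
      unfolding nn_sqi[OF s] by (intro always_eventually allI ennreal_leI power_mono b l2n_nonneg)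
  qed simp
  finally show "sqi M g" "l2n M g \<le> c" using sqi_nnI[of g M c] c by simp_all
qed

text \<open>The limit is given as an explicit function of the pointwise values, so that pointwise
  periodicity is inherited by it.\<close>

proposition riesz_fischer:
  fixes f :: "nat \<Rightarrow> 'a \<Rightarrow> 'b::euclidean_space"
  assumes f: "\<And>n. sqi M (f n)"
    and cauchy: "\<And>e. e > 0 \<Longrightarrow> \<exists>N. \<forall>m\<ge>N. \<forall>n\<ge>N. l2n M (\<lambda>x. f m x - f n x) < e"
  obtains L :: "(nat \<Rightarrow> 'b) \<Rightarrow> 'b" where "sqi M (\<lambda>x. L (\<lambda>n. f n x))"
    "(\<lambda>n. l2n M (\<lambda>x. f n x - L (\<lambda>n. f n x))) \<longlonglongrightarrow> 0"
proof -
  \<comment> \<open>A subsequence that is Cauchy at a geometric rate; adding k and summing the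
    thresholds makes it strictly increasing and above every \<open>N k\<close>.\<close>
  have "\<exists>r. strict_mono (r::nat \<Rightarrow> nat) \<and> (\<forall>k. \<forall>m\<ge>r k. \<forall>n\<ge>r k. l2n M (\<lambda>x. f m x - f n x) < (1/2)^k)"
  proof -
    obtain N where N: "\<And>k. \<forall>m\<ge>N k. \<forall>n\<ge>N k. l2n M (\<lambda>x. f m x - f n x) < (1/2)^k"
      using cauchy[of "(1/2)^k" for k] by (metis zero_less_divide_1_iff zero_less_numeral zero_less_power)
    define r where "r k = k + (\<Sum>i\<le>k. N i)" for k :: nat
    have "N k \<le> r k" for k
      unfolding r_def using member_le_sum[of k "{..k}" N] by auto
    moreover have "strict_mono r" by (rule strict_monoI_Suc) (simp add: r_def)
    ultimately show ?thesis using N by (meson le_trans)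
  qed
  then obtain r :: "nat \<Rightarrow> nat" where r: "strict_mono r"
    and rc: "\<And>k m n. m \<ge> r k \<Longrightarrow> n \<ge> r k \<Longrightarrow> l2n M (\<lambda>x. f m x - f n x) < (1/2)^k" by blast
  \<comment> \<open>Only the value sequence at one point enters, so points with equal sequences get
    equal limits. The default 0 is taken where the subsequence is not Cauchy, which will be a null
    set.\<close>
  define L where "L s = (if Cauchy (\<lambda>k. s (r k)) then lim (\<lambda>k. s (r k)) else 0)" for s :: "nat \<Rightarrow> 'b"
  define d where "d k x = f (r (Suc k)) x - f (r k) x" for k x
  have fm[measurable]: "f n \<in> borel_measurable M" for n using f by auto
  have [measurable]: "d k \<in> borel_measurable M" for k unfolding d_def[abs_def] by measurable
  \<comment> \<open>The squared rate (1/4)^k leaves room for the weight 2^k and is still summable.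
    The weight is what later turns square summability of the increments into absolute
    summability.\<close>
  have dn: "(\<integral>\<^sup>+x. ennreal (2^k * (norm (d k x))\<^sup>2) \<partial>M) \<le> ennreal ((1/2)^k)" for k
  proof -
    have s: "sqi M (d k)" unfolding d_def[abs_def] using f by auto
    have "l2n M (d k) \<le> (1/2)^k"
      unfolding d_def[abs_def] by (rule less_imp_le, rule rc) (auto simp: strict_mono_less_eq[OF r])
    then have "(l2n M (d k))\<^sup>2 \<le> ((1/2)^k)\<^sup>2" by (intro power_mono) auto
    then have "2^k * (l2n M (d k))\<^sup>2 \<le> 2^k * ((1/2)^k)\<^sup>2" by simp
    also have "\<dots> = (1/2)^k" by (simp add: power2_eq_square power_one_over)
    finally have *: "2^k * (l2n M (d k))\<^sup>2 \<le> (1/2)^k" .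
    have "(\<integral>\<^sup>+x. ennreal (2^k * (norm (d k x))\<^sup>2) \<partial>M) = (\<integral>\<^sup>+x. ennreal (2^k) * ennreal ((norm (d k x))\<^sup>2) \<partial>M)"
      by (simp add: ennreal_mult)
    also have "\<dots> = ennreal (2^k * (l2n M (d k))\<^sup>2)"
      by (subst nn_integral_cmult) (auto simp: nn_sqi[OF s] ennreal_mult)
    finally show ?thesis using * by (simp add: ennreal_leI)
  qed
  have "(\<integral>\<^sup>+x. (\<Sum>k. ennreal (2^k * (norm (d k x))\<^sup>2)) \<partial>M) = (\<Sum>k. \<integral>\<^sup>+x. ennreal (2^k * (norm (d k x))\<^sup>2) \<partial>M)"
    by (rule nn_integral_suminf) measurable
  also have "\<dots> \<le> (\<Sum>k. ennreal ((1/2)^k))"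
    by (intro suminf_le dn) auto
  also have "\<dots> < \<infinity>"
    by (subst suminf_ennreal2) (auto simp: summable_geometric)
  finally have "AE x in M. (\<Sum>k. ennreal (2^k * (norm (d k x))\<^sup>2)) \<noteq> \<infinity>"
    by (intro nn_integral_noteq_infinite) (auto simp: less_top)
  then have conv: "AE x in M. convergent (\<lambda>k. f (r k) x)"
  proof eventually_elim
    case (elim x)
    then have s1: "summable (\<lambda>k. 2^k * (norm (d k x))\<^sup>2)"
      by (intro summable_suminf_not_top) (auto simp: top_unique infinity_ennreal_def)
    have "summable (\<lambda>k. 2^k * (norm (d k x))\<^sup>2 + (1/2)^k)"
      using s1 by (intro summable_add) (auto simp: summable_geometric)
    then have "summable (\<lambda>k. norm (d k x))"
    proof (rule summable_comparison_test'[where N=0])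
      fix k
      \<comment> \<open>AM-GM with the factors sqrt (2^k) and its inverse: the increment is bounded
        by the weighted square plus a geometric term.\<close>
      have "2 * (sqrt (2^k) * norm (d k x)) * sqrt ((1/2)^k) \<le> (sqrt (2^k) * norm (d k x))\<^sup>2 + (sqrt ((1/2)^k))\<^sup>2"
        by (rule sum_squares_bound)
      moreover have "sqrt (2^k) * sqrt ((1/2)^k) = 1"
        by (simp add: real_sqrt_mult[symmetric] power_mult_distrib[symmetric])
      then have "2 * (sqrt (2^k) * norm (d k x)) * sqrt ((1/2)^k) = 2 * norm (d k x)"
        by (simp add: algebra_simps)
      ultimately have "2 * norm (d k x) \<le> 2^k * (norm (d k x))\<^sup>2 + (1/2)^k"
        by (simp add: power_mult_distrib)
      then show "norm (norm (d k x)) \<le> 2^k * (norm (d k x))\<^sup>2 + (1/2)^k"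
        using norm_ge_zero[of "d k x"] unfolding real_norm_def abs_norm_cancel by linarith
    qed
    then have "summable (\<lambda>k. d k x)" by (rule summable_norm_cancel)
    then have "convergent (\<lambda>n. \<Sum>k<n. d k x)" by (simp add: summable_iff_convergent)
    moreover have "(\<Sum>k<n. d k x) = f (r n) x - f (r 0) x" for n
      unfolding d_def by (rule sum_lessThan_telescope)
    ultimately have "convergent (\<lambda>n. (f (r n) x - f (r 0) x) + f (r 0) x)"
      by (intro convergent_add convergent_const) auto
    then show ?case by simp
  qed
  define g where "g x = L (\<lambda>n. f n x)" for x
  have lim: "AE x in M. (\<lambda>k. f (r k) x) \<longlonglongrightarrow> g x"
    using conv by eventually_elim (auto simp: g_def L_def convergent_LIMSEQ_iff Cauchy_convergent_iff)
  have g[measurable]: "g \<in> borel_measurable M"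
    unfolding g_def[abs_def] L_def by measurable
  \<comment> \<open>Fatou in the second index, along the subsequence, turns the Cauchy bound into a
    bound for the distance to the limit.\<close>
  have dif: "sqi M (\<lambda>x. f n x - g x)" "l2n M (\<lambda>x. f n x - g x) \<le> (1/2)^k" if n: "n \<ge> r k" for n k
  proof -
    have b: "l2n M (\<lambda>x. f n x - f (r (i + k)) x) \<le> (1/2)^k" for i
      by (rule less_imp_le[OF rc[OF n]]) (simp add: strict_mono_less_eq[OF r])
    have l: "AE x in M. (\<lambda>i. f n x - f (r (i + k)) x) \<longlonglongrightarrow> f n x - g x"
      using lim
    proof eventually_elim
      case (elim x) show ?case by (intro tendsto_intros LIMSEQ_ignore_initial_segment[OF elim])
    qed
    show "sqi M (\<lambda>x. f n x - g x)" "l2n M (\<lambda>x. f n x - g x) \<le> (1/2)^k"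
      by (rule sqi_fatou[OF sqi_diff[OF f f] b l], measurable)+
  qed
  have "sqi M (\<lambda>x. f (r 0) x - (f (r 0) x - g x))"
    by (rule sqi_diff[OF f dif(1)[OF order_refl]])
  then have gs: "sqi M g" by simp
  have "(\<lambda>n. l2n M (\<lambda>x. f n x - g x)) \<longlonglongrightarrow> 0"
  proof (rule LIMSEQ_I)
    fix e :: real assume "0 < e"
    then obtain k where k: "(1/2)^k < e" using real_arch_pow_inv[of e "1/2"] by auto
    show "\<exists>no. \<forall>n\<ge>no. norm (l2n M (\<lambda>x. f n x - g x) - 0) < e"
      using dif(2)[of k] k by (intro exI[of _ "r k"]) (auto intro: le_less_trans)
  qed
  with gs show ?thesis unfolding g_def[abs_def] by (rule that)
qed

text \<open>Jensen's inequality for the square, by Cauchy-Schwarz against the constant 1. If the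
  right-hand side is infinite there is nothing to prove, whatever value the integral on the left has
  by convention.\<close>

lemma norm_integral_sq_le:
  fixes g :: "'c \<Rightarrow> 'b::euclidean_space"
  assumes "prob_space \<mu>" and [measurable]: "g \<in> borel_measurable \<mu>"
  shows "ennreal ((norm (\<integral>s. g s \<partial>\<mu>))\<^sup>2) \<le> (\<integral>\<^sup>+s. ennreal ((norm (g s))\<^sup>2) \<partial>\<mu>)"
proof (cases "(\<integral>\<^sup>+s. ennreal ((norm (g s))\<^sup>2) \<partial>\<mu>) = \<infinity>")
  case False
  interpret \<mu>: prob_space \<mu> by fact
  have s: "sqi \<mu> g"
    unfolding sqi_def using False by (auto intro!: integrableI_bounded simp: less_top)
  have s1: "sqi \<mu> (\<lambda>s. 1::real)" by (simp add: sqi_def)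
  have sn: "sqi \<mu> (\<lambda>s. norm (g s))" using s by (simp add: sqi_def)
  have "norm (\<integral>s. g s \<partial>\<mu>) \<le> (\<integral>s. norm (g s) \<partial>\<mu>)" by (rule integral_norm_bound)
  also have "\<dots> \<le> \<bar>\<integral>s. norm (g s) \<bullet> (1::real) \<partial>\<mu>\<bar>" by simp
  also have "\<dots> \<le> l2n \<mu> (\<lambda>s. norm (g s)) * l2n \<mu> (\<lambda>s. 1::real)"
    by (rule l2_Cauchy_Schwarz[OF sn s1])
  also have "\<dots> = l2n \<mu> g" by (simp add: l2n_def \<mu>.prob_space)
  finally have "(norm (\<integral>s. g s \<partial>\<mu>))\<^sup>2 \<le> (l2n \<mu> g)\<^sup>2" by (intro power_mono) auto
  then show ?thesis unfolding nn_sqi[OF s] by (rule ennreal_leI)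
qed simp

text \<open>Jensen in \<open>s\<close>, then Tonelli. Segment averages, cell averages and weighted
  kernels are all bounded through this. The bound is asked for almost every \<open>s\<close> only,
  because the cell measure is a density on the whole space and sees the cell only up to null
  sets.\<close>

lemma l2_average:
  fixes d :: "'a \<times> 'c \<Rightarrow> 'b::euclidean_space"
  assumes "sigma_finite_measure M" "prob_space \<mu>"
    and d[measurable]: "d \<in> borel_measurable (M \<Otimes>\<^sub>M \<mu>)"
    and bd: "AE s in \<mu>. (\<integral>\<^sup>+x. ennreal ((norm (d (x, s)))\<^sup>2) \<partial>M) \<le> ennreal (c\<^sup>2)" and c: "0 \<le> c"
  shows "sqi M (\<lambda>x. \<integral>s. d (x, s) \<partial>\<mu>)" "l2n M (\<lambda>x. \<integral>s. d (x, s) \<partial>\<mu>) \<le> c"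
proof -
  interpret M: sigma_finite_measure M by fact
  interpret \<mu>: prob_space \<mu> by fact
  interpret P: pair_sigma_finite M \<mu> ..
  have m: "(\<lambda>x. \<integral>s. d (x, s) \<partial>\<mu>) \<in> borel_measurable M"
    by (rule \<mu>.borel_measurable_lebesgue_integral) simp
  have "(\<integral>\<^sup>+x. ennreal ((norm (\<integral>s. d (x, s) \<partial>\<mu>))\<^sup>2) \<partial>M) \<le> (\<integral>\<^sup>+x. \<integral>\<^sup>+s. ennreal ((norm (d (x, s)))\<^sup>2) \<partial>\<mu> \<partial>M)"
    by (intro nn_integral_mono norm_integral_sq_le assms(2)) measurable
  also have "\<dots> = (\<integral>\<^sup>+s. \<integral>\<^sup>+x. ennreal ((norm (d (x, s)))\<^sup>2) \<partial>M \<partial>\<mu>)"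
    by (rule P.Fubini'[symmetric]) measurable
  also have "\<dots> \<le> (\<integral>\<^sup>+s. ennreal (c\<^sup>2) \<partial>\<mu>)"
    using bd by (intro nn_integral_mono_AE)
  also have "\<dots> = ennreal (c\<^sup>2)" by (simp add: \<mu>.emeasure_space_1)
  finally have "(\<integral>\<^sup>+x. ennreal ((norm (\<integral>s. d (x, s) \<partial>\<mu>))\<^sup>2) \<partial>M) \<le> ennreal (c\<^sup>2)" .
  from sqi_nnI[OF m this c] show "sqi M (\<lambda>x. \<integral>s. d (x, s) \<partial>\<mu>)" "l2n M (\<lambda>x. \<integral>s. d (x, s) \<partial>\<mu>) \<le> c" by auto
qed

section \<open>Translations\<close>

lemma nn_integral_shift:
  fixes f :: "'a::euclidean_space \<Rightarrow> ennreal"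
  assumes "f \<in> bmeas"
  shows "(\<integral>\<^sup>+x. f (x + h) \<partial>lborel) = (\<integral>\<^sup>+x. f x \<partial>lborel)"
proof -
  have "(\<integral>\<^sup>+x. f x \<partial>lborel) = (\<integral>\<^sup>+x. f x \<partial>distr lborel borel ((+) h))"
    by (simp add: lborel_distr_plus)
  also have "\<dots> = (\<integral>\<^sup>+x. f (h + x) \<partial>lborel)"
    using assms by (subst nn_integral_distr) auto
  finally show ?thesis by (simp add: add.commute)
qed

lemma integral_shift:
  fixes f :: "'a::euclidean_space \<Rightarrow> 'b::{banach, second_countable_topology}"
  assumes "f \<in> bmeas"
  shows "(LBINT x. f (x + h)) = (LBINT x. f x)"
proof -
  have "(LBINT x. f x) = (\<integral>x. f x \<partial>distr lborel borel ((+) h))"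
    by (simp add: lborel_distr_plus)
  also have "\<dots> = (LBINT x. f (h + x))"
    using assms by (subst integral_distr) auto
  finally show ?thesis by (simp add: add.commute)
qed

lemma integrable_shift:
  fixes f :: "'a::euclidean_space \<Rightarrow> 'b::{banach, second_countable_topology}"
  assumes "integrable lborel f"
  shows "integrable lborel (\<lambda>x. f (x + h))"
proof -
  have "integrable (distr lborel borel ((+) h)) f"
    using assms by (simp add: lborel_distr_plus)
  then have "integrable lborel (\<lambda>x. f (h + x))"
    by (rule integrable_distr[rotated]) auto
  then show ?thesis by (simp add: add.commute)
qed

lemma AE_shift:
  fixes h :: "'a::euclidean_space"
  assumes "AE x in lborel. Q x"
  shows "AE x in lborel. Q (x + h)"
proof -
  have "AE x in distr lborel borel ((+) h). Q x"
    using assms by (simp only: lborel_distr_plus)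
  then have "AE x in lborel. Q (h + x)"
    by (intro AE_distrD[where M'=borel and f="(+) h"]) auto
  then show ?thesis by (simp add: add.commute)
qed

section \<open>Approximation by continuous functions and continuity of translations in L2\<close>

lemma cball_borel [measurable]: "cball (a :: vec3) r \<in> sets borel"
  by (simp add: borel_closed)

lemma integrable_bounded_cball:
  fixes f :: "vec3 \<Rightarrow> real"
  assumes [measurable]: "f \<in> bmeas" and "\<And>x. \<bar>f x\<bar> \<le> B"
  shows "integrable lborel (\<lambda>x. f x * iball R x)"
proof (rule bi_integrable_bound[of _ "\<lambda>x. B * iball R x"])
  have "emeasure lborel (cball (0::vec3) R) < \<infinity>"
    by (rule emeasure_bounded_finite) simp
  then show "integrable lborel (\<lambda>x::vec3. B * iball R x)"
    by (intro integrable_mult_right) (simp add: integrable_indicator_iff)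
  show "AE x in lborel. norm (f x * iball R x) \<le> norm (B * iball R x)"
    using assms(2) by (auto split: split_indicator intro: order_trans[OF _ abs_ge_self])
qed measurable

text \<open>\<open>measurable_on\<close> supplies continuous approximants that converge off a
  negligible set. Clipping them to [-B, B] leaves the limit unchanged and gives the domination that
  is needed later.\<close>

lemma borel_AE_limit_continuous:
  fixes f :: "vec3 \<Rightarrow> real"
  assumes f: "f \<in> bmeas" and B: "\<And>x. \<bar>f x\<bar> \<le> B"
  obtains g where "\<And>k. continuous_on UNIV (g k)" "\<And>k x. \<bar>g k x\<bar> \<le> B"
    "AE x in lborel. (\<lambda>k. g k x) \<longlonglongrightarrow> f x"
proof -
  have "f measurable_on UNIV"
    by (rule lebesgue_measurable_imp_measurable_on) (use f in \<open>auto intro: measurable_completion\<close>)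
  then obtain N g where N: "negligible N" and g: "\<And>n. continuous_on UNIV (g n)"
    and lim: "\<And>x. x \<notin> N \<Longrightarrow> (\<lambda>n. g n x) \<longlonglongrightarrow> f x"
    unfolding measurable_on_def by auto
  have "AE x in lebesgue. x \<notin> N"
    using N by (intro AE_not_in) (simp add: negligible_iff_null_sets)
  then have "AE x in lborel. x \<notin> N" by (simp add: AE_completion_iff)
  then have "AE x in lborel. (\<lambda>k. max (- B) (min B (g k x))) \<longlonglongrightarrow> f x"
  proof eventually_elim
    case (elim x)
    have "(\<lambda>k. max (- B) (min B (g k x))) \<longlonglongrightarrow> max (- B) (min B (f x))"
      using lim[OF elim] by (intro tendsto_intros)
    moreover have "max (- B) (min B (f x)) = f x" using B[of x] by auto
    ultimately show ?case by simp
  qed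
  moreover have "continuous_on UNIV (\<lambda>x. max (- B) (min B (g k x)))" for k
    using g by (intro continuous_intros)
  moreover have "\<bar>max (- B) (min B (g k x))\<bar> \<le> B" for k x
    using B[of x] by auto
  ultimately show ?thesis by (intro that[of "\<lambda>k x. max (- B) (min B (g k x))"])
qed

lemma sqi_indicator_cball: "sq2 (iball R :: _ \<Rightarrow> real)"
proof -
  have "integrable lborel (iball R :: _ \<Rightarrow> real)"
    by (intro integrable_real_indicator emeasure_bounded_finite bounded_cball) simp
  moreover have "(norm (iball R x :: real))\<^sup>2 = iball R x" for x
    by (auto split: split_indicator)
  ultimately show ?thesis unfolding sqi_def by simp
qed

lemma indicator_cball_tendsto: "(\<lambda>n. iball (real n) x :: real) \<longlonglongrightarrow> 1" for x :: vec3
proof (rule tendsto_eventually)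
  obtain N :: nat where "norm x \<le> real N" using real_arch_simple by blast
  then show "\<forall>\<^sub>F n in sequentially. iball (real n) x = (1::real)"
    by (intro eventually_sequentiallyI[of N]) (auto intro: order_trans)
qed

text \<open>Truncate \<open>f\<close> in space and in value, approximate the truncation by bounded
  continuous functions, and multiply these by the tent \<open>\<psi>\<close>, which equals 1 on the
  ball that carries the truncation.\<close>

lemma l2_dense_continuous:
  fixes f :: "vec3 \<Rightarrow> real"
  assumes f: "sq2 f" and e: "0 < e"
  obtains g R B where "continuous_on UNIV g" "\<And>x. \<bar>g x\<bar> \<le> B" "\<And>x. g x \<noteq> 0 \<Longrightarrow> norm x \<le> R"
    "sq2 g" "nl2 (\<lambda>x. g x - f x) < e"
proof -
  have [measurable]: "f \<in> bmeas" using sqi_measurable[OF f] by simp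
  define c where "c n x = iball (real n) x * max (- real n) (min (real n) (f x))" for n :: nat and x
  have cm [measurable]: "c n \<in> bmeas" for n unfolding c_def[abs_def] by measurable
  have cf: "\<bar>c n x - f x\<bar> \<le> \<bar>f x\<bar>" "\<bar>c n x\<bar> \<le> real n" for n x by (auto simp: c_def split: split_indicator)
  have "(\<lambda>n. nl2 (\<lambda>x. c n x - f x)) \<longlonglongrightarrow> 0"
  proof (rule l2n_dominated[OF f])
    show "AE x in lborel. (\<lambda>n. c n x - f x) \<longlonglongrightarrow> 0"
    proof (rule AE_I2)
      fix x :: vec3
      obtain N :: nat where "max (norm x) \<bar>f x\<bar> \<le> real N" using real_arch_simple by blast
      then have "\<forall>\<^sub>F n in sequentially. c n x - f x = 0"
        by (intro eventually_sequentiallyI[of N]) (auto simp: c_def split: split_indicator)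
      then show "(\<lambda>n. c n x - f x) \<longlonglongrightarrow> 0" by (rule tendsto_eventually)
    qed
  qed (use cf(1) in simp_all)
  from order_tendstoD(2)[OF this, of "e / 2"] e
  obtain n where n: "nl2 (\<lambda>x. c n x - f x) < e / 2" by (auto simp: eventually_sequentially)
  obtain g where gc: "\<And>k. continuous_on UNIV (g k)" and gB: "\<And>k x. \<bar>g k x\<bar> \<le> real n"
    and gl: "AE x in lborel. (\<lambda>k. g k x) \<longlonglongrightarrow> c n x"
    by (rule borel_AE_limit_continuous[OF cm cf(2)[of n]]) blast
  define \<psi> where "\<psi> x = max 0 (min 1 (real n + 1 - norm x))" for x :: vec3
  have p: "0 \<le> \<psi> x" "\<psi> x \<le> 1" "\<psi> x \<noteq> 0 \<Longrightarrow> norm x \<le> real n + 1" for x by (auto simp: \<psi>_def)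
  have pc: "\<psi> x * c n x = c n x" for x by (auto simp: \<psi>_def c_def split: split_indicator)
  have cg: "continuous_on UNIV (\<lambda>x. \<psi> x * g k x)" for k unfolding \<psi>_def by (intro continuous_intros gc)
  have [measurable]: "(\<lambda>x. \<psi> x * g k x) \<in> bmeas" for k by (rule borel_measurable_continuous_onI[OF cg])
  have gn: "\<bar>\<psi> x * g k x\<bar> \<le> real n" for k x
    using mult_mono[OF p(2) gB[of k x]] p(1)[of x] by (simp add: abs_mult)
  have w: "sq2 (\<lambda>x::vec3. (2 * real n) *\<^sub>R (iball (real n + 1) x :: real))"
    by (intro sqi_scaleR sqi_indicator_cball)
  have d: "\<bar>\<psi> x * g k x - c n x\<bar> \<le> norm ((2 * real n) *\<^sub>R (iball (real n + 1) x :: real))" for k x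
    using gn[of x k] cf(2)[of n x] p(3)[of x] by (auto simp: c_def split: split_indicator)
  have "(\<lambda>k. nl2 (\<lambda>x. \<psi> x * g k x - c n x)) \<longlonglongrightarrow> 0"
  proof (rule l2n_dominated[OF w])
    show "AE x in lborel. (\<lambda>k. \<psi> x * g k x - c n x) \<longlonglongrightarrow> 0"
      using gl
    proof eventually_elim
      case (elim x)
      from tendsto_diff[OF tendsto_mult_left[OF elim] tendsto_const, of "\<psi> x" "c n x"] show ?case by (simp add: pc)
    qed
  qed (use d in simp_all)
  from order_tendstoD(2)[OF this, of "e / 2"] e
  obtain k where k: "nl2 (\<lambda>x. \<psi> x * g k x - c n x) < e / 2" by (auto simp: eventually_sequentially)
  have gw: "\<bar>\<psi> x * g k x\<bar> \<le> 1 * norm ((2 * real n) *\<^sub>R (iball (real n + 1) x :: real))" for x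
    using gn[of x k] p(3)[of x] by (auto split: split_indicator)
  have sg: "sq2 (\<lambda>x. \<psi> x * g k x)"
    by (rule sqi_bound(1)[OF _ w, of _ 1]) (use gw in simp_all)
  have "sq2 (\<lambda>x. c n x - f x)" by (rule sqi_bound(1)[OF _ f, of _ 1]) (use cf(1) in simp_all)
  from sqi_add[OF this f] have sc: "sq2 (c n)" by simp
  have "nl2 (\<lambda>x. \<psi> x * g k x - f x) \<le> nl2 (\<lambda>x. \<psi> x * g k x - c n x) + nl2 (\<lambda>x. c n x - f x)"
    by (rule l2n_triangle3[OF sg sc f])
  then show ?thesis by (intro that[OF cg gn _ sg, where R="real n + 1"]) (use n k p(3) in auto)
qed

lemma sqi_lborel_shift:
  assumes f: "sq2 f"
  shows "sq2 (\<lambda>x. f (x + h :: vec3))" "nl2 (\<lambda>x. f (x + h)) = nl2 f"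
proof -
  have [measurable]: "f \<in> bmeas" using sqi_measurable[OF f] by simp
  have "integrable lborel (\<lambda>x. (norm (f (x + h)))\<^sup>2)" by (rule integrable_shift[OF sqi_integrable_sq[OF f]])
  then show "sq2 (\<lambda>x. f (x + h))" by (simp add: sqi_def)
  show "nl2 (\<lambda>x. f (x + h)) = nl2 f"
    unfolding l2n_def using integral_shift[of "\<lambda>x. (norm (f x))\<^sup>2" h] by simp
qed

text \<open>A three-epsilon argument: translations are isometries, and for a continuous approximant
  of bounded support dominated convergence applies.\<close>

lemma l2_translation:
  fixes f :: "vec3 \<Rightarrow> real"
  assumes f: "sq2 f" and h: "h \<longlonglongrightarrow> 0"
  shows "(\<lambda>n. nl2 (\<lambda>x. f (x + h n) - f x)) \<longlonglongrightarrow> 0"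
proof (rule LIMSEQ_I)
  fix e :: real assume "0 < e"
  then have e: "0 < e / 3" by simp
  obtain g R B where g: "continuous_on UNIV g" "\<And>x. \<bar>g x\<bar> \<le> B" "\<And>x. g x \<noteq> 0 \<Longrightarrow> norm x \<le> R"
    "sq2 g" "nl2 (\<lambda>x. g x - f x) < e / 3"
    by (rule l2_dense_continuous[OF f e]) blast
  have [measurable]: "g \<in> bmeas" by (rule borel_measurable_continuous_onI[OF g(1)])
  obtain H where H: "\<And>n. norm (h n) \<le> H" using convergent_imp_Bseq[OF convergentI[OF h]] by (auto simp: Bseq_def)
  have w: "sq2 (\<lambda>x::vec3. (2 * B) *\<^sub>R (iball (R + H) x :: real))"
    by (intro sqi_scaleR sqi_indicator_cball)
  have "(\<lambda>n. nl2 (\<lambda>x. g (x + h n) - g x)) \<longlonglongrightarrow> 0"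
  proof (rule l2n_dominated[OF w])
    show "AE x in lborel. (\<lambda>n. g (x + h n) - g x) \<longlonglongrightarrow> 0"
    proof (rule AE_I2)
      fix x
      have "(\<lambda>n. g (x + h n)) \<longlonglongrightarrow> g (x + 0)"
        using g(1) by (intro isCont_tendsto_compose[of _ g] tendsto_intros h) (simp add: continuous_on_eq_continuous_at)
      from tendsto_diff[OF this tendsto_const, of "g x"] show "(\<lambda>n. g (x + h n) - g x) \<longlonglongrightarrow> 0" by simp
    qed
    fix n
    show "AE x in lborel. norm (g (x + h n) - g x) \<le> norm ((2 * B) *\<^sub>R (iball (R + H) x :: real))"
    proof (rule AE_I2)
      fix x
      have "norm x \<le> norm (x + h n) + H" using norm_triangle_ineq4[of "x + h n" "h n"] H[of n] by simp
      then have z: "g (x + h n) = 0 \<and> g x = 0" if "x \<notin> cball 0 (R + H)"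
        using that g(3)[of x] g(3)[of "x + h n"] order_trans[OF norm_ge_zero H] by force
      have "\<bar>g (x + h n) - g x\<bar> \<le> \<bar>2 * B\<bar>" using g(2)[of "x + h n"] g(2)[of x] by linarith
      then show "norm (g (x + h n) - g x) \<le> norm ((2 * B) *\<^sub>R (iball (R + H) x :: real))"
        using z by (cases "x \<in> cball 0 (R + H)") simp_all
    qed
  qed simp
  from order_tendstoD(2)[OF this e]
  have "\<forall>\<^sub>F n in sequentially. norm (nl2 (\<lambda>x. f (x + h n) - f x) - 0) < e"
  proof eventually_elim
    case (elim n)
    have "nl2 (\<lambda>x. f (x + h n) - f x) \<le> nl2 (\<lambda>x. f (x + h n) - g (x + h n)) + nl2 (\<lambda>x. g (x + h n) - f x)"
      by (intro l2n_triangle3 f sqi_lborel_shift(1) g)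
    also have "nl2 (\<lambda>x. f (x + h n) - g (x + h n)) = nl2 (\<lambda>x. g x - f x)"
      using sqi_lborel_shift(2)[OF sqi_diff[OF g(4) f]] by (subst l2n_commute)
    also have "nl2 (\<lambda>x. g (x + h n) - f x) \<le> nl2 (\<lambda>x. g (x + h n) - g x) + nl2 (\<lambda>x. g x - f x)"
      by (intro l2n_triangle3 f sqi_lborel_shift(1) g)
    finally show ?case using elim g(5) by simp
  qed
  then show "\<exists>no. \<forall>n\<ge>no. norm (nl2 (\<lambda>x. f (x + h n) - f x) - 0) < e" by (simp add: eventually_sequentially)
qed

text \<open>The whole space (\<open>D = UNIV\<close>, \<open>P = {}\<close>) and the torus (\<open>D = cellY\<close>, \<open>P = lattice\<close>)
  are treated simultaneously.\<close>

locale tdomain =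
  fixes D P :: "vec3 set"
  assumes D[measurable]: "D \<in> sets borel"
    and inv: "\<And>(f :: vec3 \<Rightarrow> ennreal) h. f \<in> bmeas \<Longrightarrow> (\<forall>x n. n \<in> P \<longrightarrow> f (x + n) = f x) \<Longrightarrow>
       (\<integral>\<^sup>+x. f (x + h) * indicator D x \<partial>lborel) = (\<integral>\<^sup>+x. f x * indicator D x \<partial>lborel)"
    and locb: "\<And>R. \<exists>C::real. \<forall>f :: vec3 \<Rightarrow> ennreal. f \<in> bmeas \<longrightarrow> (\<forall>x n. n \<in> P \<longrightarrow> f (x + n) = f x) \<longrightarrow>
       (\<integral>\<^sup>+x. f x * iball R x \<partial>lborel) \<le> ennreal C * (\<integral>\<^sup>+x. f x * indicator D x \<partial>lborel)"
    and bdd: "D = UNIV \<or> bounded D"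
begin

definition per :: "(vec3 \<Rightarrow> 'b) \<Rightarrow> bool" where
  "per g \<longleftrightarrow> (\<forall>x n. n \<in> P \<longrightarrow> g (x + n) = g x)"

definition M :: "vec3 measure" where "M = density lborel (\<lambda>x. indicator D x)"

lemma M_ennreal: "M = density lborel (\<lambda>x. ennreal (indicator D x))"
  unfolding M_def by (intro arg_cong2[where f=density] ext) (auto split: split_indicator)

lemma sets_M [simp, measurable_cong]: "sets M = sets borel"
  by (simp add: M_def)

lemma space_M [simp]: "space M = UNIV"
  by (simp add: M_def)

lemma measurable_M [simp]: "borel_measurable M = (borel_measurable borel :: (vec3 \<Rightarrow> 'b::topological_space) set)"
  by (rule measurable_cong_sets) simp_all

lemma nn_integral_M: "f \<in> bmeas \<Longrightarrow> (\<integral>\<^sup>+x. f x \<partial>M) = (\<integral>\<^sup>+x. f x * indicator D x \<partial>lborel)"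
  unfolding M_def by (subst nn_integral_density) (auto simp: mult.commute)

lemma integrable_M_iff:
  fixes f :: "vec3 \<Rightarrow> 'b::{banach, second_countable_topology}"
  assumes "f \<in> bmeas"
  shows "integrable M f \<longleftrightarrow> set_integrable lborel D f"
  using assms unfolding set_integrable_def M_ennreal by (simp add: integrable_density)

lemma integral_M:
  fixes f :: "vec3 \<Rightarrow> 'b::{banach, second_countable_topology}"
  assumes "f \<in> bmeas"
  shows "(\<integral>x. f x \<partial>M) = (LINT x:D|lborel. f x)"
  using assms unfolding set_lebesgue_integral_def M_ennreal by (simp add: integral_density)

lemma sqi_M_iff: "sqi M f \<longleftrightarrow> L2_on D f"
  unfolding sqi_def L2_on_def by (auto simp: integrable_M_iff)

lemma AE_M: "AE x in lborel. Q x \<Longrightarrow> AE x in M. Q x"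
  unfolding M_def by (subst AE_density) auto

lemma sigma_finite_M: "sigma_finite_measure M"
  unfolding M_ennreal by (simp add: sigma_finite_measure.sigma_finite_iff_density_finite[OF sigma_finite_lborel])

lemma nn_integral_M_shift:
  assumes [measurable]: "f \<in> bmeas" and "per f"
  shows "(\<integral>\<^sup>+x. f (x + h) \<partial>M) = (\<integral>\<^sup>+x. f x \<partial>M)"
  using inv[of f h] assms by (simp add: nn_integral_M per_def)

lemma per_shift [intro]: "per f \<Longrightarrow> per (\<lambda>x. f (x + h))"
  unfolding per_def by (metis add.assoc add.commute)

lemma per_comp: "per f \<Longrightarrow> per (\<lambda>x. F (f x))"
  unfolding per_def by simp

lemma per_comp2: "per f \<Longrightarrow> per g \<Longrightarrow> per (\<lambda>x. F (f x) (g x))"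
  unfolding per_def by simp

lemma integrable_M_shift:
  fixes f :: "vec3 \<Rightarrow> real"
  assumes f: "integrable M f" and p: "per f"
  shows "integrable M (\<lambda>x. f (x + h))" "(\<integral>x. f (x + h) \<partial>M) = (\<integral>x. f x \<partial>M)"
proof -
  have m[measurable]: "f \<in> bmeas" using f by auto
  have e: "(\<integral>\<^sup>+x. F (f (x + h)) \<partial>M) = (\<integral>\<^sup>+x. F (f x) \<partial>M)" if [measurable]: "F \<in> bmeas" for F :: "real \<Rightarrow> ennreal"
    by (rule nn_integral_M_shift) (use p in \<open>auto intro: per_comp\<close>)
  show i: "integrable M (\<lambda>x. f (x + h))"
    using f e[of "\<lambda>y. ennreal (norm y)"] by (simp add: integrable_iff_bounded)
  show "(\<integral>x. f (x + h) \<partial>M) = (\<integral>x. f x \<partial>M)"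
    using e[of ennreal] e[of "\<lambda>y. ennreal (- y)"]
    by (simp add: real_lebesgue_integral_def[OF i] real_lebesgue_integral_def[OF f])
qed

lemma sqi_shift:
  assumes f: "sqi M f" and p: "per f"
  shows "sqi M (\<lambda>x. f (x + h))" "l2n M (\<lambda>x. f (x + h)) = l2n M f"
proof -
  have [measurable]: "f \<in> bmeas" using f by auto
  note * = integrable_M_shift[of "\<lambda>x. (norm (f x))\<^sup>2" h, OF sqi_integrable_sq[OF f] per_comp[OF p]]
  show "sqi M (\<lambda>x. f (x + h))" using * by (simp add: sqi_def)
  show "l2n M (\<lambda>x. f (x + h)) = l2n M f" using * by (simp add: l2n_def)
qed

lemma integral_M_le:
  fixes q :: "vec3 \<Rightarrow> real"
  assumes q: "integrable lborel q" "\<And>x. 0 \<le> q x"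
  shows "integrable M q" "(\<integral>x. q x \<partial>M) \<le> (LBINT x. q x)"
proof -
  have m[measurable]: "q \<in> bmeas" using q by auto
  have i: "set_integrable lborel D q"
    unfolding set_integrable_def
    by (rule bi_integrable_bound[OF q(1)]) (auto split: split_indicator)
  then show "integrable M q" by (simp add: integrable_M_iff)
  show "(\<integral>x. q x \<partial>M) \<le> (LBINT x. q x)"
    unfolding integral_M[OF m] set_lebesgue_integral_def using i q unfolding set_integrable_def
    by (intro integral_mono) (auto split: split_indicator)
qed

text \<open>On the torus \<open>sqi M\<close> controls one cell only. This transfers the control to
  balls of the whole space, where test functions and weak derivatives live.\<close>

lemma local_l2:
  "\<exists>C\<ge>0. \<forall>f :: vec3 \<Rightarrow> 'b::euclidean_space. sqi M f \<longrightarrow> per f \<longrightarrow>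
     sq2 (\<lambda>x. iball R x *\<^sub>R f x) \<and> nl2 (\<lambda>x. iball R x *\<^sub>R f x) \<le> C * l2n M f"
proof -
  obtain C :: real where C: "\<And>f :: vec3 \<Rightarrow> ennreal. f \<in> bmeas \<Longrightarrow> (\<forall>x n. n \<in> P \<longrightarrow> f (x + n) = f x) \<Longrightarrow>
       (\<integral>\<^sup>+x. f x * iball R x \<partial>lborel) \<le> ennreal C * (\<integral>\<^sup>+x. f x * indicator D x \<partial>lborel)"
    using locb[of R] by blast
  define c where "c = sqrt (max 0 C)"
  have "sq2 (\<lambda>x. iball R x *\<^sub>R f x) \<and> nl2 (\<lambda>x. iball R x *\<^sub>R f x) \<le> c * l2n M f"
    if f: "sqi M f" and p: "per f" for f :: "vec3 \<Rightarrow> 'b"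
  proof -
    have [measurable]: "f \<in> bmeas" using f by auto
    have "(\<integral>\<^sup>+x. ennreal ((norm (iball R x *\<^sub>R f x))\<^sup>2) \<partial>lborel)
      = (\<integral>\<^sup>+x. ennreal ((norm (f x))\<^sup>2) * iball R x \<partial>lborel)"
      by (intro nn_integral_cong) (auto split: split_indicator)
    also have "\<dots> \<le> ennreal C * (\<integral>\<^sup>+x. ennreal ((norm (f x))\<^sup>2) * indicator D x \<partial>lborel)"
      by (rule C) (use p in \<open>auto simp: per_def\<close>)
    also have "\<dots> = ennreal C * (\<integral>\<^sup>+x. ennreal ((norm (f x))\<^sup>2) \<partial>M)"
      by (subst nn_integral_M) auto
    also have "\<dots> \<le> ennreal ((c * l2n M f)\<^sup>2)"
      unfolding nn_sqi[OF f] by (auto simp: c_def power_mult_distrib ennreal_mult'' intro!: mult_right_mono ennreal_leI)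
    finally have "(\<integral>\<^sup>+x. ennreal ((norm (iball R x *\<^sub>R f x))\<^sup>2) \<partial>lborel) \<le> ennreal ((c * l2n M f)\<^sup>2)" .
    from sqi_nnI[OF _ this] show ?thesis by (auto simp: c_def)
  qed
  moreover have "c \<ge> 0" by (simp add: c_def)
  ultimately show ?thesis by blast
qed

proposition translation_continuous:
  fixes f :: "vec3 \<Rightarrow> real"
  assumes f: "sqi M f" "per f" and h: "h \<longlonglongrightarrow> 0"
  shows "(\<lambda>n. l2n M (\<lambda>x. f (x + h n) - f x)) \<longlonglongrightarrow> 0"
  using bdd
proof
  assume "D = UNIV"
  then have "M = lborel" unfolding M_def by (simp add: density_1)
  then show ?thesis using l2_translation[of f h] f h by simp
next
  assume "bounded D"
  then obtain R where R: "\<And>x. x \<in> D \<Longrightarrow> norm x \<le> R" by (auto simp: bounded_iff)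
  obtain H where H: "\<And>n. norm (h n) \<le> H" using convergent_imp_Bseq[OF convergentI[OF h]] by (auto simp: Bseq_def)
  have [measurable]: "f \<in> bmeas" using sqi_measurable[OF f(1)] by simp
  \<comment> \<open>Enlarging the radius by the bound H on the shifts makes the cut function agree
    with \<open>f\<close> at x and at x + h n, for every x in D.\<close>
  let ?g = "\<lambda>x. iball (R + H) x *\<^sub>R f x"
  obtain C where "\<forall>f :: vec3 \<Rightarrow> real. sqi M f \<longrightarrow> per f \<longrightarrow> sq2 (\<lambda>x. iball (R + H) x *\<^sub>R f x) \<and>
    nl2 (\<lambda>x. iball (R + H) x *\<^sub>R f x) \<le> C * l2n M f"
    using local_l2[of "R + H", where 'b=real] by (elim exE conjE) (rule that)
  then have g: "sq2 ?g" using f by simp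
  show ?thesis
  proof (rule tendsto_sandwich[OF _ _ tendsto_const l2_translation[OF g h]])
    have "l2n M (\<lambda>x. f (x + h n) - f x) \<le> nl2 (\<lambda>x. ?g (x + h n) - ?g x)" for n
    proof (rule power2_le_imp_le)
      have d: "sq2 (\<lambda>x. ?g (x + h n) - ?g x)"
        by (rule sqi_diff[OF sqi_lborel_shift(1)[OF g] g])
      have n: "norm (x + h n) \<le> R + H" "norm x \<le> R + H" if "x \<in> D" for x
        using norm_triangle_ineq[of x "h n"] R[OF that] H[of n] order_trans[OF norm_ge_zero H] by linarith+
      have "(l2n M (\<lambda>x. f (x + h n) - f x))\<^sup>2 = (LBINT x. indicator D x *\<^sub>R (norm (?g (x + h n) - ?g x))\<^sup>2)"
        unfolding l2n_sq by (subst integral_M) (use n in \<open>auto simp: set_lebesgue_integral_def intro!: bi_integral_cong split: split_indicator\<close>)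
      also have "\<dots> \<le> (nl2 (\<lambda>x. ?g (x + h n) - ?g x))\<^sup>2"
        unfolding l2n_sq
      proof (rule integral_mono')
        show "integrable lborel (\<lambda>x. (norm (?g (x + h n) - ?g x))\<^sup>2)" by (rule sqi_integrable_sq[OF d])
      qed (auto split: split_indicator)
      finally show "(l2n M (\<lambda>x. f (x + h n) - f x))\<^sup>2 \<le> (nl2 (\<lambda>x. ?g (x + h n) - ?g x))\<^sup>2" .
    qed simp
    then show "\<forall>\<^sub>F n in sequentially. l2n M (\<lambda>x. f (x + h n) - f x) \<le> nl2 (\<lambda>x. ?g (x + h n) - ?g x)" by simp
  qed simp
qed

end

section \<open>Smooth bump functions and the fundamental lemma\<close>

text \<open>The flat function exp (-1/t), extended by 0 to nonpositive t, times a polynomial in 1/t.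
  Carrying the polynomial closes the family under differentiation.\<close>

definition expm :: "real poly \<Rightarrow> real \<Rightarrow> real" where
  "expm p t = (if 0 < t then poly p (1 / t) * exp (- (1 / t)) else 0)"

lemma poly_div_exp_tendsto_0: "((\<lambda>y::real. poly p y * exp (- y)) \<longlongrightarrow> 0) at_top"
proof -
  have "((\<lambda>y::real. \<Sum>i\<le>degree p. coeff p i * (y ^ i / exp y)) \<longlongrightarrow> (\<Sum>i\<le>degree p. coeff p i * 0)) at_top"
    by (intro tendsto_intros tendsto_power_div_exp_0)
  moreover have "(\<lambda>y. \<Sum>i\<le>degree p. coeff p i * (y ^ i / exp y)) = (\<lambda>y. poly p y * exp (- y))"
    by (simp add: fun_eq_iff poly_altdef exp_minus divide_inverse[symmetric] sum_divide_distrib)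
  ultimately show ?thesis by simp
qed

text \<open>The difference quotient at the gluing point 0. Dividing by h multiplies the polynomial
  by its own argument 1/h, so the exponential still wins.\<close>

lemma expm_quotient_tendsto_0: "((\<lambda>h. expm p h / h) \<longlongrightarrow> 0) (at 0)"
proof -
  have "((\<lambda>h. expm p h / h) \<longlongrightarrow> 0) (at_right 0)"
  proof (rule Lim_transform_eventually)
    show "((\<lambda>h. poly (p * [:0, 1:]) (inverse h) * exp (- inverse h)) \<longlongrightarrow> 0) (at_right (0::real))"
      by (rule filterlim_compose[OF poly_div_exp_tendsto_0 filterlim_inverse_at_top_right])
    show "\<forall>\<^sub>F h in at_right 0. poly (p * [:0, 1:]) (inverse h) * exp (- inverse h) = expm p h / h"
      using eventually_at_right_less[of 0] by eventually_elim (simp add: expm_def field_simps)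
  qed
  moreover have "((\<lambda>h. expm p h / h) \<longlongrightarrow> 0) (at_left 0)"
  proof (rule Lim_transform_eventually[OF tendsto_const])
    have "\<forall>\<^sub>F h in at_left (0::real). h < 0" by (simp add: eventually_at_filter)
    then show "\<forall>\<^sub>F h in at_left 0. 0 = expm p h / h"
      by eventually_elim (simp add: expm_def)
  qed
  ultimately show ?thesis by (simp add: filterlim_at_split)
qed

text \<open>With y = 1/t one has dy/dt = -y^2, and differentiating p(y) exp(-y) produces y^2 (p -
  p').\<close>

lemma DERIV_expm: "(expm p has_real_derivative expm ([:0, 0, 1:] * (p - pderiv p)) t) (at t)"
proof (cases t "0::real" rule: linorder_cases)
  case less
  have "((\<lambda>_. 0) has_real_derivative 0) (at t)" by simp
  then have "(expm p has_real_derivative 0) (at t)"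
    by (rule has_field_derivative_transform_within_open[where S="{..<0}"]) (use less in \<open>auto simp: expm_def\<close>)
  then show ?thesis using less by (simp add: expm_def)
next
  case equal
  have "((\<lambda>h. (expm p (0 + h) - expm p 0) / h) \<longlongrightarrow> 0) (at 0)"
    using expm_quotient_tendsto_0[of p] by (simp add: expm_def[of p 0])
  then have "(expm p has_real_derivative 0) (at 0)" by (simp add: DERIV_def)
  then show ?thesis using equal by (simp add: expm_def[of _ 0])
next
  case greater
  have "((\<lambda>t. poly p (1 / t) * exp (- (1 / t))) has_real_derivative
      poly ([:0, 0, 1:] * (p - pderiv p)) (1 / t) * exp (- (1 / t))) (at t)"
    using greater
    by (auto intro!: derivative_eq_intros poly_DERIV[THEN DERIV_chain2] simp: field_simps power2_eq_square)
  then have "(expm p has_real_derivative poly ([:0, 0, 1:] * (p - pderiv p)) (1 / t) * exp (- (1 / t))) (at t)"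
    by (rule has_field_derivative_transform_within_open[where S="{0<..}"]) (use greater in \<open>auto simp: expm_def\<close>)
  then show ?thesis using greater by (simp add: expm_def)
qed

lemma expm_1: "0 \<le> expm 1 t" "expm 1 t \<le> 1" "expm 1 t \<noteq> 0 \<longleftrightarrow> 0 < t"
  by (auto simp: expm_def)

lemma expm_1_tendsto: "0 < t \<Longrightarrow> (\<lambda>n. expm 1 (real n * t)) \<longlonglongrightarrow> 1"
proof -
  assume t: "0 < t"
  have "(\<lambda>n. exp (- (1 / t * inverse (real n)))) \<longlonglongrightarrow> exp (- (1 / t * 0))"
    by (intro tendsto_intros LIMSEQ_inverse_real_of_nat[THEN LIMSEQ_imp_Suc[of "\<lambda>n. inverse (real n)"]])
  then have "(\<lambda>n. exp (- (1 / t * inverse (real n)))) \<longlonglongrightarrow> 1" by simp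
  then show "(\<lambda>n. expm 1 (real n * t)) \<longlonglongrightarrow> 1"
  proof (rule Lim_transform_eventually)
    show "\<forall>\<^sub>F n in sequentially. exp (- (1 / t * inverse (real n))) = expm 1 (real n * t)"
      using eventually_gt_at_top[of 0] by eventually_elim (use t in \<open>simp add: expm_def field_simps\<close>)
  qed
qed

text \<open>A class generated so that partial derivatives stay inside it: the derivative of an atom
  is a constant times an atom. Membership therefore gives all iterated \<open>dpart\<close> at
  once.\<close>

inductive smoothc :: "(vec3 \<Rightarrow> real) \<Rightarrow> bool" where
  atom: "smoothc (\<lambda>x. expm p (a * x $ i + c))"
| const: "smoothc (\<lambda>x. c)"
| add: "smoothc f \<Longrightarrow> smoothc g \<Longrightarrow> smoothc (\<lambda>x. f x + g x)"
| mult: "smoothc f \<Longrightarrow> smoothc g \<Longrightarrow> smoothc (\<lambda>x. f x * g x)"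

lemma smoothc_prod: "finite I \<Longrightarrow> (\<And>i. i \<in> I \<Longrightarrow> smoothc (f i)) \<Longrightarrow> smoothc (\<lambda>x. \<Prod>i\<in>I. f i x)"
  by (induction I rule: finite_induct) (auto intro: smoothc.intros)

lemma smoothc_derivative:
  assumes "smoothc f"
  shows "(\<forall>x. f differentiable (at x)) \<and> (\<forall>j. smoothc (\<lambda>x. frechet_derivative f (at x) (axis j 1)))"
  using assms
proof induction
  case (atom p a i c)
  let ?p = "[:0, 0, 1:] * (p - pderiv p)"
  have d: "((\<lambda>x. expm p (a * x $ i + c)) has_derivative (\<lambda>v. expm ?p (a * x $ i + c) * (a * v $ i))) (at x)" for x :: vec3
  proof -
    have "((\<lambda>x. a * x $ i + c) has_derivative (\<lambda>v. a * v $ i)) (at x)"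
      by (auto intro!: derivative_eq_intros bounded_linear.has_derivative[OF bounded_linear_vec_nth])
    from has_derivative_compose[OF this DERIV_expm[THEN has_field_derivative_imp_has_derivative]]
    show ?thesis by simp
  qed
  have "(\<lambda>x. frechet_derivative (\<lambda>x. expm p (a * x $ i + c)) (at x) (axis j 1))
      = (\<lambda>x. (a * axis j 1 $ i) * expm ?p (a * x $ i + c))" for j
    by (simp add: frechet_derivative_at[OF d, symmetric] mult.commute)
  then show ?case using d by (auto simp: differentiable_def intro: smoothc.intros)
next
  case (const c)
  then show ?case by (simp add: frechet_derivative_const smoothc.const)
next
  case (add f g)
  have d: "((\<lambda>x. f x + g x) has_derivative (\<lambda>v. frechet_derivative f (at x) v + frechet_derivative g (at x) v)) (at x)" for x
    using add by (intro has_derivative_add) (auto simp: frechet_derivative_works)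
  show ?case using add d by (auto simp: differentiable_def frechet_derivative_at[OF d, symmetric] intro: smoothc.intros)
next
  case (mult f g)
  have d: "((\<lambda>x. f x * g x) has_derivative (\<lambda>v. f x * frechet_derivative g (at x) v + frechet_derivative f (at x) v * g x)) (at x)" for x
    using mult by (intro has_derivative_mult) (auto simp: frechet_derivative_works)
  show ?case using mult d by (auto simp: differentiable_def frechet_derivative_at[OF d, symmetric] intro!: smoothc.intros)
qed

lemma smoothc_dpart: "smoothc f \<Longrightarrow> smoothc (dpart js f)"
  by (induction js) (auto dest: smoothc_derivative)

lemma smoothc_test_fun:
  assumes "smoothc f" "\<And>x. f x \<noteq> 0 \<Longrightarrow> norm x \<le> R"
  shows "test_fun f"
proof -
  have "bounded {x. f x \<noteq> 0}"
    by (rule bounded_subset[OF bounded_cball[of 0 R]]) (use assms(2) in auto)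
  then show ?thesis unfolding test_fun_def
    using smoothc_dpart[OF assms(1)] smoothc_derivative by (auto simp: compact_closure)
qed

text \<open>For t > 0 the number exp (-1/(n t)) tends to 1 as n grows. Scaling the argument thus
  yields smooth functions that approach the indicator of the open box while their support stays in
  its closure.\<close>

definition bump :: "vec3 \<Rightarrow> vec3 \<Rightarrow> nat \<Rightarrow> vec3 \<Rightarrow> real" where
  "bump a b n x = (\<Prod>i\<in>UNIV. expm 1 (real n * (x $ i - a $ i)) * expm 1 (real n * (b $ i - x $ i)))"

lemma bump_smoothc: "smoothc (bump a b n)"
proof -
  have "smoothc (\<lambda>x. expm 1 (real n * (x $ i - a $ i)) * expm 1 (real n * (b $ i - x $ i)))" for i
    using smoothc.mult[OF smoothc.atom[of 1 "real n" i "- real n * a $ i"] smoothc.atom[of 1 "- real n" i "real n * b $ i"]]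
    by (simp add: algebra_simps)
  then show ?thesis unfolding bump_def[abs_def] by (intro smoothc_prod) auto
qed

lemma bump_bounds: "0 \<le> bump a b n x" "bump a b n x \<le> 1"
  unfolding bump_def by (auto intro!: prod_nonneg prod_le_1 mult_le_one simp: expm_1)

lemma bump_support: "0 < n \<Longrightarrow> bump a b n x \<noteq> 0 \<longleftrightarrow> x \<in> box a b"
  by (auto simp: bump_def expm_1(3) mem_box_cart zero_less_mult_iff)

lemma bump_0: "bump a b 0 x = 0"
  by (simp add: bump_def expm_def)

lemma box_norm_bound: "\<exists>R. \<forall>x\<in>box a b. norm (x::vec3) \<le> R"
  using bounded_box[of a b] by (auto simp: bounded_iff)

lemma bump_test_fun: "test_fun (bump a b n)"
proof -
  obtain R where R: "\<And>x. x \<in> box a b \<Longrightarrow> norm x \<le> R" using box_norm_bound by blast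
  show ?thesis
    by (rule smoothc_test_fun[OF bump_smoothc, where R=R])
      (use R bump_support in \<open>cases "n = 0"; force simp: bump_0\<close>)
qed

lemma bump_tendsto: "(\<lambda>n. bump a b n x) \<longlonglongrightarrow> indicator (box a b) x"
proof (cases "x \<in> box a b")
  case True
  have "(\<lambda>n. bump a b n x) \<longlonglongrightarrow> (\<Prod>i\<in>(UNIV::3 set). 1 * 1)"
    unfolding bump_def using True by (intro tendsto_intros expm_1_tendsto) (auto simp: mem_box_cart)
  then show ?thesis using True by simp
next
  case False
  then have "bump a b n x = 0" for n using bump_support[of n a b x] by (cases "n = 0") (auto simp: bump_0)
  then show ?thesis using False by simp
qed

section \<open>Locally integrable functions and the fundamental lemma of the calculus of
  variations\<close>

lemma loc_int_cball: "loc_int g \<Longrightarrow> integrable lborel (\<lambda>x. g x * iball R x)"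
  unfolding loc_int_def set_integrable_def by (auto simp: mult.commute)

text \<open>Local integrability speaks of compact sets only; the function is the pointwise limit of
  its restrictions to growing balls.\<close>

lemma loc_int_measurable [measurable_dest]:
  assumes "loc_int g" shows "g \<in> bmeas"
proof (rule borel_measurable_LIMSEQ_real)
  show "(\<lambda>n. g x * iball (real n) x) \<longlonglongrightarrow> g x" for x
  proof -
    obtain N :: nat where "norm x \<le> real N" using real_arch_simple by blast
    then have "\<forall>\<^sub>F R in sequentially. g x * iball (real R) x = g x"
      by (intro eventually_sequentiallyI[of N]) (auto split: split_indicator)
    then show ?thesis by (rule tendsto_eventually)
  qed
  show "(\<lambda>x. g x * iball (real n) x) \<in> bmeas" for n
    using loc_int_cball[OF assms] by auto
qed

lemma loc_intI:
  assumes [measurable]: "g \<in> bmeas"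
    and i: "\<And>R. integrable lborel (\<lambda>x. g x * iball R x)"
  shows "loc_int g"
  unfolding loc_int_def set_integrable_def
proof (intro allI impI)
  fix K :: "vec3 set" assume K: "compact K"
  then obtain R where R: "\<And>x. x \<in> K \<Longrightarrow> norm x \<le> R"
    using compact_imp_bounded bounded_iff by metis
  have [measurable]: "K \<in> sets borel" using K by (intro borel_closed compact_imp_closed)
  show "integrable lborel (\<lambda>x. indicator K x *\<^sub>R g x)"
    by (rule bi_integrable_bound[OF i[of R]]) (use R in \<open>auto split: split_indicator\<close>)
qed

lemma loc_int_mult:
  assumes g: "loc_int g" and [measurable]: "\<eta> \<in> bmeas"
    and B: "\<And>x. \<bar>\<eta> x\<bar> \<le> B" and R: "\<And>x. \<eta> x \<noteq> 0 \<Longrightarrow> norm x \<le> R"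
  shows "integrable lborel (\<lambda>x. g x * \<eta> x)"
proof (rule bi_integrable_bound[of _ "\<lambda>x. B * (g x * iball R x)"])
  show "integrable lborel (\<lambda>x. B * (g x * iball R x))"
    by (intro integrable_mult_right loc_int_cball g)
  have [measurable]: "g \<in> bmeas" by (rule loc_int_measurable[OF g])
  show "(\<lambda>x. g x * \<eta> x) \<in> borel_measurable lborel" by measurable
  have "\<bar>g x * \<eta> x\<bar> \<le> \<bar>B * (g x * iball R x)\<bar>" for x
  proof (cases "\<eta> x = 0")
    case False
    then have "iball R x = (1::real)" using R[of x] by simp
    then show ?thesis using mult_left_mono[OF order_trans[OF B[of x] abs_ge_self], of "\<bar>g x\<bar>"]
      by (simp add: abs_mult mult.commute)
  qed simp
  then show "AE x in lborel. norm (g x * \<eta> x) \<le> norm (B * (g x * iball R x))" by simp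
qed

lemma loc_int_add: "loc_int f \<Longrightarrow> loc_int g \<Longrightarrow> loc_int (\<lambda>x. f x + g x)"
  using loc_int_measurable[of f] loc_int_measurable[of g] loc_int_cball[of f] loc_int_cball[of g]
  by (intro loc_intI) (auto simp: distrib_right)

lemma loc_int_cmult: "loc_int g \<Longrightarrow> loc_int (\<lambda>x. c * g x)"
  using loc_int_measurable[of g] loc_int_cball[of g]
  by (intro loc_intI) (auto simp: mult.assoc)

lemma loc_int_diff: "loc_int f \<Longrightarrow> loc_int g \<Longrightarrow> loc_int (\<lambda>x. f x - g x)"
  using loc_int_add[of f "\<lambda>x. (-1) * g x"] loc_int_cmult[of g "-1"] by simp

lemma loc_int_zero: "loc_int (\<lambda>x. 0)"
  by (intro loc_intI) auto

lemma loc_int_shift: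
  assumes "loc_int g" shows "loc_int (\<lambda>x. g (x + h))"
proof (rule loc_intI)
  have [measurable]: "g \<in> bmeas" by (rule loc_int_measurable[OF assms])
  show "(\<lambda>x. g (x + h)) \<in> bmeas" by measurable
  fix R
  have *: "norm x \<le> R \<Longrightarrow> norm (x + h) \<le> R + norm h" for x using norm_triangle_ineq[of x h] by linarith
  show "integrable lborel (\<lambda>x. g (x + h) * iball R x)"
    by (rule bi_integrable_bound[OF integrable_shift[OF loc_int_cball[OF assms, of "R + norm h"], of h]])
      (use * in \<open>auto split: split_indicator\<close>)
qed

lemma fundamental_lemma_box:
  assumes q: "loc_int q" and z: "\<And>\<phi>. test_fun \<phi> \<Longrightarrow> (LBINT x. q x * \<phi> x) = 0"
  shows "(LBINT x. q x * indicator (box a b) x) = 0"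
proof -
  have [measurable]: "q \<in> bmeas" by (rule loc_int_measurable[OF q])
  have [measurable]: "bump a b n \<in> bmeas" for n
    using smoothc_derivative[OF bump_smoothc]
    by (intro borel_measurable_continuous_onI) (auto simp: continuous_at_imp_continuous_on differentiable_imp_continuous_within)
  obtain R where R: "\<And>x. x \<in> box a b \<Longrightarrow> norm x \<le> R" using box_norm_bound by blast
  have "(\<lambda>n. LBINT x. q x * bump a b n x) \<longlonglongrightarrow> (LBINT x. q x * indicator (box a b) x)"
  proof (rule integral_dominated_convergence[where w="\<lambda>x. \<bar>q x * iball R x\<bar>"])
    show "AE x in lborel. (\<lambda>n. q x * bump a b n x) \<longlonglongrightarrow> q x * indicator (box a b) x"
      by (intro AE_I2 tendsto_intros bump_tendsto)
    show "integrable lborel (\<lambda>x. \<bar>q x * iball R x\<bar>)"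
      by (intro integrable_abs loc_int_cball q)
    have "\<bar>q x * bump a b n x\<bar> \<le> \<bar>q x * iball R x\<bar>" for n x
    proof (cases "x \<in> box a b \<and> 0 < n")
      case True
      then show ?thesis using R bump_bounds[of a b n x] by (auto simp: abs_mult intro: mult_left_le)
    next
      case False
      then have "bump a b n x = 0" using bump_support[of n a b x] by (cases "n = 0") (auto simp: bump_0)
      then show ?thesis by simp
    qed
    then show "AE x in lborel. norm (q x * bump a b n x) \<le> \<bar>q x * iball R x\<bar>" for n by simp
  qed measurable
  then show ?thesis using z[OF bump_test_fun] by (simp add: LIMSEQ_const_iff)
qed

text \<open>Positive and negative part are taken as densities. The two measures agree on boxes, an
  intersection-stable generator, hence everywhere, and densities are unique almost
  everywhere.\<close>

lemma box_integrals_zero_imp_AE_zero: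
  fixes q :: "vec3 \<Rightarrow> real"
  assumes q: "integrable lborel q" and z: "\<And>a b. (LBINT x. q x * indicator (box a b) x) = 0"
  shows "AE x in lborel. q x = 0"
proof -
  have [measurable]: "q \<in> bmeas" using q by auto
  let ?E = "range (\<lambda>(a, b). box a b :: vec3 set)"
  let ?f = "\<lambda>x. max 0 (q x)" and ?g = "\<lambda>x. max 0 (- q x)"
  let ?M = "density lborel (\<lambda>x. ennreal (?f x))" and ?N = "density lborel (\<lambda>x. ennreal (?g x))"
  have i: "integrable lborel ?f" "integrable lborel ?g" using q by auto
  have em: "emeasure (density lborel (\<lambda>x. ennreal (p x))) X = ennreal (LBINT x. p x * indicator X x)"
    if p: "integrable lborel p" "\<And>x. 0 \<le> p x" and [measurable]: "X \<in> sets borel" for p :: "vec3 \<Rightarrow> real" and X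
  proof -
    have [measurable]: "p \<in> bmeas" using p by auto
    have "emeasure (density lborel (\<lambda>x. ennreal (p x))) X = (\<integral>\<^sup>+x. ennreal (p x * indicator X x) \<partial>lborel)"
      by (subst emeasure_density) (auto intro!: nn_integral_cong split: split_indicator)
    also have "\<dots> = ennreal (LBINT x. p x * indicator X x)"
    proof (rule nn_integral_eq_integral)
      show "integrable lborel (\<lambda>x. p x * indicator X x)"
        by (rule bi_integrable_bound[OF p(1)]) (auto split: split_indicator)
    qed (use p in auto)
    finally show ?thesis .
  qed
  have "?M = ?N"
  proof (rule measure_eqI_generator_eq[where E="?E" and \<Omega>=UNIV and A="\<lambda>n::nat. box (- (real n *\<^sub>R One)) (real n *\<^sub>R One)"])
    show "Int_stable ?E"
      by (auto simp: Int_stable_def box_Int_box)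
    show "sets ?M = sigma_sets UNIV ?E" "sets ?N = sigma_sets UNIV ?E"
      by (simp_all add: borel_eq_box sets_measure_of)
    show "\<And>X. X \<in> ?E \<Longrightarrow> emeasure ?M X = emeasure ?N X"
    proof -
      fix X assume "X \<in> ?E"
      then obtain a b where X: "X = box a b" by auto
      have i': "integrable lborel (\<lambda>x. ?f x * indicator X x)" "integrable lborel (\<lambda>x. ?g x * indicator X x)"
        by (rule bi_integrable_bound[OF i(1)] bi_integrable_bound[OF i(2)];
            auto simp: X split: split_indicator)+
      have "(LBINT x. ?f x * indicator X x) - (LBINT x. ?g x * indicator X x) = (LBINT x. q x * indicator X x)"
      proof -
        have "(LBINT x. q x * indicator X x) = (LBINT x. ?f x * indicator X x - ?g x * indicator X x)"
          by (rule bi_integral_cong) (auto simp: max_def split: split_indicator)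
        then show ?thesis by (simp only: bi_integral_diff[OF i'])
      qed
      then have "(LBINT x. ?f x * indicator X x) = (LBINT x. ?g x * indicator X x)"
        using z[of a b] X by simp
      moreover have "emeasure ?M X = ennreal (LBINT x. ?f x * indicator X x)"
        by (rule em[OF i(1)]) (auto simp: X)
      moreover have "emeasure ?N X = ennreal (LBINT x. ?g x * indicator X x)"
        by (rule em[OF i(2)]) (auto simp: X)
      ultimately show "emeasure ?M X = emeasure ?N X" by simp
    qed
    show "(\<Union>n::nat. box (- (real n *\<^sub>R One)) (real n *\<^sub>R One :: vec3)) = UNIV"
      using UN_box_eq_UNIV by simp
    show "emeasure ?M (box (- (real n *\<^sub>R One)) (real n *\<^sub>R One)) \<noteq> \<infinity>" for n
      by (subst em[OF i(1)]) auto
  qed auto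
  then have "AE x in lborel. ennreal (?f x) = ennreal (?g x)"
    by (subst (asm) sigma_finite_measure.density_unique_iff[OF sigma_finite_lborel]) auto
  then show ?thesis by eventually_elim (auto simp: max_def split: if_splits)
qed

text \<open>The measure argument needs an integrable function, so \<open>q\<close> is cut to large
  boxes. This preserves the hypothesis because the intersection of two boxes is a box.\<close>

proposition fundamental_lemma:
  assumes q: "loc_int q" and z: "\<And>\<phi>. test_fun \<phi> \<Longrightarrow> (LBINT x. q x * \<phi> x) = 0"
  shows "AE x in lborel. q x = 0"
proof -
  have [measurable]: "q \<in> bmeas" by (rule loc_int_measurable[OF q])
  let ?B = "\<lambda>n::nat. box (- (real n *\<^sub>R One)) (real n *\<^sub>R One) :: vec3 set"
  have "AE x in lborel. q x * indicator (?B n) x = 0" for n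
  proof (rule box_integrals_zero_imp_AE_zero)
    obtain R where R: "\<And>x. x \<in> ?B n \<Longrightarrow> norm x \<le> R" using box_norm_bound by blast
    show "integrable lborel (\<lambda>x. q x * indicator (?B n) x)"
      by (rule loc_int_mult[OF q, of _ 1 R]) (use R in \<open>auto simp: indicator_def split: if_splits\<close>)
    fix a b
    obtain c d where "box a b \<inter> ?B n = box c d" unfolding box_Int_box by blast
    then have "(\<lambda>x. q x * indicator (?B n) x * indicator (box a b) x) = (\<lambda>x. q x * indicator (box c d) x)"
      by (auto simp: fun_eq_iff split: split_indicator)
    then show "(LBINT x. q x * indicator (?B n) x * indicator (box a b) x) = 0"
      using fundamental_lemma_box[OF q z] by simp
  qed
  then have "AE x in lborel. \<forall>n. q x * indicator (?B n) x = 0" by (simp only: AE_all_countable simp_thms)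
  then show ?thesis
  proof eventually_elim
    case (elim x)
    have "(\<Union>n. ?B n) = UNIV" by (rule UN_box_eq_UNIV)
    then obtain n where "x \<in> ?B n" by blast
    with elim[rule_format, of n] show ?case by simp
  qed
qed

section \<open>Weak derivatives and difference quotients\<close>

definition unif01 :: "real measure" where "unif01 = restrict_space lborel {0..1}"

lemma space_unif01 [simp]: "space unif01 = {0..1}"
  by (simp add: unif01_def space_restrict_space)

lemma prob_space_unif01: "prob_space unif01"
  by (rule prob_spaceI) (simp add: unif01_def space_restrict_space emeasure_restrict_space)

lemma measurable_unif01: "f \<in> bmeas \<Longrightarrow> f \<in> borel_measurable unif01"
  unfolding unif01_def by (intro measurable_restrict_space1) simp

lemma integral_unif01: "(\<integral>s. f s \<partial>unif01) = (LINT s:{0..1}|lborel. f s)" for f :: "real \<Rightarrow> 'b::{banach,second_countable_topology}"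
  unfolding unif01_def set_lebesgue_integral_def by (subst integral_restrict_space) auto

definition av :: "'c measure \<Rightarrow> ('c \<Rightarrow> vec3) \<Rightarrow> (vec3 \<Rightarrow> real) \<Rightarrow> vec3 \<Rightarrow> real" where
  "av \<mu> \<sigma> g x = (\<integral>s. g (x + \<sigma> s) \<partial>\<mu>)"

context
  fixes \<mu> :: "'c measure" and \<sigma> :: "'c \<Rightarrow> vec3" and \<rho> :: real
  assumes mu: "prob_space \<mu>" and sigma[measurable]: "\<sigma> \<in> borel_measurable \<mu>"
    and rho: "\<And>s. s \<in> space \<mu> \<Longrightarrow> norm (\<sigma> s) \<le> \<rho>"
begin

interpretation prob_space \<mu> by (rule mu)
interpretation Q: pair_sigma_finite lborel \<mu> ..

text \<open>The prerequisite for Fubini. Shifts of length at most \<rho> keep the ball of radius R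
  inside the one of radius R + \<rho>, so a single local integral bounds every section.\<close>

lemma joint_shift_integrable:
  assumes g: "loc_int g"
  shows "integrable (lborel \<Otimes>\<^sub>M \<mu>) (\<lambda>(x, s). g (x + \<sigma> s) * iball R x)"
proof (rule integrableI_bounded)
  have [measurable]: "g \<in> bmeas" by (rule loc_int_measurable[OF g])
  show m: "(\<lambda>(x, s). g (x + \<sigma> s) * iball R x) \<in> borel_measurable (lborel \<Otimes>\<^sub>M \<mu>)" by measurable
  let ?I = "\<integral>\<^sup>+x. ennreal \<bar>g x * iball (R + \<rho>) x\<bar> \<partial>lborel"
  have fin: "?I < \<infinity>"
    using loc_int_cball[OF g, of "R + \<rho>"] by (simp add: integrable_iff_bounded)
  have "(\<integral>\<^sup>+z. ennreal (norm (case z of (x, s) \<Rightarrow> g (x + \<sigma> s) * iball R x)) \<partial>(lborel \<Otimes>\<^sub>M \<mu>))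
    = (\<integral>\<^sup>+s. \<integral>\<^sup>+x. ennreal \<bar>g (x + \<sigma> s) * iball R x\<bar> \<partial>lborel \<partial>\<mu>)"
    by (subst Q.nn_integral_snd[symmetric]) simp_all
  also have "\<dots> \<le> (\<integral>\<^sup>+s. ?I \<partial>\<mu>)"
  proof (rule nn_integral_mono)
    fix s assume s: "s \<in> space \<mu>"
    have "norm x \<le> R \<Longrightarrow> norm (x + \<sigma> s) \<le> R + \<rho>" for x
      using norm_triangle_ineq[of x "\<sigma> s"] rho[OF s] by linarith
    then have "(\<integral>\<^sup>+x. ennreal \<bar>g (x + \<sigma> s) * iball R x\<bar> \<partial>lborel)
      \<le> (\<integral>\<^sup>+x. ennreal \<bar>g (x + \<sigma> s) * iball (R + \<rho>) (x + \<sigma> s)\<bar> \<partial>lborel)"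
      by (intro nn_integral_mono ennreal_leI) (auto split: split_indicator)
    also have "\<dots> = ?I"
      by (rule nn_integral_shift[of "\<lambda>x. ennreal \<bar>g x * iball (R + \<rho>) x\<bar>"]) measurable
    finally show "(\<integral>\<^sup>+x. ennreal \<bar>g (x + \<sigma> s) * iball R x\<bar> \<partial>lborel) \<le> ?I" .
  qed
  also have "\<dots> = ?I" by (simp add: emeasure_space_1)
  finally show "(\<integral>\<^sup>+z. ennreal (norm (case z of (x, s) \<Rightarrow> g (x + \<sigma> s) * iball R x)) \<partial>(lborel \<Otimes>\<^sub>M \<mu>)) < \<infinity>"
    using fin by (rule le_less_trans)
qed

lemma av_measurable [measurable]:
  assumes [measurable]: "g \<in> bmeas" shows "av \<mu> \<sigma> g \<in> bmeas"
  unfolding av_def[abs_def] by measurable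

lemma av_AE_integrable:
  assumes g: "loc_int g"
  shows "AE x in lborel. integrable \<mu> (\<lambda>s. g (x + \<sigma> s))"
proof -
  have "AE x in lborel. \<forall>n::nat. integrable \<mu> (\<lambda>s. g (x + \<sigma> s) * iball (real n) x)"
    unfolding AE_all_countable
    using Q.AE_integrable_fst'[OF joint_shift_integrable[OF g]] by simp
  then show ?thesis
  proof eventually_elim
    case (elim x)
    obtain N :: nat where "norm x \<le> real N" using real_arch_simple by blast
    with elim[rule_format, of N] show ?case by simp
  qed
qed

lemma loc_int_av:
  assumes g: "loc_int g" shows "loc_int (av \<mu> \<sigma> g)"
proof (rule loc_intI)
  have [measurable]: "g \<in> bmeas" by (rule loc_int_measurable[OF g])
  show "av \<mu> \<sigma> g \<in> bmeas" by measurable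
  show "integrable lborel (\<lambda>x. av \<mu> \<sigma> g x * iball R x)" for R
    using Q.integrable_fst'[OF joint_shift_integrable[OF g, of R]] by (simp add: av_def)
qed

lemma av_pairing:
  assumes g: "loc_int g" and [measurable]: "\<eta> \<in> bmeas"
    and B: "\<And>x. \<bar>\<eta> x\<bar> \<le> B" and R: "\<And>x. \<eta> x \<noteq> 0 \<Longrightarrow> norm x \<le> R"
  shows "(LBINT x. av \<mu> \<sigma> g x * \<eta> x) = (\<integral>s. \<integral>x. g (x + \<sigma> s) * \<eta> x \<partial>lborel \<partial>\<mu>)"
proof -
  have [measurable]: "g \<in> bmeas" by (rule loc_int_measurable[OF g])
  have "integrable (lborel \<Otimes>\<^sub>M \<mu>) (\<lambda>(x, s). g (x + \<sigma> s) * \<eta> x)"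
  proof (rule bi_integrable_bound[OF integrable_mult_right[OF joint_shift_integrable[OF g, of R], of B]])
    have "\<bar>g (x + \<sigma> s) * \<eta> x\<bar> \<le> \<bar>B * (g (x + \<sigma> s) * iball R x)\<bar>" for x s
    proof (cases "\<eta> x = 0")
      case False
      then have "iball R x = (1::real)" using R[of x] by simp
      then show ?thesis using mult_left_mono[OF order_trans[OF B[of x] abs_ge_self], of "\<bar>g (x + \<sigma> s)\<bar>"]
        by (simp add: abs_mult mult.commute)
    qed simp
    then show "AE z in lborel \<Otimes>\<^sub>M \<mu>. norm (case z of (x, s) \<Rightarrow> g (x + \<sigma> s) * \<eta> x)
        \<le> norm (B * (case z of (x, s) \<Rightarrow> g (x + \<sigma> s) * iball R x))"
      by (auto simp: split_beta)
  qed measurable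
  from Q.Fubini_integral[OF this] show ?thesis by (simp add: av_def)
qed

lemma av_pairing_right:
  assumes g: "loc_int g" and [measurable]: "\<eta> \<in> bmeas"
    and B: "\<And>x. \<bar>\<eta> x\<bar> \<le> B" and R: "\<And>x. \<eta> x \<noteq> 0 \<Longrightarrow> norm x \<le> R"
  shows "(\<integral>s. \<integral>x. g x * \<eta> (x + \<sigma> s) \<partial>lborel \<partial>\<mu>) = (LBINT x. g x * av \<mu> \<sigma> \<eta> x)"
proof -
  have [measurable]: "g \<in> bmeas" by (rule loc_int_measurable[OF g])
  have B0: "0 \<le> B" using B[of 0] by linarith
  have i0: "integrable (lborel \<Otimes>\<^sub>M \<mu>) (\<lambda>(x, s). g x * iball (R + \<rho>) x)"
  proof (rule integrableI_bounded)
    have "(\<integral>\<^sup>+z. ennreal (norm (case z of (x, s) \<Rightarrow> g x * iball (R + \<rho>) x)) \<partial>(lborel \<Otimes>\<^sub>M \<mu>))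
      = (\<integral>\<^sup>+x. \<integral>\<^sup>+s. ennreal (norm (g x * iball (R + \<rho>) x)) \<partial>\<mu> \<partial>lborel)"
      by (subst nn_integral_fst[symmetric]) simp_all
    also have "\<dots> < \<infinity>"
      using loc_int_cball[OF g, of "R + \<rho>"] by (simp add: emeasure_space_1 integrable_iff_bounded)
    finally show "(\<integral>\<^sup>+z. ennreal (norm (case z of (x, s) \<Rightarrow> g x * iball (R + \<rho>) x)) \<partial>(lborel \<Otimes>\<^sub>M \<mu>)) < \<infinity>" .
  qed measurable
  have "integrable (lborel \<Otimes>\<^sub>M \<mu>) (\<lambda>(x, s). g x * \<eta> (x + \<sigma> s))"
  proof (rule bi_integrable_bound[OF integrable_mult_right[OF i0, of B]])
    have "\<bar>g x * \<eta> (x + \<sigma> s)\<bar> \<le> \<bar>B * (g x * iball (R + \<rho>) x)\<bar>" if s: "s \<in> space \<mu>" for x s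
    proof (cases "\<eta> (x + \<sigma> s) = 0")
      case False
      then have "norm x \<le> R + \<rho>"
        using R[of "x + \<sigma> s"] norm_triangle_ineq[of "x + \<sigma> s" "- \<sigma> s"] rho[OF s] by simp
      then have "iball (R + \<rho>) x = (1::real)" by simp
      then show ?thesis using mult_left_mono[OF order_trans[OF B[of "x + \<sigma> s"] abs_ge_self], of "\<bar>g x\<bar>"]
        by (simp add: abs_mult mult.commute)
    qed simp
    then show "AE z in lborel \<Otimes>\<^sub>M \<mu>. norm (case z of (x, s) \<Rightarrow> g x * \<eta> (x + \<sigma> s))
        \<le> norm (B * (case z of (x, s) \<Rightarrow> g x * iball (R + \<rho>) x))"
      by (intro AE_I2) (auto simp: space_pair_measure split_beta)
  qed measurable
  from Q.Fubini_integral[OF this] show ?thesis by (simp add: av_def)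
qed

end

abbreviation seg :: "3 \<Rightarrow> real \<Rightarrow> real \<Rightarrow> vec3" where
  "seg j h \<equiv> \<lambda>s. (s * h) *\<^sub>R axis j 1"

lemma seg_measurable [measurable]: "seg j h \<in> borel_measurable unif01"
  by (rule measurable_unif01) simp

lemma seg_norm: "s \<in> space unif01 \<Longrightarrow> norm (seg j h s) \<le> \<bar>h\<bar>"
  by (simp add: abs_mult mult_left_le_one_le)

lemmas seg_rules = prob_space_unif01 seg_measurable seg_norm

text \<open>Absolute continuity on lines in integrated form. The exceptional null set may depend on
  the step h. The formulation passes through shifts, dilations and linear combinations without test
  functions.\<close>

definition acl :: "3 \<Rightarrow> (vec3 \<Rightarrow> real) \<Rightarrow> (vec3 \<Rightarrow> real) \<Rightarrow> bool" where
  "acl j w g \<longleftrightarrow> loc_int w \<and> loc_int g \<and>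
    (\<forall>h. AE x in lborel. w (x + h *\<^sub>R axis j 1) - w x = h * av unif01 (seg j h) g x)"

definition wderiv :: "3 \<Rightarrow> (vec3 \<Rightarrow> real) \<Rightarrow> (vec3 \<Rightarrow> real) \<Rightarrow> bool" where
  "wderiv j w g \<longleftrightarrow> loc_int w \<and> loc_int g \<and>
    (\<forall>\<phi>. test_fun \<phi> \<longrightarrow> (LBINT x. w x * dpart [j] \<phi> x) = - (LBINT x. g x * \<phi> x))"

lemma weak_grad_iff: "weak_grad u G \<longleftrightarrow> (\<forall>i j. wderiv j (\<lambda>x. u x $ i) (\<lambda>x. G x $ i $ j))"
  unfolding weak_grad_def wderiv_def by blast

text \<open>A classical continuous derivative in one direction. The smoothed factors of the
  expansion have exactly this regularity, so it replaces \<open>test_fun\<close> in the integration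
  by parts.\<close>

definition cderiv :: "3 \<Rightarrow> (vec3 \<Rightarrow> real) \<Rightarrow> (vec3 \<Rightarrow> real) \<Rightarrow> bool" where
  "cderiv j \<eta> \<eta>' \<longleftrightarrow> continuous_on UNIV \<eta> \<and> continuous_on UNIV \<eta>' \<and>
     (\<forall>x. ((\<lambda>s. \<eta> (x + s *\<^sub>R axis j 1)) has_real_derivative \<eta>' x) (at 0))"

definition bsupp :: "(vec3 \<Rightarrow> 'b::zero) \<Rightarrow> bool" where
  "bsupp \<eta> \<longleftrightarrow> (\<exists>R. \<forall>x. \<eta> x \<noteq> 0 \<longrightarrow> norm x \<le> R)"

lemma continuous_bsupp_bounded:
  assumes "continuous_on UNIV (\<eta> :: vec3 \<Rightarrow> real)" "bsupp \<eta>"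
  obtains B where "\<And>x. \<bar>\<eta> x\<bar> \<le> B"
proof -
  obtain R where R: "\<And>x. \<eta> x \<noteq> 0 \<Longrightarrow> norm x \<le> R" using assms(2) by (auto simp: bsupp_def)
  have "compact (\<eta> ` cball 0 R)"
    by (rule compact_continuous_image[OF continuous_on_subset[OF assms(1)]]) auto
  then obtain B where B: "\<And>y. y \<in> \<eta> ` cball 0 R \<Longrightarrow> norm y \<le> B"
    using compact_imp_bounded bounded_iff by metis
  have "\<bar>\<eta> x\<bar> \<le> max B 0" for x
    using B[of "\<eta> x"] R[of x] by (cases "\<eta> x = 0") auto
  then show ?thesis by (rule that)
qed

lemma cderiv_DERIV:
  assumes "cderiv j \<eta> \<eta>'"
  shows "((\<lambda>s. \<eta> (x + (s * h) *\<^sub>R axis j 1)) has_real_derivative h * \<eta>' (x + (s * h) *\<^sub>R axis j 1)) (at s)"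
proof -
  let ?y = "x + (s * h) *\<^sub>R axis j 1"
  have "((\<lambda>r. \<eta> (?y + r *\<^sub>R axis j 1)) has_real_derivative \<eta>' ?y) (at ((s - s) * h))"
    using assms by (simp add: cderiv_def)
  moreover have "((\<lambda>r. (r - s) * h) has_real_derivative h) (at s)"
    by (auto intro!: derivative_eq_intros)
  ultimately have "((\<lambda>r. \<eta> (?y + ((r - s) * h) *\<^sub>R axis j 1)) has_real_derivative \<eta>' ?y * h) (at s)"
    by (rule DERIV_chain2)
  then show ?thesis by (simp add: algebra_simps)
qed

lemma cderiv_FTC:
  assumes "cderiv j \<eta> \<eta>'"
  shows "\<eta> (x + h *\<^sub>R axis j 1) - \<eta> x = h * av unif01 (seg j h) \<eta>' x"
proof -
  have c: "continuous_on {0..1} (\<lambda>s. h * \<eta>' (x + (s * h) *\<^sub>R axis j 1))"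
    using assms by (intro continuous_intros continuous_on_compose2[where f="\<lambda>s. x + (s * h) *\<^sub>R axis j 1" and g=\<eta>' and t=UNIV])
      (auto simp: cderiv_def)
  have "(LBINT s. indicator {0..1} s *\<^sub>R (h * \<eta>' (x + (s * h) *\<^sub>R axis j 1)))
     = \<eta> (x + (1 * h) *\<^sub>R axis j 1) - \<eta> (x + (0 * h) *\<^sub>R axis j 1)"
    by (rule integral_FTC_Icc[OF _ _ c])
      (auto intro!: has_field_derivative_at_within cderiv_DERIV[OF assms] simp: has_real_derivative_iff_has_vector_derivative[symmetric])
  then show ?thesis
    unfolding av_def integral_unif01 set_lebesgue_integral_def
    by (simp add: mult.left_commute)
qed

lemma test_fun_differentiable: "test_fun \<phi> \<Longrightarrow> dpart js \<phi> differentiable (at x)"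
  by (simp add: test_fun_def)

lemma test_fun_cderiv:
  assumes "test_fun \<phi>"
  shows "cderiv j \<phi> (dpart [j] \<phi>)" "bsupp \<phi>" "bsupp (dpart [j] \<phi>)"
proof -
  have d: "\<phi> differentiable (at x)" "dpart [j] \<phi> differentiable (at x)" for x
    using test_fun_differentiable[OF assms, of "[]" x] test_fun_differentiable[OF assms, of "[j]" x] by auto
  have "((\<lambda>s. \<phi> (x + s *\<^sub>R axis j 1)) has_real_derivative dpart [j] \<phi> x) (at 0)" for x
  proof -
    have 1: "((\<lambda>s. x + s *\<^sub>R axis j 1) has_derivative (\<lambda>s. s *\<^sub>R axis j 1)) (at (0::real))"
      by (auto intro!: derivative_eq_intros)
    have 2: "(\<phi> has_derivative frechet_derivative \<phi> (at x)) (at (x + 0 *\<^sub>R axis j 1))"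
      using d(1)[of x] by (simp add: frechet_derivative_works)
    have "((\<lambda>s. \<phi> (x + s *\<^sub>R axis j 1)) has_derivative (\<lambda>s. frechet_derivative \<phi> (at x) (s *\<^sub>R axis j 1))) (at 0)"
      by (rule has_derivative_compose[OF 1 2])
    moreover have "frechet_derivative \<phi> (at x) (s *\<^sub>R axis j 1) = dpart [j] \<phi> x * s" for s
      using linear_cmul[OF linear_frechet_derivative[OF d(1)[of x]]] by simp
    ultimately show ?thesis by (simp add: has_field_derivative_def)
  qed
  then show "cderiv j \<phi> (dpart [j] \<phi>)" unfolding cderiv_def using d
    by (auto intro!: continuous_at_imp_continuous_on differentiable_imp_continuous_within simp del: dpart.simps)
  have "bounded (closure {x. \<phi> x \<noteq> 0})"
    using assms by (auto simp: test_fun_def compact_imp_bounded)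
  then obtain R where R: "\<And>x. x \<in> closure {x. \<phi> x \<noteq> 0} \<Longrightarrow> norm x \<le> R" by (auto simp: bounded_iff)
  then show "bsupp \<phi>" unfolding bsupp_def using closure_subset[of "{x. \<phi> x \<noteq> 0}"] by blast
  have "dpart [j] \<phi> x = 0" if x: "x \<notin> closure {x. \<phi> x \<noteq> 0}" for x
  proof -
    have "((\<lambda>_. 0) has_derivative (\<lambda>_. 0)) (at x)" by simp
    then have "(\<phi> has_derivative (\<lambda>_. 0)) (at x)"
      by (rule has_derivative_transform_within_open[where s="- closure {x. \<phi> x \<noteq> 0}"])
        (use x closure_subset[of "{x. \<phi> x \<noteq> 0}"] in auto)
    then show ?thesis by (simp add: frechet_derivative_at[symmetric])
  qed
  then show "bsupp (dpart [j] \<phi>)" unfolding bsupp_def using R by blast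
qed

lemma dpart_shift:
  assumes "\<And>js x. dpart js \<phi> differentiable (at x)"
  shows "dpart js (\<lambda>x. \<phi> (x + h)) = (\<lambda>x. dpart js \<phi> (x + h))"
proof (induction js)
  case (Cons j js)
  have "frechet_derivative (\<lambda>x. dpart js \<phi> (x + h)) (at x) = frechet_derivative (dpart js \<phi>) (at (x + h))" for x
  proof (rule frechet_derivative_at[symmetric])
    have 1: "((\<lambda>x. x + h) has_derivative (\<lambda>v. v)) (at x)" by (auto intro!: derivative_eq_intros)
    have 2: "(dpart js \<phi> has_derivative frechet_derivative (dpart js \<phi>) (at (x + h))) (at (x + h))"
      using assms by (simp add: frechet_derivative_works)
    show "((\<lambda>x. dpart js \<phi> (x + h)) has_derivative frechet_derivative (dpart js \<phi>) (at (x + h))) (at x)"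
      using has_derivative_compose[OF 1 2] .
  qed
  then show ?case using Cons by simp
qed simp

lemma test_fun_shift:
  assumes "test_fun \<phi>" shows "test_fun (\<lambda>x. \<phi> (x + h))"
    and "dpart js (\<lambda>x. \<phi> (x + h)) = (\<lambda>x. dpart js \<phi> (x + h))"
proof -
  have d: "dpart js \<phi> differentiable (at x)" for js x using assms by (rule test_fun_differentiable)
  show *: "dpart js (\<lambda>x. \<phi> (x + h)) = (\<lambda>x. dpart js \<phi> (x + h))" for js by (rule dpart_shift[OF d])
  obtain R where R: "\<And>x. \<phi> x \<noteq> 0 \<Longrightarrow> norm x \<le> R" using test_fun_cderiv(2)[OF assms] by (auto simp: bsupp_def)
  have "bounded {x. \<phi> (x + h) \<noteq> 0}"
  proof (rule bounded_subset[OF bounded_cball[of "- h" R]], rule subsetI)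
    fix x assume "x \<in> {x. \<phi> (x + h) \<noteq> 0}"
    then have "norm (x + h) \<le> R" using R by simp
    then show "x \<in> cball (- h) R" by (simp add: dist_norm norm_minus_commute add.commute)
  qed
  moreover have "dpart js (\<lambda>x. \<phi> (x + h)) differentiable (at x)" for js x
  proof -
    have "(\<lambda>x. dpart js \<phi> (x + h)) differentiable (at x)"
      by (rule differentiable_compose[OF d]) simp
    then show ?thesis unfolding * .
  qed
  ultimately show "test_fun (\<lambda>x. \<phi> (x + h))" unfolding test_fun_def by (simp add: compact_closure)
qed

text \<open>Test the difference of both sides with \<phi>. Shifting moves the segment average onto
  \<phi>, the weak derivative is applied to each shifted test function, and the fundamental theorem
  of calculus evaluates the averaged derivative of \<phi>. The fundamental lemma then removes
  \<phi>.\<close>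

proposition wderiv_imp_acl:
  assumes "wderiv j w g" shows "acl j w g"
  unfolding acl_def
proof (intro conjI allI)
  show w: "loc_int w" and g: "loc_int g" using assms by (auto simp: wderiv_def)
  fix h :: real
  let ?e = "h *\<^sub>R axis j 1 :: vec3"
  have [measurable]: "w \<in> bmeas" "g \<in> bmeas"
    using w g by (auto intro: loc_int_measurable)
  let ?q = "\<lambda>x. (w (x + ?e) - w x) - h * av unif01 (seg j h) g x"
  have q: "loc_int ?q"
    by (intro loc_int_diff loc_int_shift loc_int_cmult loc_int_av[OF seg_rules] w g)
  have "AE x in lborel. ?q x = 0"
  proof (rule fundamental_lemma[OF q])
    fix \<phi> assume t: "test_fun \<phi>"
    let ?\<phi>' = "dpart [j] \<phi>"
    note c = test_fun_cderiv(1)[OF t, of j] test_fun_cderiv(2)[OF t] test_fun_cderiv(3)[OF t, of j]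
    have cont: "continuous_on UNIV \<phi>" "continuous_on UNIV ?\<phi>'" using c(1) by (auto simp: cderiv_def)
    then have [measurable]: "\<phi> \<in> bmeas" "?\<phi>' \<in> bmeas"
      by (auto intro!: borel_measurable_continuous_onI simp del: dpart.simps)
    obtain B where B: "\<And>x. \<bar>\<phi> x\<bar> \<le> B" by (rule continuous_bsupp_bounded[OF cont(1) c(2)]) blast
    obtain B' where B': "\<And>x. \<bar>?\<phi>' x\<bar> \<le> B'" by (rule continuous_bsupp_bounded[OF cont(2) c(3)]) blast
    obtain R where R: "\<And>x. \<phi> x \<noteq> 0 \<Longrightarrow> norm x \<le> R" using c(2) by (auto simp: bsupp_def)
    obtain R' where R': "\<And>x. ?\<phi>' x \<noteq> 0 \<Longrightarrow> norm x \<le> R'" using c(3) unfolding bsupp_def by blast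
    have i: "integrable lborel (\<lambda>x. f x * \<phi> x)" if "loc_int f" for f
      by (rule loc_int_mult[OF that _ B R]) measurable
    have Rs: "\<phi> (x - ?e) \<noteq> 0 \<Longrightarrow> norm x \<le> R + norm ?e" for x
      using R[of "x - ?e"] norm_triangle_ineq[of "x - ?e" ?e] by simp
    have i': "integrable lborel (\<lambda>x. w x * \<phi> (x - ?e))"
      by (rule loc_int_mult[OF w _ B Rs]) measurable
    have "h * (LBINT x. av unif01 (seg j h) g x * \<phi> x)
      = h * (\<integral>s. \<integral>x. g (x + seg j h s) * \<phi> x \<partial>lborel \<partial>unif01)"
      by (subst av_pairing[OF seg_rules g _ B R]) auto
    also have "(\<lambda>s. LBINT x. g (x + seg j h s) * \<phi> x) = (\<lambda>s. LBINT x. g x * \<phi> (x + seg j (- h) s))"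
    proof
      fix s
      show "(LBINT x. g (x + seg j h s) * \<phi> x) = (LBINT x. g x * \<phi> (x + seg j (- h) s))"
        using integral_shift[of "\<lambda>x. g x * \<phi> (x - seg j h s)" "seg j h s"] by simp
    qed
    also have "\<dots> = (\<lambda>s. - (LBINT x. w x * ?\<phi>' (x + seg j (- h) s)))"
    proof
      fix s
      have "(LBINT x. w x * dpart [j] (\<lambda>x. \<phi> (x + seg j (- h) s)) x) = - (LBINT x. g x * \<phi> (x + seg j (- h) s))"
        using assms test_fun_shift(1)[OF t] unfolding wderiv_def by blast
      then show "(LBINT x. g x * \<phi> (x + seg j (- h) s)) = - (LBINT x. w x * ?\<phi>' (x + seg j (- h) s))"
        unfolding test_fun_shift(2)[OF t] by linarith
    qed
    also have "h * (\<integral>s. - (LBINT x. w x * ?\<phi>' (x + seg j (- h) s)) \<partial>unif01)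
       = - h * (\<integral>s. (LBINT x. w x * ?\<phi>' (x + seg j (- h) s)) \<partial>unif01)" by simp
    also have "\<dots> = (LBINT x. w x * (- h * av unif01 (seg j (- h)) ?\<phi>' x))"
      by (subst av_pairing_right[OF seg_rules w _ B' R']) (auto simp: mult.left_commute simp del: dpart.simps)
    also have "(\<lambda>x. w x * (- h * av unif01 (seg j (- h)) ?\<phi>' x)) = (\<lambda>x. w x * \<phi> (x - ?e) - w x * \<phi> x)"
      using cderiv_FTC[OF c(1), where h="- h"] by (simp add: right_diff_distrib[symmetric] del: dpart.simps)
    also have "(LBINT x. w x * \<phi> (x - ?e) - w x * \<phi> x) = (LBINT x. w x * \<phi> (x - ?e)) - (LBINT x. w x * \<phi> x)"
      by (rule bi_integral_diff[OF i' i[OF w]])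
    also have "(LBINT x. w x * \<phi> (x - ?e)) = (LBINT x. w (x + ?e) * \<phi> x)"
      using integral_shift[of "\<lambda>x. w x * \<phi> (x - ?e)" ?e] by simp
    finally have *: "h * (LBINT x. av unif01 (seg j h) g x * \<phi> x)
      = (LBINT x. w (x + ?e) * \<phi> x) - (LBINT x. w x * \<phi> x)" .
    have "(LBINT x. ?q x * \<phi> x) = (LBINT x. (w (x + ?e) * \<phi> x - w x * \<phi> x) - h * (av unif01 (seg j h) g x * \<phi> x))"
      by (simp add: algebra_simps)
    also have "\<dots> = 0"
      using i[OF w] i[OF loc_int_shift[OF w, of ?e]] i[OF loc_int_av[OF seg_rules g]] * by simp
    finally show "(LBINT x. ?q x * \<phi> x) = 0" .
  qed
  then show "AE x in lborel. w (x + ?e) - w x = h * av unif01 (seg j h) g x" by simp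
qed

text \<open>Discrete integration by parts with step \<open>h n\<close>: the shift moves from \<eta>
  to w, the increment of w becomes a segment average of g, and after division by the step the limit
  is taken. One continuous derivative of \<eta> suffices for this.\<close>

proposition acl_by_parts:
  assumes a: "acl j w g" and c: "cderiv j \<eta> \<eta>'" and s: "bsupp \<eta>" "bsupp \<eta>'"
  shows "(LBINT x. w x * \<eta>' x) = - (LBINT x. g x * \<eta> x)"
proof -
  have w: "loc_int w" and g: "loc_int g" using a by (auto simp: acl_def)
  have [measurable]: "w \<in> bmeas" "g \<in> bmeas"
    using w g by (auto intro: loc_int_measurable)
  have cont: "continuous_on UNIV \<eta>" "continuous_on UNIV \<eta>'" using c by (auto simp: cderiv_def)
  then have [measurable]: "\<eta> \<in> bmeas" "\<eta>' \<in> bmeas"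
    by (auto intro!: borel_measurable_continuous_onI)
  obtain B where B: "\<And>x. \<bar>\<eta> x\<bar> \<le> B" by (rule continuous_bsupp_bounded[OF cont(1) s(1)]) blast
  obtain B' where B': "\<And>x. \<bar>\<eta>' x\<bar> \<le> B'" by (rule continuous_bsupp_bounded[OF cont(2) s(2)]) blast
  obtain R where R: "\<And>x. \<eta> x \<noteq> 0 \<Longrightarrow> norm x \<le> R" using s(1) by (auto simp: bsupp_def)
  obtain R' where R': "\<And>x. \<eta>' x \<noteq> 0 \<Longrightarrow> norm x \<le> R'" using s(2) by (auto simp: bsupp_def)
  define h where "h n = inverse (real (Suc n))" for n
  have h: "0 < h n" "h n \<le> 1" for n by (auto simp: h_def inverse_le_1_iff)
  have hlim: "h \<longlonglongrightarrow> 0" unfolding h_def[abs_def] by (rule LIMSEQ_inverse_real_of_nat)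
  \<comment> \<open>Segment averages of a continuous function of bounded support converge boundedly,
    with supports in one ball, so they may be paired with a function that is merely locally
    integrable.\<close>
  have lim: "(\<lambda>n. LBINT x. f x * av unif01 (seg j (h n)) k x) \<longlonglongrightarrow> (LBINT x. f x * k x)"
    if f: "loc_int f" and kc: "continuous_on UNIV k" and kB: "\<And>x. \<bar>k x\<bar> \<le> b" and kR: "\<And>x. k x \<noteq> 0 \<Longrightarrow> norm x \<le> r" for f k b r
  proof -
    interpret u: prob_space unif01 by (rule prob_space_unif01)
    have [measurable]: "k \<in> bmeas" "f \<in> bmeas"
      using kc f by (auto intro: borel_measurable_continuous_onI loc_int_measurable)
    have ki: "integrable unif01 (\<lambda>s. k (x + seg j (h n) s))" for x n
      by (rule u.integrable_const_bound[where B=b]) (use kB in auto)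
    have bd: "\<bar>av unif01 (seg j (h n)) k x\<bar> \<le> b" for n x
    proof -
      have "\<bar>av unif01 (seg j (h n)) k x\<bar> \<le> (\<integral>s. \<bar>k (x + seg j (h n) s)\<bar> \<partial>unif01)"
        unfolding av_def by (rule integral_abs_bound)
      also have "\<dots> \<le> (\<integral>s. b \<partial>unif01)"
        by (intro integral_mono integrable_abs ki kB) simp
      finally show ?thesis using u.prob_space by simp
    qed
    have sp: "norm x \<le> r + 1" if "av unif01 (seg j (h n)) k x \<noteq> 0" for n x
    proof (rule ccontr)
      assume nx: "\<not> norm x \<le> r + 1"
      have "k (x + seg j (h n) s) = 0" if "s \<in> space unif01" for s
      proof (rule ccontr)
        assume "k (x + seg j (h n) s) \<noteq> 0"
        then have "norm (x + seg j (h n) s) \<le> r" by (rule kR)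
        moreover have "norm (seg j (h n) s) \<le> 1" using seg_norm[OF that, where h="h n"] h[of n] by simp
        ultimately show False using nx norm_triangle_ineq[of "x + seg j (h n) s" "- seg j (h n) s"] by simp
      qed
      then have "av unif01 (seg j (h n)) k x = (\<integral>s. 0 \<partial>unif01)"
        unfolding av_def by (intro bi_integral_cong) auto
      then show False using that by simp
    qed
    show ?thesis
    proof (rule integral_dominated_convergence[where w="\<lambda>x. b * \<bar>f x * iball (r + 1) x\<bar>"])
      show "integrable lborel (\<lambda>x. b * \<bar>f x * iball (r + 1) x\<bar>)"
        by (intro integrable_mult_right integrable_abs loc_int_cball f)
      show "(\<lambda>x. f x * av unif01 (seg j (h n)) k x) \<in> borel_measurable lborel" for n
        using av_measurable[OF seg_rules, where g=k] by simp
      show "AE x in lborel. (\<lambda>n. f x * av unif01 (seg j (h n)) k x) \<longlonglongrightarrow> f x * k x"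
      proof (intro AE_I2 tendsto_mult tendsto_const)
        fix x
        have "(\<lambda>n. \<integral>s. k (x + seg j (h n) s) \<partial>unif01) \<longlonglongrightarrow> (\<integral>s. k x \<partial>unif01)"
        proof (rule integral_dominated_convergence[where w="\<lambda>_. b"])
          show "AE s in unif01. (\<lambda>n. k (x + seg j (h n) s)) \<longlonglongrightarrow> k x"
          proof (intro AE_I2)
            fix s
            have "(\<lambda>n. x + (s * h n) *\<^sub>R axis j 1) \<longlonglongrightarrow> x + (s * 0) *\<^sub>R axis j 1"
              by (intro tendsto_intros hlim)
            then have "(\<lambda>n. x + (s * h n) *\<^sub>R axis j 1) \<longlonglongrightarrow> x" by simp
            then show "(\<lambda>n. k (x + seg j (h n) s)) \<longlonglongrightarrow> k x"
              using kc by (intro isCont_tendsto_compose[of _ k]) (simp_all add: continuous_on_eq_continuous_at)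
          qed
        qed (use kB in auto)
        then show "(\<lambda>n. av unif01 (seg j (h n)) k x) \<longlonglongrightarrow> k x" using u.prob_space by (simp add: av_def)
      qed
      have "\<bar>f x * av unif01 (seg j (h n)) k x\<bar> \<le> b * \<bar>f x * iball (r + 1) x\<bar>" for n x
      proof (cases "av unif01 (seg j (h n)) k x = 0")
        case False
        then have "iball (r + 1) x = (1::real)" using sp[of n x] by simp
        then show ?thesis using mult_left_mono[OF bd[of n x], of "\<bar>f x\<bar>"] by (simp add: abs_mult mult.commute)
      qed (use order_trans[OF abs_ge_zero kB[of 0]] in simp)
      then show "AE x in lborel. norm (f x * av unif01 (seg j (h n)) k x) \<le> b * \<bar>f x * iball (r + 1) x\<bar>" for n
        by simp
    qed measurable
  qed
  have eq: "(LBINT x. w x * av unif01 (seg j (h n)) \<eta>' x) = - (LBINT x. g x * av unif01 (seg j (h n)) \<eta> x)" for n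
  proof -
    let ?e = "h n *\<^sub>R axis j 1 :: vec3"
    have [measurable]: "av unif01 (seg j (- h n)) g \<in> bmeas"
      by (rule av_measurable[OF seg_rules]) measurable
    have ap: "(LBINT x. av unif01 (seg j (- h n)) g x * \<eta> x) = (\<integral>s. \<integral>x. g (x + seg j (- h n) s) * \<eta> x \<partial>lborel \<partial>unif01)"
      by (rule av_pairing[OF seg_rules g _ B R]) measurable
    have Rs: "\<eta> (x + ?e) \<noteq> 0 \<Longrightarrow> norm x \<le> R + norm ?e" for x
      using R[of "x + ?e"] norm_triangle_ineq[of "x + ?e" "- ?e"] by simp
    have i1: "integrable lborel (\<lambda>x. w x * \<eta> (x + ?e))"
      by (rule loc_int_mult[OF w _ B Rs]) measurable
    have i2: "integrable lborel (\<lambda>x. f x * \<eta> x)" if "loc_int f" for f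
      by (rule loc_int_mult[OF that _ B R]) measurable
    have i3: "integrable lborel (\<lambda>x. w (x - ?e) * \<eta> x)"
      using i2[OF loc_int_shift[OF w, of "- ?e"]] by simp
    have "h n * (LBINT x. w x * av unif01 (seg j (h n)) \<eta>' x) = (LBINT x. w x * \<eta> (x + ?e) - w x * \<eta> x)"
      using cderiv_FTC[OF c, where h="h n"]
      by (simp add: right_diff_distrib[symmetric] mult.left_commute[of _ "h n"])
    also have "\<dots> = (LBINT x. w x * \<eta> (x + ?e)) - (LBINT x. w x * \<eta> x)"
      using i1 i2[OF w] by simp
    also have "(LBINT x. w x * \<eta> (x + ?e)) = (LBINT x. w (x - ?e) * \<eta> x)"
      using integral_shift[of "\<lambda>x. w (x - ?e) * \<eta> x" ?e] by simp
    also have "\<dots> - (LBINT x. w x * \<eta> x) = (LBINT x. (w (x - ?e) - w x) * \<eta> x)"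
      using i3 i2[OF w] by (simp add: left_diff_distrib)
    also have "\<dots> = (LBINT x. - h n * (av unif01 (seg j (- h n)) g x * \<eta> x))"
    proof (rule integral_cong_AE)
      have "AE x in lborel. w (x + (- h n) *\<^sub>R axis j 1) - w x = (- h n) * av unif01 (seg j (- h n)) g x"
        using a unfolding acl_def by blast
      then show "AE x in lborel. (w (x - ?e) - w x) * \<eta> x = - h n * (av unif01 (seg j (- h n)) g x * \<eta> x)"
        by eventually_elim simp
    qed measurable
    also have "\<dots> = - h n * (\<integral>s. \<integral>x. g (x + seg j (- h n) s) * \<eta> x \<partial>lborel \<partial>unif01)"
      by (simp only: integral_mult_right_zero ap)
    also have "(\<lambda>s. LBINT x. g (x + seg j (- h n) s) * \<eta> x) = (\<lambda>s. LBINT x. g x * \<eta> (x + seg j (h n) s))"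
    proof
      fix s
      show "(LBINT x. g (x + seg j (- h n) s) * \<eta> x) = (LBINT x. g x * \<eta> (x + seg j (h n) s))"
        using integral_shift[of "\<lambda>x. g x * \<eta> (x + seg j (h n) s)" "seg j (- h n) s"] by simp
    qed
    also have "(\<integral>s. \<integral>x. g x * \<eta> (x + seg j (h n) s) \<partial>lborel \<partial>unif01) = (LBINT x. g x * av unif01 (seg j (h n)) \<eta> x)"
      by (rule av_pairing_right[OF seg_rules g _ B R]) measurable
    finally have "h n * (LBINT x. w x * av unif01 (seg j (h n)) \<eta>' x)
      = h n * - (LBINT x. g x * av unif01 (seg j (h n)) \<eta> x)" by simp
    then show ?thesis using h(1)[of n] by (simp only: mult_cancel_left) simp
  qed
  have "(\<lambda>n. - (LBINT x. g x * av unif01 (seg j (h n)) \<eta> x)) \<longlonglongrightarrow> - (LBINT x. g x * \<eta> x)"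
    by (intro tendsto_minus lim[OF g cont(1) B R])
  then show ?thesis
    using LIMSEQ_unique[OF lim[OF w cont(2) B' R']] unfolding eq by blast
qed

lemma wderiv_iff_acl: "wderiv j w g \<longleftrightarrow> acl j w g"
proof
  assume "acl j w g"
  then show "wderiv j w g"
    unfolding wderiv_def using acl_by_parts[OF _ test_fun_cderiv] by (auto simp: acl_def simp del: dpart.simps)
qed (rule wderiv_imp_acl)

lemma weak_grad_acl: "weak_grad u G \<longleftrightarrow> (\<forall>i j. acl j (\<lambda>x. u x $ i) (\<lambda>x. G x $ i $ j))"
  by (simp add: weak_grad_iff wderiv_iff_acl)

section \<open>Sobolev functions on the whole space and on the torus\<close>

lemma norm_vec_sq: "(norm (v :: 'a::real_inner^'n))\<^sup>2 = (\<Sum>i\<in>UNIV. (norm (v $ i))\<^sup>2)"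
  unfolding power2_norm_eq_inner by (simp add: inner_vec_def)

lemma l2n_vec_sq:
  fixes f :: "'a \<Rightarrow> 'b::euclidean_space^'n"
  assumes "sqi N f" shows "(l2n N f)\<^sup>2 = (\<Sum>i\<in>UNIV. (l2n N (\<lambda>x. f x $ i))\<^sup>2)"
  unfolding l2n_sq norm_vec_sq
  using assms by (intro bi_integral_sum) (auto intro: sqi_integrable_sq)

lemma seg_AE_integrable: "loc_int g \<Longrightarrow> AE x in lborel. integrable unif01 (\<lambda>s. g (x + seg j h s))"
  by (rule av_AE_integrable[OF seg_rules])

lemma acl_shift:
  assumes "acl j w g" shows "acl j (\<lambda>x. w (x + y)) (\<lambda>x. g (x + y))"
  unfolding acl_def
proof (intro conjI allI)
  show "loc_int (\<lambda>x. w (x + y))" "loc_int (\<lambda>x. g (x + y))"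
    using assms by (auto simp: acl_def intro: loc_int_shift)
  fix h
  have "AE x in lborel. w (x + h *\<^sub>R axis j 1) - w x = h * av unif01 (seg j h) g x"
    using assms by (simp add: acl_def)
  from AE_shift[OF this, of y]
  show "AE x in lborel. w (x + h *\<^sub>R axis j 1 + y) - w (x + y) = h * av unif01 (seg j h) (\<lambda>x. g (x + y)) x"
    by eventually_elim (simp add: av_def algebra_simps)
qed

lemma acl_lincomb:
  assumes "acl j w g" "acl j w' g'"
  shows "acl j (\<lambda>x. a * w x + b * w' x) (\<lambda>x. a * g x + b * g' x)"
  unfolding acl_def
proof (intro conjI allI)
  have l: "loc_int w" "loc_int w'" "loc_int g" "loc_int g'" using assms by (auto simp: acl_def)
  then show "loc_int (\<lambda>x. a * w x + b * w' x)" "loc_int (\<lambda>x. a * g x + b * g' x)"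
    by (auto intro: loc_int_add loc_int_cmult)
  fix h
  have "AE x in lborel. w (x + h *\<^sub>R axis j 1) - w x = h * av unif01 (seg j h) g x"
    "AE x in lborel. w' (x + h *\<^sub>R axis j 1) - w' x = h * av unif01 (seg j h) g' x"
    using assms by (auto simp: acl_def)
  with seg_AE_integrable[OF l(3), of h j] seg_AE_integrable[OF l(4), of h j]
  show "AE x in lborel. a * w (x + h *\<^sub>R axis j 1) + b * w' (x + h *\<^sub>R axis j 1) - (a * w x + b * w' x)
      = h * av unif01 (seg j h) (\<lambda>x. a * g x + b * g' x) x"
  proof eventually_elim
    case (elim x)
    then have "av unif01 (seg j h) (\<lambda>x. a * g x + b * g' x) x = a * av unif01 (seg j h) g x + b * av unif01 (seg j h) g' x"
      by (simp add: av_def)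
    moreover have "a * w (x + h *\<^sub>R axis j 1) + b * w' (x + h *\<^sub>R axis j 1) - (a * w x + b * w' x)
      = a * (w (x + h *\<^sub>R axis j 1) - w x) + b * (w' (x + h *\<^sub>R axis j 1) - w' x)" by (simp add: algebra_simps)
    ultimately show ?case using elim(3,4) by (simp add: algebra_simps)
  qed
qed

lemma weak_grad_shift: "weak_grad u G \<Longrightarrow> weak_grad (\<lambda>x. u (x + y)) (\<lambda>x. G (x + y))"
  unfolding weak_grad_acl by (auto intro: acl_shift)

lemma weak_grad_lincomb:
  "weak_grad u G \<Longrightarrow> weak_grad v H \<Longrightarrow> weak_grad (\<lambda>x. a *\<^sub>R u x + b *\<^sub>R v x) (\<lambda>x. a *\<^sub>R G x + b *\<^sub>R H x)"
  unfolding weak_grad_acl by (auto intro: acl_lincomb)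

section \<open>Algebra of the symmetric part of a matrix\<close>

lemma symm_linear: "symm (a *\<^sub>R X + b *\<^sub>R Y) = a *\<^sub>R symm X + b *\<^sub>R symm Y"
  by (simp add: symm_def transpose_def vec_eq_iff algebra_simps)

lemma symm_add: "symm (X + Y) = symm X + symm Y" using symm_linear[of 1 X 1 Y] by simp
lemma symm_diff: "symm (X - Y) = symm X - symm Y" using symm_linear[of 1 X "-1" Y] by simp
lemma symm_scaleR: "symm (a *\<^sub>R X) = a *\<^sub>R symm X" using symm_linear[of a X 0 X] by simp
lemma symm_zero [simp]: "symm 0 = 0" using symm_scaleR[of 0 0] by simp

lemma symm_bounded_linear: "bounded_linear symm"
  by (rule linear_conv_bounded_linear[THEN iffD1], rule linearI) (auto simp: symm_add symm_scaleR)

lemma symm_nth: "symm X $ i $ j = (X $ i $ j + X $ j $ i) / 2"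
  by (simp add: symm_def transpose_def)

lemma symm_transpose [simp]: "transpose (symm X) = symm X"
  by (simp add: vec_eq_iff transpose_def symm_nth add.commute)

lemma symm_of_symmetric: "transpose X = X \<Longrightarrow> symm X = X"
  by (simp add: symm_def scaleR_2[symmetric])

lemma symm_idem [simp]: "symm (symm X) = symm X"
  by (rule symm_of_symmetric[OF symm_transpose])

lemma frob_inner: "frob X Y = X \<bullet> Y"
  by (simp add: frob_def inner_vec_def)

text \<open>Isolates the cross term of the entries (i,j) and (j,i). For gradients its integral is
  the square of the divergence, which is the heart of Korn's inequality.\<close>

lemma symm_norm_sq: "(norm (symm X))\<^sup>2 = (norm X)\<^sup>2 / 2 + (\<Sum>i\<in>UNIV. \<Sum>j\<in>UNIV. X $ i $ j * X $ j $ i) / 2"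
proof -
  have "(norm (symm X))\<^sup>2 = (\<Sum>i\<in>UNIV. \<Sum>j\<in>UNIV. ((X $ i $ j)\<^sup>2 + (X $ j $ i)\<^sup>2) / 4 + X $ i $ j * X $ j $ i / 2)"
    unfolding norm_vec_sq symm_nth by (simp add: power2_sum field_simps)
  also have "\<dots> = ((\<Sum>i\<in>UNIV. \<Sum>j\<in>UNIV. (X $ i $ j)\<^sup>2) + (\<Sum>i\<in>UNIV. \<Sum>j\<in>UNIV. (X $ j $ i)\<^sup>2)) / 4
     + (\<Sum>i\<in>UNIV. \<Sum>j\<in>UNIV. X $ i $ j * X $ j $ i) / 2"
    by (simp add: sum.distrib sum_divide_distrib[symmetric])
  also have "(\<Sum>i\<in>UNIV. \<Sum>j\<in>UNIV. (X $ j $ i)\<^sup>2) = (\<Sum>i\<in>UNIV. \<Sum>j\<in>UNIV. (X $ i $ j)\<^sup>2)"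
    by (rule sum.swap)
  also have "(\<Sum>i\<in>UNIV. \<Sum>j\<in>UNIV. (X $ i $ j)\<^sup>2) = (norm X)\<^sup>2"
    unfolding norm_vec_sq by simp
  finally show ?thesis by simp
qed

lemma norm_symm_le: "norm (symm X) \<le> norm X"
proof -
  have "norm (symm X) \<le> 1/2 * (norm X + norm (transpose X))"
    unfolding symm_def using norm_triangle_ineq[of X "transpose X"] by simp
  moreover have "norm (transpose X) = norm X"
  proof -
    have "(norm (transpose X))\<^sup>2 = (norm X)\<^sup>2"
      unfolding norm_vec_sq transpose_def by (simp only: vec_lambda_beta) (rule sum.swap)
    then show ?thesis by simp
  qed
  ultimately show ?thesis by simp
qed

context tdomain
begin

lemma loc_int_sqi:
  assumes "sqi M f" "per f" shows "loc_int f"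
proof (rule loc_intI)
  show "f \<in> bmeas" using assms(1) by auto
  show "integrable lborel (\<lambda>x. f x * iball R x)" for R
  proof -
    have "sq2 (\<lambda>x. iball R x *\<^sub>R f x)" using local_l2[of R, where 'b=real] assms by blast
    from sqi_integrable_mult[OF this sqi_indicator_cball[of R]]
    show ?thesis by (rule bi_integrable_cong[OF refl, THEN iffD1, rotated]) (simp split: split_indicator)
  qed
qed

lemma av_l2:
  assumes mu: "prob_space \<mu>" and [measurable]: "\<sigma> \<in> borel_measurable \<mu>" and g: "sqi M g" "per g"
  shows "sqi M (av \<mu> \<sigma> g)" "l2n M (av \<mu> \<sigma> g) \<le> l2n M g"
proof -
  have [measurable]: "g \<in> bmeas" using g by auto
  have "AE s in \<mu>. (\<integral>\<^sup>+x. ennreal ((norm (case (x, s) of (x, s) \<Rightarrow> g (x + \<sigma> s)))\<^sup>2) \<partial>M) \<le> ennreal ((l2n M g)\<^sup>2)"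
    using nn_sqi[OF sqi_shift(1)[OF g]] sqi_shift(2)[OF g] by simp
  from l2_average[OF sigma_finite_M mu _ this]
  show "sqi M (av \<mu> \<sigma> g)" "l2n M (av \<mu> \<sigma> g) \<le> l2n M g"
    unfolding av_def[abs_def] by auto
qed

lemma acl_translation:
  assumes a: "acl j w g" and w: "sqi M w" "per w" and g: "sqi M g" "per g"
  shows "l2n M (\<lambda>x. w (x + h *\<^sub>R axis j 1) - w x) \<le> \<bar>h\<bar> * l2n M g"
proof -
  note v = av_l2[OF prob_space_unif01 seg_measurable g]
  have [measurable]: "w \<in> bmeas" "av unif01 (seg j h) g \<in> bmeas"
    using w sqi_measurable[OF v(1)] by auto
  have "l2n M (\<lambda>x. w (x + h *\<^sub>R axis j 1) - w x) = l2n M (\<lambda>x. h *\<^sub>R av unif01 (seg j h) g x)"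
  proof (rule l2n_cong_AE)
    show "AE x in M. w (x + h *\<^sub>R axis j 1) - w x = h *\<^sub>R av unif01 (seg j h) g x"
      using a by (intro AE_M) (simp add: acl_def)
  qed measurable
  also have "\<dots> \<le> \<bar>h\<bar> * l2n M g"
    unfolding l2n_scaleR using v(2) by (intro mult_left_mono) auto
  finally show ?thesis .
qed

lemma translation_eps:
  fixes f :: "vec3 \<Rightarrow> real"
  assumes f: "sqi M f" "per f" and e: "0 < e"
  obtains \<delta> where "0 < \<delta>" "\<And>y. norm y < \<delta> \<Longrightarrow> l2n M (\<lambda>x. f (x + y) - f x) < e"
proof (rule ccontr)
  assume "\<not> thesis"
  then have "\<exists>y. norm y < inverse (real (Suc n)) \<and> \<not> l2n M (\<lambda>x. f (x + y) - f x) < e" for n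
    using that[of "inverse (real (Suc n))"] by (metis inverse_positive_iff_positive of_nat_0_less_iff zero_less_Suc)
  then obtain y where y: "\<And>n. norm (y n) < inverse (real (Suc n))" "\<And>n. \<not> l2n M (\<lambda>x. f (x + y n) - f x) < e"
    by metis
  have "y \<longlonglongrightarrow> 0"
    by (rule Lim_null_comparison[OF _ LIMSEQ_inverse_real_of_nat]) (use less_imp_le[OF y(1)] in auto)
  then have "\<forall>\<^sub>F n in sequentially. l2n M (\<lambda>x. f (x + y n) - f x) < e"
    using e by (intro order_tendstoD[OF translation_continuous[OF f]]) auto
  then show False using y(2) by (auto simp: eventually_sequentially)
qed

text \<open>By \<open>acl\<close> the quotient minus \<open>g\<close> is the segment average of
  increments of \<open>g\<close>, and these are uniformly small along the segment by continuity of
  translations.\<close>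

lemma dq_tendsto:
  assumes a: "acl j w g" and w: "sqi M w" "per w" and g: "sqi M g" "per g"
    and h: "h \<longlonglongrightarrow> 0" "\<And>n. h n \<noteq> 0"
  shows "(\<lambda>n. l2n M (\<lambda>x. (w (x + h n *\<^sub>R axis j 1) - w x) / h n - g x)) \<longlonglongrightarrow> 0"
proof (rule LIMSEQ_I)
  fix e :: real assume e: "0 < e"
  have [measurable]: "w \<in> bmeas" "g \<in> bmeas" using w g by auto
  have lg: "loc_int g" using a by (simp add: acl_def)
  obtain \<delta> where \<delta>: "0 < \<delta>" "\<And>y. norm y < \<delta> \<Longrightarrow> l2n M (\<lambda>x. g (x + y) - g x) < e/2"
    using translation_eps[OF g, of "e/2"] e by auto
  have "\<forall>\<^sub>F n in sequentially. norm (h n) < \<delta>"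
    using h(1) \<delta>(1) by (intro order_tendstoD[OF tendsto_norm_zero]) auto
  then have "\<forall>\<^sub>F n in sequentially. norm (l2n M (\<lambda>x. (w (x + h n *\<^sub>R axis j 1) - w x) / h n - g x) - 0) < e"
  proof eventually_elim
    case (elim n)
    interpret u: prob_space unif01 by (rule prob_space_unif01)
    have "AE s in unif01. (\<integral>\<^sup>+x. ennreal ((norm (case (x, s) of (x, s) \<Rightarrow> g (x + seg j (h n) s) - g x))\<^sup>2) \<partial>M) \<le> ennreal ((e/2)\<^sup>2)"
    proof (intro AE_I2)
      fix s assume s: "s \<in> space unif01"
      have "l2n M (\<lambda>x. g (x + seg j (h n) s) - g x) < e/2"
        using seg_norm[OF s, where h="h n"] elim by (intro \<delta>(2)) auto
      moreover have "sqi M (\<lambda>x. g (x + seg j (h n) s) - g x)"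
        using sqi_shift[OF g] g by auto
      moreover have "(l2n M (\<lambda>x. g (x + seg j (h n) s) - g x))\<^sup>2 \<le> (e/2)\<^sup>2"
        using calculation(1) by (intro power_mono) auto
      ultimately show "(\<integral>\<^sup>+x. ennreal ((norm (case (x, s) of (x, s) \<Rightarrow> g (x + seg j (h n) s) - g x))\<^sup>2) \<partial>M) \<le> ennreal ((e/2)\<^sup>2)"
        using nn_sqi[of M "\<lambda>x. g (x + seg j (h n) s) - g x"] by (simp add: ennreal_leI)
    qed
    from l2_average[OF sigma_finite_M prob_space_unif01 _ this] e
    have i: "sqi M (\<lambda>x. \<integral>s. g (x + seg j (h n) s) - g x \<partial>unif01)"
      "l2n M (\<lambda>x. \<integral>s. g (x + seg j (h n) s) - g x \<partial>unif01) \<le> e/2"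
      by auto
    have ws: "sqi M (\<lambda>x. w (x + h n *\<^sub>R axis j 1))" using sqi_shift[OF w] by simp
    have "l2n M (\<lambda>x. (w (x + h n *\<^sub>R axis j 1) - w x) / h n - g x)
      = l2n M (\<lambda>x. \<integral>s. g (x + seg j (h n) s) - g x \<partial>unif01)"
    proof (rule l2n_cong_AE)
      have "AE x in lborel. w (x + h n *\<^sub>R axis j 1) - w x = h n * av unif01 (seg j (h n)) g x"
        using a by (simp add: acl_def)
      with seg_AE_integrable[OF lg, of "h n" j]
      have "AE x in lborel. (w (x + h n *\<^sub>R axis j 1) - w x) / h n - g x = (\<integral>s. g (x + seg j (h n) s) - g x \<partial>unif01)"
      proof eventually_elim
        case (elim x)
        then show ?case using h(2)[of n] u.prob_space by (simp add: av_def)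
      qed
      then show "AE x in M. (w (x + h n *\<^sub>R axis j 1) - w x) / h n - g x = (\<integral>s. g (x + seg j (h n) s) - g x \<partial>unif01)"
        by (rule AE_M)
    qed (use i in auto)
    then show ?case using i(2) e by simp
  qed
  then show "\<exists>no. \<forall>n\<ge>no. norm (l2n M (\<lambda>x. (w (x + h n *\<^sub>R axis j 1) - w x) / h n - g x) - 0) < e"
    by (simp add: eventually_sequentially)
qed

text \<open>The algebraic identity behind Korn's inequality: it is exact for difference quotients,
  since these commute and discrete integration by parts maps forward to backward differences.\<close>

lemma cross_derivatives:
  assumes "acl j p a" "acl i p c" "acl i q b" "acl j q d"
    and p: "sqi M p" "per p" and q: "sqi M q" "per q"
    and a: "sqi M a" "per a" and b: "sqi M b" "per b" and c: "sqi M c" "per c" and d: "sqi M d" "per d"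
  shows "(\<integral>x. a x * b x \<partial>M) = (\<integral>x. c x * d x \<partial>M)"
proof -
  define h where "h n = inverse (real (Suc n))" for n
  have hlim: "h \<longlonglongrightarrow> 0" "(\<lambda>n. - h n) \<longlonglongrightarrow> 0"
    unfolding h_def[abs_def] using LIMSEQ_inverse_real_of_nat tendsto_minus[OF LIMSEQ_inverse_real_of_nat] by auto
  have h0: "h n \<noteq> 0" "- h n \<noteq> 0" for n by (auto simp: h_def)
  let ?d = "\<lambda>w k t x. (w (x + t *\<^sub>R axis k 1) - w x) / t :: real"
  have ds: "sqi M (?d w k t)" if "sqi M w" "per w" for w k t
  proof -
    have "sqi M (\<lambda>x. (1/t) *\<^sub>R (w (x + t *\<^sub>R axis k 1) - w x))"
      using sqi_shift(1)[OF that] that by (intro sqi_scaleR sqi_diff) auto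
    then show ?thesis by simp
  qed
  have l1: "(\<lambda>n. \<integral>x. ?d p j (h n) x \<bullet> ?d q i (h n) x \<partial>M) \<longlonglongrightarrow> (\<integral>x. a x \<bullet> b x \<partial>M)"
    by (rule l2_inner_tendsto[OF ds[OF p] a(1) dq_tendsto[OF assms(1) p a hlim(1) h0(1)]
          ds[OF q] b(1) dq_tendsto[OF assms(3) q b hlim(1) h0(1)]])
  have l2: "(\<lambda>n. \<integral>x. ?d p i (- h n) x \<bullet> ?d q j (- h n) x \<partial>M) \<longlonglongrightarrow> (\<integral>x. c x \<bullet> d x \<partial>M)"
    by (rule l2_inner_tendsto[OF ds[OF p] c(1) dq_tendsto[OF assms(2) p c hlim(2) h0(2)]
          ds[OF q] d(1) dq_tendsto[OF assms(4) q d hlim(2) h0(2)]])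
  \<comment> \<open>Expanding both products leaves four correlations of p and q. Each depends only
    on the difference of its two shifts, so the forward steps in directions j, i and the backward
    steps in directions i, j give the same values.\<close>
  have dq: "(\<integral>x. ?d p j t x * ?d q i t x \<partial>M) = (\<integral>x. ?d p i (- t) x * ?d q j (- t) x \<partial>M)" for t
  proof -
    let ?j = "t *\<^sub>R axis j 1 :: vec3" and ?i = "t *\<^sub>R axis i 1 :: vec3"
    have s: "sqi M (\<lambda>x. p (x + y))" "sqi M (\<lambda>x. q (x + y))" for y
      using sqi_shift(1) p q by auto
    have pq: "integrable M (\<lambda>x. p (x + y) * q (x + z))" for y z
      by (rule sqi_integrable_mult[OF s])
    have sh: "(\<integral>x. p (x + y) * q (x + z) \<partial>M) = (\<integral>x. p (x + (y + r)) * q (x + (z + r)) \<partial>M)" for y z r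
      using integrable_M_shift(2)[OF pq[of y z], of r] per_comp2[OF per_shift[OF p(2), of y] per_shift[OF q(2), of z], where F="(*)"]
      by (simp add: algebra_simps)
    have e: "(\<integral>x. (p (x + y) - p x) * (q (x + z) - q x) \<partial>M)
      = (\<integral>x. p (x + y) * q (x + z) \<partial>M) - (\<integral>x. p (x + y) * q (x + 0) \<partial>M) - (\<integral>x. p (x + 0) * q (x + z) \<partial>M) + (\<integral>x. p (x + 0) * q (x + 0) \<partial>M)" for y z
      using pq[of y z] pq[of y 0] pq[of 0 z] pq[of 0 0] by (simp add: algebra_simps)
    have "(\<integral>x. (p (x + ?j) - p x) * (q (x + ?i) - q x) \<partial>M) = (\<integral>x. (p (x + - ?i) - p x) * (q (x + - ?j) - q x) \<partial>M)"
      unfolding e using sh[of ?j ?i "- ?j - ?i"] sh[of ?j 0 "- ?j"] sh[of 0 ?i "- ?i"] by simp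
    moreover have "(\<integral>x. ?d p j t x * ?d q i t x \<partial>M) = (\<integral>x. (p (x + ?j) - p x) * (q (x + ?i) - q x) \<partial>M) / (t * t)"
      "(\<integral>x. ?d p i (- t) x * ?d q j (- t) x \<partial>M) = (\<integral>x. (p (x + - ?i) - p x) * (q (x + - ?j) - q x) \<partial>M) / (t * t)"
      by (simp_all add: divide_simps)
    ultimately show ?thesis by simp
  qed
  have "(\<lambda>n. \<integral>x. ?d p i (- h n) x \<bullet> ?d q j (- h n) x \<partial>M) \<longlonglongrightarrow> (\<integral>x. a x \<bullet> b x \<partial>M)"
    using l1 by (simp only: inner_real_def dq)
  from LIMSEQ_unique[OF this l2] show ?thesis by (simp only: inner_real_def)
qed

text \<open>This is \<open>H1\<close> on the whole space, where \<open>per\<close> is vacuous, and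
  \<open>H1per\<close> on the torus.\<close>

definition sob :: "(vec3 \<Rightarrow> vec3) \<Rightarrow> (vec3 \<Rightarrow> mat3) \<Rightarrow> bool" where
  "sob u G \<longleftrightarrow> per u \<and> per G \<and> sqi M u \<and> sqi M G \<and> weak_grad u G"

lemma sob_component:
  assumes "sob u G"
  shows "acl j (\<lambda>x. u x $ i) (\<lambda>x. G x $ i $ j)" "sqi M (\<lambda>x. u x $ i)" "per (\<lambda>x. u x $ i)"
    "sqi M (\<lambda>x. G x $ i $ j)" "per (\<lambda>x. G x $ i $ j)"
  using assms by (auto simp: sob_def weak_grad_acl intro: per_comp)

lemma sob_lincomb:
  assumes "sob u G" "sob v H"
  shows "sob (\<lambda>x. a *\<^sub>R u x + b *\<^sub>R v x) (\<lambda>x. a *\<^sub>R G x + b *\<^sub>R H x)"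
  using assms unfolding sob_def by (auto intro: weak_grad_lincomb per_comp2)

lemma sob_diff: "sob u G \<Longrightarrow> sob v H \<Longrightarrow> sob (\<lambda>x. u x - v x) (\<lambda>x. G x - H x)"
  using sob_lincomb[of u G v H 1 "-1"] by simp

lemma sob_shift: "sob u G \<Longrightarrow> sob (\<lambda>x. u (x + h)) (\<lambda>x. G (x + h))"
  unfolding sob_def by (auto intro: weak_grad_shift sqi_shift)

lemma sqi_symm: "sqi M G \<Longrightarrow> sqi M (\<lambda>x. symm (G x))"
  by (rule sqi_linear[OF symm_bounded_linear])

text \<open>By \<open>cross_derivatives\<close> the mixed products integrate to the square of the
  divergence, which is nonnegative. The factor 2 is the one in \<open>symm_norm_sq\<close>; neither
  domain has a boundary term.\<close>

proposition korn:
  assumes s: "sob u G"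
  shows "(l2n M G)\<^sup>2 \<le> 2 * (l2n M (\<lambda>x. symm (G x)))\<^sup>2"
proof -
  note c = sob_component[OF s]
  have G: "sqi M G" using s by (simp add: sob_def)
  have i: "integrable M (\<lambda>x. G x $ i $ j * G x $ k $ l)" for i j k l
    by (intro sqi_integrable_mult c)
  have "(\<integral>x. (\<Sum>i\<in>UNIV. \<Sum>j\<in>UNIV. G x $ i $ j * G x $ j $ i) \<partial>M) = (\<Sum>i\<in>UNIV. \<Sum>j\<in>UNIV. \<integral>x. G x $ i $ j * G x $ j $ i \<partial>M)"
    using i by simp
  also have "\<dots> = (\<Sum>i\<in>UNIV. \<Sum>j\<in>UNIV. \<integral>x. G x $ i $ i * G x $ j $ j \<partial>M)"
    by (intro sum.cong refl cross_derivatives[OF c(1) c(1) c(1) c(1)] c)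
  also have "\<dots> = (\<integral>x. (\<Sum>i\<in>UNIV. \<Sum>j\<in>UNIV. G x $ i $ i * G x $ j $ j) \<partial>M)"
    using i by simp
  also have "\<dots> = (\<integral>x. (\<Sum>i\<in>UNIV. G x $ i $ i)\<^sup>2 \<partial>M)"
    by (simp add: power2_eq_square sum_product)
  finally have nn: "0 \<le> (\<integral>x. (\<Sum>i\<in>UNIV. \<Sum>j\<in>UNIV. G x $ i $ j * G x $ j $ i) \<partial>M)" by simp
  have "(l2n M (\<lambda>x. symm (G x)))\<^sup>2 = (\<integral>x. (norm (G x))\<^sup>2 / 2 + (\<Sum>i\<in>UNIV. \<Sum>j\<in>UNIV. G x $ i $ j * G x $ j $ i) / 2 \<partial>M)"
    unfolding l2n_sq symm_norm_sq ..
  also have "\<dots> = (l2n M G)\<^sup>2 / 2 + (\<integral>x. (\<Sum>i\<in>UNIV. \<Sum>j\<in>UNIV. G x $ i $ j * G x $ j $ i) \<partial>M) / 2"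
    using i sqi_integrable_sq[OF G] unfolding l2n_sq by (subst bi_integral_add) auto
  finally show ?thesis using nn by simp
qed

lemma sob_translation_axis:
  assumes s: "sob u G"
  shows "l2n M (\<lambda>x. u (x + h *\<^sub>R axis j 1) - u x) \<le> \<bar>h\<bar> * l2n M G"
proof (rule power2_le_imp_le)
  note c = sob_component[OF s]
  have u: "sqi M u" "per u" and G: "sqi M G" using s by (auto simp: sob_def)
  have d: "sqi M (\<lambda>x. u (x + h *\<^sub>R axis j 1) - u x)" using sqi_shift(1)[OF u] u by auto
  have "(l2n M (\<lambda>x. u (x + h *\<^sub>R axis j 1) - u x))\<^sup>2 = (\<Sum>i\<in>UNIV. (l2n M (\<lambda>x. u (x + h *\<^sub>R axis j 1) $ i - u x $ i))\<^sup>2)"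
    using l2n_vec_sq[OF d] by simp
  also have "\<dots> \<le> (\<Sum>i\<in>UNIV. (\<bar>h\<bar> * l2n M (\<lambda>x. G x $ i))\<^sup>2)"
  proof (intro sum_mono power_mono)
    fix i :: 3
    have "l2n M (\<lambda>x. u (x + h *\<^sub>R axis j 1) $ i - u x $ i) \<le> \<bar>h\<bar> * l2n M (\<lambda>x. G x $ i $ j)"
      using acl_translation[OF c(1) c(2) c(3) c(4) c(5)] .
    also have "\<dots> \<le> \<bar>h\<bar> * l2n M (\<lambda>x. G x $ i)"
      using l2n_nth[OF sqi_nth[OF G]] by (intro mult_left_mono) auto
    finally show "l2n M (\<lambda>x. u (x + h *\<^sub>R axis j 1) $ i - u x $ i) \<le> \<bar>h\<bar> * l2n M (\<lambda>x. G x $ i)" .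
  qed auto
  also have "\<dots> = (\<bar>h\<bar> * l2n M G)\<^sup>2"
    using l2n_vec_sq[OF G] by (simp add: power_mult_distrib sum_distrib_left)
  finally show "(l2n M (\<lambda>x. u (x + h *\<^sub>R axis j 1) - u x))\<^sup>2 \<le> (\<bar>h\<bar> * l2n M G)\<^sup>2" .
qed auto

lemma l2n_translation_triangle:
  fixes u :: "vec3 \<Rightarrow> 'b::euclidean_space"
  assumes u: "sqi M u" "per u"
  shows "l2n M (\<lambda>x. u (x + (a + b)) - u x) \<le> l2n M (\<lambda>x. u (x + a) - u x) + l2n M (\<lambda>x. u (x + b) - u x)"
proof -
  note s = sqi_shift(1)[OF u]
  have "l2n M (\<lambda>x. u (x + (a + b)) - u x) \<le> l2n M (\<lambda>x. u (x + (a + b)) - u (x + b)) + l2n M (\<lambda>x. u (x + b) - u x)"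
    by (rule l2n_triangle3[OF s s u(1)])
  also have "l2n M (\<lambda>x. u (x + (a + b)) - u (x + b)) = l2n M (\<lambda>x. u (x + a) - u x)"
  proof -
    have "per (\<lambda>x. u (x + a) - u x)" by (rule per_comp2[OF per_shift[OF u(2)] u(2)])
    from sqi_shift(2)[OF sqi_diff[OF s u(1)] this, of b] show ?thesis
      by (simp add: add.assoc add.commute[of b])
  qed
  finally show ?thesis .
qed

text \<open>The point x + h is reached along the three axes, and each leg costs at most norm h times
  the gradient norm.\<close>

proposition sob_translation:
  assumes s: "sob u G"
  shows "l2n M (\<lambda>x. u (x + h) - u x) \<le> 3 * norm h * l2n M G"
proof -
  have u: "sqi M u" "per u" using s by (auto simp: sob_def)
  have h: "h = h $ 1 *\<^sub>R axis 1 1 + (h $ 2 *\<^sub>R axis 2 1 + h $ 3 *\<^sub>R axis 3 1)"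
    by (simp add: vec_eq_iff forall_3 axis_def)
  have "l2n M (\<lambda>x. u (x + h) - u x) \<le> \<bar>h $ 1\<bar> * l2n M G + (\<bar>h $ 2\<bar> * l2n M G + \<bar>h $ 3\<bar> * l2n M G)"
    by (subst h, rule order_trans[OF l2n_translation_triangle[OF u]],
        intro add_mono order_trans[OF l2n_translation_triangle[OF u]] sob_translation_axis[OF s])
  also have "\<dots> \<le> norm h * l2n M G + (norm h * l2n M G + norm h * l2n M G)"
    by (intro add_mono mult_right_mono component_le_norm_cart) auto
  finally show ?thesis by simp
qed

text \<open>Test functions have bounded support, so L2 convergence on the domain passes to the
  pairings through \<open>local_l2\<close>, also when the domain is a single cell.\<close>

proposition sob_closed:
  assumes s: "\<And>n. sob (u n) (G n)" and u: "sqi M v" "per v" and G: "sqi M H" "per H"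
    and lim: "(\<lambda>n. l2n M (\<lambda>x. u n x - v x)) \<longlonglongrightarrow> 0" "(\<lambda>n. l2n M (\<lambda>x. G n x - H x)) \<longlonglongrightarrow> 0"
  shows "sob v H"
proof -
  have "wderiv j (\<lambda>x. v x $ i) (\<lambda>x. H x $ i $ j)" for i j
    unfolding wderiv_def
  proof (intro conjI allI impI)
    have v': "sqi M (\<lambda>x. v x $ i)" "per (\<lambda>x. v x $ i)" and H': "sqi M (\<lambda>x. H x $ i $ j)" "per (\<lambda>x. H x $ i $ j)"
      using u G by (auto intro: per_comp)
    show lv: "loc_int (\<lambda>x. v x $ i)" and lH: "loc_int (\<lambda>x. H x $ i $ j)"
      using v' H' by (auto intro: loc_int_sqi)
    fix \<phi> assume t: "test_fun \<phi>"
    note c = test_fun_cderiv(1)[OF t, of j] test_fun_cderiv(2)[OF t] test_fun_cderiv(3)[OF t, of j]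
    have cont: "continuous_on UNIV \<phi>" "continuous_on UNIV (dpart [j] \<phi>)" using c(1) by (auto simp: cderiv_def)
    have conv: "(\<lambda>n. LBINT x. f n x * \<eta> x) \<longlonglongrightarrow> (LBINT x. f' x * \<eta> x)"
      if f: "\<And>n. sqi M (f n)" "\<And>n. per (f n)" "sqi M f'" "per f'" "(\<lambda>n. l2n M (\<lambda>x. f n x - f' x)) \<longlonglongrightarrow> 0"
        and e: "continuous_on UNIV \<eta>" "bsupp \<eta>" for f :: "nat \<Rightarrow> vec3 \<Rightarrow> real" and f' \<eta>
    proof -
      have [measurable]: "\<eta> \<in> bmeas" using e by (auto intro: borel_measurable_continuous_onI)
      obtain B where B: "\<And>x. \<bar>\<eta> x\<bar> \<le> B" by (rule continuous_bsupp_bounded[OF e]) blast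
      obtain R where R: "\<And>x. \<eta> x \<noteq> 0 \<Longrightarrow> norm x \<le> R" using e(2) by (auto simp: bsupp_def)
      let ?c = "\<lambda>g x. iball R x *\<^sub>R g x :: real"
      obtain C where C: "\<forall>f :: vec3 \<Rightarrow> real. sqi M f \<longrightarrow> per f \<longrightarrow> sq2 (?c f) \<and> nl2 (?c f) \<le> C * l2n M f"
        using local_l2[of R, where 'b=real] by (elim exE conjE) (rule that)
      have le: "\<bar>\<eta> x\<bar> \<le> B * norm (iball R x :: real)" for x
        using B[of x] R[of x] order_trans[OF abs_ge_zero B[of x]] by (cases "\<eta> x = 0") auto
      have \<eta>: "sq2 \<eta>"
        by (rule sqi_bound(1)[OF _ sqi_indicator_cball[of R]]) (use le order_trans[OF abs_ge_zero B] in simp_all)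
      have cs: "sq2 (?c (f n))" "sq2 (?c f')" for n using C f by blast+
      have "nl2 (\<lambda>x. ?c (f n) x - ?c f' x) \<le> C * l2n M (\<lambda>x. f n x - f' x)" for n
        using C[rule_format, OF sqi_diff[OF f(1)[of n] f(3)] per_comp2[OF f(2)[of n] f(4)]] by (simp add: scaleR_diff_right right_diff_distrib)
      then have "(\<lambda>n. nl2 (\<lambda>x. ?c (f n) x - ?c f' x)) \<longlonglongrightarrow> 0"
        by (intro Lim_null_comparison[OF always_eventually tendsto_mult_right_zero[OF f(5), of C]]) simp
      from l2_inner_tendsto[where g="\<lambda>_. \<eta>" and g'=\<eta>, OF cs this \<eta> \<eta>]
      have "(\<lambda>n. LBINT x. ?c (f n) x \<bullet> \<eta> x) \<longlonglongrightarrow> (LBINT x. ?c f' x \<bullet> \<eta> x)" by (simp add: l2n_def)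
      moreover have "?c g x \<bullet> \<eta> x = g x * \<eta> x" for g x using R[of x] by (cases "\<eta> x = 0") auto
      ultimately show ?thesis by (simp only:)
    qed
    have k: "sqi M (u n)" "per (u n)" "sqi M (G n)" "per (G n)" for n using s[of n] by (auto simp: sob_def)
    have L1: "(\<lambda>n. LBINT x. u n x $ i * dpart [j] \<phi> x) \<longlonglongrightarrow> (LBINT x. v x $ i * dpart [j] \<phi> x)"
    proof (rule conv[OF _ _ v' _ cont(2) c(3)])
      show "(\<lambda>n. l2n M (\<lambda>x. u n x $ i - v x $ i)) \<longlonglongrightarrow> 0"
        by (rule Lim_null_comparison[OF always_eventually lim(1)])
          (use l2n_nth[OF sqi_diff[OF k(1) u(1)]] in auto)
    qed (use k in \<open>auto intro: per_comp\<close>)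
    have L2: "(\<lambda>n. LBINT x. G n x $ i $ j * \<phi> x) \<longlonglongrightarrow> (LBINT x. H x $ i $ j * \<phi> x)"
    proof (rule conv[OF _ _ H' _ cont(1) c(2)])
      have "l2n M (\<lambda>x. G n x $ i $ j - H x $ i $ j) \<le> l2n M (\<lambda>x. G n x - H x)" for n
        using order_trans[OF l2n_nth[OF sqi_nth[OF sqi_diff[OF k(3) G(1)]]] l2n_nth[OF sqi_diff[OF k(3) G(1)]]] by simp
      then show "(\<lambda>n. l2n M (\<lambda>x. G n x $ i $ j - H x $ i $ j)) \<longlonglongrightarrow> 0"
        by (intro Lim_null_comparison[OF always_eventually lim(2)]) auto
    qed (use k sqi_nth[OF sqi_nth[OF k(3)]] in \<open>auto intro: per_comp\<close>)
    have eqn: "(LBINT x. u n x $ i * dpart [j] \<phi> x) = - (LBINT x. G n x $ i $ j * \<phi> x)" for n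
      using s[of n] t unfolding sob_def weak_grad_iff wderiv_def by blast
    show "(LBINT x. v x $ i * dpart [j] \<phi> x) = - (LBINT x. H x $ i $ j * \<phi> x)"
      by (rule LIMSEQ_unique[OF L1[unfolded eqn] tendsto_minus[OF L2]])
  qed
  then show ?thesis unfolding sob_def weak_grad_iff using u G by auto
qed

end

section \<open>Existence of weak solutions\<close>

text \<open>The elements will be pairs of actual functions, not classes modulo null sets, so B is
  only semidefinite and the linear structure enters through \<open>comb\<close>. The solution is
  found by the direct method, as a minimiser of B x x - 2 l x.\<close>

proposition riesz_representation:
  fixes V :: "'a set" and B :: "'a \<Rightarrow> 'a \<Rightarrow> real" and l :: "'a \<Rightarrow> real" and comb :: "real \<Rightarrow> 'a \<Rightarrow> real \<Rightarrow> 'a \<Rightarrow> 'a"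
  assumes ne: "V \<noteq> {}" and comb: "\<And>a x b y. x \<in> V \<Longrightarrow> y \<in> V \<Longrightarrow> comb a x b y \<in> V"
    and sym: "\<And>x y. x \<in> V \<Longrightarrow> y \<in> V \<Longrightarrow> B x y = B y x"
    and lin: "\<And>a x b y z. x \<in> V \<Longrightarrow> y \<in> V \<Longrightarrow> z \<in> V \<Longrightarrow> B (comb a x b y) z = a * B x z + b * B y z"
    and pos: "\<And>x. x \<in> V \<Longrightarrow> 0 \<le> B x x"
    and llin: "\<And>a x b y. x \<in> V \<Longrightarrow> y \<in> V \<Longrightarrow> l (comb a x b y) = a * l x + b * l y"
    and lbd: "\<And>x. x \<in> V \<Longrightarrow> (l x)\<^sup>2 \<le> K * B x x" and K: "0 \<le> K"
    and complete: "\<And>X. (\<And>n. X n \<in> V) \<Longrightarrow> (\<And>e. 0 < e \<Longrightarrow> \<exists>N. \<forall>m\<ge>N. \<forall>n\<ge>N. B (comb 1 (X m) (-1) (X n)) (comb 1 (X m) (-1) (X n)) < e)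
       \<Longrightarrow> \<exists>x\<in>V. (\<lambda>n. B (comb 1 (X n) (-1) x) (comb 1 (X n) (-1) x)) \<longlonglongrightarrow> 0"
  shows "\<exists>u\<in>V. \<forall>v\<in>V. B u v = l v"
proof -
  define J where "J x = B x x - 2 * l x" for x
  have lin2: "B z (comb a x b y) = a * B z x + b * B z y" if "x \<in> V" "y \<in> V" "z \<in> V" for a b x y z
    using lin[OF that] sym that comb by metis
  have Bcomb: "B (comb a x b y) (comb a x b y) = a\<^sup>2 * B x x + 2 * a * b * B x y + b\<^sup>2 * B y y"
    if "x \<in> V" "y \<in> V" for a b x y
    using that sym[OF that] by (simp add: lin lin2 comb algebra_simps power2_eq_square)
  have CS: "(B x y)\<^sup>2 \<le> B x x * B y y" if "x \<in> V" "y \<in> V" for x y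
  proof (rule quadratic_nonneg_discriminant[OF _ pos[OF that(2)]])
    show "0 \<le> B x x + 2 * t * B x y + t\<^sup>2 * B y y" for t
      using pos[OF comb[OF that, of 1 t]] by (simp add: Bcomb[OF that])
  qed
  have Jlow: "- K \<le> J x" if "x \<in> V" for x
  proof -
    have "(2 * l x)\<^sup>2 \<le> (K + B x x)\<^sup>2"
      using lbd[OF that] sum_squares_bound[of K "B x x"] by (simp add: power2_sum power_mult_distrib)
    then have "\<bar>2 * l x\<bar> \<le> \<bar>K + B x x\<bar>" by (simp add: abs_le_square_iff)
    then show ?thesis using K pos[OF that] unfolding J_def by linarith
  qed
  define m where "m = Inf (J ` V)"
  have bdd: "bdd_below (J ` V)" using Jlow by (auto intro!: bdd_belowI[of _ "- K"])
  have mle: "m \<le> J x" if "x \<in> V" for x unfolding m_def using that bdd by (intro cInf_lower) auto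
  have "\<exists>x\<in>V. J x < m + inverse (real (Suc n))" for n
  proof -
    have "Inf (J ` V) < m + inverse (real (Suc n))" by (simp add: m_def)
    then show ?thesis using ne by (auto dest: cInf_lessD[rotated])
  qed
  then obtain X where X: "\<And>n. X n \<in> V" "\<And>n. J (X n) < m + inverse (real (Suc n))" by metis
  \<comment> \<open>The parallelogram law at the midpoint: two almost-minimisers are close to each
    other in the energy.\<close>
  have par: "B (comb 1 x (-1) y) (comb 1 x (-1) y) \<le> 2 * (J x - m) + 2 * (J y - m)" if "x \<in> V" "y \<in> V" for x y
    using mle[OF comb[OF that, of "1/2" "1/2"]] that
    by (simp add: J_def Bcomb llin power2_eq_square algebra_simps)
  have "\<exists>x\<in>V. (\<lambda>n. B (comb 1 (X n) (-1) x) (comb 1 (X n) (-1) x)) \<longlonglongrightarrow> 0"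
  proof (rule complete[OF X(1)])
    fix e :: real assume "0 < e"
    then obtain N :: nat where N: "inverse (real (Suc N)) < e / 4"
      using reals_Archimedean[of "e/4"] by auto
    have *: "J (X n) - m < e / 4" if "n \<ge> N" for n
    proof -
      have "inverse (real (Suc n)) \<le> inverse (real (Suc N))" using that by (intro le_imp_inverse_le) auto
      then show ?thesis using X(2)[of n] N by linarith
    qed
    have "B (comb 1 (X i) (-1) (X n)) (comb 1 (X i) (-1) (X n)) < e" if "i \<ge> N" "n \<ge> N" for i n
    proof -
      have "2 * (J (X i) - m) + 2 * (J (X n) - m) < e"
        using *[OF that(1)] *[OF that(2)] by (simp add: field_simps)
      then show ?thesis by (rule le_less_trans[OF par[OF X(1) X(1)]])
    qed
    then show "\<exists>N. \<forall>m\<ge>N. \<forall>n\<ge>N. B (comb 1 (X m) (-1) (X n)) (comb 1 (X m) (-1) (X n)) < e" by blast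
  qed
  then obtain u where u: "u \<in> V" and lim: "(\<lambda>n. B (comb 1 (X n) (-1) u) (comb 1 (X n) (-1) u)) \<longlonglongrightarrow> 0" by blast
  have "B u v = l v" if v: "v \<in> V" for v
  proof -
    have "(\<lambda>n. (B (X n) v - B u v)\<^sup>2) \<longlonglongrightarrow> 0"
    proof (rule Lim_null_comparison[OF always_eventually])
      show "\<forall>n. norm ((B (X n) v - B u v)\<^sup>2) \<le> B (comb 1 (X n) (-1) u) (comb 1 (X n) (-1) u) * B v v"
        using CS[OF comb[OF X(1) u, of 1 _ "-1"] v] by (simp add: lin X(1) u v)
      show "(\<lambda>n. B (comb 1 (X n) (-1) u) (comb 1 (X n) (-1) u) * B v v) \<longlonglongrightarrow> 0"
        by (rule tendsto_mult_left_zero[OF lim])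
    qed
    then have "(\<lambda>n. sqrt ((B (X n) v - B u v)\<^sup>2)) \<longlonglongrightarrow> sqrt 0" by (rule tendsto_real_sqrt)
    then have "(\<lambda>n. B (X n) v - B u v) \<longlonglongrightarrow> 0" by (simp add: tendsto_rabs_zero_iff)
    then have lv: "(\<lambda>n. B (X n) v) \<longlonglongrightarrow> B u v" by (simp add: LIM_zero_iff)
    \<comment> \<open>The first variation in the limit. The quadratic in t has no constant term, so
      the discriminant bound forces its linear coefficient to vanish.\<close>
    have "0 \<le> 0 + 2 * t * (B u v - l v) + t\<^sup>2 * B v v" for t
    proof (rule LIMSEQ_le)
      show "(\<lambda>n. 2 * t * (B (X n) v - l v) + t\<^sup>2 * B v v) \<longlonglongrightarrow> 0 + 2 * t * (B u v - l v) + t\<^sup>2 * B v v"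
        using lv by (auto intro!: tendsto_eq_intros)
      show "(\<lambda>n. - inverse (real (Suc n))) \<longlonglongrightarrow> 0"
        using tendsto_minus[OF LIMSEQ_inverse_real_of_nat] by simp
      have "- inverse (real (Suc n)) \<le> 2 * t * (B (X n) v - l v) + t\<^sup>2 * B v v" for n
        using mle[OF comb[OF X(1)[of n] v, of 1 t]] X(2)[of n]
        by (simp add: J_def Bcomb llin X(1) v algebra_simps)
      then show "\<exists>N. \<forall>n\<ge>N. - inverse (real (Suc n)) \<le> 2 * t * (B (X n) v - l v) + t\<^sup>2 * B v v" by blast
    qed
    from quadratic_nonneg_discriminant[OF this pos[OF v]] show ?thesis by simp
  qed
  with u show ?thesis by blast
qed

text \<open>Symmetrisation is built in, so full gradients can be inserted directly and correctors
  exist for every matrix.\<close>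

definition tform :: "tensor4 \<Rightarrow> mat3 \<Rightarrow> mat3 \<Rightarrow> real" where
  "tform T \<xi> \<zeta> = frob (tapply T (symm \<xi>)) (symm \<zeta>)"

lemma tform_sum: "tform T \<xi> \<zeta> = (\<Sum>i\<in>UNIV. \<Sum>j\<in>UNIV. (\<Sum>k\<in>UNIV. \<Sum>l\<in>UNIV. T i k j l * symm \<xi> $ k $ l) * symm \<zeta> $ i $ j)"
  by (simp add: tform_def frob_def tapply_def)

lemma tapply_linear: "tapply T (a *\<^sub>R X + b *\<^sub>R Y) = a *\<^sub>R tapply T X + b *\<^sub>R tapply T Y"
  by (simp add: tapply_def vec_eq_iff sum_distrib_left distrib_left sum.distrib[symmetric] mult.left_commute)

lemma tform_linear:
  "tform T (a *\<^sub>R \<xi> + b *\<^sub>R \<xi>') \<zeta> = a * tform T \<xi> \<zeta> + b * tform T \<xi>' \<zeta>"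
  "tform T \<zeta> (a *\<^sub>R \<xi> + b *\<^sub>R \<xi>') = a * tform T \<zeta> \<xi> + b * tform T \<zeta> \<xi>'"
  by (simp_all add: tform_def symm_linear tapply_linear frob_inner inner_add inner_add_right)

text \<open>The bounds are phrased through the quadratic form and not through the entries, so that
  the homogenized tensor becomes an instance with the same constant.\<close>

definition elliptic :: "real \<Rightarrow> (vec3 \<Rightarrow> tensor4) \<Rightarrow> bool" where
  "elliptic a T \<longleftrightarrow> 0 < a \<and> (\<forall>i k j l. (\<lambda>y. T y i k j l) \<in> bmeas) \<and>
    (\<forall>y \<xi> \<zeta>. tform (T y) \<xi> \<zeta> = tform (T y) \<zeta> \<xi>) \<and>
    (\<forall>y \<xi>. a * (norm (symm \<xi>))\<^sup>2 \<le> tform (T y) \<xi> \<xi> \<and> tform (T y) \<xi> \<xi> \<le> (norm (symm \<xi>))\<^sup>2 / a)"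

lemma measurable_nth [measurable (raw)]:
  fixes f :: "'a \<Rightarrow> 'b::euclidean_space^'n"
  assumes "f \<in> borel_measurable N" shows "(\<lambda>x. f x $ i) \<in> borel_measurable N"
  by (rule borel_measurable_continuous_on[OF linear_continuous_on[OF bounded_linear_vec_nth] assms])

context
  fixes a T assumes T: "elliptic a T"
begin

lemma elliptic_pos: "0 < a" using T by (simp add: elliptic_def)

lemma elliptic_sym: "tform (T y) \<xi> \<zeta> = tform (T y) \<zeta> \<xi>" using T by (simp add: elliptic_def)

lemma elliptic_lower: "a * (norm (symm \<xi>))\<^sup>2 \<le> tform (T y) \<xi> \<xi>" using T by (simp add: elliptic_def)

text \<open>Cauchy-Schwarz for the semidefinite form extends the upper bound from the diagonal to
  all pairs.\<close>

lemma elliptic_bound: "\<bar>tform (T y) \<xi> \<zeta>\<bar> \<le> norm (symm \<xi>) * norm (symm \<zeta>) / a"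
proof -
  let ?t = "tform (T y)"
  have nn: "0 \<le> ?t X X" for X
    using elliptic_lower[of X y] elliptic_pos by (meson mult_nonneg_nonneg less_imp_le order_trans zero_le_power2)
  have "(?t \<xi> \<zeta>)\<^sup>2 \<le> ?t \<xi> \<xi> * ?t \<zeta> \<zeta>"
  proof (rule quadratic_nonneg_discriminant[OF _ nn])
    show "0 \<le> ?t \<xi> \<xi> + 2 * t * ?t \<xi> \<zeta> + t\<^sup>2 * ?t \<zeta> \<zeta>" for t
      using nn[of "1 *\<^sub>R \<xi> + t *\<^sub>R \<zeta>"] elliptic_sym[of y \<zeta> \<xi>]
      by (simp only: tform_linear) (simp add: algebra_simps power2_eq_square)
  qed
  also have "\<dots> \<le> ((norm (symm \<xi>))\<^sup>2 / a) * ((norm (symm \<zeta>))\<^sup>2 / a)"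
    using T elliptic_pos nn by (intro mult_mono) (auto simp: elliptic_def)
  also have "\<dots> = (norm (symm \<xi>) * norm (symm \<zeta>) / a)\<^sup>2"
    by (simp add: power2_eq_square)
  finally have "\<bar>?t \<xi> \<zeta>\<bar> \<le> \<bar>norm (symm \<xi>) * norm (symm \<zeta>) / a\<bar>" unfolding abs_le_square_iff .
  then show ?thesis using elliptic_pos by simp
qed

lemma tform_measurable:
  assumes [measurable]: "G \<in> bmeas" "H \<in> bmeas"
  shows "(\<lambda>x. tform (T x) (G x) (H x)) \<in> bmeas"
proof -
  have [measurable]: "(\<lambda>y. T y i k j l) \<in> bmeas" for i k j l
    using T by (simp add: elliptic_def)
  show ?thesis unfolding tform_sum symm_nth by measurable
qed

end

section \<open>Weak solutions of elliptic problems\<close>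

context tdomain
begin

definition bil :: "(vec3 \<Rightarrow> tensor4) \<Rightarrow> (vec3 \<Rightarrow> mat3) \<Rightarrow> (vec3 \<Rightarrow> mat3) \<Rightarrow> real" where
  "bil T G H = (\<integral>x. tform (T x) (G x) (H x) \<partial>M)"

context
  fixes a T assumes T: "elliptic a T"
begin

lemma tform_bound_integral:
  assumes G: "sqi M G" and H: "sqi M H"
  shows "integrable M (\<lambda>x. tform (T x) (G x) (H x))"
    and "\<bar>bil T G H\<bar> \<le> l2n M (\<lambda>x. symm (G x)) * l2n M (\<lambda>x. symm (H x)) / a"
proof -
  have m: "(\<lambda>x. tform (T x) (G x) (H x)) \<in> borel_measurable M"
    using tform_measurable[OF T] sqi_measurable[OF G] sqi_measurable[OF H] by simp
  have s: "sqi M (\<lambda>x. norm (symm (G x)))" "sqi M (\<lambda>x. norm (symm (H x)))"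
    using sqi_symm[OF G] sqi_symm[OF H] by (auto simp: sqi_def)
  have i: "integrable M (\<lambda>x. norm (symm (G x)) * norm (symm (H x)) / a)"
    using sqi_integrable_mult[OF s] by simp
  show t: "integrable M (\<lambda>x. tform (T x) (G x) (H x))"
    by (rule bi_integrable_bound[OF i m])
      (use elliptic_bound[OF T] elliptic_pos[OF T] in \<open>auto intro!: AE_I2 intro: order_trans[OF _ abs_ge_self]\<close>)
  have "\<bar>bil T G H\<bar> \<le> (\<integral>x. \<bar>tform (T x) (G x) (H x)\<bar> \<partial>M)"
    unfolding bil_def by (rule integral_abs_bound)
  also have "\<dots> \<le> (\<integral>x. norm (symm (G x)) * norm (symm (H x)) / a \<partial>M)"
    by (intro integral_mono i integrable_abs t elliptic_bound[OF T])
  also have "\<dots> = (\<integral>x. norm (symm (G x)) \<bullet> norm (symm (H x)) \<partial>M) / a" by simp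
  also have "\<dots> \<le> l2n M (\<lambda>x. norm (symm (G x))) * l2n M (\<lambda>x. norm (symm (H x))) / a"
    using l2_Cauchy_Schwarz[OF s] elliptic_pos[OF T] by (intro divide_right_mono) auto
  also have "\<dots> = l2n M (\<lambda>x. symm (G x)) * l2n M (\<lambda>x. symm (H x)) / a" by (simp add: l2n_def)
  finally show "\<bar>bil T G H\<bar> \<le> l2n M (\<lambda>x. symm (G x)) * l2n M (\<lambda>x. symm (H x)) / a" .
qed

lemma bil_sym: "bil T G H = bil T H G"
  unfolding bil_def using elliptic_sym[OF T] by simp

lemma bil_linear:
  assumes "sqi M G" "sqi M G'" "sqi M H"
  shows "bil T (\<lambda>x. c *\<^sub>R G x + d *\<^sub>R G' x) H = c * bil T G H + d * bil T G' H"
  unfolding bil_def tform_linear using tform_bound_integral(1) assms by simp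

lemma bil_lower:
  assumes G: "sqi M G" shows "a * (l2n M (\<lambda>x. symm (G x)))\<^sup>2 \<le> bil T G G"
proof -
  have "a * (l2n M (\<lambda>x. symm (G x)))\<^sup>2 = (\<integral>x. a * (norm (symm (G x)))\<^sup>2 \<partial>M)" by (simp add: l2n_sq)
  also have "\<dots> \<le> bil T G G" unfolding bil_def
    using sqi_integrable_sq[OF sqi_symm[OF G]]
    by (intro integral_mono tform_bound_integral G elliptic_lower[OF T] integrable_mult_right)
  finally show ?thesis .
qed

lemma l2n_symm_le:
  assumes "sqi M G" shows "l2n M (\<lambda>x. symm (G x)) \<le> l2n M G"
  using sqi_bound(2)[OF _ assms, of "\<lambda>x. symm (G x)" 1] sqi_symm[OF assms] norm_symm_le by auto

text \<open>One solver for two situations: the resolvent problem, where \<mu> > 0 supplies the L2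
  part of the coercivity, and the cell problem, where \<mu> = 0 and the restriction to mean-zero
  functions supplies it.\<close>

proposition exists_weak_solution:
  fixes V :: "((vec3 \<Rightarrow> vec3) \<times> (vec3 \<Rightarrow> mat3)) set" and l :: "(vec3 \<Rightarrow> vec3) \<times> (vec3 \<Rightarrow> mat3) \<Rightarrow> real"
  assumes zero: "((\<lambda>x. 0), (\<lambda>x. 0)) \<in> V" and sob: "\<And>u G. (u, G) \<in> V \<Longrightarrow> sob u G"
    and comb: "\<And>u G v H c d. (u, G) \<in> V \<Longrightarrow> (v, H) \<in> V \<Longrightarrow> ((\<lambda>x. c *\<^sub>R u x + d *\<^sub>R v x), (\<lambda>x. c *\<^sub>R G x + d *\<^sub>R H x)) \<in> V"
    and closed: "\<And>u G v H. (\<And>n. (u n, G n) \<in> V) \<Longrightarrow> sob v H \<Longrightarrow>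
        (\<lambda>n. l2n M (\<lambda>x. u n x - v x)) \<longlonglongrightarrow> 0 \<Longrightarrow> (\<lambda>n. l2n M (\<lambda>x. G n x - H x)) \<longlonglongrightarrow> 0 \<Longrightarrow> (v, H) \<in> V"
    and \<mu>: "0 \<le> \<mu>" and c: "0 < c"
    and coer: "\<And>u G. (u, G) \<in> V \<Longrightarrow> c * ((l2n M u)\<^sup>2 + (l2n M G)\<^sup>2) \<le> bil T G G + \<mu> * (l2n M u)\<^sup>2"
    and llin: "\<And>u G v H c d. (u, G) \<in> V \<Longrightarrow> (v, H) \<in> V \<Longrightarrow>
        l ((\<lambda>x. c *\<^sub>R u x + d *\<^sub>R v x), (\<lambda>x. c *\<^sub>R G x + d *\<^sub>R H x)) = c * l (u, G) + d * l (v, H)"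
    and lbd: "\<And>u G. (u, G) \<in> V \<Longrightarrow> \<bar>l (u, G)\<bar> \<le> K * (l2n M u + l2n M G)"
  shows "\<exists>u G. (u, G) \<in> V \<and> (\<forall>v H. (v, H) \<in> V \<longrightarrow> bil T G H + \<mu> * (\<integral>x. u x \<bullet> v x \<partial>M) = l (v, H))"
proof -
  define B where "B p q = bil T (snd p) (snd q) + \<mu> * (\<integral>x. fst p x \<bullet> fst q x \<partial>M)"
    for p q :: "(vec3 \<Rightarrow> vec3) \<times> (vec3 \<Rightarrow> mat3)"
  define cmb where "cmb c p d q = ((\<lambda>x. c *\<^sub>R fst p x + d *\<^sub>R fst q x), (\<lambda>x. c *\<^sub>R snd p x + d *\<^sub>R snd q x))"
    for c d and p q :: "(vec3 \<Rightarrow> vec3) \<times> (vec3 \<Rightarrow> mat3)"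
  have s: "sqi M (fst p)" "sqi M (snd p)" "per (fst p)" "per (snd p)" if "p \<in> V" for p
    using sob[of "fst p" "snd p"] that by (auto simp: sob_def)
  have Bpp: "B p p = bil T (snd p) (snd p) + \<mu> * (l2n M (fst p))\<^sup>2" for p
    by (simp add: B_def l2n_sq power2_norm_eq_inner)
  have co: "c * ((l2n M (fst p))\<^sup>2 + (l2n M (snd p))\<^sup>2) \<le> B p p" if "p \<in> V" for p
    unfolding Bpp using coer[of "fst p" "snd p"] that by simp
  have "\<exists>p\<in>V. \<forall>q\<in>V. B p q = l q"
  \<comment> \<open>Combined with (a + b)^2 \<le> 2 (a^2 + b^2) and coercivity, the bound on
    \<open>l\<close> becomes the required bound in terms of the energy.\<close>
  proof (rule riesz_representation[where comb=cmb and K="2 * K\<^sup>2 / c"])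
    show "V \<noteq> {}" using zero by auto
    show "cmb a x b y \<in> V" if "x \<in> V" "y \<in> V" for a x b y
      using comb[of "fst x" "snd x" "fst y" "snd y"] that by (simp add: cmb_def)
    show "B x y = B y x" for x y
      unfolding B_def using bil_sym by (simp add: inner_commute)
    show "B (cmb a x b y) z = a * B x z + b * B y z" if "x \<in> V" "y \<in> V" "z \<in> V" for a x b y z
      using that s sqi_integrable_inner[of M "fst x" "fst z"] sqi_integrable_inner[of M "fst y" "fst z"]
      by (simp add: B_def cmb_def bil_linear inner_add_left algebra_simps)
    show "0 \<le> B x x" if "x \<in> V" for x
      using order_trans[OF _ co[OF that]] c by simp
    show "l (cmb a x b y) = a * l x + b * l y" if "x \<in> V" "y \<in> V" for a x b y
      using llin[of "fst x" "snd x" "fst y" "snd y"] that by (simp add: cmb_def)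
    show "(l x)\<^sup>2 \<le> 2 * K\<^sup>2 / c * B x x" if "x \<in> V" for x
    proof -
      have "(l x)\<^sup>2 \<le> (K * (l2n M (fst x) + l2n M (snd x)))\<^sup>2"
        using lbd[of "fst x" "snd x"] that by (subst abs_le_square_iff[symmetric]) auto
      also have "\<dots> \<le> K\<^sup>2 * (2 * ((l2n M (fst x))\<^sup>2 + (l2n M (snd x))\<^sup>2))"
        unfolding power_mult_distrib using sum_squares_bound[of "l2n M (fst x)" "l2n M (snd x)"]
        by (intro mult_left_mono) (auto simp: power2_sum)
      also have "\<dots> = 2 * K\<^sup>2 / c * (c * ((l2n M (fst x))\<^sup>2 + (l2n M (snd x))\<^sup>2))" using c by simp
      also have "\<dots> \<le> 2 * K\<^sup>2 / c * B x x" using c by (intro mult_left_mono co that) auto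
      finally show ?thesis .
    qed
    show "0 \<le> 2 * K\<^sup>2 / c" using c by simp
    show "\<exists>x\<in>V. (\<lambda>n. B (cmb 1 (X n) (- 1) x) (cmb 1 (X n) (- 1) x)) \<longlonglongrightarrow> 0"
      if X: "\<And>n. X n \<in> V" and Cauchy: "\<And>e. 0 < e \<Longrightarrow> \<exists>N. \<forall>m\<ge>N. \<forall>n\<ge>N. B (cmb 1 (X m) (- 1) (X n)) (cmb 1 (X m) (- 1) (X n)) < e" for X
    proof -
      have d: "cmb 1 p (- 1) q = ((\<lambda>x. fst p x - fst q x), (\<lambda>x. snd p x - snd q x))" for p q by (simp add: cmb_def)
      have inV: "cmb 1 (X m) (-1) (X n) \<in> V" for m n
        using comb[of "fst (X m)" "snd (X m)" "fst (X n)" "snd (X n)" 1 "-1"] X by (simp add: cmb_def)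
      let ?a = "\<lambda>m n. l2n M (\<lambda>x. fst (X m) x - fst (X n) x)" and ?b = "\<lambda>m n. l2n M (\<lambda>x. snd (X m) x - snd (X n) x)"
      have ca: "\<exists>N. \<forall>m\<ge>N. \<forall>n\<ge>N. ?a m n < e \<and> ?b m n < e"
        if e: "0 < e" for e
      proof -
        obtain N where N: "\<And>m n. m \<ge> N \<Longrightarrow> n \<ge> N \<Longrightarrow> B (cmb 1 (X m) (- 1) (X n)) (cmb 1 (X m) (- 1) (X n)) < c * e\<^sup>2"
          using Cauchy[of "c * e\<^sup>2"] c e by auto
        have "?a m n < e \<and> ?b m n < e" if "m \<ge> N" "n \<ge> N" for m n
        proof -
          have "c * ((?a m n)\<^sup>2 + (?b m n)\<^sup>2) < c * e\<^sup>2"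
            using le_less_trans[OF co[OF inV] N[OF that]] by (simp add: d)
          then have "(?a m n)\<^sup>2 + (?b m n)\<^sup>2 < e\<^sup>2"
            using c by simp
          then have "(?a m n)\<^sup>2 < e\<^sup>2" "(?b m n)\<^sup>2 < e\<^sup>2"
            using zero_le_power2[of "?a m n"]
              zero_le_power2[of "?b m n"] by linarith+
          then show ?thesis using e by (auto dest!: power_less_imp_less_base)
        qed
        then show ?thesis by blast
      qed
      have ca1: "\<exists>N. \<forall>m\<ge>N. \<forall>n\<ge>N. l2n M (\<lambda>x. fst (X m) x - fst (X n) x) < e"
        and ca2: "\<exists>N. \<forall>m\<ge>N. \<forall>n\<ge>N. l2n M (\<lambda>x. snd (X m) x - snd (X n) x) < e" if "0 < e" for e
        using ca[OF that] by blast+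
      obtain L1 where L1: "sqi M (\<lambda>x. L1 (\<lambda>n. fst (X n) x))" "(\<lambda>n. l2n M (\<lambda>x. fst (X n) x - L1 (\<lambda>n. fst (X n) x))) \<longlonglongrightarrow> 0"
        by (rule riesz_fischer[of M "\<lambda>n. fst (X n)", OF s(1)[OF X] ca1])
      obtain L2 where L2: "sqi M (\<lambda>x. L2 (\<lambda>n. snd (X n) x))" "(\<lambda>n. l2n M (\<lambda>x. snd (X n) x - L2 (\<lambda>n. snd (X n) x))) \<longlonglongrightarrow> 0"
        by (rule riesz_fischer[of M "\<lambda>n. snd (X n)", OF s(2)[OF X] ca2])
      let ?u = "\<lambda>x. L1 (\<lambda>n. fst (X n) x)" and ?G = "\<lambda>x. L2 (\<lambda>n. snd (X n) x)"
      \<comment> \<open>Periodicity holds at every point, because each limit is a function of the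
        value sequence at that point.\<close>
      have p: "per ?u" "per ?G" using s(3,4)[OF X] by (auto simp: per_def)
      have "sob ?u ?G"
        by (rule sob_closed[OF _ L1(1) p(1) L2(1) p(2) L1(2) L2(2)]) (use sob X in auto)
      then have V: "(?u, ?G) \<in> V"
        by (rule closed[rotated]) (use X L1 L2 in auto)
      have sd: "sqi M (\<lambda>x. snd (X n) x - ?G x)" for n using s(2)[OF X] L2(1) by auto
      have "(\<lambda>n. B (cmb 1 (X n) (- 1) (?u, ?G)) (cmb 1 (X n) (- 1) (?u, ?G))) \<longlonglongrightarrow> 0"
      proof (rule Lim_null_comparison[OF always_eventually])
        show "(\<lambda>n. (l2n M (\<lambda>x. snd (X n) x - ?G x))\<^sup>2 / a + \<mu> * (l2n M (\<lambda>x. fst (X n) x - ?u x))\<^sup>2) \<longlonglongrightarrow> 0"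
          using L1(2) L2(2) elliptic_pos[OF T] by (auto intro!: tendsto_eq_intros)
        show "\<forall>n. norm (B (cmb 1 (X n) (- 1) (?u, ?G)) (cmb 1 (X n) (- 1) (?u, ?G)))
          \<le> (l2n M (\<lambda>x. snd (X n) x - ?G x))\<^sup>2 / a + \<mu> * (l2n M (\<lambda>x. fst (X n) x - ?u x))\<^sup>2"
        proof
          fix n
          let ?g = "\<lambda>x. snd (X n) x - ?G x"
          have "\<bar>bil T ?g ?g\<bar> \<le> (l2n M (\<lambda>x. symm (?g x)))\<^sup>2 / a"
            using tform_bound_integral(2)[OF sd sd, of n n] by (simp add: power2_eq_square)
          also have "\<dots> \<le> (l2n M ?g)\<^sup>2 / a"
            using l2n_symm_le[OF sd, of n] elliptic_pos[OF T] by (intro divide_right_mono power_mono) auto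
          finally show "norm (B (cmb 1 (X n) (- 1) (?u, ?G)) (cmb 1 (X n) (- 1) (?u, ?G)))
            \<le> (l2n M ?g)\<^sup>2 / a + \<mu> * (l2n M (\<lambda>x. fst (X n) x - ?u x))\<^sup>2"
            using mult_nonneg_nonneg[OF \<mu> zero_le_power2[of "l2n M (\<lambda>x. fst (X n) x - ?u x)"]]
            unfolding Bpp d fst_conv snd_conv real_norm_def by linarith
        qed
      qed
      with V show ?thesis by blast
    qed
  qed
  then obtain p where "p \<in> V" "\<And>q. q \<in> V \<Longrightarrow> B p q = l q" by blast
  then show ?thesis unfolding B_def
    by (intro exI[of _ "fst p"] exI[of _ "snd p"]) fastforce
qed

lemma sob_zero: "sob (\<lambda>x. 0) (\<lambda>x. 0)"
  unfolding sob_def weak_grad_acl acl_def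
  by (auto simp: per_def loc_int_zero av_def)

lemma korn_bil:
  assumes "sob u G" shows "a / 2 * (l2n M G)\<^sup>2 \<le> bil T G G"
proof -
  have "sqi M G" using assms by (simp add: sob_def)
  then have "a * (l2n M (\<lambda>x. symm (G x)))\<^sup>2 \<le> bil T G G" by (rule bil_lower)
  moreover have "a / 2 * (l2n M G)\<^sup>2 \<le> a / 2 * (2 * (l2n M (\<lambda>x. symm (G x)))\<^sup>2)"
    using elliptic_pos[OF T] by (intro mult_left_mono korn[OF assms]) auto
  ultimately show ?thesis by simp
qed

corollary exists_resolvent:
  assumes f: "sqi M f" and \<tau>: "0 < \<tau>"
  shows "\<exists>u G. sob u G \<and> (\<forall>v H. sob v H \<longrightarrow> \<tau> * bil T G H + (\<integral>x. u x \<bullet> v x \<partial>M) = (\<integral>x. f x \<bullet> v x \<partial>M))"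
proof -
  \<comment> \<open>The equation is divided by \<tau>, since the solver has its free coefficient on
    the zero-order term.\<close>
  let ?V = "{(u, G). sob u G}" and ?l = "\<lambda>p. (1 / \<tau>) * (\<integral>x. f x \<bullet> fst p x \<partial>M)"
  have "\<exists>u G. (u, G) \<in> ?V \<and> (\<forall>v H. (v, H) \<in> ?V \<longrightarrow> bil T G H + (1 / \<tau>) * (\<integral>x. u x \<bullet> v x \<partial>M) = ?l (v, H))"
  proof (rule exists_weak_solution[where c="min (a/2) (1/\<tau>)" and K="(1 / \<tau>) * l2n M f"])
    fix u G assume "(u, G) \<in> ?V"
    then have s: "sob u G" "sqi M u" by (auto simp: sob_def)
    have "min (a/2) (1/\<tau>) * ((l2n M u)\<^sup>2 + (l2n M G)\<^sup>2) \<le> 1/\<tau> * (l2n M u)\<^sup>2 + a/2 * (l2n M G)\<^sup>2"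
      unfolding distrib_left by (intro add_mono mult_right_mono) auto
    then show "min (a/2) (1/\<tau>) * ((l2n M u)\<^sup>2 + (l2n M G)\<^sup>2) \<le> bil T G G + 1/\<tau> * (l2n M u)\<^sup>2"
      using korn_bil[OF s(1)] by simp
    have "\<bar>\<integral>x. f x \<bullet> u x \<partial>M\<bar> \<le> l2n M f * (l2n M u + l2n M G)"
      using l2_Cauchy_Schwarz[OF f s(2)] by (rule order_trans) (simp add: mult_left_mono)
    from mult_left_mono[OF this, of "1/\<tau>"]
    show "\<bar>?l (u, G)\<bar> \<le> (1 / \<tau>) * l2n M f * (l2n M u + l2n M G)" using \<tau> by (simp add: abs_mult)
  next
    fix u G v H c d assume "(u, G) \<in> ?V" "(v, H) \<in> ?V"
    then have "sqi M u" "sqi M v" by (auto simp: sob_def)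
    then show "?l ((\<lambda>x. c *\<^sub>R u x + d *\<^sub>R v x), (\<lambda>x. c *\<^sub>R G x + d *\<^sub>R H x)) = c * ?l (u, G) + d * ?l (v, H)"
      using sqi_integrable_inner[OF f] by (simp add: inner_add_right algebra_simps)
  qed (use \<tau> elliptic_pos[OF T] sob_zero sob_lincomb in auto)
  then obtain u G where "sob u G" "\<And>v H. sob v H \<Longrightarrow> bil T G H + (1 / \<tau>) * (\<integral>x. u x \<bullet> v x \<partial>M) = (1 / \<tau>) * (\<integral>x. f x \<bullet> v x \<partial>M)"
    by auto
  then show ?thesis using \<tau> by (intro exI[of _ u] exI[of _ G]) (auto simp: field_simps)
qed

end

end

section \<open>The lattice and the unit cell\<close>

definition lfloor :: "vec3 \<Rightarrow> vec3" where "lfloor x = (\<chi> i. of_int \<lfloor>x $ i\<rfloor>)"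

lemma lfloor_lattice: "lfloor x \<in> lattice"
  by (simp add: lfloor_def lattice_def)

text \<open>The cell is half open in each coordinate, so its lattice translates tile the space
  without overlap.\<close>

lemma lfloor_unique: "n \<in> lattice \<Longrightarrow> x - n \<in> cellY \<longleftrightarrow> n = lfloor x"
proof
  assume n: "n \<in> lattice" and c: "x - n \<in> cellY"
  have "n $ i = of_int \<lfloor>x $ i\<rfloor>" for i
  proof -
    obtain k :: int where k: "n $ i = of_int k" using n by (auto simp: lattice_def elim: Ints_cases)
    have "0 \<le> (x - n) $ i \<and> (x - n) $ i < 1" using c unfolding cellY_def by blast
    then have "0 \<le> x $ i - of_int k" "x $ i - of_int k < 1" using k by auto
    then have "\<lfloor>x $ i\<rfloor> = k" by (simp add: floor_eq_iff)
    then show ?thesis using k by simp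
  qed
  then show "n = lfloor x" by (simp add: lfloor_def vec_eq_iff)
next
  assume "n = lfloor x"
  then show "x - n \<in> cellY"
    unfolding cellY_def lfloor_def by (auto simp: algebra_simps) linarith
qed

lemma lattice_uminus: "n \<in> lattice \<Longrightarrow> - n \<in> lattice"
  by (auto simp: lattice_def)

lemma lattice_add: "n \<in> lattice \<Longrightarrow> m \<in> lattice \<Longrightarrow> n + m \<in> lattice"
  by (auto simp: lattice_def)

lemma lattice_diff: "n \<in> lattice \<Longrightarrow> m \<in> lattice \<Longrightarrow> n - m \<in> lattice"
  by (auto simp: lattice_def)

lemma lattice_axis: "axis j 1 \<in> lattice"
  by (auto simp: lattice_def axis_def)

lemma lattice_image: "lattice = range (\<lambda>f :: 3 \<Rightarrow> int. \<chi> i. of_int (f i))"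
proof -
  have "n \<in> range (\<lambda>f :: 3 \<Rightarrow> int. \<chi> i. of_int (f i))" if "n \<in> lattice" for n
  proof -
    have "\<exists>k :: int. n $ i = of_int k" for i using that by (auto simp: lattice_def elim: Ints_cases)
    then obtain f :: "3 \<Rightarrow> int" where "\<And>i. n $ i = of_int (f i)" by metis
    then have "n = (\<chi> i. of_int (f i))" by (simp add: vec_eq_iff)
    then show ?thesis by blast
  qed
  then show ?thesis by (auto simp: lattice_def)
qed

lemma countable_lattice: "countable lattice"
  unfolding lattice_image by (intro countable_image countableI_type)

lemma finite_lattice_ball: "finite {n \<in> lattice. norm n \<le> R}"
proof -
  have "finite ((\<lambda>f :: 3 \<Rightarrow> int. \<chi> i. of_int (f i) :: real^3) ` (UNIV \<rightarrow>\<^sub>E {- \<lceil>R\<rceil>..\<lceil>R\<rceil>}))"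
    by (intro finite_imageI finite_PiE) auto
  moreover have "{n \<in> lattice. norm n \<le> R} \<subseteq> (\<lambda>f :: 3 \<Rightarrow> int. \<chi> i. of_int (f i)) ` (UNIV \<rightarrow>\<^sub>E {- \<lceil>R\<rceil>..\<lceil>R\<rceil>})"
  proof
    fix n assume "n \<in> {n \<in> lattice. norm n \<le> R}"
    then obtain f :: "3 \<Rightarrow> int" where f: "n = (\<chi> i. of_int (f i))" and n: "norm n \<le> R"
      by (auto simp: lattice_image)
    have "f i \<in> {- \<lceil>R\<rceil>..\<lceil>R\<rceil>}" for i
    proof -
      have "\<bar>n $ i\<bar> \<le> R" using component_le_norm_cart[of n i] n by linarith
      then have "\<bar>of_int (f i) :: real\<bar> \<le> R" by (simp add: f)
      then have "of_int (f i) \<le> R" "of_int (- f i) \<le> R" by auto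
      then have "f i \<le> \<lceil>R\<rceil>" "- f i \<le> \<lceil>R\<rceil>" by linarith+
      then show ?thesis by auto
    qed
    then show "n \<in> (\<lambda>f :: 3 \<Rightarrow> int. \<chi> i. of_int (f i)) ` (UNIV \<rightarrow>\<^sub>E {- \<lceil>R\<rceil>..\<lceil>R\<rceil>})"
      using f by (intro image_eqI[of _ _ f]) auto
  qed
  ultimately show ?thesis by (rule finite_subset[rotated])
qed

lemma cellY_borel [measurable]: "cellY \<in> sets borel"
proof -
  have eq: "cellY = (\<Inter>i. {x. 0 \<le> x $ i} \<inter> {x. x $ i < 1})" by (auto simp: cellY_def)
  have "{x :: vec3. 0 \<le> x $ i} \<in> sets borel" "{x :: vec3. x $ i < 1} \<in> sets borel" for i
    by (auto intro!: borel_closed borel_open closed_halfspace_component_ge_cart open_halfspace_component_lt_cart)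
  then show ?thesis unfolding eq by (intro sets.finite_INT sets.Int) auto
qed

lemma cellY_norm: "x \<in> cellY \<Longrightarrow> norm x \<le> 3"
proof -
  assume x: "x \<in> cellY"
  have "norm x \<le> (\<Sum>i\<in>UNIV. \<bar>x $ i\<bar>)" by (rule norm_le_l1_cart)
  also have "\<dots> \<le> (\<Sum>i\<in>(UNIV::3 set). 1)" using x by (intro sum_mono) (auto simp: cellY_def intro: less_imp_le)
  finally show ?thesis by simp
qed

lemma emeasure_cellY: "emeasure lborel cellY = 1"
proof (rule antisym)
  have one: "(\<Prod>b\<in>Basis. (1::vec3) \<bullet> b) = 1" "\<forall>b\<in>Basis. 0 \<le> (1::vec3) \<bullet> b"
    by (auto intro!: prod.neutral simp: Basis_vec_def inner_axis)
  have "cellY \<subseteq> cbox 0 1" using less_imp_le by (fastforce simp: cellY_def mem_box_cart)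
  then have "emeasure lborel cellY \<le> emeasure lborel (cbox (0::vec3) 1)" by (intro emeasure_mono) auto
  also have "\<dots> = 1" using one by (simp add: emeasure_lborel_cbox_eq)
  finally show "emeasure lborel cellY \<le> 1" .
  have "box 0 1 \<subseteq> cellY" by (auto simp: cellY_def mem_box_cart intro: less_imp_le)
  then have "emeasure lborel (box (0::vec3) 1) \<le> emeasure lborel cellY" by (intro emeasure_mono) auto
  then show "1 \<le> emeasure lborel cellY" using one by (simp add: emeasure_lborel_box_eq)
qed

text \<open>The translated cells form an exact partition of unity: the only nonzero term sits at
  \<open>lfloor x\<close>.\<close>

lemma nn_integral_lattice_point:
  fixes c :: ennreal
  shows "(\<integral>\<^sup>+n. c * indicator cellY (x - n) \<partial>count_space lattice) = c"
proof -
  have "(\<integral>\<^sup>+n. c * indicator cellY (x - n) \<partial>count_space lattice) = (\<Sum>n\<in>{lfloor x}. c * indicator cellY (x - n))"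
    by (rule nn_integral_count_space') (use lfloor_unique[of _ x] lfloor_lattice[of x] in \<open>auto split: split_indicator\<close>)
  also have "\<dots> = c" using lfloor_unique[OF lfloor_lattice, of x x] by simp
  finally show ?thesis .
qed

lemma nn_integral_lattice_unfold:
  fixes f :: "vec3 \<Rightarrow> ennreal"
  assumes [measurable]: "f \<in> bmeas"
  shows "(\<integral>\<^sup>+x. f x \<partial>lborel) = (\<integral>\<^sup>+n. \<integral>\<^sup>+x. f (x + n) * indicator cellY x \<partial>lborel \<partial>count_space lattice)"
proof -
  have "(\<integral>\<^sup>+x. f x \<partial>lborel) = (\<integral>\<^sup>+x. \<integral>\<^sup>+n. f x * indicator cellY (x - n) \<partial>count_space lattice \<partial>lborel)"
    by (simp add: nn_integral_lattice_point)
  also have "\<dots> = (\<integral>\<^sup>+n. \<integral>\<^sup>+x. f x * indicator cellY (x - n) \<partial>lborel \<partial>count_space lattice)"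
    by (rule nn_integral_count_space_nn_integral[OF countable_lattice]) measurable
  also have "\<dots> = (\<integral>\<^sup>+n. \<integral>\<^sup>+x. f (x + n) * indicator cellY x \<partial>lborel \<partial>count_space lattice)"
  proof (rule nn_integral_cong)
    fix n
    show "(\<integral>\<^sup>+x. f x * indicator cellY (x - n) \<partial>lborel) = (\<integral>\<^sup>+x. f (x + n) * indicator cellY x \<partial>lborel)"
      using nn_integral_shift[of "\<lambda>x. f x * indicator cellY (x - n)" n] by simp
  qed
  finally show ?thesis .
qed

section \<open>The whole space and the torus as translation domains\<close>

lemma tdomain_UNIV: "tdomain UNIV {}"
proof
  show "\<exists>C::real. \<forall>f :: vec3 \<Rightarrow> ennreal. f \<in> bmeas \<longrightarrow> (\<forall>x n. n \<in> {} \<longrightarrow> f (x + n) = f x) \<longrightarrow>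
       (\<integral>\<^sup>+x. f x * iball R x \<partial>lborel) \<le> ennreal C * (\<integral>\<^sup>+x. f x * indicator UNIV x \<partial>lborel)" for R
    by (intro exI[of _ 1]) (auto intro!: nn_integral_mono split: split_indicator)
qed (auto simp: nn_integral_shift)

text \<open>A translated cell is cut along the lattice, and by periodicity its pieces reassemble to
  the original cell; reflecting the summation index puts the sum into the form of
  \<open>nn_integral_lattice_point\<close>.\<close>

lemma tdomain_torus: "tdomain cellY lattice"
proof
  fix f :: "vec3 \<Rightarrow> ennreal" and h
  assume [measurable]: "f \<in> bmeas" and p: "\<forall>x n. n \<in> lattice \<longrightarrow> f (x + n) = f x"
  have "(\<integral>\<^sup>+x. f (x + h) * indicator cellY x \<partial>lborel) = (\<integral>\<^sup>+x. f x * indicator cellY (x - h) \<partial>lborel)"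
    using nn_integral_shift[of "\<lambda>x. f x * indicator cellY (x - h)" h] by simp
  also have "\<dots> = (\<integral>\<^sup>+n. \<integral>\<^sup>+x. f x * indicator cellY x * indicator cellY (x + n - h) \<partial>lborel \<partial>count_space lattice)"
    by (subst nn_integral_lattice_unfold) (auto intro!: nn_integral_cong simp: p mult_ac)
  also have "\<dots> = (\<integral>\<^sup>+x. \<integral>\<^sup>+n. f x * indicator cellY x * indicator cellY (x + n - h) \<partial>count_space lattice \<partial>lborel)"
    by (rule nn_integral_count_space_nn_integral[OF countable_lattice, symmetric]) measurable
  also have "\<dots> = (\<integral>\<^sup>+x. f x * indicator cellY x \<partial>lborel)"
  proof (rule nn_integral_cong)
    fix x
    have "(\<integral>\<^sup>+n. f x * indicator cellY x * indicator cellY (x + n - h) \<partial>count_space lattice)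
      = (\<integral>\<^sup>+n. f x * indicator cellY x * indicator cellY ((x - h) - (- n)) \<partial>count_space lattice)"
      by (simp add: algebra_simps)
    also have "\<dots> = (\<integral>\<^sup>+n. f x * indicator cellY x * indicator cellY ((x - h) - n) \<partial>count_space lattice)"
      by (rule nn_integral_bij_count_space[of uminus])
        (auto intro!: bij_betwI[where g=uminus] simp: lattice_uminus)
    finally show "(\<integral>\<^sup>+n. f x * indicator cellY x * indicator cellY (x + n - h) \<partial>count_space lattice) = f x * indicator cellY x"
      by (simp add: nn_integral_lattice_point)
  qed
  finally show "(\<integral>\<^sup>+x. f (x + h) * indicator cellY x \<partial>lborel) = (\<integral>\<^sup>+x. f x * indicator cellY x \<partial>lborel)" .
next
  fix R :: real
  \<comment> \<open>Points of the cell have norm at most 3, so only lattice points of norm at most R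
    + 3 carry cells that meet the ball.\<close>
  let ?F = "{n \<in> lattice. norm n \<le> R + 3}"
  have "(\<integral>\<^sup>+x. f x * iball R x \<partial>lborel) \<le> ennreal (real (card ?F)) * (\<integral>\<^sup>+x. f x * indicator cellY x \<partial>lborel)"
    if [measurable]: "f \<in> bmeas" and p: "\<forall>x n. n \<in> lattice \<longrightarrow> f (x + n) = f x" for f :: "vec3 \<Rightarrow> ennreal"
  proof -
    have "(\<integral>\<^sup>+x. f x * iball R x \<partial>lborel)
      = (\<integral>\<^sup>+n. \<integral>\<^sup>+x. f x * iball R (x + n) * indicator cellY x \<partial>lborel \<partial>count_space lattice)"
      by (subst nn_integral_lattice_unfold) (auto intro!: nn_integral_cong simp: p)
    also have "\<dots> \<le> (\<integral>\<^sup>+n. (\<integral>\<^sup>+x. f x * indicator cellY x \<partial>lborel) * indicator ?F n \<partial>count_space lattice)"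
    proof (rule nn_integral_mono)
      fix n assume "n \<in> space (count_space lattice)"
      then have n: "n \<in> lattice" by simp
      show "(\<integral>\<^sup>+x. f x * iball R (x + n) * indicator cellY x \<partial>lborel)
         \<le> (\<integral>\<^sup>+x. f x * indicator cellY x \<partial>lborel) * indicator ?F n"
      proof (cases "n \<in> ?F")
        case True
        then show ?thesis by (auto intro!: nn_integral_mono split: split_indicator)
      next
        case False
        have "\<not> norm (x + n) \<le> R" if "x \<in> cellY" for x
          using cellY_norm[OF that] norm_triangle_ineq[of "x + n" "- x"] False n by auto
        then have "(\<lambda>x. f x * iball R (x + n) * indicator cellY x) = (\<lambda>x. 0)"
          by (auto simp: fun_eq_iff split: split_indicator)
        then show ?thesis by simp
      qed
    qed
    also have "\<dots> = (\<integral>\<^sup>+x. f x * indicator cellY x \<partial>lborel) * (\<integral>\<^sup>+n. indicator ?F n \<partial>count_space lattice)"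
      by (rule nn_integral_cmult) auto
    also have "(\<integral>\<^sup>+n. indicator ?F n \<partial>count_space lattice) = ennreal (real (card ?F))"
      using finite_lattice_ball[of "R + 3"] by (simp add: nn_integral_indicator emeasure_count_space_finite ennreal_of_nat_eq_real_of_nat)
    finally show ?thesis by (simp add: mult.commute)
  qed
  then show "\<exists>C::real. \<forall>f :: vec3 \<Rightarrow> ennreal. f \<in> bmeas \<longrightarrow> (\<forall>x n. n \<in> lattice \<longrightarrow> f (x + n) = f x) \<longrightarrow>
       (\<integral>\<^sup>+x. f x * iball R x \<partial>lborel) \<le> ennreal C * (\<integral>\<^sup>+x. f x * indicator cellY x \<partial>lborel)" by blast
  show "cellY = UNIV \<or> bounded cellY" using cellY_norm unfolding bounded_iff by blast
qed simp

interpretation W: tdomain UNIV "{}" by (rule tdomain_UNIV)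
interpretation Y: tdomain cellY lattice by (rule tdomain_torus)

lemma W_M: "W.M = lborel"
  by (simp add: W.M_def density_1)

lemma W_per: "W.per f"
  by (simp add: W.per_def)

lemma W_sob_iff: "W.sob u G \<longleftrightarrow> H1 u G"
  unfolding W.sob_def H1_def W.sqi_M_iff L2_on_def L2_def by (simp add: W_per set_integrable_def)

lemma sqi_lborel_iff: "sq2 f \<longleftrightarrow> L2 f"
  by (simp add: sqi_def L2_def)

lemma Y_per: "Y.per f \<longleftrightarrow> periodic f"
  by (simp add: Y.per_def periodic_def)

lemma Y_sob_iff: "Y.sob u G \<longleftrightarrow> H1per u G"
  unfolding Y.sob_def H1per_def Y.sqi_M_iff Y_per by blast

interpretation YP: prob_space Y.M
  by (rule prob_spaceI) (simp add: Y.M_def emeasure_density emeasure_cellY)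

lemma Y_AE_cell: "AE s in Y.M. s \<in> cellY"
  unfolding Y.M_def by (subst AE_density) (auto split: split_indicator)

lemma Y_sqi_const: "sqi Y.M (\<lambda>x. c)"
  by (simp add: sqi_def)

lemma Y_sqi_integrable: "sqi Y.M f \<Longrightarrow> integrable Y.M f" for f :: "vec3 \<Rightarrow> 'b::euclidean_space"
proof (rule bi_integrable_bound[of _ "\<lambda>x. 1 + (norm (f x))\<^sup>2"])
  assume f: "sqi Y.M f"
  have "norm (f x) \<le> 1 + (norm (f x))\<^sup>2" for x
  proof -
    have "2 * norm (f x) \<le> (norm (f x))\<^sup>2 + 1" using sum_squares_bound[of "norm (f x)" 1] by simp
    then show ?thesis using norm_ge_zero[of "f x"] by linarith
  qed
  then show "AE x in Y.M. norm (f x) \<le> norm (1 + (norm (f x))\<^sup>2)"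
    by (auto intro!: AE_I2 intro: order_trans[OF _ abs_ge_self])
qed (auto simp: sqi_def)

text \<open>Average the translation bound over all shifts in the cell: for mean-zero
  \<open>u\<close> the average of u (x + y) - u x over y is - u x. The constant is the 3 of
  \<open>sob_translation\<close> times the bound 3 for norms in the cell.\<close>

proposition poincare_torus:
  assumes s: "Y.sob u G" and m: "(\<integral>x. u x \<partial>Y.M) = 0"
  shows "l2n Y.M u \<le> 9 * l2n Y.M G"
proof -
  have u: "sqi Y.M u" "Y.per u" using s by (auto simp: Y.sob_def)
  have [measurable]: "u \<in> bmeas" using sqi_measurable[OF u(1)] by simp
  have "AE y in Y.M. (\<integral>\<^sup>+x. ennreal ((norm (case (x, y) of (x, y) \<Rightarrow> u (x + y) - u x))\<^sup>2) \<partial>Y.M) \<le> ennreal ((9 * l2n Y.M G)\<^sup>2)"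
    using Y_AE_cell
  proof eventually_elim
    case (elim y)
    have "sqi Y.M (\<lambda>x. u (x + y) - u x)" using Y.sqi_shift(1)[OF u] u(1) by (rule sqi_diff)
    moreover have "l2n Y.M (\<lambda>x. u (x + y) - u x) \<le> 9 * l2n Y.M G"
      by (rule order_trans[OF Y.sob_translation[OF s]], rule mult_right_mono) (use cellY_norm[OF elim] in auto)
    moreover from this have "(l2n Y.M (\<lambda>x. u (x + y) - u x))\<^sup>2 \<le> (9 * l2n Y.M G)\<^sup>2"
      by (rule power_mono) simp
    ultimately show ?case by (simp only: nn_sqi prod.case) (rule ennreal_leI)
  qed
  from l2_average[OF Y.sigma_finite_M YP.prob_space_axioms _ this]
  have i: "l2n Y.M (\<lambda>x. \<integral>y. u (x + y) - u x \<partial>Y.M) \<le> 9 * l2n Y.M G" by simp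
  have "(\<integral>y. u (x + y) - u x \<partial>Y.M) = - u x" for x
  proof -
    have iu: "integrable Y.M (\<lambda>y. u (y + x))" by (rule Y_sqi_integrable[OF Y.sqi_shift(1)[OF u]])
    have "(\<integral>y. u (y + x) \<partial>Y.M) $ i = 0" for i
    proof -
      have "(\<integral>y. u (y + x) \<partial>Y.M) $ i = (\<integral>y. u (y + x) $ i \<partial>Y.M)"
        by (rule integral_bounded_linear[OF bounded_linear_vec_nth iu, symmetric])
      also have "\<dots> = (\<integral>y. u y $ i \<partial>Y.M)"
        by (rule Y.integrable_M_shift(2)[OF Y_sqi_integrable[OF sqi_nth[OF u(1)]] Y.per_comp[OF u(2)]])
      also have "\<dots> = (\<integral>y. u y \<partial>Y.M) $ i"
        by (rule integral_bounded_linear[OF bounded_linear_vec_nth Y_sqi_integrable[OF u(1)]])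
      finally show ?thesis using m by simp
    qed
    then have "(\<integral>y. u (y + x) \<partial>Y.M) = 0" by (simp add: vec_eq_iff)
    then show ?thesis using iu YP.prob_space by (simp add: add.commute[of x])
  qed
  then show ?thesis using i by (simp add: l2n_minus)
qed

text \<open>For the unit step periodicity kills the increment, so the segment average of the
  derivative vanishes almost everywhere. Integrating it over the cell and undoing the shifts gives
  the mean.\<close>

lemma torus_gradient_mean_zero:
  assumes s: "Y.sob u G" shows "(\<integral>x. G x $ i $ j \<partial>Y.M) = 0"
proof -
  note c = Y.sob_component[OF s]
  let ?g = "\<lambda>x. G x $ i $ j"
  have [measurable]: "(\<lambda>s::real. s *\<^sub>R axis j (1::real) :: vec3) \<in> borel_measurable unif01"
    by (rule measurable_unif01) simp
  have [measurable]: "?g \<in> bmeas" using sqi_measurable[OF c(4)] by simp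
  interpret u01: prob_space unif01 by (rule prob_space_unif01)
  interpret Q: pair_sigma_finite Y.M unif01 ..
  have "AE x in lborel. u (x + 1 *\<^sub>R axis j 1) $ i - u x $ i = 1 * av unif01 (seg j 1) ?g x"
    using c(1) unfolding acl_def by blast
  then have "AE x in Y.M. av unif01 (seg j 1) ?g x = 0"
  proof (rule Y.AE_M[OF AE_mp], intro AE_I2 impI)
    fix x assume "u (x + 1 *\<^sub>R axis j 1) $ i - u x $ i = 1 * av unif01 (seg j 1) ?g x"
    moreover have "u (x + axis j 1) = u x" using s lattice_axis by (auto simp: Y.sob_def Y.per_def)
    ultimately show "av unif01 (seg j 1) ?g x = 0" by simp
  qed
  moreover have "av unif01 (seg j 1) ?g \<in> borel_measurable Y.M"
    by (rule sqi_measurable[OF Y.av_l2(1)[OF prob_space_unif01 seg_measurable c(4) c(5)]])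
  ultimately have "(\<integral>x. av unif01 (seg j 1) ?g x \<partial>Y.M) = (\<integral>x. 0 \<partial>Y.M)"
    by (intro integral_cong_AE) auto
  then have "0 = (\<integral>x. av unif01 (seg j 1) ?g x \<partial>Y.M)" by simp
  also have "\<dots> = (\<integral>s. \<integral>x. ?g (x + seg j 1 s) \<partial>Y.M \<partial>unif01)"
  proof -
    have "integrable (Y.M \<Otimes>\<^sub>M unif01) (\<lambda>(x, s). ?g (x + seg j 1 s))"
    proof (rule integrableI_bounded)
      have "(\<integral>\<^sup>+z. ennreal (norm (case z of (x, s) \<Rightarrow> ?g (x + seg j 1 s))) \<partial>(Y.M \<Otimes>\<^sub>M unif01))
        = (\<integral>\<^sup>+s. \<integral>\<^sup>+x. ennreal \<bar>?g (x + seg j 1 s)\<bar> \<partial>Y.M \<partial>unif01)"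
        by (subst Q.nn_integral_snd[symmetric]) simp_all
      also have "\<dots> = (\<integral>\<^sup>+s. \<integral>\<^sup>+x. ennreal \<bar>?g x\<bar> \<partial>Y.M \<partial>unif01)"
        by (intro nn_integral_cong Y.nn_integral_M_shift[of "\<lambda>x. ennreal \<bar>?g x\<bar>"] Y.per_comp[OF c(5)]) measurable
      also have "\<dots> < \<infinity>"
        using Y_sqi_integrable[OF c(4)] u01.emeasure_space_1 by (simp add: integrable_iff_bounded)
      finally show "(\<integral>\<^sup>+z. ennreal (norm (case z of (x, s) \<Rightarrow> ?g (x + seg j 1 s))) \<partial>(Y.M \<Otimes>\<^sub>M unif01)) < \<infinity>" .
    qed measurable
    from Q.Fubini_integral[OF this] show ?thesis by (simp add: av_def)
  qed
  also have "\<dots> = (\<integral>s. (\<integral>x. ?g x \<partial>Y.M) \<partial>unif01)"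
    using Y.integrable_M_shift(2)[OF Y_sqi_integrable[OF c(4)] c(5)] by simp
  also have "\<dots> = (\<integral>x. ?g x \<partial>Y.M)" using u01.prob_space by simp
  finally show ?thesis by simp
qed

section \<open>Correctors and the homogenized tensor\<close>

definition unitm :: "3 \<Rightarrow> 3 \<Rightarrow> mat3" where "unitm i j = axis i (axis j 1)"

lemma unitm_nth: "unitm i j $ k $ l = (if k = i \<and> l = j then 1 else 0)"
  by (simp add: unitm_def axis_def)

lemma mat_expand: "X = (\<Sum>i\<in>UNIV. \<Sum>j\<in>UNIV. X $ i $ j *\<^sub>R unitm i j)"
proof -
  have "(\<Sum>i\<in>UNIV. \<Sum>j\<in>UNIV. X $ i $ j * unitm i j $ k $ l) = X $ k $ l" for k l
  proof -
    have "(\<Sum>i\<in>UNIV. \<Sum>j\<in>UNIV. X $ i $ j * unitm i j $ k $ l) = (\<Sum>i\<in>UNIV. \<Sum>j\<in>UNIV. if i = k then (if j = l then X $ i $ j else 0) else 0)"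
      by (intro sum.cong) (auto simp: unitm_nth)
    also have "\<dots> = (\<Sum>i\<in>UNIV. if i = k then (\<Sum>j\<in>UNIV. if j = l then X $ i $ j else 0) else 0)"
      by (intro sum.cong) auto
    finally show ?thesis by simp
  qed
  then show ?thesis by (simp add: vec_eq_iff)
qed

lemma tform_linear_maps: "linear (\<lambda>\<xi>. tform T \<xi> \<zeta>)" "linear (\<lambda>\<zeta>. tform T \<xi> \<zeta>)"
  using tform_linear(1)[of T 1 _ 1 _ \<zeta>] tform_linear(1)[of T _ _ 0 _ \<zeta>]
    tform_linear(2)[of T \<xi> 1 _ 1] tform_linear(2)[of T \<xi> _ _ 0]
  by (auto intro!: linearI) 

lemma tform_symm [simp]: "tform T (symm \<xi>) \<zeta> = tform T \<xi> \<zeta>" "tform T \<xi> (symm \<zeta>) = tform T \<xi> \<zeta>"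
  by (simp_all add: tform_def)

lemma tform_expand_right: "tform T \<xi> \<zeta> = (\<Sum>i\<in>UNIV. \<Sum>j\<in>UNIV. \<zeta> $ i $ j * tform T \<xi> (unitm i j))"
  by (subst mat_expand[of \<zeta>]) (simp add: linear_sum[OF tform_linear_maps(2)] linear_cmul[OF tform_linear_maps(2)])

context
  fixes A \<nu> assumes ell: "elliptic \<nu> A" and perA: "Y.per A"
begin

lemma per_tform:
  assumes "Y.per G" "Y.per H" shows "Y.per (\<lambda>y. tform (A y) (G y) (H y))"
  using assms perA by (simp add: Y.per_def)

lemma torus_sob_const: "Y.sob (\<lambda>x. c) (\<lambda>x. 0)"
  unfolding Y.sob_def weak_grad_acl acl_def
  by (auto simp: Y.per_def av_def Y_sqi_const loc_int_zero intro!: Y.loc_int_sqi)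

text \<open>Poincare contributes 1 + 9^2 = 82 and Korn a further factor 2.\<close>

lemma torus_coercive:
  assumes s: "Y.sob u G" and m: "(\<integral>x. u x \<partial>Y.M) = 0"
  shows "\<nu> / 164 * ((l2n Y.M u)\<^sup>2 + (l2n Y.M G)\<^sup>2) \<le> Y.bil A G G"
proof -
  have "(l2n Y.M u)\<^sup>2 \<le> (9 * l2n Y.M G)\<^sup>2" by (intro power_mono poincare_torus[OF s m]) simp
  then have "(l2n Y.M u)\<^sup>2 + (l2n Y.M G)\<^sup>2 \<le> 82 * (l2n Y.M G)\<^sup>2" by (simp add: power_mult_distrib)
  then have "\<nu> / 164 * ((l2n Y.M u)\<^sup>2 + (l2n Y.M G)\<^sup>2) \<le> \<nu> / 164 * (82 * (l2n Y.M G)\<^sup>2)"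
    using elliptic_pos[OF ell] by (intro mult_left_mono) auto
  also have "\<dots> = \<nu> / 2 * (l2n Y.M G)\<^sup>2" by simp
  also have "\<dots> \<le> Y.bil A G G" by (rule Y.korn_bil[OF ell s])
  finally show ?thesis .
qed

lemma corrector_exists:
  "\<exists>u G. Y.sob u G \<and> (\<integral>x. u x \<partial>Y.M) = 0 \<and> (\<forall>v H. Y.sob v H \<longrightarrow> Y.bil A (\<lambda>y. \<xi> + G y) H = 0)"
proof -
  let ?V = "{(u, G). Y.sob u G \<and> (\<integral>x. u x \<partial>Y.M) = 0}"
  let ?l = "\<lambda>p. - Y.bil A (\<lambda>y. \<xi>) (snd p)"
  have bl: "Y.bil A (\<lambda>y. \<xi>) (\<lambda>x. c *\<^sub>R G x + d *\<^sub>R H x) = c * Y.bil A (\<lambda>y. \<xi>) G + d * Y.bil A (\<lambda>y. \<xi>) H"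
    if "sqi Y.M G" "sqi Y.M H" for c d G H
    using Y.bil_linear[OF ell that Y_sqi_const, of c d \<xi>] by (simp add: Y.bil_sym[OF ell, of "\<lambda>y. \<xi>"])
  have "\<exists>u G. (u, G) \<in> ?V \<and> (\<forall>v H. (v, H) \<in> ?V \<longrightarrow> Y.bil A G H + 0 * (\<integral>x. u x \<bullet> v x \<partial>Y.M) = ?l (v, H))"
  proof (rule Y.exists_weak_solution[OF ell, where c="\<nu> / 164" and K="norm (symm \<xi>) / \<nu>"])
    show "0 < \<nu> / 164" using elliptic_pos[OF ell] by simp
    show "((\<lambda>x. 0), (\<lambda>x. 0)) \<in> ?V" using torus_sob_const[of 0] by simp
    show "\<nu> / 164 * ((l2n Y.M u)\<^sup>2 + (l2n Y.M G)\<^sup>2) \<le> Y.bil A G G + 0 * (l2n Y.M u)\<^sup>2" if "(u, G) \<in> ?V" for u G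
      using torus_coercive that by simp
    show "((\<lambda>x. c *\<^sub>R u x + d *\<^sub>R v x), (\<lambda>x. c *\<^sub>R G x + d *\<^sub>R H x)) \<in> ?V" if "(u, G) \<in> ?V" "(v, H) \<in> ?V" for u G v H c d
    proof -
      have "integrable Y.M u" "integrable Y.M v" using that by (auto simp: Y.sob_def intro: Y_sqi_integrable)
      then show ?thesis using that by (auto intro: Y.sob_lincomb)
    qed
    show "(v, H) \<in> ?V" if X: "\<And>n. (u n, G n) \<in> ?V" and s: "Y.sob v H" and lim: "(\<lambda>n. l2n Y.M (\<lambda>x. u n x - v x)) \<longlonglongrightarrow> 0" for u G v H
    proof -
      have su: "sqi Y.M (u n)" for n using X[of n] by (auto simp: Y.sob_def)
      have sv: "sqi Y.M v" using s by (simp add: Y.sob_def)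
      have "(\<integral>x. v x \<partial>Y.M) \<bullet> b = 0" for b
      proof -
        have "(\<lambda>n. \<integral>x. u n x \<bullet> b \<partial>Y.M) \<longlonglongrightarrow> (\<integral>x. v x \<bullet> b \<partial>Y.M)"
          by (rule l2_inner_tendsto[OF su sv lim]) (auto simp: Y_sqi_const l2n_def)
        moreover have "(\<integral>x. u n x \<bullet> b \<partial>Y.M) = 0" for n
          using Y_sqi_integrable[OF su] X[of n] by simp
        ultimately have "(\<integral>x. v x \<bullet> b \<partial>Y.M) = 0" by (simp add: LIMSEQ_const_iff)
        then show ?thesis using Y_sqi_integrable[OF sv] by simp
      qed
      then have "(\<integral>x. v x \<partial>Y.M) = 0" using inner_eq_zero_iff by blast
      then show ?thesis using s by simp
    qed
    show "?l ((\<lambda>x. c *\<^sub>R u x + d *\<^sub>R v x), (\<lambda>x. c *\<^sub>R G x + d *\<^sub>R H x)) = c * ?l (u, G) + d * ?l (v, H)"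
      if "(u, G) \<in> ?V" "(v, H) \<in> ?V" for u G v H c d
      using that bl[of G H c d] by (auto simp: Y.sob_def)
    show "\<bar>?l (u, G)\<bar> \<le> norm (symm \<xi>) / \<nu> * (l2n Y.M u + l2n Y.M G)" if "(u, G) \<in> ?V" for u G
    proof -
      have G: "sqi Y.M G" using that by (auto simp: Y.sob_def)
      have "l2n Y.M (\<lambda>x::vec3. symm \<xi>) = norm (symm \<xi>)" using YP.prob_space by (simp add: l2n_def)
      then have "\<bar>?l (u, G)\<bar> \<le> norm (symm \<xi>) * l2n Y.M (\<lambda>x. symm (G x)) / \<nu>"
        using Y.tform_bound_integral(2)[OF ell Y_sqi_const[of \<xi>] G] by simp
      also have "\<dots> \<le> norm (symm \<xi>) * (l2n Y.M u + l2n Y.M G) / \<nu>"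
        using elliptic_pos[OF ell]
        by (intro divide_right_mono mult_left_mono order_trans[OF Y.l2n_symm_le[OF ell G]]) auto
      finally show ?thesis by simp
    qed
  qed (auto)
  then obtain u G where s: "Y.sob u G" "(\<integral>x. u x \<partial>Y.M) = 0"
    and eq: "\<And>v H. Y.sob v H \<Longrightarrow> (\<integral>x. v x \<partial>Y.M) = 0 \<Longrightarrow> Y.bil A G H = - Y.bil A (\<lambda>y. \<xi>) H" by auto
  \<comment> \<open>The solver tests with mean-zero functions only; subtracting the mean of v leaves
    its gradient unchanged.\<close>
  have "Y.bil A (\<lambda>y. \<xi> + G y) H = 0" if v: "Y.sob v H" for v H
  proof -
    let ?c = "\<integral>x. v x \<partial>Y.M"
    have sv: "sqi Y.M v" "sqi Y.M H" and sG: "sqi Y.M G" using v s by (auto simp: Y.sob_def)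
    have "Y.sob (\<lambda>x. v x - ?c) (\<lambda>x. H x - 0)" by (rule Y.sob_diff[OF v torus_sob_const])
    then have "Y.bil A G H = - Y.bil A (\<lambda>y. \<xi>) H"
      using Y_sqi_integrable[OF sv(1)] YP.prob_space by (intro eq[of "\<lambda>x. v x - ?c"]) simp_all
    then show ?thesis using Y.bil_linear[OF ell Y_sqi_const[of \<xi>] sG sv(2), of 1 1] by simp
  qed
  with s show ?thesis by blast
qed

text \<open>Symmetrising \<xi> extends the correctors to all matrices, in particular to the unit
  matrices that serve as a basis.\<close>

definition cfun :: "mat3 \<Rightarrow> vec3 \<Rightarrow> vec3" where "cfun \<xi> = fst (corrector A (symm \<xi>))"
definition cgrad :: "mat3 \<Rightarrow> vec3 \<Rightarrow> mat3" where "cgrad \<xi> = snd (corrector A (symm \<xi>))"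

lemma tform_corrector: "frob (tapply (A y) (symm \<xi> + symm X)) (symm Z) = tform (A y) (\<xi> + X) Z"
  by (simp add: tform_def symm_add)

lemma bil_cell:
  assumes "sqi Y.M G" "sqi Y.M H"
  shows "Y.bil A G H = (LINT y:cellY|lborel. tform (A y) (G y) (H y))"
  unfolding Y.bil_def
  using tform_measurable[OF ell, of G H] sqi_measurable[OF assms(1)] sqi_measurable[OF assms(2)]
  by (intro Y.integral_M) simp

lemma corrector_solution:
  shows "Y.sob (cfun \<xi>) (cgrad \<xi>)" "\<And>v H. Y.sob v H \<Longrightarrow> Y.bil A (\<lambda>y. \<xi> + cgrad \<xi> y) H = 0"
proof -
  let ?P = "\<lambda>(u, G). H1per u G \<and> set_lebesgue_integral lborel cellY u = 0 \<and>
      (\<forall>v H. H1per v H \<longrightarrow>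
         (LINT y:cellY|lborel. frob (tapply (A y) (symm \<xi> + symm (G y))) (symm (H y))) = 0)"
  have sq: "sqi Y.M (\<lambda>y. \<xi> + G y)" if "Y.sob u G" for u G
    using that by (intro sqi_add Y_sqi_const) (simp add: Y.sob_def)
  obtain u G where G: "Y.sob u G" "(\<integral>x. u x \<partial>Y.M) = 0" "\<And>v H. Y.sob v H \<Longrightarrow> Y.bil A (\<lambda>y. \<xi> + G y) H = 0"
    using corrector_exists by blast
  have "set_lebesgue_integral lborel cellY u = 0"
    using G(1,2) sqi_measurable[of Y.M u] by (subst Y.integral_M[symmetric]) (auto simp: Y.sob_def)
  then have "?P (u, G)"
    using G(1,3) sq[OF G(1)] by (auto simp: Y_sob_iff[symmetric] tform_corrector bil_cell[symmetric] Y.sob_def)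
  then have P: "?P (corrector A (symm \<xi>))"
    unfolding corrector_def by (rule someI)
  show s: "Y.sob (cfun \<xi>) (cgrad \<xi>)"
    using P by (auto simp: Y_sob_iff cfun_def cgrad_def split_beta)
  show "Y.bil A (\<lambda>y. \<xi> + cgrad \<xi> y) H = 0" if v: "Y.sob v H" for v H
  proof -
    have "(LINT y:cellY|lborel. frob (tapply (A y) (symm \<xi> + symm (cgrad \<xi> y))) (symm (H y))) = 0"
      using P v by (auto simp: Y_sob_iff cgrad_def split_beta)
    then show ?thesis
      using sq[OF s] v by (subst bil_cell) (auto simp: tform_corrector Y.sob_def)
  qed
qed

lemma cgrad_sqi: "sqi Y.M (cgrad \<xi>)" "sqi Y.M (\<lambda>y. \<xi> + cgrad \<xi> y)" "sqi Y.M (cfun \<xi>)"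
  using corrector_solution(1)[of \<xi>] sqi_add[OF Y_sqi_const, of "cgrad \<xi>" \<xi>] by (auto simp: Y.sob_def)

section \<open>The homogenized form and its ellipticity\<close>

definition hform :: "mat3 \<Rightarrow> mat3 \<Rightarrow> real" where "hform \<xi> \<zeta> = Ahom A (symm \<xi>) (symm \<zeta>)"

lemma hform_bil: "hform \<xi> \<zeta> = Y.bil A (\<lambda>y. \<xi> + cgrad \<xi> y) (\<lambda>y. \<zeta>)"
proof -
  have "hform \<xi> \<zeta> = (LINT y:cellY|lborel. tform (A y) (\<xi> + cgrad \<xi> y) \<zeta>)"
    unfolding hform_def Ahom_def cgrad_def[symmetric] tform_corrector ..
  then show ?thesis by (simp add: bil_cell[OF cgrad_sqi(2) Y_sqi_const])
qed

text \<open>The cell equation for \<xi>, tested with the corrector of \<zeta>, allows \<zeta> to be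
  completed by its corrector gradient. Symmetry and the lower bound are read off from this
  form.\<close>

lemma hform_energy: "hform \<xi> \<zeta> = Y.bil A (\<lambda>y. \<xi> + cgrad \<xi> y) (\<lambda>y. \<zeta> + cgrad \<zeta> y)"
proof -
  have "Y.bil A (\<lambda>y. \<zeta> + cgrad \<zeta> y) (\<lambda>y. \<xi> + cgrad \<xi> y)
    = 1 * Y.bil A (\<lambda>y. \<zeta>) (\<lambda>y. \<xi> + cgrad \<xi> y) + 1 * Y.bil A (cgrad \<zeta>) (\<lambda>y. \<xi> + cgrad \<xi> y)"
    using Y.bil_linear[OF ell Y_sqi_const cgrad_sqi(1) cgrad_sqi(2), of 1 \<zeta> 1 \<zeta> \<xi>] by simp
  then show ?thesis
    using corrector_solution(2)[OF corrector_solution(1), of \<xi> \<zeta>] hform_bil[of \<xi> \<zeta>]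
    by (simp add: Y.bil_sym[OF ell, of "\<lambda>y. \<xi> + cgrad \<xi> y"])
qed

lemma hform_sym: "hform \<xi> \<zeta> = hform \<zeta> \<xi>"
  unfolding hform_energy by (rule Y.bil_sym[OF ell])

lemma hform_linear_right: "linear (\<lambda>\<zeta>. hform \<xi> \<zeta>)"
proof -
  have "hform \<xi> (a *\<^sub>R \<zeta> + b *\<^sub>R \<eta>) = a * hform \<xi> \<zeta> + b * hform \<xi> \<eta>" for a b \<zeta> \<eta>
    using Y.bil_linear[OF ell Y_sqi_const Y_sqi_const cgrad_sqi(2), of a \<zeta> b \<eta> \<xi>]
    unfolding hform_bil by (simp only: Y.bil_sym[OF ell, of "\<lambda>y. \<xi> + cgrad \<xi> y"])
  from this[of 1 _ 1] this[of _ _ 0] show ?thesis by (auto intro!: linearI)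
qed

text \<open>Linearity in \<xi> is obtained from symmetry. The correctors are chosen separately for
  each \<xi>, so the choice itself does not exhibit a linear dependence.\<close>

lemma hform_linear_left: "linear (\<lambda>\<xi>. hform \<xi> \<zeta>)"
  using hform_linear_right[of \<zeta>] by (simp add: hform_sym[of _ \<zeta>])

lemma hform_symm [simp]: "hform (symm \<xi>) \<zeta> = hform \<xi> \<zeta>" "hform \<xi> (symm \<zeta>) = hform \<xi> \<zeta>"
  by (simp_all add: hform_def)

lemma mean_symm_cgrad: "(\<integral>y. symm X \<bullet> symm (cgrad \<xi> y) \<partial>Y.M) = 0"
proof -
  note c = corrector_solution(1)[of \<xi>]
  have i: "integrable Y.M (\<lambda>y. cgrad \<xi> y $ i $ j)" for i j
    by (rule Y_sqi_integrable[OF Y.sob_component(4)[OF c]])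
  show ?thesis
    unfolding inner_vec_def symm_nth using i torus_gradient_mean_zero[OF c] by simp
qed

text \<open>The corrector gradient has mean zero, hence is orthogonal to constants, and adding it
  can only increase the L2 norm.\<close>

lemma hform_lower: "\<nu> * (norm (symm \<xi>))\<^sup>2 \<le> hform \<xi> \<xi>"
proof -
  have s: "sqi Y.M (\<lambda>y. symm (cgrad \<xi> y))" by (rule Y.sqi_symm[OF cgrad_sqi(1)])
  have "(norm (symm \<xi>))\<^sup>2 = (l2n Y.M (\<lambda>x::vec3. symm \<xi>))\<^sup>2"
    using YP.prob_space by (simp add: l2n_def)
  also have "\<dots> \<le> (l2n Y.M (\<lambda>y. symm (\<xi> + cgrad \<xi> y)))\<^sup>2"
    using l2_quadratic[OF Y_sqi_const[of "symm \<xi>"] s, of 1] mean_symm_cgrad[of \<xi> \<xi>] by (simp add: symm_add)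
  finally have "\<nu> * (norm (symm \<xi>))\<^sup>2 \<le> \<nu> * (l2n Y.M (\<lambda>y. symm (\<xi> + cgrad \<xi> y)))\<^sup>2"
    using elliptic_pos[OF ell] by (intro mult_left_mono) auto
  also have "\<dots> \<le> hform \<xi> \<xi>" unfolding hform_energy by (rule Y.bil_lower[OF ell cgrad_sqi(2)])
  finally show ?thesis .
qed

text \<open>The corrector lowers the energy: by the cell equation the cross term is minus the energy
  of the corrector gradient. The uncorrected energy is bounded by the ellipticity of
  \<open>A\<close>.\<close>

lemma hform_upper: "hform \<xi> \<xi> \<le> (norm (symm \<xi>))\<^sup>2 / \<nu>"
proof -
  note l = Y.bil_linear[OF ell Y_sqi_const cgrad_sqi(1), of _ 1 \<xi> 1 \<xi>, simplified]
  have "0 \<le> Y.bil A (cgrad \<xi>) (cgrad \<xi>)"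
    using Y.bil_lower[OF ell cgrad_sqi(1)] elliptic_pos[OF ell] by (meson mult_nonneg_nonneg less_imp_le order_trans zero_le_power2)
  also have "\<dots> = - Y.bil A (\<lambda>y. \<xi>) (cgrad \<xi>)"
    using l[OF cgrad_sqi(1)] corrector_solution(2)[OF corrector_solution(1), of \<xi> \<xi>] by simp
  finally have "Y.bil A (cgrad \<xi>) (\<lambda>y. \<xi>) \<le> 0" by (simp add: Y.bil_sym[OF ell])
  then have "hform \<xi> \<xi> \<le> Y.bil A (\<lambda>y. \<xi>) (\<lambda>y. \<xi>)"
    unfolding hform_bil using l[OF Y_sqi_const] by simp
  also have "\<dots> \<le> (norm (symm \<xi>))\<^sup>2 / \<nu>"
    using Y.tform_bound_integral(2)[OF ell Y_sqi_const Y_sqi_const, of \<xi> \<xi>] YP.prob_space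
    by (simp add: l2n_def power2_eq_square)
  finally show ?thesis .
qed

text \<open>Writing the homogenized form as a constant tensor makes the homogenized problem another
  instance of the solver, Korn's inequality and the rescaling.\<close>

definition hom_tensor :: "tensor4" where "hom_tensor = (\<lambda>i k j l. hform (unitm k l) (unitm i j))"

lemma tform_hom_tensor: "tform hom_tensor \<xi> \<zeta> = hform \<xi> \<zeta>"
proof -
  have e: "hform (symm \<xi>) Z = (\<Sum>k\<in>UNIV. \<Sum>l\<in>UNIV. symm \<xi> $ k $ l * hform (unitm k l) Z)" for Z
    by (subst mat_expand[of "symm \<xi>"]) (simp add: linear_sum[OF hform_linear_left] linear_cmul[OF hform_linear_left] del: hform_symm)
  have "hform \<xi> \<zeta> = hform (symm \<xi>) (symm \<zeta>)" by simp
  also have "\<dots> = (\<Sum>i\<in>UNIV. \<Sum>j\<in>UNIV. symm \<zeta> $ i $ j * hform (symm \<xi>) (unitm i j))"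
    by (subst mat_expand[of "symm \<zeta>"]) (simp add: linear_sum[OF hform_linear_right] linear_cmul[OF hform_linear_right] del: hform_symm)
  also have "\<dots> = (\<Sum>i\<in>UNIV. \<Sum>j\<in>UNIV. symm \<zeta> $ i $ j * (\<Sum>k\<in>UNIV. \<Sum>l\<in>UNIV. symm \<xi> $ k $ l * hform (unitm k l) (unitm i j)))"
    by (simp only: e)
  finally show ?thesis by (simp add: tform_sum hom_tensor_def mult.commute)
qed

lemma elliptic_hom: "elliptic \<nu> (\<lambda>_. hom_tensor)"
  unfolding elliptic_def tform_hom_tensor
  using elliptic_pos[OF ell] hform_sym hform_lower hform_upper by auto

end

section \<open>Smoothing\<close>

text \<open>Reduction to \<open>l2_average\<close>: after division by its mass I, the absolute value
  of k is a probability density, and the sign and the mass are moved into the integrand. For I = 0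
  the kernel vanishes almost everywhere.\<close>

lemma l2_minkowski:
  fixes d :: "vec3 \<times> vec3 \<Rightarrow> 'b::euclidean_space" and k :: "vec3 \<Rightarrow> real"
  assumes k: "integrable lborel k" and d[measurable]: "d \<in> borel_measurable (lborel \<Otimes>\<^sub>M lborel)"
    and bd: "\<And>s. k s \<noteq> 0 \<Longrightarrow> (\<integral>\<^sup>+x. ennreal ((norm (d (x, s)))\<^sup>2) \<partial>lborel) \<le> ennreal (c\<^sup>2)" and c: "0 \<le> c"
  shows "sq2 (\<lambda>x. LBINT s. k s *\<^sub>R d (x, s))"
    "nl2 (\<lambda>x. LBINT s. k s *\<^sub>R d (x, s)) \<le> (LBINT s. \<bar>k s\<bar>) * c"
proof -
  have [measurable]: "k \<in> bmeas" using k by auto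
  define I where "I = (LBINT s. \<bar>k s\<bar>)"
  have I0: "0 \<le> I" by (simp add: I_def)
  have "sq2 (\<lambda>x. LBINT s. k s *\<^sub>R d (x, s)) \<and> nl2 (\<lambda>x. LBINT s. k s *\<^sub>R d (x, s)) \<le> I * c"
  proof (cases "I = 0")
    case True
    then have "AE s in lborel. k s = 0"
      using k by (simp add: I_def integral_nonneg_eq_0_iff_AE)
    then have "(LBINT s. k s *\<^sub>R d (x, s)) = (\<integral>s. 0 \<partial>(lborel :: vec3 measure))" for x
      by (intro integral_cong_AE) auto
    then show ?thesis using True by (simp add: l2n_def)
  next
    case False
    then have I: "0 < I" using I0 by simp
    define \<mu> where "\<mu> = density lborel (\<lambda>s. ennreal (\<bar>k s\<bar> / I))"
    have [measurable_cong, simp]: "sets \<mu> = sets borel" by (simp add: \<mu>_def)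
    have "(\<integral>\<^sup>+s. ennreal (\<bar>k s\<bar> / I) \<partial>lborel) = ennreal (LBINT s. \<bar>k s\<bar> / I)"
      using k I by (intro nn_integral_eq_integral) auto
    also have "\<dots> = 1" using I by (simp add: I_def[symmetric])
    finally have "emeasure \<mu> (space \<mu>) = 1"
      by (simp add: \<mu>_def emeasure_density)
    then have p: "prob_space \<mu>" by (rule prob_spaceI)
    let ?d = "\<lambda>(x, s). (I * sgn (k s)) *\<^sub>R d (x, s)"
    have [measurable]: "d \<in> borel_measurable (lborel \<Otimes>\<^sub>M \<mu>)"
    proof -
      have "sets (lborel \<Otimes>\<^sub>M \<mu>) = sets (lborel \<Otimes>\<^sub>M (lborel :: vec3 measure))" by (rule sets_pair_measure_cong) auto
      then show ?thesis using d by (simp cong: measurable_cong_sets)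
    qed
    have "AE s in \<mu>. (\<integral>\<^sup>+x. ennreal ((norm (?d (x, s)))\<^sup>2) \<partial>lborel) \<le> ennreal ((I * c)\<^sup>2)"
      unfolding \<mu>_def
    proof (subst AE_density, measurable, intro AE_I2 impI)
      fix s assume "0 < ennreal (\<bar>k s\<bar> / I)"
      then have ks: "k s \<noteq> 0" by auto
      then have "(\<integral>\<^sup>+x. ennreal ((norm (?d (x, s)))\<^sup>2) \<partial>lborel) = (\<integral>\<^sup>+x. ennreal (I\<^sup>2) * ennreal ((norm (d (x, s)))\<^sup>2) \<partial>lborel)"
        using I by (simp add: power_mult_distrib ennreal_mult abs_mult sgn_if)
      also have "\<dots> = ennreal (I\<^sup>2) * (\<integral>\<^sup>+x. ennreal ((norm (d (x, s)))\<^sup>2) \<partial>lborel)"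
        by (rule nn_integral_cmult) measurable
      also have "\<dots> \<le> ennreal (I\<^sup>2) * ennreal (c\<^sup>2)"
        by (rule mult_left_mono[OF bd[OF ks]]) simp
      finally show "(\<integral>\<^sup>+x. ennreal ((norm (?d (x, s)))\<^sup>2) \<partial>lborel) \<le> ennreal ((I * c)\<^sup>2)"
        by (simp add: ennreal_mult[symmetric] power_mult_distrib)
    qed
    from l2_average[OF sigma_finite_lborel p _ this] I c
    have r: "sq2 (\<lambda>x. \<integral>s. ?d (x, s) \<partial>\<mu>)" "nl2 (\<lambda>x. \<integral>s. ?d (x, s) \<partial>\<mu>) \<le> I * c" by auto
    have "(\<integral>s. ?d (x, s) \<partial>\<mu>) = (LBINT s. k s *\<^sub>R d (x, s))" for x
    proof -
      have "(\<integral>s. ?d (x, s) \<partial>\<mu>) = (LBINT s. (\<bar>k s\<bar> / I) *\<^sub>R ?d (x, s))"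
        unfolding \<mu>_def using I by (intro integral_density) auto
      also have "\<dots> = (LBINT s. k s *\<^sub>R d (x, s))"
        using I by (intro bi_integral_cong) (auto simp: sgn_if)
      finally show ?thesis .
    qed
    then show ?thesis using r by simp
  qed
  then show "sq2 (\<lambda>x. LBINT s. k s *\<^sub>R d (x, s))"
    "nl2 (\<lambda>x. LBINT s. k s *\<^sub>R d (x, s)) \<le> (LBINT s. \<bar>k s\<bar>) * c" by (auto simp: I_def)
qed

text \<open>Differentiation under the integral sign, along sequences: the mean value inequality
  dominates the difference quotients by \<open>w\<close>. Dropping an initial segment keeps all
  steps inside the unit interval.\<close>

lemma DERIV_integral:
  fixes f f' :: "real \<Rightarrow> 'a \<Rightarrow> real"
  assumes D: "\<And>s r. \<bar>r\<bar> < 1 \<Longrightarrow> ((\<lambda>r. f r s) has_real_derivative f' r s) (at r)"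
    and w: "\<And>s r. \<bar>r\<bar> < 1 \<Longrightarrow> \<bar>f' r s\<bar> \<le> w s" "integrable \<mu> w"
    and i: "\<And>r. \<bar>r\<bar> < 1 \<Longrightarrow> integrable \<mu> (f r)" and m: "f' 0 \<in> borel_measurable \<mu>"
  shows "((\<lambda>r. \<integral>s. f r s \<partial>\<mu>) has_real_derivative (\<integral>s. f' 0 s \<partial>\<mu>)) (at 0)"
  unfolding DERIV_def
proof (subst LIMSEQ_SEQ_conv[symmetric], intro allI impI)
  fix X :: "nat \<Rightarrow> real" assume X: "(\<forall>n. X n \<noteq> 0) \<and> X \<longlonglongrightarrow> 0"
  then have "\<forall>\<^sub>F n in sequentially. \<bar>X n\<bar> < 1"
    by (intro order_tendstoD(2)[where y=0] tendsto_rabs_zero) auto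
  then obtain N where N: "\<And>n. n \<ge> N \<Longrightarrow> \<bar>X n\<bar> < 1" by (auto simp: eventually_sequentially)
  define Z where "Z n = X (n + N)" for n
  have Z: "\<And>n. Z n \<noteq> 0" "\<And>n. \<bar>Z n\<bar> < 1" "Z \<longlonglongrightarrow> 0"
    using X N LIMSEQ_ignore_initial_segment[of X 0 N] by (auto simp: Z_def[abs_def])
  have lim: "(\<lambda>n. \<integral>s. (f (Z n) s - f 0 s) / Z n \<partial>\<mu>) \<longlonglongrightarrow> (\<integral>s. f' 0 s \<partial>\<mu>)"
  proof (rule integral_dominated_convergence[OF m _ w(2)])
    show "(\<lambda>s. (f (Z n) s - f 0 s) / Z n) \<in> borel_measurable \<mu>" for n
      using i[OF Z(2)[of n]] i[of 0] by auto
    show "AE s in \<mu>. (\<lambda>n. (f (Z n) s - f 0 s) / Z n) \<longlonglongrightarrow> f' 0 s"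
    proof (intro AE_I2)
      fix s
      have "((\<lambda>h. (f (0 + h) s - f 0 s) / h) \<longlongrightarrow> f' 0 s) (at 0)"
        using D[of 0 s] by (simp add: DERIV_def)
      moreover have "filterlim Z (at 0) sequentially"
        using Z by (intro filterlim_atI) auto
      ultimately have "(\<lambda>n. (f (0 + Z n) s - f 0 s) / Z n) \<longlonglongrightarrow> f' 0 s" by (rule filterlim_compose)
      then show "(\<lambda>n. (f (Z n) s - f 0 s) / Z n) \<longlonglongrightarrow> f' 0 s" by simp
    qed
    show "AE s in \<mu>. norm ((f (Z n) s - f 0 s) / Z n) \<le> w s" for n
    proof (intro AE_I2)
      fix s
      have "norm (f (Z n) s - f 0 s) \<le> w s * norm (Z n - 0)"
      proof (rule field_differentiable_bound[where S="{-1<..<1}" and f'="\<lambda>r. f' r s"])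
        show "((\<lambda>r. f r s) has_real_derivative f' r s) (at r within {-1<..<1})" if "r \<in> {-1<..<1}" for r
          using that by (intro has_field_derivative_at_within[OF D]) (simp add: abs_less_iff)
        show "norm (f' r s) \<le> w s" if "r \<in> {-1<..<1}" for r
          using w(1)[of r s] that by (simp add: abs_less_iff)
      qed (use Z(2)[of n] in \<open>auto simp: abs_less_iff\<close>)
      then show "norm ((f (Z n) s - f 0 s) / Z n) \<le> w s" using Z(1)[of n] by (simp add: field_simps)
    qed
  qed
  have eq: "(\<integral>s. (f (Z n) s - f 0 s) / Z n \<partial>\<mu>) = ((\<integral>s. f (Z n) s \<partial>\<mu>) - (\<integral>s. f 0 s \<partial>\<mu>)) / Z n" for n
    using i[OF Z(2)[of n]] i[of 0] by simp
  have "(\<lambda>n. ((\<integral>s. f (Z n) s \<partial>\<mu>) - (\<integral>s. f 0 s \<partial>\<mu>)) / Z n) \<longlonglongrightarrow> (\<integral>s. f' 0 s \<partial>\<mu>)"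
    using lim by (simp only: eq)
  then have "(\<lambda>n. ((\<integral>s. f (0 + X (n + N)) s \<partial>\<mu>) - (\<integral>s. f 0 s \<partial>\<mu>)) / X (n + N)) \<longlonglongrightarrow> (\<integral>s. f' 0 s \<partial>\<mu>)"
    by (simp add: Z_def)
  then show "(\<lambda>n. ((\<integral>s. f (0 + X n) s \<partial>\<mu>) - (\<integral>s. f 0 s \<partial>\<mu>)) / X n) \<longlonglongrightarrow> (\<integral>s. f' 0 s \<partial>\<mu>)"
    by (rule LIMSEQ_offset[where k=N])
qed

text \<open>A correlation, with \<eta> evaluated at y - x: it averages the translates \<phi> (x + s)
  with weight \<eta> s. Differentiating in x therefore brings a minus sign.\<close>

definition conv :: "(vec3 \<Rightarrow> real) \<Rightarrow> (vec3 \<Rightarrow> real) \<Rightarrow> vec3 \<Rightarrow> real" where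
  "conv \<eta> \<phi> x = (LBINT y. \<phi> y * \<eta> (y - x))"

lemma conv_shift:
  assumes [measurable]: "\<eta> \<in> bmeas" "\<phi> \<in> bmeas"
  shows "conv \<eta> \<phi> x = (LBINT s. \<eta> s *\<^sub>R \<phi> (x + s))"
  unfolding conv_def using integral_shift[of "\<lambda>y. \<phi> y * \<eta> (y - x)" x] by (simp add: add.commute mult.commute)

context
  fixes \<eta> \<phi> :: "vec3 \<Rightarrow> real"
  assumes \<eta>: "continuous_on UNIV \<eta>" "bsupp \<eta>" and \<phi>: "loc_int \<phi>"
begin

text \<open>A majorant valid for all base points within distance 1 of x; continuity,
  differentiability and integrability of \<open>conv\<close> rest on it.\<close>

lemma conv_dominated:
  obtains w where "integrable lborel w" "\<And>y z. norm z < 1 \<Longrightarrow> \<bar>\<phi> y * \<eta> (y - (x + z))\<bar> \<le> w y"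
proof -
  obtain B where B: "\<And>x. \<bar>\<eta> x\<bar> \<le> B" by (rule continuous_bsupp_bounded[OF \<eta>]) blast
  obtain R where R: "\<And>x. \<eta> x \<noteq> 0 \<Longrightarrow> norm x \<le> R" using \<eta>(2) by (auto simp: bsupp_def)
  have "integrable lborel (\<lambda>y. B * \<bar>\<phi> y * iball (R + norm x + 1) y\<bar>)"
    by (intro integrable_mult_right integrable_abs loc_int_cball \<phi>)
  moreover have "\<bar>\<phi> y * \<eta> (y - (x + z))\<bar> \<le> B * \<bar>\<phi> y * iball (R + norm x + 1) y\<bar>" if "norm z < 1" for y z
  proof (cases "\<eta> (y - (x + z)) = 0")
    case False
    then have "norm y \<le> R + norm x + 1"
      using R[of "y - (x + z)"] norm_triangle_ineq[of "y - (x + z)" "x + z"] norm_triangle_ineq[of x z] that by simp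
    then show ?thesis using mult_left_mono[OF B[of "y - (x + z)"], of "\<bar>\<phi> y\<bar>"] by (simp add: abs_mult mult.commute)
  qed (use order_trans[OF abs_ge_zero B] in simp)
  ultimately show ?thesis by (rule that)
qed

lemma conv_integrable: "integrable lborel (\<lambda>y. \<phi> y * \<eta> (y - x))"
proof -
  obtain w where w: "integrable lborel w" "\<And>y z. norm z < 1 \<Longrightarrow> \<bar>\<phi> y * \<eta> (y - (x + z))\<bar> \<le> w y"
    by (rule conv_dominated[of x]) blast
  have [measurable]: "\<eta> \<in> bmeas" "\<phi> \<in> bmeas"
    using \<eta>(1) \<phi> by (auto intro: borel_measurable_continuous_onI loc_int_measurable)
  show ?thesis
    by (rule bi_integrable_bound[OF w(1)])
      (use w(2)[of 0] in \<open>auto intro!: AE_I2 intro: order_trans[OF _ abs_ge_self]\<close>)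
qed

lemma conv_continuous: "continuous_on UNIV (conv \<eta> \<phi>)"
proof (intro continuous_at_imp_continuous_on ballI continuous_at_sequentiallyI)
  fix x and u :: "nat \<Rightarrow> vec3" assume u: "u \<longlonglongrightarrow> x"
  have [measurable]: "\<eta> \<in> bmeas" "\<phi> \<in> bmeas"
    using \<eta>(1) \<phi> by (auto intro: borel_measurable_continuous_onI loc_int_measurable)
  obtain w where w: "integrable lborel w" "\<And>y z. norm z < 1 \<Longrightarrow> \<bar>\<phi> y * \<eta> (y - (x + z))\<bar> \<le> w y"
    by (rule conv_dominated[of x]) blast
  have "\<forall>\<^sub>F n in sequentially. norm (u n - x) < 1"
    using u by (intro order_tendstoD(2)[where y=0] tendsto_norm_zero) (auto simp: LIM_zero_iff)
  then obtain N where N: "\<And>n. n \<ge> N \<Longrightarrow> norm (u n - x) < 1" by (auto simp: eventually_sequentially)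
  have "(\<lambda>n. conv \<eta> \<phi> (u (n + N))) \<longlonglongrightarrow> conv \<eta> \<phi> x"
    unfolding conv_def
  proof (rule integral_dominated_convergence[OF _ _ w(1)])
    show "AE y in lborel. (\<lambda>n. \<phi> y * \<eta> (y - u (n + N))) \<longlonglongrightarrow> \<phi> y * \<eta> (y - x)"
      using \<eta>(1) LIMSEQ_ignore_initial_segment[OF u, of N]
      by (intro AE_I2 tendsto_mult tendsto_const isCont_tendsto_compose[of _ \<eta>] tendsto_diff)
        (auto simp: continuous_on_eq_continuous_at)
    show "AE y in lborel. norm (\<phi> y * \<eta> (y - u (n + N))) \<le> w y" for n
      using w(2)[OF N[of "n + N"]] by simp
  qed measurable
  then show "(\<lambda>n. conv \<eta> \<phi> (u n)) \<longlonglongrightarrow> conv \<eta> \<phi> x" by (rule LIMSEQ_offset[where k=N])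
qed

end

lemma conv_cderiv:
  assumes c: "cderiv j \<eta> \<eta>'" and s: "bsupp \<eta>" "bsupp \<eta>'" and \<phi>: "loc_int \<phi>"
  shows "cderiv j (conv \<eta> \<phi>) (\<lambda>x. - conv \<eta>' \<phi> x)"
  unfolding cderiv_def
proof (intro conjI allI)
  have e: "continuous_on UNIV \<eta>" "continuous_on UNIV \<eta>'" using c by (auto simp: cderiv_def)
  show "continuous_on UNIV (conv \<eta> \<phi>)" "continuous_on UNIV (\<lambda>x. - conv \<eta>' \<phi> x)"
    using conv_continuous[OF e(1) s(1) \<phi>] conv_continuous[OF e(2) s(2) \<phi>] by (auto intro: continuous_on_minus)
  fix x
  obtain w where w: "integrable lborel w" "\<And>y z. norm z < 1 \<Longrightarrow> \<bar>\<phi> y * \<eta>' (y - (x + z))\<bar> \<le> w y"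
    by (rule conv_dominated[OF e(2) s(2) \<phi>, of x]) blast
  have [measurable]: "\<eta>' \<in> bmeas" "\<phi> \<in> bmeas"
    using e \<phi> by (auto intro: borel_measurable_continuous_onI loc_int_measurable)
  have "((\<lambda>r. LBINT y. \<phi> y * \<eta> (y - (x + r *\<^sub>R axis j 1))) has_real_derivative
     (LBINT y. - (\<phi> y * \<eta>' (y - (x + 0 *\<^sub>R axis j 1))))) (at 0)"
  proof (rule DERIV_integral[OF _ _ w(1)])
    show "((\<lambda>r. \<phi> y * \<eta> (y - (x + r *\<^sub>R axis j 1))) has_real_derivative - (\<phi> y * \<eta>' (y - (x + r *\<^sub>R axis j 1)))) (at r)" for y r
      using DERIV_cmult[OF cderiv_DERIV[OF c, of "y - x" "-1" r], of "\<phi> y"] by (simp add: algebra_simps)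
    show "\<bar>- (\<phi> y * \<eta>' (y - (x + r *\<^sub>R axis j 1)))\<bar> \<le> w y" if "\<bar>r\<bar> < 1" for y r
      using w(2)[of "r *\<^sub>R axis j 1" y] that by simp
    show "integrable lborel (\<lambda>y. \<phi> y * \<eta> (y - (x + r *\<^sub>R axis j 1)))" for r
      by (rule conv_integrable[OF e(1) s(1) \<phi>])
  qed measurable
  then show "((\<lambda>r. conv \<eta> \<phi> (x + r *\<^sub>R axis j 1)) has_real_derivative - conv \<eta>' \<phi> x) (at 0)"
    by (simp add: conv_def)
qed

text \<open>Integration by parts against the constant function 1.\<close>

lemma cderiv_integral_zero:
  assumes c: "cderiv j \<eta> \<eta>'" and s: "bsupp \<eta>" "bsupp \<eta>'"
  shows "(LBINT x. \<eta>' x) = 0"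
proof -
  have "loc_int (\<lambda>x. 1)" by (rule loc_intI, simp, rule integrable_bounded_cball[where B=1]) auto
  then have "acl j (\<lambda>x. 1) (\<lambda>x. 0)" by (simp add: acl_def loc_int_zero av_def)
  from acl_by_parts[OF this c s] show ?thesis by simp
qed

lemma continuous_bsupp_integrable:
  assumes "continuous_on UNIV (\<eta> :: vec3 \<Rightarrow> real)" "bsupp \<eta>" shows "integrable lborel \<eta>"
proof -
  have "loc_int (\<lambda>x. 1)" by (rule loc_intI, simp, rule integrable_bounded_cball[where B=1]) auto
  from conv_integrable[OF assms this, of 0] show ?thesis by simp
qed

lemma continuous_bsupp_sqi:
  assumes "continuous_on UNIV (\<eta> :: vec3 \<Rightarrow> real)" "bsupp \<eta>" shows "sq2 \<eta>"
proof -
  have "integrable lborel (\<lambda>x. (\<eta> x)\<^sup>2)"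
    by (rule continuous_bsupp_integrable) (use assms in \<open>auto simp: bsupp_def intro!: continuous_intros\<close>)
  then show ?thesis using assms(1) by (simp add: sqi_def borel_measurable_continuous_onI)
qed

text \<open>A bump on the open unit box, normalised to mass 1. Its support lies in the closed ball
  of radius 3, the range that also covers the shifts of a cell average, so one modulus \<omega>
  serves both smoothings.\<close>

definition kern :: "vec3 \<Rightarrow> real" where
  "kern s = (1 / (LBINT x. bump 0 1 1 x)) * bump 0 1 1 s"

lemma kern_facts:
  shows kern_test: "test_fun kern" and kern_nonneg: "0 \<le> kern s" and kern_supp: "kern s \<noteq> 0 \<Longrightarrow> norm s \<le> 3"
    and kern_integral: "(LBINT s. kern s) = 1"
proof -
  let ?b = "bump 0 1 1"
  note b = test_fun_cderiv[OF bump_test_fun[of 0 1 1]]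
  have i: "integrable lborel ?b" by (rule continuous_bsupp_integrable) (use b(1,2) in \<open>auto simp: cderiv_def\<close>)
  have "(LBINT x. ?b x) \<noteq> 0"
  proof
    assume "(LBINT x. ?b x) = 0"
    then have "AE x in lborel. ?b x = 0"
      using i bump_bounds(1) by (simp add: integral_nonneg_eq_0_iff_AE)
    then have "AE x in lborel. x \<notin> box (0::vec3) 1"
      by eventually_elim (use bump_support[of 1 0 1] in auto)
    then have "emeasure lborel (box (0::vec3) 1) = 0"
      by (subst (asm) AE_iff_measurable[of "box 0 1"]) auto
    moreover have "(\<Prod>b\<in>Basis. (1::vec3) \<bullet> b) = 1" "\<forall>b\<in>Basis. 0 \<le> (1::vec3) \<bullet> b"
      by (auto intro!: prod.neutral simp: Basis_vec_def inner_axis)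
    ultimately show False by (simp add: emeasure_lborel_box_eq)
  qed
  then have pos: "0 < (LBINT x. ?b x)"
    using bi_integral_nonneg[of lborel ?b] bump_bounds(1) by (simp add: less_le)
  have sc: "smoothc kern" unfolding kern_def[abs_def] by (intro smoothc.mult smoothc.const bump_smoothc)
  have sp: "norm s \<le> 3" if "kern s \<noteq> 0" for s
  proof (rule cellY_norm)
    have "s \<in> box 0 1" using that bump_support[of 1 0 1 s] by (auto simp: kern_def)
    then have "\<forall>i. 0 < s $ i \<and> s $ i < 1" by (simp add: mem_box_cart)
    then show "s \<in> cellY" unfolding cellY_def by (simp add: less_imp_le)
  qed
  show "kern s \<noteq> 0 \<Longrightarrow> norm s \<le> 3" by (rule sp)
  show "test_fun kern" by (rule smoothc_test_fun[OF sc sp])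
  show "0 \<le> kern s" unfolding kern_def using pos bump_bounds(1) by simp
  show "(LBINT s. kern s) = 1" unfolding kern_def using i pos by simp
qed

abbreviation dkern :: "3 \<Rightarrow> vec3 \<Rightarrow> real" where "dkern j \<equiv> dpart [j] kern"

lemmas kern_cderiv = test_fun_cderiv[OF kern_test]

lemma kern_measurable [measurable]: "kern \<in> bmeas" "dkern j \<in> bmeas"
  using kern_cderiv(1)[of j] unfolding cderiv_def by (auto intro!: borel_measurable_continuous_onI simp del: dpart.simps)

lemma kern_integrable: "integrable lborel kern" "integrable lborel (dkern j)"
  using kern_cderiv(1)[of j] kern_cderiv(2) kern_cderiv(3)[of j] unfolding cderiv_def
  by (auto intro!: continuous_bsupp_integrable simp del: dpart.simps)

context
  fixes \<phi> :: "vec3 \<Rightarrow> real"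
  assumes \<phi>: "sq2 \<phi>"
begin

lemma phi_measurable [measurable]: "\<phi> \<in> bmeas"
  using sqi_measurable[OF \<phi>] by simp

lemma phi_loc: "loc_int \<phi>"
  using W.loc_int_sqi[OF _ W_per] \<phi> by (simp add: W_M)

lemma phi_shift: "sq2 (\<lambda>x. \<phi> (x + s))" "nl2 (\<lambda>x. \<phi> (x + s)) = nl2 \<phi>"
  using W.sqi_shift[OF _ W_per, of \<phi> s] \<phi> by (simp_all add: W_M)

lemma conv_kern_l2: "sq2 (conv kern \<phi>)" "nl2 (conv kern \<phi>) \<le> nl2 \<phi>"
proof -
  have "(\<integral>\<^sup>+x. ennreal ((norm (case (x, s) of (x, s) \<Rightarrow> \<phi> (x + s)))\<^sup>2) \<partial>lborel) \<le> ennreal ((nl2 \<phi>)\<^sup>2)" for s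
    using nn_sqi[OF phi_shift(1)[of s]] phi_shift(2)[of s] by simp
  note * = l2_minkowski[OF kern_integrable(1) _ this]
  have "conv kern \<phi> = (\<lambda>x. LBINT s. kern s *\<^sub>R \<phi> (x + s))"
    by (rule ext, rule conv_shift) measurable
  with * show "sq2 (conv kern \<phi>)" "nl2 (conv kern \<phi>) \<le> nl2 \<phi>"
    using kern_integral kern_nonneg by simp_all
qed

context
  fixes \<omega> :: real
  assumes \<omega>: "\<And>s. norm s \<le> 3 \<Longrightarrow> nl2 (\<lambda>x. \<phi> (x + s) - \<phi> x) \<le> \<omega>"
begin

lemma modulus_nn: "norm s \<le> 3 \<Longrightarrow> (\<integral>\<^sup>+x. ennreal ((norm (case (x, s) of (x, s) \<Rightarrow> \<phi> (x + s) - \<phi> x))\<^sup>2) \<partial>lborel) \<le> ennreal (\<omega>\<^sup>2)"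
  using nn_sqi[OF sqi_diff[OF phi_shift(1)[of s] \<phi>]] power_mono[OF \<omega>[of s] l2n_nonneg, of 2] by (simp add: ennreal_leI)

lemma modulus_nonneg: "0 \<le> \<omega>"
  using order_trans[OF l2n_nonneg \<omega>[of 0]] by simp

lemma conv_kern_approx: "nl2 (\<lambda>x. conv kern \<phi> x - \<phi> x) \<le> \<omega>"
proof -
  have "nl2 (\<lambda>x. LBINT s. kern s *\<^sub>R (case (x, s) of (x, s) \<Rightarrow> \<phi> (x + s) - \<phi> x)) \<le> (LBINT s. \<bar>kern s\<bar>) * \<omega>"
    by (rule l2_minkowski(2)[OF kern_integrable(1)]) (use modulus_nn kern_supp modulus_nonneg in auto)
  moreover have "(LBINT s. kern s *\<^sub>R (\<phi> (x + s) - \<phi> x)) = conv kern \<phi> x - \<phi> x" for x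
  proof -
    have "integrable lborel (\<lambda>s. kern s * \<phi> (x + s))"
      using integrable_shift[OF conv_integrable[OF _ kern_cderiv(2) phi_loc, of x], of x] kern_cderiv(1)
      by (simp add: cderiv_def add.commute mult.commute)
    then show ?thesis using kern_integrable(1) kern_integral
      by (simp add: conv_shift right_diff_distrib)
  qed
  ultimately show ?thesis using kern_integral kern_nonneg by simp
qed

text \<open>The derivative of the kernel has integral zero, so \<phi> (x + s) may be replaced by its
  increment. The gradient of the smoothed function is thus controlled by the modulus \<omega> and
  not by the norm of \<phi>.\<close>

lemma conv_dkern_l2:
  shows "sq2 (\<lambda>x. - conv (dkern j) \<phi> x)"
    and "nl2 (\<lambda>x. - conv (dkern j) \<phi> x) \<le> (LBINT s. \<bar>dkern j s\<bar>) * \<omega>"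
proof -
  have dsupp: "norm s \<le> 3" if "dkern j s \<noteq> 0" for s
  proof (rule ccontr)
    assume s: "\<not> norm s \<le> 3"
    have z: "((\<lambda>_. 0) has_derivative (\<lambda>_. 0)) (at s)" by simp
    have "(kern has_derivative (\<lambda>_. 0)) (at s)"
    proof (rule has_derivative_transform_within_open[OF z])
      show "open (- cball 0 3 :: vec3 set)" by (simp add: open_Compl)
      show "0 = kern x" if "x \<in> - cball 0 3" for x using that kern_supp[of x] by auto
    qed (use s in auto)
    then show False using that by (simp add: frechet_derivative_at[symmetric])
  qed
  have *: "sq2 (\<lambda>x. LBINT s. dkern j s *\<^sub>R (case (x, s) of (x, s) \<Rightarrow> \<phi> (x + s) - \<phi> x))"
    "nl2 (\<lambda>x. LBINT s. dkern j s *\<^sub>R (case (x, s) of (x, s) \<Rightarrow> \<phi> (x + s) - \<phi> x)) \<le> (LBINT s. \<bar>dkern j s\<bar>) * \<omega>"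
    by (rule l2_minkowski[OF kern_integrable(2)]; use modulus_nn dsupp modulus_nonneg in \<open>auto simp del: dpart.simps\<close>)+
  have "(LBINT s. dkern j s *\<^sub>R (\<phi> (x + s) - \<phi> x)) = conv (dkern j) \<phi> x" for x
  proof -
    have "integrable lborel (\<lambda>s. dkern j s * \<phi> (x + s))"
      using integrable_shift[OF conv_integrable[OF _ kern_cderiv(3)[of j] phi_loc, of x], of x] kern_cderiv(1)[of j]
      by (simp add: cderiv_def add.commute mult.commute del: dpart.simps)
    then show ?thesis using kern_integrable(2)[of j] cderiv_integral_zero[OF kern_cderiv(1)[of j] kern_cderiv(2) kern_cderiv(3)]
      by (simp add: conv_shift right_diff_distrib del: dpart.simps)
  qed
  then show "sq2 (\<lambda>x. - conv (dkern j) \<phi> x)"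
    "nl2 (\<lambda>x. - conv (dkern j) \<phi> x) \<le> (LBINT s. \<bar>dkern j s\<bar>) * \<omega>"
    using * by (auto simp: l2n_minus simp del: dpart.simps)
qed

end

text \<open>A qualitative pointwise bound: differentiating cell averages and the flux identity both
  ask for bounded factors. It does not enter the final constant.\<close>

lemma conv_bounded:
  assumes \<eta>: "continuous_on UNIV \<eta>" "bsupp \<eta>"
  shows "\<bar>conv \<eta> \<phi> x\<bar> \<le> nl2 \<phi> * nl2 \<eta>"
proof -
  have s: "sq2 (\<lambda>y. \<eta> (y + - x))" "nl2 (\<lambda>y. \<eta> (y + - x)) = nl2 \<eta>"
    using W.sqi_shift[OF _ W_per, of \<eta> "- x"] continuous_bsupp_sqi[OF \<eta>] by (auto simp: W_M)
  show ?thesis using l2_Cauchy_Schwarz[OF \<phi> s(1)] s(2) by (simp add: conv_def)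
qed

end

section \<open>Averages over the unit cell\<close>

interpretation QY: pair_sigma_finite lborel Y.M
  using YP.sigma_finite_measure_axioms sigma_finite_lborel by (simp add: pair_sigma_finite_def)

text \<open>The Steklov average. The translates are x - s, so the substitution x = y + s moves the
  shift onto a periodic factor evaluated at x.\<close>

definition cmean :: "(vec3 \<Rightarrow> real) \<Rightarrow> vec3 \<Rightarrow> real" where
  "cmean \<rho> x = (\<integral>s. \<rho> (x - s) \<partial>Y.M)"

lemma cmean_continuous:
  assumes \<rho>: "continuous_on UNIV \<rho>" and B: "\<And>x. \<bar>\<rho> x\<bar> \<le> B"
  shows "continuous_on UNIV (cmean \<rho>)"
proof (intro continuous_at_imp_continuous_on ballI continuous_at_sequentiallyI)
  fix x and u :: "nat \<Rightarrow> vec3" assume u: "u \<longlonglongrightarrow> x"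
  have [measurable]: "\<rho> \<in> bmeas" using \<rho> by (rule borel_measurable_continuous_onI)
  show "(\<lambda>n. cmean \<rho> (u n)) \<longlonglongrightarrow> cmean \<rho> x"
    unfolding cmean_def
  proof (rule integral_dominated_convergence[where w="\<lambda>_. B"])
    show "AE s in Y.M. (\<lambda>n. \<rho> (u n - s)) \<longlonglongrightarrow> \<rho> (x - s)"
      using \<rho> u by (intro AE_I2 isCont_tendsto_compose[of _ \<rho>] tendsto_diff tendsto_const)
        (auto simp: continuous_on_eq_continuous_at)
    show "AE s in Y.M. norm (\<rho> (u n - s)) \<le> B" for n using B by simp
  qed simp_all
qed

lemma cmean_integrable:
  fixes \<rho> :: "vec3 \<Rightarrow> real"
  assumes [measurable]: "\<rho> \<in> bmeas" and B: "\<And>x. \<bar>\<rho> x\<bar> \<le> B"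
  shows "integrable Y.M (\<lambda>s. \<rho> (x - s))"
  by (rule YP.integrable_const_bound[where B=B]) (use B in auto)

lemma cmean_bound:
  assumes [measurable]: "\<rho> \<in> bmeas" and B: "\<And>x. \<bar>\<rho> x\<bar> \<le> B"
  shows "\<bar>cmean \<rho> x\<bar> \<le> B"
proof -
  have "\<bar>cmean \<rho> x\<bar> \<le> (\<integral>s. \<bar>\<rho> (x - s)\<bar> \<partial>Y.M)" unfolding cmean_def by (rule integral_abs_bound)
  also have "\<dots> \<le> (\<integral>s. B \<partial>Y.M)"
    by (intro integral_mono integrable_abs cmean_integrable[OF assms] B) simp
  finally show ?thesis using YP.prob_space by simp
qed

lemma cmean_cderiv:
  assumes c: "cderiv j \<rho> \<rho>'" and B: "\<And>x. \<bar>\<rho> x\<bar> \<le> B" and B': "\<And>x. \<bar>\<rho>' x\<bar> \<le> B'"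
  shows "cderiv j (cmean \<rho>) (cmean \<rho>')"
  unfolding cderiv_def
proof (intro conjI allI)
  have e: "continuous_on UNIV \<rho>" "continuous_on UNIV \<rho>'" using c by (auto simp: cderiv_def)
  then have [measurable]: "\<rho> \<in> bmeas" "\<rho>' \<in> bmeas"
    by (auto intro: borel_measurable_continuous_onI)
  show "continuous_on UNIV (cmean \<rho>)" "continuous_on UNIV (cmean \<rho>')"
    by (rule cmean_continuous[OF e(1) B], rule cmean_continuous[OF e(2) B'])
  fix x
  have "((\<lambda>r. \<integral>s. \<rho> (x + r *\<^sub>R axis j 1 - s) \<partial>Y.M) has_real_derivative
     (\<integral>s. \<rho>' (x + 0 *\<^sub>R axis j 1 - s) \<partial>Y.M)) (at 0)"
  proof (rule DERIV_integral[where w="\<lambda>_. B'"])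
    show "((\<lambda>r. \<rho> (x + r *\<^sub>R axis j 1 - s)) has_real_derivative \<rho>' (x + r *\<^sub>R axis j 1 - s)) (at r)" for s r
      using cderiv_DERIV[OF c, of "x - s" 1 r] by (simp add: algebra_simps)
    show "\<bar>\<rho>' (x + r *\<^sub>R axis j 1 - s)\<bar> \<le> B'" for s r by (rule B')
    show "integrable Y.M (\<lambda>s. \<rho> (x + r *\<^sub>R axis j 1 - s))" for r by (rule cmean_integrable[OF _ B]) measurable
    show "(\<lambda>s. \<rho>' (x + 0 *\<^sub>R axis j 1 - s)) \<in> borel_measurable Y.M" by simp
  qed simp
  then show "((\<lambda>r. cmean \<rho> (x + r *\<^sub>R axis j 1)) has_real_derivative cmean \<rho>' x) (at 0)"
    by (simp add: cmean_def)
qed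

text \<open>The two functions correspond under x = y + s. In the form with b (y + s), Tonelli
  integrates the periodic factor over a whole cell first, and that integral does not depend on y;
  hence the norm factorises although \<open>b\<close> is only square integrable on a cell.\<close>

lemma cmean_joint:
  fixes b :: "vec3 \<Rightarrow> 'b::euclidean_space"
  assumes b: "sqi Y.M b" "Y.per b" and \<rho>: "sq2 \<rho>"
  shows "sqi (lborel \<Otimes>\<^sub>M Y.M) (\<lambda>(y, s). \<rho> y *\<^sub>R b (y + s))"
    "l2n (lborel \<Otimes>\<^sub>M Y.M) (\<lambda>(y, s). \<rho> y *\<^sub>R b (y + s)) \<le> l2n Y.M b * nl2 \<rho>"
    "sqi (lborel \<Otimes>\<^sub>M Y.M) (\<lambda>(x, s). \<rho> (x - s) *\<^sub>R b x)"
    "l2n (lborel \<Otimes>\<^sub>M Y.M) (\<lambda>(x, s). \<rho> (x - s) *\<^sub>R b x) \<le> l2n Y.M b * nl2 \<rho>"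
proof -
  have [measurable]: "b \<in> bmeas" "\<rho> \<in> bmeas"
    using sqi_measurable[OF b(1)] sqi_measurable[OF \<rho>] by simp_all
  have m: "(\<lambda>(y, s). \<rho> y *\<^sub>R b (y + s)) \<in> borel_measurable (lborel \<Otimes>\<^sub>M Y.M)"
    "(\<lambda>(x, s). \<rho> (x - s) *\<^sub>R b x) \<in> borel_measurable (lborel \<Otimes>\<^sub>M Y.M)" by measurable
  let ?f = "\<lambda>y s. ennreal ((\<rho> y)\<^sup>2) * ennreal ((norm (b (y + s)))\<^sup>2)"
  have eq: "(\<integral>\<^sup>+s. \<integral>\<^sup>+y. ?f y s \<partial>lborel \<partial>Y.M) = ennreal ((l2n Y.M b * nl2 \<rho>)\<^sup>2)"
  proof -
    have "(\<integral>\<^sup>+s. \<integral>\<^sup>+y. ?f y s \<partial>lborel \<partial>Y.M) = (\<integral>\<^sup>+y. \<integral>\<^sup>+s. ?f y s \<partial>Y.M \<partial>lborel)"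
      by (rule QY.Fubini') measurable
    also have "\<dots> = (\<integral>\<^sup>+y. ennreal ((\<rho> y)\<^sup>2) * ennreal ((l2n Y.M b)\<^sup>2) \<partial>lborel)"
    proof (rule nn_integral_cong)
      fix y
      have "(\<integral>\<^sup>+s. ?f y s \<partial>Y.M) = ennreal ((\<rho> y)\<^sup>2) * (\<integral>\<^sup>+s. ennreal ((norm (b (y + s)))\<^sup>2) \<partial>Y.M)"
        by (rule nn_integral_cmult) measurable
      also have "(\<integral>\<^sup>+s. ennreal ((norm (b (y + s)))\<^sup>2) \<partial>Y.M) = ennreal ((l2n Y.M b)\<^sup>2)"
        using nn_sqi[OF Y.sqi_shift(1)[OF b, of y]] Y.sqi_shift(2)[OF b, of y] by (simp add: add.commute)
      finally show "(\<integral>\<^sup>+s. ?f y s \<partial>Y.M) = ennreal ((\<rho> y)\<^sup>2) * ennreal ((l2n Y.M b)\<^sup>2)" .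
    qed
    also have "\<dots> = (\<integral>\<^sup>+y. ennreal ((norm (\<rho> y))\<^sup>2) \<partial>lborel) * ennreal ((l2n Y.M b)\<^sup>2)"
      by (subst nn_integral_multc) auto
    also have "\<dots> = ennreal ((l2n Y.M b * nl2 \<rho>)\<^sup>2)"
      unfolding nn_sqi[OF \<rho>] by (simp add: ennreal_mult[symmetric] power_mult_distrib mult.commute)
    finally show ?thesis .
  qed
  have 1: "(\<integral>\<^sup>+z. ennreal ((norm (case z of (y, s) \<Rightarrow> \<rho> y *\<^sub>R b (y + s)))\<^sup>2) \<partial>(lborel \<Otimes>\<^sub>M Y.M)) = ennreal ((l2n Y.M b * nl2 \<rho>)\<^sup>2)"
    unfolding eq[symmetric]
    by (subst QY.nn_integral_snd[symmetric]) (auto simp: power_mult_distrib ennreal_mult)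
  have "(\<integral>\<^sup>+z. ennreal ((norm (case z of (x, s) \<Rightarrow> \<rho> (x - s) *\<^sub>R b x))\<^sup>2) \<partial>(lborel \<Otimes>\<^sub>M Y.M))
     = (\<integral>\<^sup>+s. \<integral>\<^sup>+x. ennreal ((\<rho> (x - s))\<^sup>2) * ennreal ((norm (b x))\<^sup>2) \<partial>lborel \<partial>Y.M)"
    by (subst QY.nn_integral_snd[symmetric]) (auto simp: power_mult_distrib ennreal_mult)
  also have "\<dots> = (\<integral>\<^sup>+s. \<integral>\<^sup>+y. ?f y s \<partial>lborel \<partial>Y.M)"
  proof (rule nn_integral_cong)
    fix s
    show "(\<integral>\<^sup>+x. ennreal ((\<rho> (x - s))\<^sup>2) * ennreal ((norm (b x))\<^sup>2) \<partial>lborel) = (\<integral>\<^sup>+y. ?f y s \<partial>lborel)"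
      using nn_integral_shift[of "\<lambda>x. ennreal ((\<rho> (x - s))\<^sup>2) * ennreal ((norm (b x))\<^sup>2)" s] by simp
  qed
  also note eq
  finally have 2: "(\<integral>\<^sup>+z. ennreal ((norm (case z of (x, s) \<Rightarrow> \<rho> (x - s) *\<^sub>R b x))\<^sup>2) \<partial>(lborel \<Otimes>\<^sub>M Y.M)) = ennreal ((l2n Y.M b * nl2 \<rho>)\<^sup>2)" .
  show "sqi (lborel \<Otimes>\<^sub>M Y.M) (\<lambda>(y, s). \<rho> y *\<^sub>R b (y + s))"
    "l2n (lborel \<Otimes>\<^sub>M Y.M) (\<lambda>(y, s). \<rho> y *\<^sub>R b (y + s)) \<le> l2n Y.M b * nl2 \<rho>"
    using sqi_nnI[OF m(1) eq_refl[OF 1]] by simp_all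
  show "sqi (lborel \<Otimes>\<^sub>M Y.M) (\<lambda>(x, s). \<rho> (x - s) *\<^sub>R b x)"
    "l2n (lborel \<Otimes>\<^sub>M Y.M) (\<lambda>(x, s). \<rho> (x - s) *\<^sub>R b x) \<le> l2n Y.M b * nl2 \<rho>"
    using sqi_nnI[OF m(2) eq_refl[OF 2]] by simp_all
qed

text \<open>The reason for averaging over a full cell: Jensen in s and \<open>cmean_joint\<close>
  let the average be multiplied by an unbounded periodic function within L2.\<close>

proposition cmean_mult:
  fixes b :: "vec3 \<Rightarrow> 'b::euclidean_space"
  assumes b: "sqi Y.M b" "Y.per b" and \<rho>: "sq2 \<rho>"
  shows "sq2 (\<lambda>x. cmean \<rho> x *\<^sub>R b x)" "nl2 (\<lambda>x. cmean \<rho> x *\<^sub>R b x) \<le> l2n Y.M b * nl2 \<rho>"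
proof -
  have [measurable]: "b \<in> bmeas" "\<rho> \<in> bmeas"
    using sqi_measurable[OF b(1)] sqi_measurable[OF \<rho>] by simp_all
  have [measurable]: "cmean \<rho> \<in> bmeas"
    unfolding cmean_def[abs_def] by measurable
  let ?d = "\<lambda>(x, s). \<rho> (x - s) *\<^sub>R b x"
  note j = cmean_joint(3,4)[OF b \<rho>]
  have "(\<integral>\<^sup>+x. ennreal ((norm (cmean \<rho> x *\<^sub>R b x))\<^sup>2) \<partial>lborel) \<le> (\<integral>\<^sup>+x. \<integral>\<^sup>+s. ennreal ((norm (?d (x, s)))\<^sup>2) \<partial>Y.M \<partial>lborel)"
  proof (rule nn_integral_mono)
    fix x
    have "cmean \<rho> x *\<^sub>R b x = (\<integral>s. ?d (x, s) \<partial>Y.M)"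
    proof (cases "integrable Y.M (\<lambda>s. \<rho> (x - s))")
      case True then show ?thesis by (simp add: cmean_def)
    next
      \<comment> \<open>Where the average does not exist as an integral, both sides are 0 by
        convention if b x is nonzero, and trivially 0 otherwise.\<close>
      case False
      show ?thesis
      proof (cases "b x = 0")
        case nz: False
        have "\<not> integrable Y.M (\<lambda>s. \<rho> (x - s) *\<^sub>R b x)"
        proof
          assume "integrable Y.M (\<lambda>s. \<rho> (x - s) *\<^sub>R b x)"
          then have "integrable Y.M (\<lambda>s. ((\<rho> (x - s) *\<^sub>R b x) \<bullet> b x) / (b x \<bullet> b x))" by (intro integrable_divide integrable_inner_left)
          then show False using False nz by simp
        qed
        then show ?thesis using False by (simp add: cmean_def not_integrable_integral_eq)
      qed simp
    qed
    then show "ennreal ((norm (cmean \<rho> x *\<^sub>R b x))\<^sup>2) \<le> (\<integral>\<^sup>+s. ennreal ((norm (?d (x, s)))\<^sup>2) \<partial>Y.M)"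
      using norm_integral_sq_le[OF YP.prob_space_axioms, of "\<lambda>s. ?d (x, s)"] by simp
  qed
  also have "\<dots> = (\<integral>\<^sup>+z. ennreal ((norm (?d z))\<^sup>2) \<partial>(lborel \<Otimes>\<^sub>M Y.M))"
    by (subst YP.nn_integral_fst[symmetric]) auto
  also have "\<dots> \<le> ennreal ((l2n Y.M b * nl2 \<rho>)\<^sup>2)"
    unfolding nn_sqi[OF j(1)] by (intro ennreal_leI power_mono j(2)) simp
  finally have "(\<integral>\<^sup>+x. ennreal ((norm (cmean \<rho> x *\<^sub>R b x))\<^sup>2) \<partial>lborel) \<le> ennreal ((l2n Y.M b * nl2 \<rho>)\<^sup>2)" .
  from sqi_nnI[OF _ this]
  show "sq2 (\<lambda>x. cmean \<rho> x *\<^sub>R b x)" "nl2 (\<lambda>x. cmean \<rho> x *\<^sub>R b x) \<le> l2n Y.M b * nl2 \<rho>"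
    by simp_all
qed

lemma cmean_l2:
  assumes "sq2 \<rho>" shows "sq2 (cmean \<rho>)" "nl2 (cmean \<rho>) \<le> nl2 \<rho>"
proof -
  have "l2n Y.M (\<lambda>x::vec3. 1::real) = 1" using YP.prob_space by (simp add: l2n_def)
  then show "sq2 (cmean \<rho>)" "nl2 (cmean \<rho>) \<le> nl2 \<rho>"
    using cmean_mult[OF Y_sqi_const[of "1::real"] _ assms] by (simp_all add: Y.per_def)
qed

lemma cmean_approx:
  assumes \<rho>: "sq2 \<rho>" and B: "\<And>x. \<bar>\<rho> x\<bar> \<le> B"
    and \<omega>: "\<And>s. norm s \<le> 3 \<Longrightarrow> nl2 (\<lambda>x. \<rho> (x + s) - \<rho> x) \<le> \<omega>"
  shows "nl2 (\<lambda>x. cmean \<rho> x - \<rho> x) \<le> \<omega>"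
proof -
  have [measurable]: "\<rho> \<in> bmeas" using sqi_measurable[OF \<rho>] by simp
  have "AE s in Y.M. (\<integral>\<^sup>+x. ennreal ((norm (case (x, s) of (x, s) \<Rightarrow> \<rho> (x - s) - \<rho> x))\<^sup>2) \<partial>lborel) \<le> ennreal (\<omega>\<^sup>2)"
    using Y_AE_cell
  proof eventually_elim
    case (elim s)
    have "sq2 (\<lambda>x. \<rho> (x + - s) - \<rho> x)" using phi_shift(1)[OF \<rho>] \<rho> by (rule sqi_diff)
    moreover have "nl2 (\<lambda>x. \<rho> (x + - s) - \<rho> x) \<le> \<omega>" by (rule \<omega>) (use cellY_norm[OF elim] in simp)
    ultimately show ?case
      using nn_sqi[of lborel "\<lambda>x. \<rho> (x + - s) - \<rho> x"] power_mono[OF _ l2n_nonneg, of lborel "\<lambda>x. \<rho> (x + - s) - \<rho> x" \<omega> 2]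
      by (simp add: ennreal_leI)
  qed
  from l2_average(2)[OF sigma_finite_lborel YP.prob_space_axioms _ this]
  have "nl2 (\<lambda>x. \<integral>s. \<rho> (x - s) - \<rho> x \<partial>Y.M) \<le> \<omega>"
    using order_trans[OF l2n_nonneg \<omega>[of 0]] by simp
  moreover have "(\<integral>s. \<rho> (x - s) - \<rho> x \<partial>Y.M) = cmean \<rho> x - \<rho> x" for x
    using cmean_integrable[of \<rho> B x] B YP.prob_space by (simp add: cmean_def)
  ultimately show ?thesis by simp
qed

text \<open>Since \<open>b\<close> has mean zero, \<open>v (y + s)\<close> may be replaced by \<open>v (y + s) - v y\<close>,
  which gains one power of the period.\<close>

proposition cmean_pairing:
  fixes b v :: "vec3 \<Rightarrow> real"
  assumes b: "sqi Y.M b" "Y.per b" "(\<integral>x. b x \<partial>Y.M) = 0" and \<rho>: "sq2 \<rho>" and v: "sq2 v"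
    and c: "\<And>s. norm s \<le> 3 \<Longrightarrow> nl2 (\<lambda>x. v (x + s) - v x) \<le> c"
  shows "\<bar>\<integral>x. cmean \<rho> x * b x * v x \<partial>lborel\<bar> \<le> l2n Y.M b * nl2 \<rho> * c"
proof -
  have [measurable]: "b \<in> bmeas" "\<rho> \<in> bmeas" "v \<in> bmeas"
    using sqi_measurable[OF b(1)] sqi_measurable[OF \<rho>] sqi_measurable[OF v] by simp_all
  let ?N = "lborel \<Otimes>\<^sub>M Y.M"
  let ?f = "\<lambda>(x, s). \<rho> (x - s) *\<^sub>R b x" and ?g = "\<lambda>(y, s). \<rho> y *\<^sub>R b (y + s)"
    and ?v = "\<lambda>(y :: vec3, s :: vec3). v y" and ?w = "\<lambda>(y, s). v (y + s) - v y"
  note f = cmean_joint(3)[OF b(1,2) \<rho>] and g = cmean_joint(1,2)[OF b(1,2) \<rho>]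
  have "(\<integral>\<^sup>+z. ennreal ((norm (?v z))\<^sup>2) \<partial>?N) = (\<integral>\<^sup>+s. \<integral>\<^sup>+y. ennreal ((norm (v y))\<^sup>2) \<partial>lborel \<partial>Y.M)"
    by (subst QY.nn_integral_snd[symmetric]) auto
  also have "\<dots> \<le> ennreal ((nl2 v)\<^sup>2)"
    unfolding nn_sqi[OF v] using YP.emeasure_space_1 by simp
  finally have sv: "sqi ?N ?v" by (intro sqi_nnI) auto
  have "(\<integral>\<^sup>+z. ennreal ((norm (?w z))\<^sup>2) \<partial>?N) = (\<integral>\<^sup>+s. \<integral>\<^sup>+y. ennreal ((norm (v (y + s) - v y))\<^sup>2) \<partial>lborel \<partial>Y.M)"
    by (subst QY.nn_integral_snd[symmetric]) auto
  also have "\<dots> \<le> (\<integral>\<^sup>+s. ennreal (c\<^sup>2) \<partial>Y.M)"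
  proof (rule nn_integral_mono_AE)
    show "AE s in Y.M. (\<integral>\<^sup>+y. ennreal ((norm (v (y + s) - v y))\<^sup>2) \<partial>lborel) \<le> ennreal (c\<^sup>2)"
      using Y_AE_cell
    proof eventually_elim
      case (elim s)
      show ?case
        unfolding nn_sqi[OF sqi_diff[OF phi_shift(1)[OF v, of s] v]]
        by (intro ennreal_leI power_mono c cellY_norm elim) simp
    qed
  qed
  also have "\<dots> = ennreal (c\<^sup>2)" using YP.emeasure_space_1 by simp
  finally have wn: "(\<integral>\<^sup>+z. ennreal ((norm (?w z))\<^sup>2) \<partial>?N) \<le> ennreal (c\<^sup>2)" .
  have c0: "0 \<le> c" using order_trans[OF l2n_nonneg c[of 0]] by simp
  have w: "sqi ?N ?w" "l2n ?N ?w \<le> c" by (rule sqi_nnI[OF _ wn c0]; measurable)+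
  have ifv: "integrable ?N (\<lambda>(x, s). \<rho> (x - s) * b x * v x)"
    using sqi_integrable_mult[OF f sv] by (simp add: case_prod_unfold)
  have igv: "integrable ?N (\<lambda>(y, s). \<rho> y * b (y + s) * v y)"
    using sqi_integrable_mult[OF g(1) sv] by (simp add: case_prod_unfold)
  have igw: "integrable ?N (\<lambda>(y, s). \<rho> y * b (y + s) * (v (y + s) - v y))"
    using sqi_integrable_mult[OF g(1) w(1)] by (simp add: case_prod_unfold)
  have "(LBINT x. cmean \<rho> x * b x * v x) = (LBINT x. \<integral>s. \<rho> (x - s) * b x * v x \<partial>Y.M)"
    by (simp add: cmean_def)
  also have "\<dots> = (\<integral>s. \<integral>x. \<rho> (x - s) * b x * v x \<partial>lborel \<partial>Y.M)"
    by (rule QY.Fubini_integral[OF ifv, symmetric])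
  also have "\<dots> = (\<integral>s. \<integral>y. \<rho> y * b (y + s) * v (y + s) \<partial>lborel \<partial>Y.M)"
  proof (rule bi_integral_cong[OF refl])
    fix s
    show "(LBINT x. \<rho> (x - s) * b x * v x) = (LBINT y. \<rho> y * b (y + s) * v (y + s))"
      using integral_shift[of "\<lambda>x. \<rho> (x - s) * b x * v x" s] by simp
  qed
  also have "\<dots> = (\<integral>z. (case z of (y, s) \<Rightarrow> \<rho> y * b (y + s) * (v (y + s) - v y)) + (case z of (y, s) \<Rightarrow> \<rho> y * b (y + s) * v y) \<partial>?N)"
  proof -
    have "integrable ?N (\<lambda>(y, s). \<rho> y * b (y + s) * v (y + s))"
      using bi_integrable_add[OF igw igv] by (simp add: case_prod_unfold algebra_simps)
    from QY.integral_snd[OF this] show ?thesis by (simp add: case_prod_unfold algebra_simps)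
  qed
  also have "\<dots> = (\<integral>z. (case z of (y, s) \<Rightarrow> \<rho> y * b (y + s) * (v (y + s) - v y)) \<partial>?N) + (\<integral>z. (case z of (y, s) \<Rightarrow> \<rho> y * b (y + s) * v y) \<partial>?N)"
    by (rule bi_integral_add[OF igw igv])
  also have "(\<integral>z. (case z of (y, s) \<Rightarrow> \<rho> y * b (y + s) * v y) \<partial>?N) = (LBINT y. \<integral>s. \<rho> y * b (y + s) * v y \<partial>Y.M)"
    by (subst QY.integral_fst'[symmetric, OF igv]) simp
  also have "\<dots> = (\<integral>y. 0 \<partial>(lborel :: vec3 measure))"
  proof (rule bi_integral_cong[OF refl])
    fix y
    have "(\<integral>s. b (y + s) \<partial>Y.M) = 0"
      using Y.integrable_M_shift(2)[OF Y_sqi_integrable[OF b(1)] b(2), of y] b(3) by (simp add: add.commute)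
    then show "(\<integral>s. \<rho> y * b (y + s) * v y \<partial>Y.M) = 0" by simp
  qed
  finally have eq: "(LBINT x. cmean \<rho> x * b x * v x) = (\<integral>z. ?g z \<bullet> ?w z \<partial>?N)"
    by (simp add: case_prod_unfold)
  have "\<bar>\<integral>z. ?g z \<bullet> ?w z \<partial>?N\<bar> \<le> l2n ?N ?g * l2n ?N ?w" by (rule l2_Cauchy_Schwarz[OF g(1) w(1)])
  also have "\<dots> \<le> l2n Y.M b * nl2 \<rho> * c" by (intro mult_mono g w) auto
  finally show ?thesis unfolding eq .
qed

section \<open>Products and periodization\<close>

lemma cderiv_mult:
  assumes "cderiv j \<psi> \<psi>'" "cderiv j \<phi> \<phi>'"
  shows "cderiv j (\<lambda>x. \<psi> x * \<phi> x) (\<lambda>x. \<psi>' x * \<phi> x + \<psi> x * \<phi>' x)"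
  unfolding cderiv_def
proof (intro conjI allI)
  show "continuous_on UNIV (\<lambda>x. \<psi> x * \<phi> x)" "continuous_on UNIV (\<lambda>x. \<psi>' x * \<phi> x + \<psi> x * \<phi>' x)"
    using assms by (auto simp: cderiv_def intro!: continuous_intros)
  fix x
  show "((\<lambda>s. \<psi> (x + s *\<^sub>R axis j 1) * \<phi> (x + s *\<^sub>R axis j 1)) has_real_derivative \<psi>' x * \<phi> x + \<psi> x * \<phi>' x) (at 0)"
    using DERIV_mult[of "\<lambda>s. \<psi> (x + s *\<^sub>R axis j 1)" "\<psi>' x" 0 UNIV "\<lambda>s. \<phi> (x + s *\<^sub>R axis j 1)" "\<phi>' x"] assms
    by (simp add: cderiv_def algebra_simps)
qed

lemma loc_int_mult_continuous:
  assumes f: "loc_int f" and c: "continuous_on UNIV (\<psi> :: vec3 \<Rightarrow> real)"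
  shows "loc_int (\<lambda>x. \<psi> x * f x)"
proof (rule loc_intI)
  have [measurable]: "f \<in> bmeas" "\<psi> \<in> bmeas"
    using f c by (auto intro: loc_int_measurable borel_measurable_continuous_onI)
  show "(\<lambda>x. \<psi> x * f x) \<in> bmeas" by measurable
  fix R
  have "compact (\<psi> ` cball 0 R)" by (rule compact_continuous_image[OF continuous_on_subset[OF c]]) auto
  then obtain B where B: "\<And>y. y \<in> \<psi> ` cball 0 R \<Longrightarrow> norm y \<le> B" using compact_imp_bounded bounded_iff by metis
  show "integrable lborel (\<lambda>x. \<psi> x * f x * iball R x)"
  proof (rule bi_integrable_bound[of _ "\<lambda>x. \<bar>B\<bar> * (f x * iball R x)"])
    show "integrable lborel (\<lambda>x. \<bar>B\<bar> * (f x * iball R x))" by (intro integrable_mult_right loc_int_cball f)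
    have "\<bar>\<psi> x * f x * iball R x\<bar> \<le> \<bar>\<bar>B\<bar> * (f x * iball R x)\<bar>" for x
    proof (cases "x \<in> cball 0 R")
      case True
      then have "\<bar>\<psi> x\<bar> \<le> \<bar>B\<bar>" using B[of "\<psi> x"] by auto
      then show ?thesis using True by (simp add: abs_mult mult_right_mono)
    qed simp
    then show "AE x in lborel. norm (\<psi> x * f x * iball R x) \<le> norm (\<bar>B\<bar> * (f x * iball R x))" by simp
  qed measurable
qed

text \<open>The product \<psi> \<phi> is used as the C1 factor in \<open>acl_by_parts\<close>. It
  need not be a smooth test function, since \<psi> has only one continuous derivative.\<close>

proposition acl_mult:
  assumes a: "acl j w g" and c: "cderiv j \<psi> \<psi>'"
  shows "acl j (\<lambda>x. \<psi> x * w x) (\<lambda>x. \<psi> x * g x + \<psi>' x * w x)"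
  unfolding wderiv_iff_acl[symmetric] wderiv_def
proof (intro conjI allI impI)
  have l: "loc_int w" "loc_int g" using a by (auto simp: acl_def)
  have cc: "continuous_on UNIV \<psi>" "continuous_on UNIV \<psi>'" using c by (auto simp: cderiv_def)
  show "loc_int (\<lambda>x. \<psi> x * w x)" and lg: "loc_int (\<lambda>x. \<psi> x * g x + \<psi>' x * w x)"
    by (intro loc_int_add loc_int_mult_continuous l cc)+
  fix \<phi> assume t: "test_fun \<phi>"
  note p = test_fun_cderiv(1)[OF t, of j] test_fun_cderiv(2)[OF t] test_fun_cderiv(3)[OF t, of j]
  have pc: "continuous_on UNIV \<phi>" "continuous_on UNIV (dpart [j] \<phi>)" using p(1) by (auto simp: cderiv_def)
  have i: "integrable lborel (\<lambda>x. f x * \<eta> x)" if "loc_int f" "continuous_on UNIV \<eta>" "bsupp \<eta>" for f \<eta>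
    using conv_integrable[OF that(2,3,1), of 0] by simp
  have b: "bsupp (\<lambda>x. \<psi> x * \<phi> x)" using p(2) unfolding bsupp_def mult_eq_0_iff by blast
  have b': "bsupp (\<lambda>x. \<psi>' x * \<phi> x + \<psi> x * dpart [j] \<phi> x)"
  proof -
    obtain R1 where R1: "\<And>x. \<phi> x \<noteq> 0 \<Longrightarrow> norm x \<le> R1" using p(2) by (auto simp: bsupp_def)
    obtain R2 where R2: "\<And>x. dpart [j] \<phi> x \<noteq> 0 \<Longrightarrow> norm x \<le> R2" using p(3) unfolding bsupp_def by blast
    have "norm x \<le> max R1 R2" if "\<psi>' x * \<phi> x + \<psi> x * dpart [j] \<phi> x \<noteq> 0" for x
    proof (cases "\<phi> x = 0")
      case True
      then have "dpart [j] \<phi> x \<noteq> 0" using that by (auto simp del: dpart.simps)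
      then show ?thesis using R2 by (simp add: le_max_iff_disj del: dpart.simps)
    qed (use R1 in \<open>simp add: le_max_iff_disj\<close>)
    then show ?thesis unfolding bsupp_def by blast
  qed
  have "(LBINT x. w x * (\<psi>' x * \<phi> x + \<psi> x * dpart [j] \<phi> x)) = - (LBINT x. g x * (\<psi> x * \<phi> x))"
    by (rule acl_by_parts[OF a cderiv_mult[OF c p(1)] b b'])
  moreover have "(LBINT x. w x * (\<psi>' x * \<phi> x + \<psi> x * dpart [j] \<phi> x))
     = (LBINT x. \<psi>' x * w x * \<phi> x) + (LBINT x. \<psi> x * w x * dpart [j] \<phi> x)"
    using i[OF loc_int_mult_continuous[OF l(1) cc(2)] pc(1) p(2)] i[OF loc_int_mult_continuous[OF l(1) cc(1)] pc(2) p(3)]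
    by (subst bi_integral_add[symmetric]) (auto simp: algebra_simps simp del: dpart.simps)
  moreover have "(LBINT x. (\<psi> x * g x + \<psi>' x * w x) * \<phi> x) = (LBINT x. g x * (\<psi> x * \<phi> x)) + (LBINT x. \<psi>' x * w x * \<phi> x)"
    using i[OF loc_int_mult_continuous[OF l(1) cc(2)] pc(1) p(2)] i[OF loc_int_mult_continuous[OF l(2) cc(1)] pc(1) p(2)]
    by (subst bi_integral_add[symmetric]) (auto simp: algebra_simps)
  ultimately show "(LBINT x. \<psi> x * w x * dpart [j] \<phi> x) = - (LBINT x. (\<psi> x * g x + \<psi>' x * w x) * \<phi> x)"
    by linarith
qed

text \<open>The rank-one matrix that appears in the gradient of \<psi> u, with \<open>p\<close> the
  gradient of \<psi>.\<close>

definition outer :: "vec3 \<Rightarrow> (3 \<Rightarrow> real) \<Rightarrow> mat3" where "outer u p = (\<chi> i j. p j * u $ i)"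

lemma outer_nth: "outer u p $ i $ j = p j * u $ i"
  by (simp add: outer_def)

lemma weak_grad_mult:
  assumes "weak_grad u G" "\<And>j. cderiv j \<psi> (\<psi>' j)"
  shows "weak_grad (\<lambda>x. \<psi> x *\<^sub>R u x) (\<lambda>x. \<psi> x *\<^sub>R G x + outer (u x) (\<lambda>j. \<psi>' j x))"
  using assms unfolding weak_grad_acl by (simp add: outer_nth acl_mult)

lemma sqi_vecI:
  fixes f :: "'a \<Rightarrow> 'b::euclidean_space^'n"
  assumes "\<And>i. sqi N (\<lambda>x. f x $ i)" shows "sqi N f"
  unfolding sqi_def
proof
  show "f \<in> borel_measurable N"
    by (subst borel_measurable_euclidean_space)
      (use sqi_measurable[OF assms] in \<open>auto simp: Basis_vec_def inner_axis\<close>)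
  show "integrable N (\<lambda>x. (norm (f x))\<^sup>2)"
    unfolding norm_vec_sq using sqi_integrable_sq[OF assms] by simp
qed

lemma sqi_outer:
  assumes "\<And>i j. sqi N (\<lambda>x. p x j * u x $ i)" shows "sqi N (\<lambda>x. outer (u x) (p x))"
  by (intro sqi_vecI) (simp add: outer_nth assms)

lemma sqi_bounded_mult:
  fixes f :: "'a \<Rightarrow> 'b::euclidean_space" and \<psi> :: "'a \<Rightarrow> real"
  assumes f: "sqi N f" and [measurable]: "\<psi> \<in> borel_measurable N" and B: "\<And>x. \<bar>\<psi> x\<bar> \<le> B"
  shows "sqi N (\<lambda>x. \<psi> x *\<^sub>R f x)"
proof (rule sqi_bound(1)[OF _ f, where C="\<bar>B\<bar>"])
  show "(\<lambda>x. \<psi> x *\<^sub>R f x) \<in> borel_measurable N" using sqi_measurable[OF f] by simp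
  show "AE x in N. norm (\<psi> x *\<^sub>R f x) \<le> \<bar>B\<bar> * norm (f x)"
    using B by (auto intro!: AE_I2 mult_right_mono intro: order_trans[OF _ abs_ge_self])
qed simp

text \<open>Dilations of one bump, normalised to 1 at the origin, by the factors 1/(n+1). The values
  tend to the value at the origin and the derivatives pick up a factor 1/(n+1).\<close>

lemma bump_cutoffs:
  obtains \<zeta> :: "nat \<Rightarrow> vec3 \<Rightarrow> real" and \<zeta>' :: "nat \<Rightarrow> 3 \<Rightarrow> vec3 \<Rightarrow> real" and B :: real where
    "\<And>n j. cderiv j (\<zeta> n) (\<zeta>' n j)" "\<And>n. bsupp (\<zeta> n)" "\<And>n j. bsupp (\<zeta>' n j)"
    "\<And>n x. \<bar>\<zeta> n x\<bar> \<le> B" "\<And>n j x. \<bar>\<zeta>' n j x\<bar> \<le> B"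
    "\<And>x. (\<lambda>n. \<zeta> n x) \<longlonglongrightarrow> 1" "\<And>j x. (\<lambda>n. \<zeta>' n j x) \<longlonglongrightarrow> 0"
    "\<And>n. \<zeta> n \<in> bmeas" "\<And>n j. \<zeta>' n j \<in> bmeas"
proof -
  define z where "z x = (1 / bump (-1) 1 1 0) * bump (-1) 1 1 x" for x
  have b0: "bump (-1) 1 1 0 \<noteq> 0" using bump_support[of 1 "-1" 1 0] by (simp add: mem_box_cart)
  have sc: "smoothc z" unfolding z_def[abs_def] by (intro smoothc.mult smoothc.const bump_smoothc)
  obtain R where R: "\<And>x. x \<in> box (-1) (1::vec3) \<Longrightarrow> norm x \<le> R" using box_norm_bound by blast
  have t: "test_fun z"
    by (rule smoothc_test_fun[OF sc, of R]) (use R bump_support[of 1 "-1" 1] in \<open>simp add: z_def\<close>)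
  note c = test_fun_cderiv[OF t]
  have cz: "continuous_on UNIV z" and cz': "\<And>j. continuous_on UNIV (dpart [j] z)"
    using c(1) unfolding cderiv_def by blast+
  obtain B0 where B0: "\<And>x. \<bar>z x\<bar> \<le> B0" by (rule continuous_bsupp_bounded[OF cz c(2)]) blast
  have "\<exists>B. \<forall>x. \<bar>dpart [j] z x\<bar> \<le> B" for j by (rule continuous_bsupp_bounded[OF cz' c(3)]) blast
  then obtain B1 where B1: "\<And>j x. \<bar>dpart [j] z x\<bar> \<le> B1 j" by metis
  define B where "B = max B0 (\<Sum>j\<in>UNIV. B1 j)"
  have B1': "B1 j \<le> B" for j
  proof -
    have "0 \<le> B1 k" for k using order_trans[OF abs_ge_zero B1] .
    then have "B1 j \<le> (\<Sum>j\<in>UNIV. B1 j)" by (intro member_le_sum) auto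
    then show ?thesis by (simp add: B_def)
  qed
  define r where "r n = inverse (real (Suc n))" for n
  have r: "0 < r n" "r n \<le> 1" for n by (auto simp: r_def inverse_le_1_iff)
  have rl: "r \<longlonglongrightarrow> 0" unfolding r_def[abs_def] by (rule LIMSEQ_inverse_real_of_nat)
  define \<zeta> where "\<zeta> n x = z (r n *\<^sub>R x)" for n x
  define \<zeta>' where "\<zeta>' n j x = r n * dpart [j] z (r n *\<^sub>R x)" for n j x
  have supp: "bsupp (\<lambda>x. c * f (r n *\<^sub>R x))" if f: "bsupp f" for f :: "vec3 \<Rightarrow> real" and n c
  proof -
    obtain Q where Q: "\<And>x. f x \<noteq> 0 \<Longrightarrow> norm x \<le> Q" using f by (auto simp: bsupp_def)
    have "norm x \<le> Q / r n" if "c * f (r n *\<^sub>R x) \<noteq> 0" for x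
      using Q[of "r n *\<^sub>R x"] that r(1)[of n] by (simp add: field_simps)
    then show ?thesis unfolding bsupp_def by blast
  qed
  show thesis
  proof (rule that)
    show "cderiv j (\<zeta> n) (\<zeta>' n j)" for n j
      unfolding cderiv_def
    proof (intro conjI allI)
      show "continuous_on UNIV (\<zeta> n)" "continuous_on UNIV (\<zeta>' n j)"
        unfolding \<zeta>_def[abs_def] \<zeta>'_def[abs_def]
        by (intro continuous_intros continuous_on_compose2[OF cz] continuous_on_compose2[OF cz'] subset_UNIV)+
      fix x
      show "((\<lambda>s. \<zeta> n (x + s *\<^sub>R axis j 1)) has_real_derivative \<zeta>' n j x) (at 0)"
        using cderiv_DERIV[OF c(1)[of j], of "r n *\<^sub>R x" "r n" 0]
        by (simp add: \<zeta>_def \<zeta>'_def scaleR_add_right mult.commute del: dpart.simps)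
    qed
    show "bsupp (\<zeta> n)" for n using supp[OF c(2), of 1 n] by (simp add: \<zeta>_def[abs_def])
    show "bsupp (\<zeta>' n j)" for n j using supp[OF c(3)[of j], of "r n" n] unfolding \<zeta>'_def[abs_def] .
    show "\<bar>\<zeta> n x\<bar> \<le> B" for n x using B0[of "r n *\<^sub>R x"] by (simp add: \<zeta>_def B_def)
    show "\<bar>\<zeta>' n j x\<bar> \<le> B" for n j x
    proof -
      have "\<bar>\<zeta>' n j x\<bar> \<le> 1 * \<bar>dpart [j] z (r n *\<^sub>R x)\<bar>"
        unfolding \<zeta>'_def abs_mult using r[of n] by (intro mult_right_mono) auto
      then show ?thesis using B1[of j "r n *\<^sub>R x"] B1'[of j] by linarith
    qed
    have lim: "(\<lambda>n. r n *\<^sub>R x) \<longlonglongrightarrow> 0" for x :: vec3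
      using tendsto_scaleR[OF rl tendsto_const[of x]] by simp
    show "(\<lambda>n. \<zeta> n x) \<longlonglongrightarrow> 1" for x
    proof -
      have "(\<lambda>n. z (r n *\<^sub>R x)) \<longlonglongrightarrow> z 0"
        using cz lim by (intro isCont_tendsto_compose[of _ z]) (auto simp: continuous_on_eq_continuous_at)
      then show ?thesis using b0 by (simp add: \<zeta>_def z_def)
    qed
    show "\<zeta> n \<in> bmeas" "\<zeta>' n j \<in> bmeas" for n j
      unfolding \<zeta>_def[abs_def] \<zeta>'_def[abs_def]
      using borel_measurable_continuous_onI[OF cz] borel_measurable_continuous_onI[OF cz'[of j]] by (simp_all del: dpart.simps)
    show "(\<lambda>n. \<zeta>' n j x) \<longlonglongrightarrow> 0" for j x
    proof (rule Lim_null_comparison[OF always_eventually])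
      show "\<forall>n. norm (\<zeta>' n j x) \<le> r n * B1 j"
        unfolding \<zeta>'_def real_norm_def abs_mult using r(1) B1 by (auto intro!: mult_mono simp: less_imp_le simp del: dpart.simps)
      show "(\<lambda>n. r n * B1 j) \<longlonglongrightarrow> 0" by (rule tendsto_mult_left_zero[OF rl])
    qed
  qed
qed

section \<open>Periodization over the lattice\<close>

lemma acl_zero: "acl j (\<lambda>x. 0) (\<lambda>x. 0)"
  by (simp add: acl_def loc_int_zero av_def)

lemma acl_sum: "finite I \<Longrightarrow> (\<And>n. n \<in> I \<Longrightarrow> acl j (w n) (g n)) \<Longrightarrow> acl j (\<lambda>x. \<Sum>n\<in>I. w n x) (\<lambda>x. \<Sum>n\<in>I. g n x)"
proof (induction I rule: finite_induct)
  case empty then show ?case by (simp add: acl_zero)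
next
  case (insert m I)
  then show ?case using acl_lincomb[of j "w m" "g m" "\<lambda>x. \<Sum>n\<in>I. w n x" "\<lambda>x. \<Sum>n\<in>I. g n x" 1 1] by simp
qed

lemma lfloor_measurable [measurable]: "lfloor \<in> bmeas"
proof -
  have "lfloor x = (\<Sum>i\<in>UNIV. real_of_int \<lfloor>x $ i\<rfloor> *\<^sub>R axis i 1)" for x
  proof -
    have "(\<Sum>i\<in>UNIV. real_of_int \<lfloor>x $ i\<rfloor> * axis i 1 $ k) = (\<Sum>i\<in>UNIV. if i = k then real_of_int \<lfloor>x $ i\<rfloor> else 0)" for k
      by (intro sum.cong) (auto simp: axis_def)
    then show ?thesis by (simp add: vec_eq_iff lfloor_def)
  qed
  then have e: "lfloor = (\<lambda>x. \<Sum>i\<in>UNIV. real_of_int \<lfloor>x $ i\<rfloor> *\<^sub>R axis i 1)" by auto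
  have "(\<lambda>x :: vec3. real_of_int \<lfloor>x $ i\<rfloor>) \<in> bmeas" for i
    by (rule measurable_compose[OF _ borel_measurable_real_floor]) measurable
  then show ?thesis by (subst e) (intro borel_measurable_sum borel_measurable_scaleR borel_measurable_const)
qed

lemma lfloor_shift: "m \<in> lattice \<Longrightarrow> lfloor (x + m) = lfloor x + m"
  using lfloor_unique[of "lfloor x + m" "x + m"] lfloor_unique[OF lfloor_lattice, of x x] lattice_add[OF lfloor_lattice, of m x]
  by simp

lemma lfloor_cell: "x - lfloor x \<in> cellY"
  using lfloor_unique[OF lfloor_lattice, of x x] by simp

definition lball :: "real \<Rightarrow> vec3 set" where "lball r = {n \<in> lattice. norm n \<le> r}"

lemma finite_lball: "finite (lball r)"
  unfolding lball_def by (rule finite_lattice_ball)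

text \<open>The sum over all lattice translates, evaluated at the cell representative of x. That
  point has norm at most 3, so for a function supported in radius R this fixed finite index set
  contains every nonzero term, and periodicity is exact.\<close>

definition periodize :: "real \<Rightarrow> (vec3 \<Rightarrow> 'b::comm_monoid_add) \<Rightarrow> vec3 \<Rightarrow> 'b" where
  "periodize R f x = (\<Sum>n\<in>lball (R + 3). f (x - lfloor x + n))"

lemma periodize_per: "Y.per (periodize R f)"
  unfolding Y.per_def periodize_def by (simp add: lfloor_shift)

text \<open>On a ball the periodization is one fixed finite sum of translates, without
  \<open>lfloor\<close>. Integrability and weak derivatives are read off from this form.\<close>

lemma periodize_local:
  assumes f: "\<And>x. f x \<noteq> 0 \<Longrightarrow> norm x \<le> R" and x: "norm x \<le> r"
  shows "periodize R f x = (\<Sum>n\<in>lball (R + r). f (x + n))"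
proof -
  let ?S = "{n \<in> lattice. norm (x + n) \<le> R}"
  let ?S' = "{n \<in> lattice. norm (x - lfloor x + n) \<le> R}"
  have "?S \<subseteq> lball (R + r)"
  proof
    fix n assume "n \<in> ?S"
    then show "n \<in> lball (R + r)" using norm_triangle_ineq[of "x + n" "- x"] x by (simp add: lball_def)
  qed
  then have 1: "(\<Sum>n\<in>lball (R + r). f (x + n)) = (\<Sum>n\<in>?S. f (x + n))"
    using f by (intro sum.mono_neutral_right finite_lball) (auto simp: lball_def)
  have "?S' \<subseteq> lball (R + 3)"
  proof
    fix n assume "n \<in> ?S'"
    then show "n \<in> lball (R + 3)"
      using norm_triangle_ineq[of "x - lfloor x + n" "- (x - lfloor x)"] cellY_norm[OF lfloor_cell[of x]]
      by (simp add: lball_def norm_minus_commute)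
  qed
  then have 2: "periodize R f x = (\<Sum>n\<in>?S'. f (x - lfloor x + n))"
    unfolding periodize_def using f by (intro sum.mono_neutral_right finite_lball) (auto simp: lball_def)
  have "(\<Sum>n\<in>?S'. f (x - lfloor x + n)) = (\<Sum>n\<in>?S. f (x + n))"
    by (rule sum.reindex_bij_witness[of _ "\<lambda>n. n + lfloor x" "\<lambda>n. n - lfloor x"])
      (auto simp: lattice_add lattice_diff lfloor_lattice algebra_simps)
  then show ?thesis using 1 2 by simp
qed

lemma periodize_nth: "periodize R f x $ i = periodize R (\<lambda>x. f x $ i) x"
  by (simp add: periodize_def)

lemma periodize_measurable:
  fixes f :: "vec3 \<Rightarrow> 'b::euclidean_space"
  assumes [measurable]: "f \<in> bmeas" shows "periodize R f \<in> bmeas"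
  unfolding periodize_def[abs_def] by measurable

lemma sqi_lborel_imp_Y:
  assumes "sq2 f" shows "sqi Y.M f"
  using Y.integral_M_le(1)[OF sqi_integrable_sq[OF assms]] sqi_measurable[OF assms] by (simp add: sqi_def)

lemma periodize_sqi:
  fixes f :: "vec3 \<Rightarrow> 'b::euclidean_space"
  assumes s: "sq2 f" and f: "\<And>x. f x \<noteq> 0 \<Longrightarrow> norm x \<le> R"
  shows "sqi Y.M (periodize R f)"
proof -
  have "sq2 (\<lambda>x. \<Sum>n\<in>lball (R + 3). f (x + n))"
    by (intro sqi_sum sqi_lborel_shift(1) s)
  then have g: "sqi Y.M (\<lambda>x. \<Sum>n\<in>lball (R + 3). f (x + n))" by (rule sqi_lborel_imp_Y)
  show ?thesis
  proof (rule sqi_bound(1)[OF _ g, where C=1])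
    show "periodize R f \<in> borel_measurable Y.M"
      using periodize_measurable sqi_measurable[OF s] by simp
    show "AE x in Y.M. norm (periodize R f x) \<le> 1 * norm (\<Sum>n\<in>lball (R + 3). f (x + n))"
      using Y_AE_cell
    proof eventually_elim
      case (elim x)
      then show ?case using periodize_local[of f R x 3, OF f] cellY_norm[of x] by simp
    qed
  qed simp
qed

text \<open>A test function sees only a ball, and there the periodization is a finite sum of
  translates of w.\<close>

lemma periodize_acl:
  assumes a: "acl j w g" and w: "\<And>x. w x \<noteq> 0 \<Longrightarrow> norm x \<le> R" and g: "\<And>x. g x \<noteq> 0 \<Longrightarrow> norm x \<le> R"
  shows "acl j (periodize R w) (periodize R g)"
proof -
  have s: "acl j (\<lambda>x. \<Sum>n\<in>lball r. w (x + n)) (\<lambda>x. \<Sum>n\<in>lball r. g (x + n))" for r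
    by (intro acl_sum finite_lball acl_shift a)
  have loc: "loc_int (periodize R f)" if f: "\<And>x. f x \<noteq> 0 \<Longrightarrow> norm x \<le> R" and lf: "loc_int f"
    and l: "\<And>r. loc_int (\<lambda>x. \<Sum>n\<in>lball r. f (x + n))" for f :: "vec3 \<Rightarrow> real"
  proof (rule loc_intI)
    show "periodize R f \<in> bmeas" by (rule periodize_measurable[OF loc_int_measurable[OF lf]])
    show "integrable lborel (\<lambda>x. periodize R f x * indicator (cball 0 r) x)" for r
    proof -
      have "(\<lambda>x. periodize R f x * indicator (cball 0 r) x) = (\<lambda>x. (\<Sum>n\<in>lball (R + r). f (x + n)) * indicator (cball 0 r) x)"
        using periodize_local[of f R _ r, OF f] by (auto simp: fun_eq_iff split: split_indicator)
      then show ?thesis using loc_int_cball[OF l[of "R + r"], of r] by simp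
    qed
  qed
  have "wderiv j (periodize R w) (periodize R g)"
    unfolding wderiv_def
  proof (intro conjI allI impI)
    have l: "loc_int w" "loc_int g" using a by (auto simp: acl_def)
    have ls: "loc_int (\<lambda>x. \<Sum>n\<in>lball r. w (x + n))" "loc_int (\<lambda>x. \<Sum>n\<in>lball r. g (x + n))" for r
      using s[of r] by (auto simp: acl_def)
    show "loc_int (periodize R w)" by (rule loc[OF w l(1) ls(1)])
    show "loc_int (periodize R g)" by (rule loc[OF g l(2) ls(2)])
    fix \<phi> assume t: "test_fun \<phi>"
    obtain R1 where R1: "\<And>x. \<phi> x \<noteq> 0 \<Longrightarrow> norm x \<le> R1" using test_fun_cderiv(2)[OF t] by (auto simp: bsupp_def)
    obtain R2 where R2: "\<And>x. dpart [j] \<phi> x \<noteq> 0 \<Longrightarrow> norm x \<le> R2" using test_fun_cderiv(3)[OF t] unfolding bsupp_def by blast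
    let ?r = "max R1 R2"
    have e: "periodize R f x * k x = (\<Sum>n\<in>lball (R + ?r). f (x + n)) * k x"
      if "\<And>x. f x \<noteq> 0 \<Longrightarrow> norm x \<le> R" "k x \<noteq> 0 \<Longrightarrow> norm x \<le> ?r" for f k :: "vec3 \<Rightarrow> real" and x
      using periodize_local[of f R x ?r, OF that(1)] that(2) by (cases "k x = 0") auto
    have "(LBINT x. periodize R w x * dpart [j] \<phi> x) = (LBINT x. (\<Sum>n\<in>lball (R + ?r). w (x + n)) * dpart [j] \<phi> x)"
      by (rule bi_integral_cong[OF refl], rule e[OF w]) (use R2 in \<open>simp_all add: le_max_iff_disj del: dpart.simps\<close>)
    also have "\<dots> = - (LBINT x. (\<Sum>n\<in>lball (R + ?r). g (x + n)) * \<phi> x)"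
      using s[of "R + ?r"] t unfolding wderiv_iff_acl[symmetric] wderiv_def by blast
    also have "(LBINT x. (\<Sum>n\<in>lball (R + ?r). g (x + n)) * \<phi> x) = (LBINT x. periodize R g x * \<phi> x)"
      by (rule bi_integral_cong[OF refl], rule e[OF g, symmetric]) (use R1 in \<open>simp_all add: le_max_iff_disj\<close>)
    finally show "(LBINT x. periodize R w x * dpart [j] \<phi> x) = - (LBINT x. periodize R g x * \<phi> x)" .
  qed
  then show ?thesis by (rule wderiv_imp_acl)
qed

section \<open>Periodic divergence-free fields tested on the whole space\<close>

context
  fixes g :: "vec3 \<Rightarrow> mat3"
  assumes g: "sqi Y.M g" "Y.per g" and zero: "\<And>v H. Y.sob v H \<Longrightarrow> (\<integral>x. g x \<bullet> H x \<partial>Y.M) = 0"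
begin

text \<open>Periodize the field, test on the torus, and unfold the lattice sum: each translate
  contributes the integral over one translated cell, and these cells add up to the whole
  space.\<close>

lemma flux_compact_support:
  assumes w: "sq2 w" and \<Gamma>: "sq2 \<Gamma>" and wg: "weak_grad w \<Gamma>"
    and Rw: "\<And>x. w x \<noteq> 0 \<Longrightarrow> norm x \<le> R" and R\<Gamma>: "\<And>x. \<Gamma> x \<noteq> 0 \<Longrightarrow> norm x \<le> R"
  shows "(LBINT x. g x \<bullet> \<Gamma> x) = 0"
proof -
  have [measurable]: "g \<in> bmeas" "\<Gamma> \<in> bmeas"
    using sqi_measurable[OF g(1)] sqi_measurable[OF \<Gamma>] by simp_all
  have nz: "w x $ i \<noteq> 0 \<Longrightarrow> norm x \<le> R" "\<Gamma> x $ i $ j \<noteq> 0 \<Longrightarrow> norm x \<le> R" for x i j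
    by (metis Rw zero_index, metis R\<Gamma> zero_index)
  have "weak_grad (periodize R w) (periodize R \<Gamma>)"
    unfolding weak_grad_acl periodize_nth using wg[unfolded weak_grad_acl] by (blast intro: periodize_acl nz)
  then have "Y.sob (periodize R w) (periodize R \<Gamma>)"
    unfolding Y.sob_def using periodize_sqi[OF w Rw] periodize_sqi[OF \<Gamma> R\<Gamma>] by (simp add: periodize_per)
  then have "0 = (\<integral>x. g x \<bullet> periodize R \<Gamma> x \<partial>Y.M)" using zero by simp
  let ?F = "lball (R + 3)"
  have si: "sqi Y.M (\<lambda>x. \<Gamma> (x + n))" for n by (rule sqi_lborel_imp_Y[OF sqi_lborel_shift(1)[OF \<Gamma>]])
  note \<open>0 = (\<integral>x. g x \<bullet> periodize R \<Gamma> x \<partial>Y.M)\<close>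
  also have "(\<integral>x. g x \<bullet> periodize R \<Gamma> x \<partial>Y.M) = (\<integral>x. (\<Sum>n\<in>?F. g x \<bullet> \<Gamma> (x + n)) \<partial>Y.M)"
  proof (rule integral_cong_AE)
    show "AE x in Y.M. g x \<bullet> periodize R \<Gamma> x = (\<Sum>n\<in>?F. g x \<bullet> \<Gamma> (x + n))"
      using Y_AE_cell
    proof eventually_elim
      case (elim x)
      then show ?case using periodize_local[of \<Gamma> R x 3, OF R\<Gamma>] cellY_norm[of x] by (simp add: inner_sum_right)
    qed
  qed (use periodize_measurable[of \<Gamma> R] in simp_all)
  also have "\<dots> = (\<Sum>n\<in>?F. \<integral>x. g x \<bullet> \<Gamma> (x + n) \<partial>Y.M)"
    by (rule bi_integral_sum) (rule sqi_integrable_inner[OF g(1) si])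
  also have "\<dots> = (\<Sum>n\<in>?F. LBINT x. indicator cellY (x - n) * (g x \<bullet> \<Gamma> x))"
  proof (rule sum.cong[OF refl])
    fix n assume "n \<in> ?F"
    then have n: "n \<in> lattice" by (simp add: lball_def)
    have "(\<integral>x. g x \<bullet> \<Gamma> (x + n) \<partial>Y.M) = (LBINT x. indicator cellY x * (g x \<bullet> \<Gamma> (x + n)))"
      by (subst Y.integral_M) (simp_all add: set_lebesgue_integral_def)
    also have "\<dots> = (LBINT x. indicator cellY (x + n - n) * (g (x + n) \<bullet> \<Gamma> (x + n)))"
      using g(2) n by (simp add: Y.per_def)
    also have "\<dots> = (LBINT x. indicator cellY (x - n) * (g x \<bullet> \<Gamma> x))"
      by (rule integral_shift[of "\<lambda>x. indicator cellY (x - n) * (g x \<bullet> \<Gamma> x)"]) measurable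
    finally show "(\<integral>x. g x \<bullet> \<Gamma> (x + n) \<partial>Y.M) = (LBINT x. indicator cellY (x - n) * (g x \<bullet> \<Gamma> x))" .
  qed
  also have "\<dots> = (LBINT x. (\<Sum>n\<in>?F. indicator cellY (x - n) * (g x \<bullet> \<Gamma> x)))"
  proof (rule bi_integral_sum[symmetric])
    fix n
    have "sq2 (\<lambda>x. iball R x *\<^sub>R g x)"
      using Y.local_l2[where 'b=mat3, of R] g by blast
    then have i: "integrable lborel (\<lambda>x. (iball R x *\<^sub>R g x) \<bullet> \<Gamma> x)"
      by (rule sqi_integrable_inner[OF _ \<Gamma>])
    have "\<not> norm x \<le> R \<Longrightarrow> \<Gamma> x = 0" for x using R\<Gamma> by blast
    then show "integrable lborel (\<lambda>x. indicator cellY (x - n) * (g x \<bullet> \<Gamma> x))"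
      by (intro bi_integrable_bound[OF i])
        (auto intro!: AE_I2 split: split_indicator)
  qed
  also have "\<dots> = (LBINT x. g x \<bullet> \<Gamma> x)"
  proof (rule bi_integral_cong[OF refl])
    fix x
    show "(\<Sum>n\<in>?F. indicator cellY (x - n) * (g x \<bullet> \<Gamma> x)) = g x \<bullet> \<Gamma> x"
    proof (cases "\<Gamma> x = 0")
      case False
      have lf: "lfloor x \<in> ?F"
        using norm_triangle_ineq[of x "- (x - lfloor x)"] cellY_norm[OF lfloor_cell[of x]] R\<Gamma>[OF False] lfloor_lattice
        by (simp add: lball_def norm_minus_commute)
      have "(\<Sum>n\<in>?F. indicator cellY (x - n)) = (\<Sum>n\<in>?F. if n = lfloor x then 1 else 0 :: real)"
        using lfloor_unique[of _ x] by (intro sum.cong) (auto simp: lball_def split: split_indicator)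
      also have "\<dots> = 1" using lf finite_lball by simp
      finally show ?thesis by (simp add: sum_distrib_right[symmetric])
    qed simp
  qed
  finally show ?thesis by simp
qed

text \<open>The field \<psi> v need not have compact support, so cut-offs are inserted and removed
  by dominated convergence. As \<open>g\<close> itself is not in L2 of the space, the majorants come
  from the hypotheses on its products with \<psi> and \<psi>'.\<close>

proposition flux_identity:
  assumes v: "W.sob v H" and c: "\<And>j. cderiv j \<psi> (\<psi>' j)"
    and B: "\<And>x. \<bar>\<psi> x\<bar> \<le> B" "\<And>j x. \<bar>\<psi>' j x\<bar> \<le> B"
    and s: "sq2 (\<lambda>x. \<psi> x *\<^sub>R g x)" "\<And>j. sq2 (\<lambda>x. \<psi>' j x *\<^sub>R g x)"
  shows "(LBINT x. g x \<bullet> (\<psi> x *\<^sub>R H x)) = - (LBINT x. g x \<bullet> outer (v x) (\<lambda>j. \<psi>' j x))"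
    and "integrable lborel (\<lambda>x. g x \<bullet> (\<psi> x *\<^sub>R H x))" "integrable lborel (\<lambda>x. g x \<bullet> outer (v x) (\<lambda>j. \<psi>' j x))"
proof -
  have vH: "sq2 v" "sq2 H" "weak_grad v H" using v by (auto simp: W.sob_def W_M)
  have cont: "continuous_on UNIV \<psi>" "\<And>j. continuous_on UNIV (\<psi>' j)" using c by (auto simp: cderiv_def)
  have [measurable]: "g \<in> bmeas" "H \<in> bmeas" "v \<in> bmeas"
    using sqi_measurable[OF g(1)] sqi_measurable[OF vH(1)] sqi_measurable[OF vH(2)] by simp_all
  have [measurable]: "\<psi> \<in> bmeas" "\<psi>' j \<in> bmeas" for j
    using cont by (auto intro: borel_measurable_continuous_onI)
  let ?a = "\<lambda>x. g x \<bullet> (\<psi> x *\<^sub>R H x)" and ?b = "\<lambda>x. g x \<bullet> outer (v x) (\<lambda>j. \<psi>' j x)"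
    and ?c = "\<lambda>j x. \<Sum>i\<in>UNIV. (\<psi> x *\<^sub>R g x) $ i $ j * v x $ i"
  have gouter: "g x \<bullet> outer u p = (\<Sum>i\<in>UNIV. \<Sum>j\<in>UNIV. (p j *\<^sub>R g x) $ i $ j * u $ i)" for x u p
    by (simp add: inner_vec_def outer_nth mult_ac)
  show ia: "integrable lborel ?a"
    using sqi_integrable_inner[OF s(1) vH(2)] by simp
  show ib: "integrable lborel ?b"
    unfolding gouter by (intro bi_integrable_sum sqi_integrable_mult sqi_nth s vH)
  have ic: "integrable lborel (?c j)" for j
    by (intro bi_integrable_sum sqi_integrable_mult sqi_nth s vH)
  obtain \<zeta> \<zeta>' C where z: "\<And>n j. cderiv j (\<zeta> n) (\<zeta>' n j)" "\<And>n. bsupp (\<zeta> n)" "\<And>n j. bsupp (\<zeta>' n j)"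
    "\<And>n x. \<bar>\<zeta> n x\<bar> \<le> C" "\<And>n j x. \<bar>\<zeta>' n j x\<bar> \<le> C"
    "\<And>x. (\<lambda>n. \<zeta> n x) \<longlonglongrightarrow> 1" "\<And>j x. (\<lambda>n. \<zeta>' n j x) \<longlonglongrightarrow> 0"
    and [measurable]: "\<And>n. \<zeta> n \<in> bmeas" "\<And>n j. \<zeta>' n j \<in> bmeas"
    by (rule bump_cutoffs) blast
  \<comment> \<open>The product rule gives three terms; the last one carries the derivative of the
    cut-off and disappears in the limit.\<close>
  define T where "T n x = \<zeta> n x * ?a x + (\<zeta> n x * ?b x + (\<Sum>j\<in>UNIV. \<zeta>' n j x * ?c j x))" for n x
  have eq: "(LBINT x. T n x) = 0" for n
  proof -
    let ?p = "\<lambda>x j. \<zeta>' n j x * \<psi> x + \<zeta> n x * \<psi>' j x"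
    let ?G = "\<lambda>x. (\<zeta> n x * \<psi> x) *\<^sub>R H x + outer (v x) (?p x)"
    have bz: "\<bar>\<zeta> n x * \<psi> x\<bar> \<le> C * B" "\<bar>?p x j\<bar> \<le> C * B + C * B" for x j
    proof -
      have C0: "0 \<le> C" by (rule order_trans[OF abs_ge_zero z(4)])
      show 1: "\<bar>\<zeta> n x * \<psi> x\<bar> \<le> C * B" unfolding abs_mult by (intro mult_mono z B C0) simp
      have "\<bar>\<zeta>' n j x * \<psi> x\<bar> \<le> C * B" "\<bar>\<zeta> n x * \<psi>' j x\<bar> \<le> C * B"
        unfolding abs_mult by (intro mult_mono z B C0; simp)+
      then show "\<bar>?p x j\<bar> \<le> C * B + C * B" by linarith
    qed
    have wg: "weak_grad (\<lambda>x. (\<zeta> n x * \<psi> x) *\<^sub>R v x) ?G"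
      by (rule weak_grad_mult[OF vH(3) cderiv_mult[OF z(1) c]])
    have sv: "sq2 (\<lambda>x. (\<zeta> n x * \<psi> x) *\<^sub>R v x)" "sq2 (\<lambda>x. (\<zeta> n x * \<psi> x) *\<^sub>R H x)"
      by (rule sqi_bounded_mult[OF _ _ bz(1)]; use vH in simp)+
    have so: "sq2 (\<lambda>x. outer (v x) (?p x))"
    proof (rule sqi_outer)
      show "sq2 (\<lambda>x. ?p x j * v x $ i)" for i j
        using sqi_bounded_mult[OF sqi_nth[OF vH(1), of i] _ bz(2)[where j=j]] by simp
    qed
    obtain R1 where R1: "\<And>x. \<zeta> n x \<noteq> 0 \<Longrightarrow> norm x \<le> R1" using z(2)[of n] by (auto simp: bsupp_def)
    have "\<exists>R. \<forall>x. \<zeta>' n j x \<noteq> 0 \<longrightarrow> norm x \<le> R" for j using z(3)[of n j] by (simp add: bsupp_def)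
    then obtain R2 where R2: "\<And>j x. \<zeta>' n j x \<noteq> 0 \<Longrightarrow> norm x \<le> R2 j" by metis
    define R where "R = Max (insert R1 (range R2))"
    have R: "R1 \<le> R" "R2 j \<le> R" for j unfolding R_def by (rule Max_ge; simp)+
    have z0: "\<zeta> n x = 0 \<and> (\<forall>j. \<zeta>' n j x = 0)" if "\<not> norm x \<le> R" for x
      using R1[of x] R2[of _ x] R that by (meson order_trans)
    have "(LBINT x. g x \<bullet> ?G x) = 0"
    proof (rule flux_compact_support[OF sv(1) sqi_add[OF sv(2) so] wg, where R=R])
      show "norm x \<le> R" if "(\<zeta> n x * \<psi> x) *\<^sub>R v x \<noteq> 0" for x using z0[of x] that by auto
      show "norm x \<le> R" if "?G x \<noteq> 0" for x
      proof (rule ccontr)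
        assume "\<not> norm x \<le> R"
        with z0[of x] have "?G x = 0" by (simp add: outer_def vec_eq_iff)
        with that show False by simp
      qed
    qed
    moreover have "g x \<bullet> ?G x = T n x" for x
    proof -
      have "g x \<bullet> outer (v x) (?p x) = \<zeta> n x * ?b x + (\<Sum>i\<in>UNIV. \<Sum>j\<in>UNIV. \<zeta>' n j x * ((\<psi> x *\<^sub>R g x) $ i $ j * v x $ i))"
        unfolding gouter by (simp add: sum_distrib_left sum.distrib[symmetric] algebra_simps)
      also have "(\<Sum>i\<in>UNIV. \<Sum>j\<in>UNIV. \<zeta>' n j x * ((\<psi> x *\<^sub>R g x) $ i $ j * v x $ i)) = (\<Sum>j\<in>UNIV. \<zeta>' n j x * ?c j x)"
        by (subst sum.swap) (simp add: sum_distrib_left)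
      finally show ?thesis by (simp add: T_def inner_add_right)
    qed
    ultimately show ?thesis by simp
  qed
  have "(\<lambda>n. LBINT x. T n x) \<longlonglongrightarrow> (LBINT x. ?a x + ?b x)"
  proof (rule integral_dominated_convergence[where w="\<lambda>x. C * \<bar>?a x\<bar> + (C * \<bar>?b x\<bar> + (\<Sum>j\<in>UNIV. C * \<bar>?c j x\<bar>))"])
    have mb: "?a \<in> bmeas" "?b \<in> bmeas" "?c j \<in> bmeas" for j
      using ia ib ic[of j] by auto
    then show "(\<lambda>x. ?a x + ?b x) \<in> borel_measurable lborel" by simp
    show "T n \<in> borel_measurable lborel" for n
      unfolding T_def[abs_def] using mb by simp
    show "integrable lborel (\<lambda>x. C * \<bar>?a x\<bar> + (C * \<bar>?b x\<bar> + (\<Sum>j\<in>UNIV. C * \<bar>?c j x\<bar>)))"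
      by (intro bi_integrable_add bi_integrable_sum integrable_mult_right integrable_abs ia ib ic)
    show "AE x in lborel. (\<lambda>n. T n x) \<longlonglongrightarrow> ?a x + ?b x"
    proof (intro AE_I2)
      fix x
      have "(\<lambda>n. T n x) \<longlonglongrightarrow> 1 * ?a x + (1 * ?b x + (\<Sum>j\<in>UNIV. 0 * ?c j x))"
        unfolding T_def by (intro tendsto_intros z)
      then show "(\<lambda>n. T n x) \<longlonglongrightarrow> ?a x + ?b x" by simp
    qed
    show "AE x in lborel. norm (T n x) \<le> C * \<bar>?a x\<bar> + (C * \<bar>?b x\<bar> + (\<Sum>j\<in>UNIV. C * \<bar>?c j x\<bar>))" for n
    proof (intro AE_I2)
      fix x
      have "\<bar>\<Sum>j\<in>UNIV. \<zeta>' n j x * ?c j x\<bar> \<le> (\<Sum>j\<in>UNIV. C * \<bar>?c j x\<bar>)"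
        by (rule order_trans[OF sum_abs]) (intro sum_mono, unfold abs_mult[of "\<zeta>' n _ x"], intro mult_right_mono z abs_ge_zero)
      moreover have "\<bar>\<zeta> n x * ?a x\<bar> \<le> C * \<bar>?a x\<bar>" "\<bar>\<zeta> n x * ?b x\<bar> \<le> C * \<bar>?b x\<bar>"
        unfolding abs_mult[of "\<zeta> n x"] by (intro mult_right_mono z abs_ge_zero)+
      ultimately show "norm (T n x) \<le> C * \<bar>?a x\<bar> + (C * \<bar>?b x\<bar> + (\<Sum>j\<in>UNIV. C * \<bar>?c j x\<bar>))"
        unfolding T_def real_norm_def by linarith
    qed
  qed
  then have "(LBINT x. ?a x + ?b x) = 0" unfolding eq by (simp add: LIMSEQ_const_iff)
  then show "(LBINT x. ?a x) = - (LBINT x. ?b x)"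
    using ia ib by simp
qed

end

section \<open>The homogenization estimate\<close>

text \<open>Smoothing commutes with translations and does not increase the norm, so it inherits the
  modulus of \<phi>.\<close>

lemma conv_kern_modulus:
  assumes \<phi>: "sq2 \<phi>"
  shows "nl2 (\<lambda>x. conv kern \<phi> (x + s) - conv kern \<phi> x) \<le> nl2 (\<lambda>x. \<phi> (x + s) - \<phi> x)"
proof -
  let ?d = "\<lambda>x. \<phi> (x + s) - \<phi> x"
  have d: "sq2 ?d" using phi_shift(1)[OF \<phi>] \<phi> by (rule sqi_diff)
  have k: "continuous_on UNIV kern" using kern_cderiv(1) by (simp add: cderiv_def)
  have [measurable]: "\<phi> \<in> bmeas" using \<phi> by (rule phi_measurable)
  have i: "integrable lborel (\<lambda>t. kern t * \<phi> (x + t))" for x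
    using integrable_shift[OF conv_integrable[OF k kern_cderiv(2) phi_loc[OF \<phi>], of x], of x]
    by (simp add: add.commute mult.commute)
  have "conv kern ?d x = conv kern \<phi> (x + s) - conv kern \<phi> x" for x
  proof -
    have "conv kern ?d x = (LBINT t. kern t * \<phi> (x + s + t) - kern t * \<phi> (x + t))"
      by (subst conv_shift) (simp_all add: right_diff_distrib add.assoc add.commute[of _ s])
    also have "\<dots> = (LBINT t. kern t * \<phi> (x + s + t)) - (LBINT t. kern t * \<phi> (x + t))"
      by (rule bi_integral_diff[OF i i])
    finally show ?thesis by (simp add: conv_shift)
  qed
  then have "conv kern ?d = (\<lambda>x. conv kern \<phi> (x + s) - conv kern \<phi> x)" by (rule ext)
  then show ?thesis using conv_kern_l2(2)[OF d] by (simp only:)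
qed

lemma W_sobD:
  assumes "W.sob v H" shows "sq2 v" "sq2 H" "weak_grad v H"
  using assms by (auto simp: W.sob_def W_M)

lemma W_sobI: "sq2 v \<Longrightarrow> sq2 H \<Longrightarrow> weak_grad v H \<Longrightarrow> W.sob v H"
  by (simp add: W.sob_def W_M W_per)

lemma norm_unitm: "norm (unitm i j) = 1"
  by (simp add: unitm_def)

context
  fixes A \<nu> assumes ell: "elliptic \<nu> A" and perA: "Y.per A"
begin

text \<open>The fluctuation of the cell stress about its mean, the homogenized stress, given by its
  entries against unit matrices.\<close>

definition flux :: "mat3 \<Rightarrow> vec3 \<Rightarrow> mat3" where
  "flux \<xi> y = (\<chi> i j. tform (A y) (\<xi> + cgrad A \<xi> y) (unitm i j) - hform A \<xi> (unitm i j))"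

lemma flux_inner: "flux \<xi> y \<bullet> \<zeta> = tform (A y) (\<xi> + cgrad A \<xi> y) \<zeta> - hform A \<xi> \<zeta>"
proof -
  have "hform A \<xi> \<zeta> = (\<Sum>i\<in>UNIV. \<Sum>j\<in>UNIV. \<zeta> $ i $ j * hform A \<xi> (unitm i j))"
    by (subst mat_expand[of \<zeta>])
      (simp add: linear_sum[OF hform_linear_right[OF ell perA]] linear_cmul[OF hform_linear_right[OF ell perA]])
  then show ?thesis
    by (subst tform_expand_right)
      (simp add: flux_def inner_vec_def sum_subtractf right_diff_distrib mult.commute)
qed

lemma cgrad_per: "Y.per (cgrad A \<xi>)" "Y.per (cfun A \<xi>)"
  using corrector_solution(1)[OF ell perA, of \<xi>] by (auto simp: Y.sob_def)

lemma flux_per: "Y.per (flux \<xi>)"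
  using cgrad_per(1)[of \<xi>] perA by (simp add: flux_def Y.per_def)

lemma flux_component_integrable:
  "sqi Y.M (\<lambda>y. tform (A y) (\<xi> + cgrad A \<xi> y) \<zeta>)"
proof (rule sqi_bound(1)[OF _ cgrad_sqi(2)[OF ell perA, of \<xi>], where C="norm \<zeta> / \<nu>"])
  show "(\<lambda>y. tform (A y) (\<xi> + cgrad A \<xi> y) \<zeta>) \<in> borel_measurable Y.M"
    using tform_measurable[OF ell, of "\<lambda>y. \<xi> + cgrad A \<xi> y" "\<lambda>y. \<zeta>"] sqi_measurable[OF cgrad_sqi(2)[OF ell perA, of \<xi>]] by simp
  have "\<bar>tform (A y) X \<zeta>\<bar> \<le> norm \<zeta> / \<nu> * norm X" for y X
  proof -
    have "\<bar>tform (A y) X \<zeta>\<bar> \<le> norm (symm X) * norm (symm \<zeta>) / \<nu>" by (rule elliptic_bound[OF ell])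
    also have "\<dots> \<le> norm X * norm \<zeta> / \<nu>"
      using elliptic_pos[OF ell] by (intro divide_right_mono mult_mono norm_symm_le) auto
    finally show ?thesis by (simp add: mult.commute)
  qed
  then show "AE y in Y.M. norm (tform (A y) (\<xi> + cgrad A \<xi> y) \<zeta>) \<le> norm \<zeta> / \<nu> * norm (\<xi> + cgrad A \<xi> y)" by simp
qed (use elliptic_pos[OF ell] in simp)

lemma flux_sqi: "sqi Y.M (flux \<xi>)"
  by (intro sqi_vecI) (simp add: flux_def sqi_diff flux_component_integrable Y_sqi_const)

lemma flux_mean: "(\<integral>y. flux \<xi> y $ i $ j \<partial>Y.M) = 0"
  using Y_sqi_integrable[OF flux_component_integrable] hform_bil[OF ell perA, of \<xi> "unitm i j"] YP.prob_space
  by (simp add: flux_def Y.bil_def)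

text \<open>The cell stress pairs to zero with periodic gradients by the cell equation, and the
  constant homogenized stress does so because periodic gradients have mean zero.\<close>

lemma flux_solenoidal:
  assumes v: "Y.sob v H" shows "(\<integral>y. flux \<xi> y \<bullet> H y \<partial>Y.M) = 0"
proof -
  have H: "sqi Y.M H" using v by (simp add: Y.sob_def)
  have i: "integrable Y.M (\<lambda>y. H y $ i $ j)" for i j
    by (rule Y_sqi_integrable[OF Y.sob_component(4)[OF v]])
  have h: "hform A \<xi> (H y) = (\<Sum>i\<in>UNIV. \<Sum>j\<in>UNIV. H y $ i $ j * hform A \<xi> (unitm i j))" for y
    by (subst mat_expand[of "H y"])
      (simp add: linear_sum[OF hform_linear_right[OF ell perA]] linear_cmul[OF hform_linear_right[OF ell perA]])
  have ih: "integrable Y.M (\<lambda>y. hform A \<xi> (H y))" and zh: "(\<integral>y. hform A \<xi> (H y) \<partial>Y.M) = 0"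
    unfolding h using i torus_gradient_mean_zero[OF v] by simp_all
  have "(\<integral>y. flux \<xi> y \<bullet> H y \<partial>Y.M) = Y.bil A (\<lambda>y. \<xi> + cgrad A \<xi> y) H - 0"
    unfolding flux_inner Y.bil_def zh[symmetric]
    by (rule bi_integral_diff[OF Y.tform_bound_integral(1)[OF ell cgrad_sqi(2)[OF ell perA] H] ih])
  then show ?thesis using corrector_solution(2)[OF ell perA v] by simp
qed

lemma hform_bound: "\<bar>hform A \<xi> \<zeta>\<bar> \<le> norm (symm \<xi>) * norm (symm \<zeta>) / \<nu>"
  using elliptic_bound[OF elliptic_hom[OF ell perA]] by (simp add: tform_hom_tensor[OF ell perA])

text \<open>The two-scale expansion for one scalar factor \<phi>: w is the corrector times the
  smoothed \<psi>. The residual consists of the error \<phi> - \<psi>, the flux paired with \<psi>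
  H, and the part of the gradient of w in which \<psi> is differentiated. All three are of order
  \<omega>; only the L2 norm of w needs the norm of \<phi>.\<close>

lemma corrector_block:
  assumes \<xi>: "norm \<xi> = 1"
  shows "\<exists>c\<ge>0. \<forall>\<phi> \<omega>. sq2 \<phi> \<longrightarrow> (\<forall>s. norm s \<le> 3 \<longrightarrow> nl2 (\<lambda>x. \<phi> (x + s) - \<phi> x) \<le> \<omega>) \<longrightarrow>
    (\<exists>w G. W.sob w G \<and> nl2 w \<le> c * nl2 \<phi> \<and>
      (\<forall>v H. W.sob v H \<longrightarrow>
        \<bar>\<integral>x. \<phi> x * hform A \<xi> (H x) - \<phi> x * tform (A x) \<xi> (H x) - tform (A x) (G x) (H x) \<partial>lborel\<bar> \<le> c * \<omega> * nl2 H))"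
proof -
  define D where "D = (\<Sum>j\<in>UNIV. LBINT s. \<bar>dkern j s\<bar>)"
  have Dj: "(LBINT s. \<bar>dkern j s\<bar>) \<le> D" for j
    unfolding D_def by (rule member_le_sum) simp_all
  have D0: "0 \<le> D" unfolding D_def by (intro sum_nonneg bi_integral_nonneg) simp
  let ?N = "cfun A \<xi>" and ?\<Gamma> = "cgrad A \<xi>"
  have \<nu>: "0 < \<nu>" by (rule elliptic_pos[OF ell])
  define n where "n = l2n Y.M ?N"
  define q where "q = (\<Sum>i\<in>UNIV. \<Sum>j\<in>(UNIV::3 set). l2n Y.M (\<lambda>y. flux \<xi> y $ i $ j))"
  \<comment> \<open>In order: the L2 bound for w, the replacement of \<phi> by \<psi>, the flux
    term, and the derivative of \<psi> inside the gradient of w.\<close>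
  define c where "c = n + 4 / \<nu> + 9 * D * q + 3 * D * n / \<nu>"
  have n0: "0 \<le> n" and q0: "0 \<le> q" by (auto simp: n_def q_def intro!: sum_nonneg)
  have c0: "0 \<le> c" unfolding c_def using n0 q0 D0 \<nu> by auto
  have "\<exists>w G. W.sob w G \<and> nl2 w \<le> c * nl2 \<phi> \<and>
      (\<forall>v H. W.sob v H \<longrightarrow>
        \<bar>\<integral>x. \<phi> x * hform A \<xi> (H x) - \<phi> x * tform (A x) \<xi> (H x) - tform (A x) (G x) (H x) \<partial>lborel\<bar> \<le> c * \<omega> * nl2 H)"
    if \<phi>: "sq2 \<phi>" and \<omega>: "\<And>s. norm s \<le> 3 \<Longrightarrow> nl2 (\<lambda>x. \<phi> (x + s) - \<phi> x) \<le> \<omega>" for \<phi> \<omega>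
  proof -
    have \<omega>0: "0 \<le> \<omega>" by (rule modulus_nonneg[OF \<phi> \<omega>])
    let ?\<rho> = "conv kern \<phi>" and ?\<rho>' = "\<lambda>j x. - conv (dkern j) \<phi> x"
    define \<psi> where "\<psi> = cmean ?\<rho>"
    define \<psi>' where "\<psi>' j = cmean (?\<rho>' j)" for j
    have kc: "continuous_on UNIV kern" "\<And>j. continuous_on UNIV (dkern j)"
      using kern_cderiv(1) unfolding cderiv_def by blast+
    have rc: "cderiv j ?\<rho> (?\<rho>' j)" for j
      by (rule conv_cderiv[OF kern_cderiv(1) kern_cderiv(2) kern_cderiv(3) phi_loc[OF \<phi>]])
    define B where "B = nl2 \<phi> * (nl2 kern + (\<Sum>j\<in>UNIV. nl2 (dkern j)))"
    have B1: "\<bar>?\<rho> x\<bar> \<le> B" for x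
    proof -
      have "\<bar>?\<rho> x\<bar> \<le> nl2 \<phi> * nl2 kern" by (rule conv_bounded[OF \<phi> kc(1) kern_cderiv(2)])
      also have "\<dots> \<le> B" unfolding B_def by (intro mult_left_mono) (simp_all add: sum_nonneg del: dpart.simps)
      finally show ?thesis .
    qed
    have B2: "\<bar>?\<rho>' j x\<bar> \<le> B" for j x
    proof -
      have "\<bar>?\<rho>' j x\<bar> \<le> nl2 \<phi> * nl2 (dkern j)"
        using conv_bounded[OF \<phi> kc(2) kern_cderiv(3), of j x] by (simp del: dpart.simps)
      also have "\<dots> \<le> B" unfolding B_def
        by (intro mult_left_mono add_increasing member_le_sum) (simp_all del: dpart.simps)
      finally show ?thesis .
    qed
    have pc: "cderiv j \<psi> (\<psi>' j)" for j
      unfolding \<psi>_def \<psi>'_def by (rule cmean_cderiv[OF rc B1 B2])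
    have rs: "sq2 ?\<rho>" "nl2 ?\<rho> \<le> nl2 \<phi>" by (rule conv_kern_l2[OF \<phi>])+
    have rs': "sq2 (?\<rho>' j)" "nl2 (?\<rho>' j) \<le> D * \<omega>" for j
    proof -
      show "sq2 (?\<rho>' j)" by (rule conv_dkern_l2(1)[OF \<phi> \<omega>])
      show "nl2 (?\<rho>' j) \<le> D * \<omega>"
        by (rule order_trans[OF conv_dkern_l2(2)[OF \<phi> \<omega>]], assumption) (intro mult_right_mono Dj \<omega>0)
    qed
    have ps: "sq2 \<psi>" unfolding \<psi>_def by (rule cmean_l2(1)[OF rs(1)])
    have psi_phi: "nl2 (\<lambda>x. \<phi> x - \<psi> x) \<le> 2 * \<omega>"
    proof -
      have "nl2 (\<lambda>x. \<psi> x - ?\<rho> x) \<le> \<omega>"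
        unfolding \<psi>_def by (rule cmean_approx[OF rs(1) B1]) (rule order_trans[OF conv_kern_modulus[OF \<phi>] \<omega>])
      moreover have "nl2 (\<lambda>x. ?\<rho> x - \<phi> x) \<le> \<omega>" by (rule conv_kern_approx[OF \<phi> \<omega>])
      moreover have "nl2 (\<lambda>x. \<psi> x - \<phi> x) \<le> nl2 (\<lambda>x. \<psi> x - ?\<rho> x) + nl2 (\<lambda>x. ?\<rho> x - \<phi> x)"
        by (rule l2n_triangle3[OF ps rs(1) \<phi>])
      ultimately show ?thesis by (subst l2n_commute) simp
    qed
    let ?w = "\<lambda>x. \<psi> x *\<^sub>R ?N x"
    let ?O = "\<lambda>x. outer (?N x) (\<lambda>j. \<psi>' j x)"
    let ?G = "\<lambda>x. \<psi> x *\<^sub>R ?\<Gamma> x + ?O x"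
    note N = cgrad_sqi(3)[OF ell perA, of \<xi>] cgrad_per(2)[of \<xi>]
    note Ga = cgrad_sqi(1)[OF ell perA, of \<xi>] cgrad_per(1)[of \<xi>]
    have ws: "sq2 ?w" "nl2 ?w \<le> n * nl2 \<phi>"
    proof -
      show "sq2 ?w" unfolding \<psi>_def by (rule cmean_mult(1)[OF N rs(1)])
      show "nl2 ?w \<le> n * nl2 \<phi>"
        unfolding \<psi>_def n_def by (rule order_trans[OF cmean_mult(2)[OF N rs(1)]]) (intro mult_left_mono rs(2) l2n_nonneg)
    qed
    have gs: "sq2 (\<lambda>x. \<psi> x *\<^sub>R ?\<Gamma> x)" unfolding \<psi>_def by (rule cmean_mult(1)[OF Ga rs(1)])
    have pN: "sq2 (\<lambda>x. \<psi>' j x *\<^sub>R ?N x)" "nl2 (\<lambda>x. \<psi>' j x *\<^sub>R ?N x) \<le> n * (D * \<omega>)" for j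
    proof -
      show "sq2 (\<lambda>x. \<psi>' j x *\<^sub>R ?N x)" unfolding \<psi>'_def by (rule cmean_mult(1)[OF N rs'(1)])
      show "nl2 (\<lambda>x. \<psi>' j x *\<^sub>R ?N x) \<le> n * (D * \<omega>)"
        unfolding \<psi>'_def n_def by (rule order_trans[OF cmean_mult(2)[OF N rs'(1)]]) (intro mult_left_mono rs'(2) l2n_nonneg)
    qed
    have os: "sq2 ?O"
      by (rule sqi_outer) (use sqi_nth[OF pN(1)] in simp)
    have on: "nl2 ?O \<le> 3 * (n * (D * \<omega>))"
    proof (rule power2_le_imp_le)
      have "(nl2 ?O)\<^sup>2 = (\<Sum>i\<in>UNIV. \<Sum>j\<in>UNIV. (nl2 (\<lambda>x. (\<psi>' j x *\<^sub>R ?N x) $ i))\<^sup>2)"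
        by (simp add: l2n_vec_sq[OF os] l2n_vec_sq[OF sqi_nth[OF os]] outer_nth)
      also have "\<dots> = (\<Sum>j\<in>UNIV. \<Sum>i\<in>UNIV. (nl2 (\<lambda>x. (\<psi>' j x *\<^sub>R ?N x) $ i))\<^sup>2)" by (rule sum.swap)
      also have "\<dots> = (\<Sum>j\<in>UNIV. (nl2 (\<lambda>x. \<psi>' j x *\<^sub>R ?N x))\<^sup>2)" by (simp add: l2n_vec_sq[OF pN(1)])
      also have "\<dots> \<le> (\<Sum>j\<in>(UNIV::3 set). (n * (D * \<omega>))\<^sup>2)" by (intro sum_mono power_mono pN(2) l2n_nonneg)
      also have "\<dots> \<le> (3 * (n * (D * \<omega>)))\<^sup>2" by (simp add: power_mult_distrib)
      finally show "(nl2 ?O)\<^sup>2 \<le> (3 * (n * (D * \<omega>)))\<^sup>2" .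
    qed (use n0 D0 \<omega>0 in simp)
    have Gs: "sq2 ?G" by (rule sqi_add[OF gs os])
    have sob: "W.sob ?w ?G"
      by (intro W_sobI ws(1) Gs weak_grad_mult pc) (use corrector_solution(1)[OF ell perA, of \<xi>] in \<open>simp add: Y.sob_def\<close>)
    have est: "\<bar>\<integral>x. \<phi> x * hform A \<xi> (H x) - \<phi> x * tform (A x) \<xi> (H x) - tform (A x) (?G x) (H x) \<partial>lborel\<bar> \<le> c * \<omega> * nl2 H"
      if v: "W.sob v H" for v H
    proof -
      note vH = W_sobD[OF v]
      have [measurable]: "H \<in> bmeas" "\<phi> \<in> bmeas" "\<psi> \<in> bmeas"
        using sqi_measurable[OF vH(2)] sqi_measurable[OF \<phi>] sqi_measurable[OF ps] by simp_all
      let ?k = "\<lambda>x. hform A \<xi> (H x) - tform (A x) \<xi> (H x)"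
      have kb: "\<bar>?k x\<bar> \<le> (2 / \<nu>) * norm (H x)" for x
      proof -
        have s: "norm (symm \<xi>) * norm (symm (H x)) / \<nu> \<le> 1 * norm (H x) / \<nu>"
          using norm_symm_le[of \<xi>] \<xi> \<nu> by (intro divide_right_mono mult_mono norm_symm_le) auto
        have "\<bar>hform A \<xi> (H x)\<bar> \<le> norm (H x) / \<nu>" "\<bar>tform (A x) \<xi> (H x)\<bar> \<le> norm (H x) / \<nu>"
          using order_trans[OF hform_bound s] order_trans[OF elliptic_bound[OF ell] s] by simp_all
        then have "\<bar>?k x\<bar> \<le> norm (H x) / \<nu> + norm (H x) / \<nu>" by linarith
        then show ?thesis by simp
      qed
      have km: "?k \<in> borel_measurable lborel"
        using tform_measurable[OF ell, of "\<lambda>_. \<xi>" H] tform_measurable[OF elliptic_hom[OF ell perA], of "\<lambda>_. \<xi>" H]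
        by (simp add: tform_hom_tensor[OF ell perA])
      have ks: "sq2 ?k" "nl2 ?k \<le> (2 / \<nu>) * nl2 H"
        by (rule sqi_bound(1)[OF km vH(2), where C="2 / \<nu>"]; use kb \<nu> in simp)
          (rule sqi_bound(2)[OF km vH(2)]; use kb \<nu> in simp)
      have pps: "sq2 (\<lambda>x. \<phi> x - \<psi> x)" by (rule sqi_diff[OF \<phi> ps])
      have i1: "integrable lborel (\<lambda>x. (\<phi> x - \<psi> x) * ?k x)" by (rule sqi_integrable_mult[OF pps ks(1)])
      have e1: "\<bar>\<integral>x. (\<phi> x - \<psi> x) * ?k x \<partial>lborel\<bar> \<le> 2 * \<omega> * ((2 / \<nu>) * nl2 H)"
      proof -
        have "\<bar>\<integral>x. (\<phi> x - \<psi> x) * ?k x \<partial>lborel\<bar> \<le> nl2 (\<lambda>x. \<phi> x - \<psi> x) * nl2 ?k"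
          using l2_Cauchy_Schwarz[OF pps ks(1)] by simp
        also have "\<dots> \<le> 2 * \<omega> * ((2 / \<nu>) * nl2 H)"
          by (intro mult_mono psi_phi ks(2)) (use \<omega>0 in auto)
        finally show ?thesis .
      qed
      have fs: "sq2 (\<lambda>x. \<psi> x *\<^sub>R flux \<xi> x)" "sq2 (\<lambda>x. \<psi>' j x *\<^sub>R flux \<xi> x)" for j
        unfolding \<psi>_def \<psi>'_def by (rule cmean_mult(1)[OF flux_sqi flux_per rs(1)], rule cmean_mult(1)[OF flux_sqi flux_per rs'(1)])
      have pB: "\<bar>\<psi> x\<bar> \<le> B" "\<bar>\<psi>' j x\<bar> \<le> B" for x j
      proof -
        have m: "?\<rho> \<in> bmeas" "?\<rho>' j \<in> bmeas"
          using sqi_measurable[OF rs(1)] sqi_measurable[OF rs'(1)[of j]] by (simp_all del: dpart.simps)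
        show "\<bar>\<psi> x\<bar> \<le> B" unfolding \<psi>_def by (rule cmean_bound[OF m(1) B1])
        show "\<bar>\<psi>' j x\<bar> \<le> B" unfolding \<psi>'_def by (rule cmean_bound[OF m(2) B2])
      qed
      note fi = flux_identity[OF flux_sqi flux_per flux_solenoidal v pc pB fs]
      have i2: "integrable lborel (\<lambda>x. flux \<xi> x \<bullet> (\<psi> x *\<^sub>R H x))" by (rule fi(2))
      have e2: "\<bar>\<integral>x. flux \<xi> x \<bullet> (\<psi> x *\<^sub>R H x) \<partial>lborel\<bar> \<le> 9 * D * q * \<omega> * nl2 H"
      proof -
        have ij: "integrable lborel (\<lambda>x. \<psi>' j x * flux \<xi> x $ i $ j * v x $ i)" for i j
          using sqi_integrable_mult[OF sqi_nth[OF sqi_nth[OF fs(2)[of j], of i], of j] sqi_nth[OF vH(1), of i]] by simp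
        have "(LBINT x. flux \<xi> x \<bullet> (\<psi> x *\<^sub>R H x)) = - (LBINT x. flux \<xi> x \<bullet> outer (v x) (\<lambda>j. \<psi>' j x))"
          by (rule fi(1))
        also have "(LBINT x. flux \<xi> x \<bullet> outer (v x) (\<lambda>j. \<psi>' j x)) = (LBINT x. (\<Sum>i\<in>UNIV. \<Sum>j\<in>UNIV. \<psi>' j x * flux \<xi> x $ i $ j * v x $ i))"
          by (simp add: inner_vec_def outer_nth mult_ac)
        also have "\<dots> = (\<Sum>i\<in>UNIV. \<Sum>j\<in>UNIV. LBINT x. \<psi>' j x * flux \<xi> x $ i $ j * v x $ i)"
          using ij by simp
        finally have "\<bar>\<integral>x. flux \<xi> x \<bullet> (\<psi> x *\<^sub>R H x) \<partial>lborel\<bar> \<le> (\<Sum>i\<in>UNIV. \<Sum>j\<in>UNIV. \<bar>\<integral>x. \<psi>' j x * flux \<xi> x $ i $ j * v x $ i \<partial>lborel\<bar>)"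
          by (simp add: order_trans[OF sum_abs sum_mono[OF sum_abs]])
        also have "\<dots> \<le> (\<Sum>i\<in>UNIV. \<Sum>j\<in>UNIV. l2n Y.M (\<lambda>y. flux \<xi> y $ i $ j) * (D * \<omega>) * (9 * nl2 H))"
        proof (intro sum_mono)
          fix i j :: 3
          \<comment> \<open>9 is the 3 of \<open>sob_translation\<close> times the radius 3 of the
            shifts.\<close>
          have c: "nl2 (\<lambda>x. v (x + s) $ i - v x $ i) \<le> 9 * nl2 H" if "norm s \<le> 3" for s
          proof -
            have "nl2 (\<lambda>x. v (x + s) $ i - v x $ i) \<le> nl2 (\<lambda>x. v (x + s) - v x)"
              using l2n_nth[OF sqi_diff[OF sqi_lborel_shift(1)[OF vH(1), of s] vH(1)], of i] by simp
            also have "\<dots> \<le> 3 * norm s * nl2 H" using W.sob_translation[OF v, of s] by (simp add: W_M)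
            also have "\<dots> \<le> 9 * nl2 H" using that by (intro mult_right_mono) auto
            finally show ?thesis .
          qed
          have "\<bar>\<integral>x. \<psi>' j x * flux \<xi> x $ i $ j * v x $ i \<partial>lborel\<bar>
            \<le> l2n Y.M (\<lambda>y. flux \<xi> y $ i $ j) * nl2 (?\<rho>' j) * (9 * nl2 H)"
            unfolding \<psi>'_def
            by (rule cmean_pairing[OF sqi_nth[OF sqi_nth[OF flux_sqi]] Y.per_comp[OF flux_per] flux_mean rs'(1) sqi_nth[OF vH(1)] c])
          also have "\<dots> \<le> l2n Y.M (\<lambda>y. flux \<xi> y $ i $ j) * (D * \<omega>) * (9 * nl2 H)"
            by (intro mult_right_mono mult_left_mono rs'(2)) auto
          finally show "\<bar>\<integral>x. \<psi>' j x * flux \<xi> x $ i $ j * v x $ i \<partial>lborel\<bar> \<le> l2n Y.M (\<lambda>y. flux \<xi> y $ i $ j) * (D * \<omega>) * (9 * nl2 H)" .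
        qed
        also have "\<dots> = 9 * D * q * \<omega> * nl2 H"
          by (simp add: q_def sum_distrib_left sum_distrib_right mult_ac)
        finally show ?thesis .
      qed
      have i3: "integrable lborel (\<lambda>x. tform (A x) (?O x) (H x))"
        using W.tform_bound_integral(1)[OF ell, of ?O H] os vH(2) by (simp add: W_M)
      have e3: "\<bar>\<integral>x. tform (A x) (?O x) (H x) \<partial>lborel\<bar> \<le> 3 * D * n / \<nu> * \<omega> * nl2 H"
      proof -
        have "\<bar>\<integral>x. tform (A x) (?O x) (H x) \<partial>lborel\<bar> \<le> nl2 (\<lambda>x. symm (?O x)) * nl2 (\<lambda>x. symm (H x)) / \<nu>"
          using W.tform_bound_integral(2)[OF ell, of ?O H] os vH(2) by (simp add: W_M W.bil_def)
        also have "\<dots> \<le> (3 * (n * (D * \<omega>))) * nl2 H / \<nu>"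
          using W.l2n_symm_le[OF ell, of ?O] W.l2n_symm_le[OF ell, of H] os vH(2) on \<nu>
          by (intro divide_right_mono mult_mono) (auto simp: W_M intro: order_trans mult_nonneg_nonneg n0 D0 \<omega>0)
        finally show ?thesis by (simp add: mult_ac)
      qed
      \<comment> \<open>Replacing \<phi> by \<psi> in the first two terms costs the error term. The
        terms with undifferentiated \<psi> then combine into minus the flux.\<close>
      have pt: "\<phi> x * hform A \<xi> (H x) - \<phi> x * tform (A x) \<xi> (H x) - tform (A x) (?G x) (H x)
         = (\<phi> x - \<psi> x) * ?k x - flux \<xi> x \<bullet> (\<psi> x *\<^sub>R H x) - tform (A x) (?O x) (H x)" for x
      proof -
        have "tform (A x) (?G x) (H x) = \<psi> x * tform (A x) (?\<Gamma> x) (H x) + tform (A x) (?O x) (H x)"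
          using tform_linear(1)[of "A x" "\<psi> x" "?\<Gamma> x" 1 "?O x" "H x"] by simp
        moreover have "tform (A x) (\<xi> + ?\<Gamma> x) (H x) = tform (A x) \<xi> (H x) + tform (A x) (?\<Gamma> x) (H x)"
          using tform_linear(1)[of "A x" 1 \<xi> 1 "?\<Gamma> x" "H x"] by simp
        ultimately show ?thesis by (simp add: flux_inner algebra_simps)
      qed
      have "(LBINT x. \<phi> x * hform A \<xi> (H x) - \<phi> x * tform (A x) \<xi> (H x) - tform (A x) (?G x) (H x))
        = (LBINT x. (\<phi> x - \<psi> x) * ?k x) - (LBINT x. flux \<xi> x \<bullet> (\<psi> x *\<^sub>R H x)) - (LBINT x. tform (A x) (?O x) (H x))"
        unfolding pt
        by (subst bi_integral_diff[OF bi_integrable_diff[OF i1 i2] i3],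
            subst bi_integral_diff[OF i1 i2], rule refl)
      also have "\<bar>\<dots>\<bar> \<le> 2 * \<omega> * ((2 / \<nu>) * nl2 H) + 9 * D * q * \<omega> * nl2 H + 3 * D * n / \<nu> * \<omega> * nl2 H"
        using e1 e2 e3 by linarith
      also have "\<dots> = (c - n) * \<omega> * nl2 H"
        unfolding c_def by (simp add: field_simps)
      also have "\<dots> \<le> c * \<omega> * nl2 H"
        using n0 \<omega>0 by (intro mult_right_mono) auto
      finally show ?thesis .
    qed
    have "nl2 ?w \<le> c * nl2 \<phi>"
      by (rule order_trans[OF ws(2)], rule mult_right_mono) (use n0 q0 D0 \<nu> in \<open>auto simp: c_def\<close>)
    then show ?thesis using sob est by blast
  qed
  then show ?thesis using c0 by blast
qed

end

lemma W_sob_sum: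
  assumes "finite I" "\<And>i. i \<in> I \<Longrightarrow> W.sob (w i) (G i)"
  shows "W.sob (\<lambda>x. \<Sum>i\<in>I. w i x) (\<lambda>x. \<Sum>i\<in>I. G i x)"
  using assms
proof (induction I rule: finite_induct)
  case empty then show ?case by (simp add: W_sobI weak_grad_acl acl_zero)
next
  case (insert m I)
  then show ?case using W.sob_lincomb[of "w m" "G m" "\<lambda>x. \<Sum>i\<in>I. w i x" "\<lambda>x. \<Sum>i\<in>I. G i x" 1 1] by simp
qed

text \<open>Young's inequality twice: the term in X is absorbed completely, the term in y up to half
  of y^2. The weights are chosen so that both remainders scale like m^2 / r^2.\<close>

lemma energy_absorb:
  fixes X y m r P Q \<nu> :: real
  assumes r: "0 < r" and \<nu>: "0 < \<nu>" and nn: "0 \<le> m"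
    and le: "r\<^sup>2 * (\<nu> / 2) * X\<^sup>2 + y\<^sup>2 \<le> P * m * X + Q / r * m * y"
  shows "y \<le> sqrt (P\<^sup>2 / \<nu> + Q\<^sup>2) * m / r"
proof -
  have 1: "P * m * X \<le> r\<^sup>2 * (\<nu> / 2) * X\<^sup>2 + P\<^sup>2 * m\<^sup>2 / (2 * \<nu> * r\<^sup>2)"
  proof -
    have "0 \<le> (r\<^sup>2 * \<nu> * X - P * m)\<^sup>2 / (2 * \<nu> * r\<^sup>2)" using \<nu> by simp
    also have "\<dots> = r\<^sup>2 * (\<nu> / 2) * X\<^sup>2 - P * m * X + P\<^sup>2 * m\<^sup>2 / (2 * \<nu> * r\<^sup>2)"
      using r \<nu> by (simp add: field_simps power2_eq_square)
    finally show ?thesis by simp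
  qed
  have 2: "Q / r * m * y \<le> y\<^sup>2 / 2 + Q\<^sup>2 * m\<^sup>2 / (2 * r\<^sup>2)"
    using sum_squares_bound[of "Q / r * m" y] by (simp add: power_mult_distrib power_divide)
  have "y\<^sup>2 \<le> P\<^sup>2 * m\<^sup>2 / (\<nu> * r\<^sup>2) + Q\<^sup>2 * m\<^sup>2 / r\<^sup>2"
    using le 1 2 by (simp add: field_simps)
  also have "\<dots> = (sqrt (P\<^sup>2 / \<nu> + Q\<^sup>2) * m / r)\<^sup>2"
    using \<nu> r by (simp add: power_mult_distrib power_divide field_simps)
  finally show ?thesis by (rule power2_le_imp_le) (use \<nu> r nn in simp)
qed

section \<open>A priori bounds for the homogenized problem and the energy estimate\<close>

context
  fixes A \<nu> assumes ell: "elliptic \<nu> A" and perA: "Y.per A"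
begin

abbreviation "ahom \<equiv> (\<lambda>_ :: vec3. hom_tensor A)"

context
  fixes \<tau> :: real and F u0 G0
  assumes \<tau>: "0 < \<tau>" and F: "sq2 F" and u0: "W.sob u0 G0"
    and eq0: "\<And>v H. W.sob v H \<Longrightarrow> \<tau> * W.bil ahom G0 H + (LBINT x. u0 x \<bullet> v x) = (LBINT x. F x \<bullet> v x)"
begin

lemma hom_energy: "\<tau> * (\<nu> / 2) * (nl2 G0)\<^sup>2 \<le> (nl2 F)\<^sup>2"
proof -
  note s = W_sobD[OF u0]
  have k: "\<nu> / 2 * (nl2 G0)\<^sup>2 \<le> W.bil ahom G0 G0"
    using W.korn_bil[OF elliptic_hom[OF ell perA] u0] by (simp add: W_M)
  have "\<tau> * (\<nu> / 2 * (nl2 G0)\<^sup>2) + (nl2 u0)\<^sup>2 \<le> \<tau> * W.bil ahom G0 G0 + (nl2 u0)\<^sup>2"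
    using mult_left_mono[OF k, of \<tau>] \<tau> by simp
  also have "\<dots> = (LBINT x. F x \<bullet> u0 x)" using eq0[OF u0] by (simp add: l2n_sq power2_norm_eq_inner)
  also have "\<dots> \<le> nl2 F * nl2 u0" using l2_Cauchy_Schwarz[OF F s(1)] by simp
  also have "\<dots> \<le> (nl2 F)\<^sup>2 + (nl2 u0)\<^sup>2"
    using sum_squares_bound[of "nl2 F" "nl2 u0"] mult_nonneg_nonneg[OF l2n_nonneg l2n_nonneg, of lborel F lborel u0] by linarith
  finally show ?thesis by (simp add: mult.assoc)
qed

text \<open>\<open>H\<^sup>2\<close> regularity in terms of translations: the increments solve the same equation.\<close>

lemma hom_regularity:
  "nl2 (\<lambda>x. G0 (x + s) - G0 x) \<le> 6 * norm s * nl2 F / (\<nu> * \<tau>)"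
proof -
  note sb = W_sobD[OF u0]
  have ellh: "elliptic \<nu> ahom" by (rule elliptic_hom[OF ell perA])
  have \<nu>: "0 < \<nu>" by (rule elliptic_pos[OF ell])
  let ?u = "\<lambda>x. u0 (x + s) - u0 x" and ?G = "\<lambda>x. G0 (x + s) - G0 x"
  have sh: "W.sob (\<lambda>x. u0 (x + s)) (\<lambda>x. G0 (x + s))" by (rule W.sob_shift[OF u0])
  have w: "W.sob ?u ?G" by (rule W.sob_diff[OF sh u0])
  note ws = W_sobD[OF w] and shs = W_sobD[OF sh]
  have [measurable]: "u0 \<in> bmeas" "G0 \<in> bmeas" "F \<in> bmeas"
    "?u \<in> bmeas" "?G \<in> bmeas"
    using sqi_measurable[OF sb(1)] sqi_measurable[OF sb(2)] sqi_measurable[OF F] sqi_measurable[OF ws(1)] sqi_measurable[OF ws(2)] by simp_all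
  have wm: "W.sob (\<lambda>x. ?u (x + - s)) (\<lambda>x. ?G (x + - s))" by (rule W.sob_shift[OF w])
  note wms = W_sobD[OF wm]
  have m: "(\<lambda>x. tform (hom_tensor A) (G0 x) (?G (x + - s))) \<in> bmeas"
    using tform_measurable[OF ellh, of G0 "\<lambda>x. ?G (x + - s)"] by simp
  \<comment> \<open>The homogenized coefficients are constant, so a shift of the solution can be
    moved to the test function.\<close>
  have "W.bil ahom (\<lambda>x. G0 (x + s)) ?G = W.bil ahom G0 (\<lambda>x. ?G (x + - s))"
    unfolding W.bil_def W_M using integral_shift[OF m, of s] by simp
  moreover have "(LBINT x. u0 (x + s) \<bullet> ?u x) = (LBINT x. u0 x \<bullet> ?u (x + - s))"
    using integral_shift[of "\<lambda>x. u0 x \<bullet> ?u (x + - s)" s] by simp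
  ultimately have e1: "\<tau> * W.bil ahom (\<lambda>x. G0 (x + s)) ?G + (LBINT x. u0 (x + s) \<bullet> ?u x) = (LBINT x. F x \<bullet> ?u (x + - s))"
    using eq0[OF wm] by simp
  have bl: "W.bil ahom ?G ?G = W.bil ahom (\<lambda>x. G0 (x + s)) ?G - W.bil ahom G0 ?G"
    using W.bil_linear[OF ellh, of "\<lambda>x. G0 (x + s)" G0 ?G 1 "-1"] shs(2) sb(2) ws(2) by (simp add: W_M)
  have ul: "(nl2 ?u)\<^sup>2 = (LBINT x. u0 (x + s) \<bullet> ?u x) - (LBINT x. u0 x \<bullet> ?u x)"
    unfolding l2n_sq power2_norm_eq_inner
    by (subst bi_integral_diff[OF sqi_integrable_inner[OF shs(1) ws(1)] sqi_integrable_inner[OF sb(1) ws(1)], symmetric])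
      (simp add: inner_diff_left)
  have "\<tau> * W.bil ahom ?G ?G + (nl2 ?u)\<^sup>2 = (LBINT x. F x \<bullet> ?u (x + - s)) - (LBINT x. F x \<bullet> ?u x)"
    using e1 eq0[OF w] unfolding bl ul by (simp add: algebra_simps)
  also have "\<dots> = (LBINT x. F x \<bullet> (?u (x + - s) - ?u x))"
    by (subst bi_integral_diff[OF sqi_integrable_inner[OF F wms(1)] sqi_integrable_inner[OF F ws(1)], symmetric])
      (simp only: inner_diff_right)
  also have "\<dots> \<le> nl2 F * nl2 (\<lambda>x. ?u (x + - s) - ?u x)"
    using l2_Cauchy_Schwarz[OF F sqi_diff[OF wms(1) ws(1)]] by linarith
  \<comment> \<open>The increment rests on the test function and not on F, so no regularity of F is
    used. It costs one gradient norm, which is divided out below; with the \<nu> / 2 of Korn's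
    inequality the 3 becomes 6.\<close>
  also have "\<dots> \<le> nl2 F * (3 * norm s * nl2 ?G)"
    using W.sob_translation[OF w, of "- s"] by (intro mult_left_mono) (simp_all add: W_M)
  finally have "\<tau> * W.bil ahom ?G ?G + (nl2 ?u)\<^sup>2 \<le> nl2 F * (3 * norm s * nl2 ?G)" .
  moreover have "\<tau> * (\<nu> / 2 * (nl2 ?G)\<^sup>2) \<le> \<tau> * W.bil ahom ?G ?G"
    using W.korn_bil[OF ellh w] \<tau> by (intro mult_left_mono) (simp_all add: W_M)
  ultimately have le: "\<tau> * (\<nu> / 2 * (nl2 ?G)\<^sup>2) \<le> nl2 F * (3 * norm s * nl2 ?G)"
    using zero_le_power2[of "nl2 ?u"] by linarith
  show ?thesis
  proof (cases "nl2 ?G = 0")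
    case True
    then show ?thesis using \<nu> \<tau> by simp
  next
    case False
    then have g: "0 < nl2 ?G" using l2n_nonneg[of lborel ?G] by linarith
    have "(\<tau> * \<nu> / 2 * nl2 ?G) * nl2 ?G \<le> (3 * norm s * nl2 F) * nl2 ?G"
      using le by (simp add: power2_eq_square mult_ac)
    then have "\<tau> * \<nu> / 2 * nl2 ?G \<le> 3 * norm s * nl2 F" using g by simp
    then show ?thesis using \<nu> \<tau> by (simp add: field_simps)
  qed
qed

end

text \<open>The difference u - u0 minus the sum of the corrector terms is tested with itself. The
  constant c0 allows the homogenized problem to have other data F, close to f when tested with H1
  functions; this is where the smoothing operator enters.\<close>

proposition scaled_estimate:
  assumes c0: "0 \<le> c0"
  shows "\<exists>C\<ge>0. \<forall>\<tau> f F u G u0 G0. 0 < \<tau> \<longrightarrow> sq2 f \<longrightarrow> sq2 F \<longrightarrow> nl2 F \<le> nl2 f \<longrightarrow>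
    (\<forall>v H. W.sob v H \<longrightarrow> \<bar>\<integral>x. (f x - F x) \<bullet> v x \<partial>lborel\<bar> \<le> c0 * nl2 f * nl2 H) \<longrightarrow>
    W.sob u G \<longrightarrow> (\<forall>v H. W.sob v H \<longrightarrow> \<tau> * W.bil A G H + (LBINT x. u x \<bullet> v x) = (LBINT x. f x \<bullet> v x)) \<longrightarrow>
    W.sob u0 G0 \<longrightarrow> (\<forall>v H. W.sob v H \<longrightarrow> \<tau> * W.bil ahom G0 H + (LBINT x. u0 x \<bullet> v x) = (LBINT x. F x \<bullet> v x)) \<longrightarrow>
    nl2 (\<lambda>x. u x - u0 x) \<le> C * nl2 f / sqrt \<tau>"
proof -
  have \<nu>: "0 < \<nu>" by (rule elliptic_pos[OF ell])
  let ?R = "\<lambda>p c. 0 \<le> c \<and> (\<forall>\<phi> \<omega>. sq2 \<phi> \<longrightarrow> (\<forall>s. norm s \<le> 3 \<longrightarrow> nl2 (\<lambda>x. \<phi> (x + s) - \<phi> x) \<le> \<omega>) \<longrightarrow>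
    (\<exists>w G. W.sob w G \<and> nl2 w \<le> c * nl2 \<phi> \<and>
      (\<forall>v H. W.sob v H \<longrightarrow>
        \<bar>\<integral>x. \<phi> x * hform A (unitm (fst p) (snd p)) (H x) - \<phi> x * tform (A x) (unitm (fst p) (snd p)) (H x) - tform (A x) (G x) (H x) \<partial>lborel\<bar> \<le> c * \<omega> * nl2 H)))"
  have "\<exists>c. \<forall>p. ?R p (c p)"
    by (intro choice allI corrector_block[OF ell perA norm_unitm])
  then obtain c where c: "\<forall>p. ?R p (c p)" by (rule exE)
  note cp = conjunct1[OF spec[OF c]] and block = conjunct2[OF spec[OF c], rule_format]
  define E where "E p = unitm (fst p) (snd p)" for p :: "3 \<times> 3"
  define K where "K = (\<Sum>p\<in>UNIV. c p)"
  \<comment> \<open>\<open>a\<close> is the constant in the bound a m / r for the gradient of u0. P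
    collects what multiplies the gradient of the test function: c0 from the data, and K times the
    constant 18 / \<nu> of the modulus. Q bounds the corrector terms in L2.\<close>
  define a where "a = sqrt (2 / \<nu>)"
  define P where "P = c0 + 18 * K / \<nu>"
  define Q where "Q = K * a"
  define C where "C = sqrt (P\<^sup>2 / \<nu> + Q\<^sup>2) + Q"
  have K0: "0 \<le> K" unfolding K_def by (intro sum_nonneg cp)
  have a0: "0 \<le> a" using \<nu> by (simp add: a_def)
  have Q0: "0 \<le> Q" unfolding Q_def using K0 a0 by simp
  have C0: "0 \<le> C" unfolding C_def using Q0 \<nu> by simp
  have "nl2 (\<lambda>x. u x - u0 x) \<le> C * nl2 f / sqrt \<tau>"
    if \<tau>: "0 < \<tau>" and f: "sq2 f" and F: "sq2 F" and Ff: "nl2 F \<le> nl2 f"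
    and fF: "\<And>v H. W.sob v H \<Longrightarrow> \<bar>\<integral>x. (f x - F x) \<bullet> v x \<partial>lborel\<bar> \<le> c0 * nl2 f * nl2 H"
    and u: "W.sob u G" and eq: "\<And>v H. W.sob v H \<Longrightarrow> \<tau> * W.bil A G H + (LBINT x. u x \<bullet> v x) = (LBINT x. f x \<bullet> v x)"
    and u0: "W.sob u0 G0" and eq0: "\<And>v H. W.sob v H \<Longrightarrow> \<tau> * W.bil ahom G0 H + (LBINT x. u0 x \<bullet> v x) = (LBINT x. F x \<bullet> v x)"
    for \<tau> f F u G u0 G0
  proof -
    define m where "m = nl2 f"
    define r where "r = sqrt \<tau>"
    have r: "0 < r" "r\<^sup>2 = \<tau>" using \<tau> by (auto simp: r_def)
    have m0: "0 \<le> m" by (simp add: m_def)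
    note s0 = W_sobD[OF u0] and su = W_sobD[OF u]
    have G0n: "nl2 G0 \<le> a / r * m"
    proof (rule power2_le_imp_le)
      have "\<tau> * (\<nu> / 2) * (nl2 G0)\<^sup>2 \<le> m\<^sup>2"
        unfolding m_def by (rule order_trans[OF hom_energy[OF \<tau> F u0 eq0]], assumption) (rule power_mono[OF Ff l2n_nonneg])
      then have "(nl2 G0)\<^sup>2 \<le> 2 / \<nu> * m\<^sup>2 / \<tau>" using \<tau> \<nu> by (simp add: field_simps)
      then show "(nl2 G0)\<^sup>2 \<le> (a / r * m)\<^sup>2"
        using \<nu> r(2) by (simp add: a_def power_mult_distrib power_divide)
    qed (use a0 r m0 in simp)
    \<comment> \<open>The constant 6 of \<open>hom_regularity\<close> times the largest shift
      3.\<close>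
    define \<omega> where "\<omega> = 18 * m / (\<nu> * \<tau>)"
    have reg: "nl2 (\<lambda>x. G0 (x + s) - G0 x) \<le> \<omega>" if s: "norm s \<le> 3" for s
    proof -
      have "6 * norm s * nl2 F \<le> 6 * 3 * m" unfolding m_def
        by (intro mult_mono Ff) (use s in auto)
      then have "6 * norm s * nl2 F / (\<nu> * \<tau>) \<le> \<omega>"
        unfolding \<omega>_def using \<nu> \<tau> by (intro divide_right_mono) auto
      then show ?thesis using hom_regularity[OF \<tau> F u0 eq0, of s] by linarith
    qed
    define \<phi> where "\<phi> p x = symm (G0 x) $ fst p $ snd p" for p x
    have cn: "nl2 (\<lambda>x. symm (X x) $ i $ j) \<le> nl2 X" if X: "sq2 X" for X :: "vec3 \<Rightarrow> mat3" and i j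
    proof -
      have sx: "sq2 (\<lambda>x. symm (X x))" using W.sqi_symm[of X] X by (simp add: W_M)
      have "nl2 (\<lambda>x. symm (X x) $ i $ j) \<le> nl2 (\<lambda>x. symm (X x) $ i)" by (rule l2n_nth[OF sqi_nth[OF sx]])
      also have "\<dots> \<le> nl2 (\<lambda>x. symm (X x))" by (rule l2n_nth[OF sx])
      also have "\<dots> \<le> nl2 X" using W.l2n_symm_le[OF ell, of X] X by (simp add: W_M)
      finally show ?thesis .
    qed
    have ps: "sq2 (\<phi> p)" for p
      unfolding \<phi>_def[abs_def] using W.sqi_symm[of G0] s0(2) by (intro sqi_nth) (simp add: W_M)
    have pn: "nl2 (\<phi> p) \<le> a / r * m" for p
      unfolding \<phi>_def[abs_def] by (rule order_trans[OF cn[OF s0(2)] G0n])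
    have pm: "nl2 (\<lambda>x. \<phi> p (x + s) - \<phi> p x) \<le> \<omega>" if s: "norm s \<le> 3" for p s
    proof -
      have "(\<lambda>x. \<phi> p (x + s) - \<phi> p x) = (\<lambda>x. symm (G0 (x + s) - G0 x) $ fst p $ snd p)"
        by (simp add: \<phi>_def symm_diff)
      then show ?thesis using order_trans[OF cn[OF sqi_diff[OF sqi_lborel_shift(1)[OF s0(2), of s] s0(2)]] reg[OF s]] by simp
    qed
    let ?S = "\<lambda>p w G. W.sob w G \<and> nl2 w \<le> c p * nl2 (\<phi> p) \<and>
      (\<forall>v H. W.sob v H \<longrightarrow>
        \<bar>\<integral>x. \<phi> p x * hform A (E p) (H x) - \<phi> p x * tform (A x) (E p) (H x) - tform (A x) (G x) (H x) \<partial>lborel\<bar> \<le> c p * \<omega> * nl2 H)"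
    have "\<forall>p. \<exists>w G. ?S p w G"
      unfolding E_def by (rule allI, rule block[OF ps pm])
    from choice[OF this] obtain w where "\<forall>p. \<exists>G. ?S p (w p) G" by (rule exE)
    from choice[OF this] obtain Gw where wG: "\<forall>p. ?S p (w p) (Gw p)" by (rule exE)
    note w = conjunct1[OF spec[OF wG]] and wn = conjunct1[OF conjunct2[OF spec[OF wG]]]
      and wb = conjunct2[OF conjunct2[OF spec[OF wG]], rule_format]
    let ?ws = "\<lambda>x. \<Sum>p\<in>UNIV. w p x" and ?Gs = "\<lambda>x. \<Sum>p\<in>UNIV. Gw p x"
    have wsum: "W.sob ?ws ?Gs" by (rule W_sob_sum) (use w in auto)
    note wss = W_sobD[OF wsum] and wp = W_sobD[OF w]
    have wpn: "nl2 (w p) \<le> c p * (a / r * m)" for p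
      by (rule order_trans[OF wn]) (intro mult_left_mono pn cp)
    have wsn: "nl2 ?ws \<le> Q / r * m"
    proof -
      have "nl2 ?ws \<le> (\<Sum>p\<in>UNIV. nl2 (w p))" by (rule l2n_sum) (use wp in auto)
      also have "\<dots> \<le> (\<Sum>p\<in>UNIV. c p * (a / r * m))" by (intro sum_mono wpn)
      also have "\<dots> = K * (a / r * m)" by (simp only: K_def sum_distrib_right)
      also have "\<dots> = Q / r * m" by (simp add: Q_def)
      finally show ?thesis .
    qed
    let ?z = "\<lambda>x. u x - u0 x - ?ws x" and ?Z = "\<lambda>x. G x - G0 x - ?Gs x"
    have z: "W.sob ?z ?Z" by (intro W.sob_diff u u0 wsum)
    note zs = W_sobD[OF z]
    have res: "\<tau> * W.bil A ?Z H + (LBINT x. ?z x \<bullet> v x) \<le> P * m * nl2 H + Q / r * m * nl2 v"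
      if v: "W.sob v H" for v H
    proof -
      note vs = W_sobD[OF v]
      have sE: "sq2 (\<lambda>x. \<phi> p x *\<^sub>R E p)" for p
        by (rule sqi_linear[OF bounded_linear_scaleR_left ps])
      have ti: "integrable lborel (\<lambda>x. tform (A x) (X x) (H x))" if "sq2 X" for X
        using W.tform_bound_integral(1)[OF ell, of X H] that vs(2) by (simp add: W_M)
      have hi: "integrable lborel (\<lambda>x. hform A (X x) (H x))" if "sq2 X" for X
        using W.tform_bound_integral(1)[OF elliptic_hom[OF ell perA], of X H] that vs(2) by (simp add: W_M tform_hom_tensor[OF ell perA])
      let ?t = "\<lambda>p x. \<phi> p x * hform A (E p) (H x) - \<phi> p x * tform (A x) (E p) (H x) - tform (A x) (Gw p x) (H x)"
      have it: "integrable lborel (?t p)" for p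
      proof -
        have "integrable lborel (\<lambda>x. hform A (\<phi> p x *\<^sub>R E p) (H x) - tform (A x) (\<phi> p x *\<^sub>R E p) (H x) - tform (A x) (Gw p x) (H x))"
          by (intro bi_integrable_diff ti hi sE wp)
        then show ?thesis by (simp add: linear_cmul[OF hform_linear_left[OF ell perA]] linear_cmul[OF tform_linear_maps(1)])
      qed
      have ex: "symm (G0 x) = (\<Sum>p\<in>UNIV. \<phi> p x *\<^sub>R E p)" for x
        by (subst mat_expand) (simp add: \<phi>_def E_def sum.cartesian_product case_prod_unfold UNIV_Times_UNIV[symmetric] del: UNIV_Times_UNIV)
      have pt: "hform A (G0 x) (H x) - tform (A x) (G0 x) (H x) - tform (A x) (?Gs x) (H x) = (\<Sum>p\<in>UNIV. ?t p x)" for x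
      proof -
        have "hform A (G0 x) (H x) = hform A (symm (G0 x)) (H x)" by (simp add: hform_symm[OF ell perA])
        also have "\<dots> = (\<Sum>p\<in>UNIV. \<phi> p x * hform A (E p) (H x))"
          unfolding ex by (simp add: linear_sum[OF hform_linear_left[OF ell perA]] linear_cmul[OF hform_linear_left[OF ell perA]])
        finally have 1: "hform A (G0 x) (H x) = (\<Sum>p\<in>UNIV. \<phi> p x * hform A (E p) (H x))" .
        have "tform (A x) (G0 x) (H x) = tform (A x) (symm (G0 x)) (H x)" by simp
        also have "\<dots> = (\<Sum>p\<in>UNIV. \<phi> p x * tform (A x) (E p) (H x))"
          unfolding ex by (simp add: linear_sum[OF tform_linear_maps(1)] linear_cmul[OF tform_linear_maps(1)])
        finally show ?thesis unfolding 1 by (simp add: linear_sum[OF tform_linear_maps(1)] sum_subtractf)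
      qed
      have "W.bil ahom G0 H - W.bil A G0 H - W.bil A ?Gs H = (LBINT x. hform A (G0 x) (H x) - tform (A x) (G0 x) (H x) - tform (A x) (?Gs x) (H x))"
        unfolding W.bil_def W_M tform_hom_tensor[OF ell perA]
        by (subst bi_integral_diff[OF bi_integrable_diff[OF hi[OF s0(2)] ti[OF s0(2)]] ti[OF wss(2)]],
            subst bi_integral_diff[OF hi[OF s0(2)] ti[OF s0(2)]], rule refl)
      also have "\<dots> = (\<Sum>p\<in>UNIV. LBINT x. ?t p x)" unfolding pt by (rule bi_integral_sum[OF it])
      also have "\<dots> \<le> (\<Sum>p\<in>UNIV. c p * \<omega> * nl2 H)"
        by (intro sum_mono order_trans[OF abs_ge_self wb[OF v]])
      also have "\<dots> = K * \<omega> * nl2 H" by (simp add: K_def sum_distrib_right)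
      finally have b1: "W.bil ahom G0 H - W.bil A G0 H - W.bil A ?Gs H \<le> K * \<omega> * nl2 H" .
      \<comment> \<open>Here the factor \<tau> cancels the 1/\<tau> of the modulus, so the residual
        is bounded uniformly in \<tau>.\<close>
      have "\<tau> * (W.bil ahom G0 H - W.bil A G0 H - W.bil A ?Gs H) \<le> \<tau> * (K * \<omega> * nl2 H)"
        by (intro mult_left_mono b1) (use \<tau> in simp)
      also have "\<tau> * (K * \<omega> * nl2 H) = 18 * K / \<nu> * m * nl2 H" using \<tau> by (simp add: \<omega>_def)
      finally have b2: "\<tau> * (W.bil ahom G0 H - W.bil A G0 H - W.bil A ?Gs H) \<le> 18 * K / \<nu> * m * nl2 H" .
      have b3: "- (LBINT x. ?ws x \<bullet> v x) \<le> Q / r * m * nl2 v"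
        using l2_Cauchy_Schwarz[OF wss(1) vs(1)] mult_right_mono[OF wsn l2n_nonneg[of lborel v]] by linarith
      have b4: "(LBINT x. (f x - F x) \<bullet> v x) \<le> c0 * m * nl2 H"
        using fF[OF v] by (simp add: m_def)
      have z1: "W.bil A ?Z H = W.bil A G H - W.bil A G0 H - W.bil A ?Gs H"
      proof -
        have gd: "sq2 (\<lambda>x. G x - G0 x)" by (rule sqi_diff[OF su(2) s0(2)])
        have "W.bil A ?Z H = W.bil A (\<lambda>x. G x - G0 x) H - W.bil A ?Gs H"
          using W.bil_linear[OF ell, of "\<lambda>x. G x - G0 x" ?Gs H 1 "-1"] gd wss(2) vs(2) by (simp add: W_M)
        moreover have "W.bil A (\<lambda>x. G x - G0 x) H = W.bil A G H - W.bil A G0 H"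
          using W.bil_linear[OF ell, of G G0 H 1 "-1"] su(2) s0(2) vs(2) by (simp add: W_M)
        ultimately show ?thesis by simp
      qed
      have z2: "(LBINT x. ?z x \<bullet> v x) = (LBINT x. u x \<bullet> v x) - (LBINT x. u0 x \<bullet> v x) - (LBINT x. ?ws x \<bullet> v x)"
        using sqi_integrable_inner[OF su(1) vs(1)] sqi_integrable_inner[OF s0(1) vs(1)] sqi_integrable_inner[OF wss(1) vs(1)]
        by (simp only: inner_diff_left bi_integral_diff bi_integrable_diff)
      have z3: "(LBINT x. (f x - F x) \<bullet> v x) = (LBINT x. f x \<bullet> v x) - (LBINT x. F x \<bullet> v x)"
        using sqi_integrable_inner[OF f vs(1)] sqi_integrable_inner[OF F vs(1)] by (simp add: inner_diff_left)
      have "\<tau> * W.bil A ?Z H + (LBINT x. ?z x \<bullet> v x)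
        = (LBINT x. (f x - F x) \<bullet> v x) + \<tau> * (W.bil ahom G0 H - W.bil A G0 H - W.bil A ?Gs H) - (LBINT x. ?ws x \<bullet> v x)"
        using eq[OF v] eq0[OF v] unfolding z1 z2 z3 by (simp only: right_diff_distrib)
      also have "\<dots> \<le> c0 * m * nl2 H + 18 * K / \<nu> * m * nl2 H + Q / r * m * nl2 v"
        using b2 b3 b4 by linarith
      also have "\<dots> = P * m * nl2 H + Q / r * m * nl2 v" by (simp add: P_def algebra_simps)
      finally show ?thesis .
    qed
    have "\<tau> * (\<nu> / 2 * (nl2 ?Z)\<^sup>2) + (nl2 ?z)\<^sup>2 \<le> \<tau> * W.bil A ?Z ?Z + (nl2 ?z)\<^sup>2"
      using W.korn_bil[OF ell z] \<tau> by (simp add: W_M mult_left_mono)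
    also have "\<dots> \<le> P * m * nl2 ?Z + Q / r * m * nl2 ?z"
      using res[OF z] by (simp add: l2n_sq power2_norm_eq_inner)
    finally have "r\<^sup>2 * (\<nu> / 2) * (nl2 ?Z)\<^sup>2 + (nl2 ?z)\<^sup>2 \<le> P * m * nl2 ?Z + Q / r * m * nl2 ?z"
      using r(2) by (simp add: mult.assoc)
    from energy_absorb[OF r(1) \<nu> m0 this]
    have zn: "nl2 ?z \<le> sqrt (P\<^sup>2 / \<nu> + Q\<^sup>2) * m / r" .
    have "nl2 (\<lambda>x. u x - u0 x) \<le> nl2 ?z + nl2 ?ws"
      using l2n_triangle[OF zs(1) wss(1)] by simp
    also have "\<dots> \<le> sqrt (P\<^sup>2 / \<nu> + Q\<^sup>2) * m / r + Q / r * m" by (intro add_mono zn wsn)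
    also have "\<dots> = C * nl2 f / sqrt \<tau>" by (simp add: C_def m_def r_def add_divide_distrib distrib_right)
    finally show ?thesis .
  qed
  then show ?thesis using C0 by blast
qed

end

section \<open>The Fourier transform and the smoothing operator\<close>

lemma distr_dilation:
  fixes s :: real assumes "s \<noteq> 0"
  shows "density (distr lborel borel (\<lambda>x::vec3. s *\<^sub>R x)) (\<lambda>_. ennreal (\<bar>s\<bar> ^ 3)) = lborel"
  using lborel_affine[of s "0::vec3"] assms by (simp add: ennreal_power)

lemma nn_integral_dilation:
  fixes f :: "vec3 \<Rightarrow> ennreal"
  assumes s: "s \<noteq> 0" and [measurable]: "f \<in> bmeas"
  shows "(\<integral>\<^sup>+x. f x \<partial>lborel) = ennreal (\<bar>s\<bar> ^ 3) * (\<integral>\<^sup>+x. f (s *\<^sub>R x) \<partial>lborel)"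
  by (subst distr_dilation[OF s, symmetric])
    (simp add: nn_integral_density nn_integral_distr nn_integral_cmult)

lemma integrable_dilation:
  fixes f :: "vec3 \<Rightarrow> 'b::{banach, second_countable_topology}"
  assumes s: "s \<noteq> 0" and f: "integrable lborel f"
  shows "integrable lborel (\<lambda>x. f (s *\<^sub>R x))"
proof -
  have [measurable]: "f \<in> bmeas" using f by auto
  have "integrable (density (distr lborel borel (\<lambda>x::vec3. s *\<^sub>R x)) (\<lambda>_. ennreal (\<bar>s\<bar> ^ 3))) f"
    using f by (simp add: distr_dilation[OF s])
  then have "integrable (distr lborel borel (\<lambda>x::vec3. s *\<^sub>R x)) (\<lambda>x. \<bar>s\<bar> ^ 3 *\<^sub>R f x)"
    by (subst (asm) integrable_density) auto
  then have "integrable lborel (\<lambda>x. \<bar>s\<bar> ^ 3 *\<^sub>R f (s *\<^sub>R x))"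
    by (rule integrable_distr[rotated]) auto
  from integrable_scaleR_right[OF this, of "1 / \<bar>s\<bar> ^ 3"] show ?thesis using s by simp
qed

lemma integral_dilation:
  fixes f :: "vec3 \<Rightarrow> 'b::{banach, second_countable_topology}"
  assumes s: "s \<noteq> 0" and [measurable]: "f \<in> bmeas"
  shows "(LBINT x. f x) = \<bar>s\<bar> ^ 3 *\<^sub>R (LBINT x. f (s *\<^sub>R x))"
proof -
  have "(LBINT x. f x) = (\<integral>x. f x \<partial>density (distr lborel borel (\<lambda>x::vec3. s *\<^sub>R x)) (\<lambda>_. ennreal (\<bar>s\<bar> ^ 3)))"
    by (simp add: distr_dilation[OF s])
  also have "\<dots> = (\<integral>x. \<bar>s\<bar> ^ 3 *\<^sub>R f x \<partial>distr lborel borel (\<lambda>x::vec3. s *\<^sub>R x))"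
    by (rule integral_density) auto
  also have "\<dots> = (LBINT x. \<bar>s\<bar> ^ 3 *\<^sub>R f (s *\<^sub>R x))"
    by (rule integral_distr) auto
  finally show ?thesis by simp
qed

text \<open>\<open>lborel\<close> is the image of the product of one-dimensional Lebesgue measures
  over the basis, so products of one-variable functions factorise.\<close>

lemma has_integral_prod_Basis:
  fixes \<phi> :: "'a::euclidean_space \<Rightarrow> real \<Rightarrow> complex"
  assumes "\<And>b. b \<in> Basis \<Longrightarrow> integrable lborel (\<phi> b)"
  shows "integrable lborel (\<lambda>x. \<Prod>b\<in>Basis. \<phi> b (x \<bullet> b))"
    "(LBINT x. (\<Prod>b\<in>Basis. \<phi> b (x \<bullet> b))) = (\<Prod>b\<in>Basis. LBINT t. \<phi> b t)"
proof -
  interpret product_sigma_finite "\<lambda>_::'a. lborel :: real measure" ..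
  have [measurable]: "b \<in> Basis \<Longrightarrow> \<phi> b \<in> bmeas" for b using assms[of b] by auto
  have m: "(\<lambda>f. \<Sum>b\<in>Basis. f b *\<^sub>R b) \<in> (\<Pi>\<^sub>M b\<in>Basis. lborel) \<rightarrow>\<^sub>M (borel :: 'a measure)"
    by measurable
  have e: "(\<Prod>b\<in>Basis. \<phi> b ((\<Sum>c\<in>Basis. f c *\<^sub>R c) \<bullet> b)) = (\<Prod>b\<in>Basis. \<phi> b (f b))" for f :: "'a \<Rightarrow> real"
    by (intro prod.cong refl) (simp add: inner_sum_left inner_Basis if_distrib cong: if_cong)
  have mb: "(\<lambda>x::'a. \<Prod>b\<in>Basis. \<phi> b (x \<bullet> b)) \<in> bmeas" by measurable
  show "integrable lborel (\<lambda>x. \<Prod>b\<in>Basis. \<phi> b (x \<bullet> b))"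
    by (subst lborel_eq, subst integrable_distr_eq[OF m mb]) (simp add: e product_integrable_prod assms)
  show "(LBINT x. (\<Prod>b\<in>Basis. \<phi> b (x \<bullet> b))) = (\<Prod>b\<in>Basis. LBINT t. \<phi> b t)"
    by (subst lborel_eq, subst integral_distr[OF m mb]) (simp add: e product_integral_prod assms)
qed

text \<open>The characteristic function of the standard normal distribution, with the normalising
  factor sqrt (2 pi) restored.\<close>

lemma gauss_transform_real:
  "integrable lborel (\<lambda>t. exp (- t\<^sup>2 / 2) *\<^sub>R cis (a * t))"
  "(LBINT t. exp (- t\<^sup>2 / 2) *\<^sub>R cis (a * t)) = of_real (sqrt (2 * pi) * exp (- a\<^sup>2 / 2))"
proof -
  have e: "exp (- t\<^sup>2 / 2) *\<^sub>R cis (a * t) = sqrt (2 * pi) *\<^sub>R (std_normal_density t *\<^sub>R iexp (a * t))" for t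
    by (simp add: std_normal_density_def cis_conv_exp)
  have i: "integrable lborel (\<lambda>t. std_normal_density t *\<^sub>R iexp (a * t))"
    by (rule bi_integrable_bound[where f=std_normal_density]) auto
  show "integrable lborel (\<lambda>t. exp (- t\<^sup>2 / 2) *\<^sub>R cis (a * t))"
    unfolding e by (intro integrable_scaleR_right i)
  have "(LBINT t. std_normal_density t *\<^sub>R iexp (a * t)) = char std_normal_distribution a"
    unfolding char_def by (subst integral_density) auto
  then show "(LBINT t. exp (- t\<^sup>2 / 2) *\<^sub>R cis (a * t)) = of_real (sqrt (2 * pi) * exp (- a\<^sup>2 / 2))"
    unfolding e by (simp add: char_std_normal_distribution scaleR_conv_of_real)
qed

definition gauss :: "vec3 \<Rightarrow> real" where "gauss x = exp (- (norm x)\<^sup>2 / 2)"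

lemma gauss_bounds: "0 \<le> gauss x" "gauss x \<le> 1"
  by (auto simp: gauss_def)

lemma gauss_measurable [measurable]: "gauss \<in> bmeas"
  unfolding gauss_def[abs_def] by measurable

lemma gauss_transform:
  "integrable lborel gauss"
  "(LBINT \<xi>. gauss \<xi> * cos (\<xi> \<bullet> z)) = sqrt (2 * pi) ^ 3 * gauss z"
proof -
  have e: "(\<Prod>b\<in>Basis. exp (- (x \<bullet> b)\<^sup>2 / 2) *\<^sub>R cis ((z \<bullet> b) * (x \<bullet> b))) = gauss x *\<^sub>R cis (x \<bullet> z)" for x z :: vec3
  proof -
    have "(\<Prod>b\<in>Basis. exp (- (x \<bullet> b)\<^sup>2 / 2)) = exp (\<Sum>b\<in>Basis. - (x \<bullet> b)\<^sup>2 / 2)" by (simp add: exp_sum)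
    also have "(\<Sum>b\<in>Basis. - (x \<bullet> b)\<^sup>2 / 2) = - (norm x)\<^sup>2 / 2"
      unfolding power2_norm_eq_inner by (subst euclidean_inner) (simp add: power2_eq_square sum_divide_distrib sum_negf)
    finally have 1: "(\<Prod>b\<in>Basis. exp (- (x \<bullet> b)\<^sup>2 / 2)) = gauss x" by (simp add: gauss_def)
    have "(\<Prod>b\<in>Basis. cis ((z \<bullet> b) * (x \<bullet> b))) = cis (\<Sum>b\<in>Basis. (z \<bullet> b) * (x \<bullet> b))"
      by (simp add: cis_conv_exp exp_sum sum_distrib_left)
    also have "(\<Sum>b\<in>Basis. (z \<bullet> b) * (x \<bullet> b)) = x \<bullet> z"
      by (subst (3) euclidean_inner) (simp add: mult.commute)
    finally have 2: "(\<Prod>b\<in>Basis. cis ((z \<bullet> b) * (x \<bullet> b))) = cis (x \<bullet> z)" .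
    show ?thesis using 1 2 by (simp add: scaleR_conv_of_real prod.distrib flip: of_real_prod)
  qed
  note h = has_integral_prod_Basis[where 'a=vec3 and \<phi>="\<lambda>b t. exp (- t\<^sup>2 / 2) *\<^sub>R cis ((z \<bullet> b) * t)" for z,
      OF gauss_transform_real(1), unfolded e gauss_transform_real(2)]
  have p: "(\<Prod>b\<in>Basis. complex_of_real (sqrt (2 * pi) * exp (- (z \<bullet> b)\<^sup>2 / 2))) = of_real (sqrt (2 * pi) ^ 3 * gauss z)"
  proof -
    have "(\<Prod>b\<in>Basis. exp (- (z \<bullet> b)\<^sup>2 / 2)) = exp (\<Sum>b\<in>Basis. - (z \<bullet> b)\<^sup>2 / 2)" by (simp add: exp_sum)
    also have "(\<Sum>b\<in>Basis. - (z \<bullet> b)\<^sup>2 / 2) = - (norm z)\<^sup>2 / 2"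
      unfolding power2_norm_eq_inner by (subst euclidean_inner) (simp add: power2_eq_square sum_divide_distrib sum_negf)
    finally have "(\<Prod>b\<in>Basis. exp (- (z \<bullet> b)\<^sup>2 / 2)) = gauss z" by (simp add: gauss_def)
    then show ?thesis by (simp add: prod.distrib flip: of_real_prod of_real_mult)
  qed
  show g: "integrable lborel gauss"
    using integrable_Re[OF h(1)[of 0]] by simp
  have "(LBINT \<xi>. gauss \<xi> * cos (\<xi> \<bullet> z)) = (LBINT \<xi>. Re (gauss \<xi> *\<^sub>R cis (\<xi> \<bullet> z)))" by simp
  also have "\<dots> = Re (LBINT \<xi>. gauss \<xi> *\<^sub>R cis (\<xi> \<bullet> z))" by (rule integral_Re[OF h(1)])
  also have "\<dots> = sqrt (2 * pi) ^ 3 * gauss z" unfolding h(2) p by simp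
  finally show "(LBINT \<xi>. gauss \<xi> * cos (\<xi> \<bullet> z)) = sqrt (2 * pi) ^ 3 * gauss z" .
qed

lemma gauss_scaled_transform:
  assumes s: "0 < s"
  shows "(LBINT \<xi>. gauss (s *\<^sub>R \<xi>) * cos (\<xi> \<bullet> z)) = sqrt (2 * pi) ^ 3 * gauss ((1 / s) *\<^sub>R z) / s ^ 3"
proof -
  have "sqrt (2 * pi) ^ 3 * gauss ((1 / s) *\<^sub>R z) = (LBINT \<xi>. gauss \<xi> * cos (\<xi> \<bullet> ((1 / s) *\<^sub>R z)))"
    by (simp only: gauss_transform)
  also have "\<dots> = s ^ 3 * (LBINT \<xi>. gauss (s *\<^sub>R \<xi>) * cos (\<xi> \<bullet> z))"
    using s by (subst integral_dilation[of s]) auto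
  finally show ?thesis using s by simp
qed

text \<open>Unnormalised, with a plus sign in the exponent. The inner product of two values is taken
  in the plane, so it is the real part of the Hermitian product, which suits Parseval for real
  functions.\<close>

definition FT :: "(vec3 \<Rightarrow> real) \<Rightarrow> vec3 \<Rightarrow> complex" where
  "FT f \<xi> = (LBINT x. f x *\<^sub>R cis (\<xi> \<bullet> x))"

text \<open>The correlation: its value at 0 is the L2 pairing, and its cosine transform is the inner
  product of the two Fourier transforms.\<close>

definition corr :: "(vec3 \<Rightarrow> real) \<Rightarrow> (vec3 \<Rightarrow> real) \<Rightarrow> vec3 \<Rightarrow> real" where
  "corr f v z = (LBINT y. v y * f (y - z))"

lemma cis_measurable [measurable]: "cis \<in> bmeas"
  by (intro borel_measurable_continuous_onI continuous_intros)

lemma FT_integrable: "integrable lborel f \<Longrightarrow> integrable lborel (\<lambda>x. f x *\<^sub>R cis (\<xi> \<bullet> x))"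
  by (rule bi_integrable_bound[of _ f]) auto

lemma FT_measurable [measurable]:
  assumes [measurable]: "f \<in> bmeas" shows "FT f \<in> bmeas"
  unfolding FT_def[abs_def] by measurable

lemma integral_reflect:
  fixes f :: "vec3 \<Rightarrow> 'b::{banach, second_countable_topology}"
  assumes "f \<in> bmeas"
  shows "(LBINT z. f (y - z)) = (LBINT z. f z)"
  using integral_dilation[of "-1" "\<lambda>x. f (x + y)"] integral_shift[OF assms, of y] assms by simp

text \<open>Applied with k = 1 for integrability, with k a cosine for the transform of the
  correlation, and with k = \<open>K1\<close> for the smoothing operator.\<close>

lemma corr_fubini:
  assumes f: "integrable lborel f" and v: "integrable lborel v"
    and k[measurable]: "k \<in> bmeas" and B: "\<And>x. \<bar>k x\<bar> \<le> B"
  shows "integrable lborel (\<lambda>z. k z * corr f v z)"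
    "(LBINT z. k z * corr f v z) = (LBINT y. v y * (LBINT w. k (y - w) * f w))"
proof -
  have [measurable]: "f \<in> bmeas" "v \<in> bmeas" using f v by auto
  have fr: "integrable lborel (\<lambda>z. f (y - z))" for y
    using integrable_dilation[OF _ integrable_shift[OF f, of y], of "-1"] by simp
  have kf: "integrable lborel (\<lambda>z. k z * f (y - z))" for y
  proof (rule bi_integrable_bound[OF integrable_mult_right[OF fr[of y], of B]])
    show "AE z in lborel. norm (k z * f (y - z)) \<le> norm (B * f (y - z))"
      using B by (auto simp: abs_mult intro!: AE_I2 mult_right_mono intro: order_trans[OF _ abs_ge_self])
  qed measurable
  have J: "integrable (lborel \<Otimes>\<^sub>M lborel) (\<lambda>(y, z). v y * (k z * f (y - z)))"
  proof (rule lborel_pair.Fubini_integrable)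
    show "integrable lborel (\<lambda>y. LBINT z. norm (case (y, z) of (y, z) \<Rightarrow> v y * (k z * f (y - z))))"
    proof (rule bi_integrable_bound[OF integrable_mult_right[OF integrable_abs[OF v], of "B * (LBINT x. \<bar>f x\<bar>)"]])
      have "\<bar>\<integral>z. \<bar>v y * (k z * f (y - z))\<bar> \<partial>lborel\<bar> \<le> \<bar>B * (LBINT x. \<bar>f x\<bar>) * \<bar>v y\<bar>\<bar>" for y
      proof -
        have "(LBINT z. \<bar>v y * (k z * f (y - z))\<bar>) \<le> (LBINT z. (\<bar>v y\<bar> * B) * \<bar>f (y - z)\<bar>)"
          by (rule integral_mono[OF integrable_abs[OF integrable_mult_right[OF kf]] integrable_mult_right[OF integrable_abs[OF fr]]])
            (auto simp: abs_mult mult.assoc intro!: mult_left_mono mult_right_mono B)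
        also have "\<dots> = \<bar>v y\<bar> * B * (LBINT x. \<bar>f x\<bar>)"
          using integral_reflect[of "\<lambda>x. \<bar>f x\<bar>" y] by simp
        finally show ?thesis by (auto simp: algebra_simps intro: order_trans[OF _ abs_ge_self])
      qed
      then show "AE y in lborel. norm (LBINT z. norm (case (y, z) of (y, z) \<Rightarrow> v y * (k z * f (y - z))))
        \<le> norm (B * (LBINT x. \<bar>f x\<bar>) * \<bar>v y\<bar>)" by simp
    qed measurable
    show "AE y in lborel. integrable lborel (\<lambda>z. case (y, z) of (y, z) \<Rightarrow> v y * (k z * f (y - z)))"
      using kf by simp
  qed measurable
  have e: "(LBINT y. v y * (k z * f (y - z))) = k z * corr f v z" for z
    unfolding corr_def by (subst integral_mult_right_zero[symmetric]) (simp add: ac_simps)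
  show "integrable lborel (\<lambda>z. k z * corr f v z)"
    using lborel_pair.integrable_snd[OF J] by (simp add: e)
  have "(LBINT z. k z * corr f v z) = (LBINT y. \<integral>z. v y * (k z * f (y - z)) \<partial>lborel)"
    using lborel_pair.Fubini_integral[OF J] by (simp add: e)
  also have "\<dots> = (LBINT y. v y * (LBINT w. k (y - w) * f w))"
  proof (rule bi_integral_cong[OF refl])
    fix y
    show "(LBINT z. v y * (k z * f (y - z))) = v y * (LBINT w. k (y - w) * f w)"
      using integral_reflect[of "\<lambda>z. k z * f (y - z)" y] by simp
  qed
  finally show "(LBINT z. k z * corr f v z) = (LBINT y. v y * (LBINT w. k (y - w) * f w))" .
qed

lemma corr_integrable: "integrable lborel f \<Longrightarrow> integrable lborel v \<Longrightarrow> integrable lborel (corr f v)"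
  using corr_fubini(1)[of f v "\<lambda>_. 1" 1] by simp

lemma FT_inner:
  assumes f: "integrable lborel f" and v: "integrable lborel v"
  shows "FT f \<xi> \<bullet> FT v \<xi> = (LBINT z. cos (\<xi> \<bullet> z) * corr f v z)"
proof -
  have 1: "FT f \<xi> \<bullet> cis (\<xi> \<bullet> y) = (LBINT w. cos (\<xi> \<bullet> (y - w)) * f w)" for y
  proof -
    have "FT f \<xi> \<bullet> cis (\<xi> \<bullet> y) = (LBINT w. (f w *\<^sub>R cis (\<xi> \<bullet> w)) \<bullet> cis (\<xi> \<bullet> y))"
      unfolding FT_def by (rule integral_inner_left[symmetric]) (rule FT_integrable[OF f])
    then show ?thesis by (simp add: inner_complex_def cos_diff inner_diff_right algebra_simps)
  qed
  have "FT f \<xi> \<bullet> FT v \<xi> = (LBINT y. FT f \<xi> \<bullet> (v y *\<^sub>R cis (\<xi> \<bullet> y)))"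
    unfolding FT_def[of v] by (rule integral_inner_right[symmetric]) (rule FT_integrable[OF v])
  also have "\<dots> = (LBINT y. v y * (LBINT w. cos (\<xi> \<bullet> (y - w)) * f w))"
    by (simp add: 1)
  also have "\<dots> = (LBINT z. cos (\<xi> \<bullet> z) * corr f v z)"
    by (rule corr_fubini(2)[OF f v, symmetric]) (auto intro: abs_cos_le_one)
  finally show ?thesis .
qed

text \<open>A weight in frequency turns into integration of the correlation against the transform of
  the weight. Gaussian weights lead to Parseval's identity, the box weight to the smoothing
  operator.\<close>

lemma FT_weighted:
  assumes f: "integrable lborel f" and v: "integrable lborel v" and m: "integrable lborel m"
  shows "integrable lborel (\<lambda>\<xi>. m \<xi> * (FT f \<xi> \<bullet> FT v \<xi>))"
    "(LBINT \<xi>. m \<xi> * (FT f \<xi> \<bullet> FT v \<xi>)) = (LBINT z. (LBINT \<xi>. m \<xi> * cos (\<xi> \<bullet> z)) * corr f v z)"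
proof -
  note R = corr_integrable[OF f v]
  have [measurable]: "m \<in> bmeas" "corr f v \<in> bmeas" using m R by auto
  have c: "integrable lborel (\<lambda>z. cos (\<xi> \<bullet> z) * corr f v z)" for \<xi>
    by (rule bi_integrable_bound[OF R]) (auto simp: abs_mult intro!: mult_left_le_one_le)
  have J: "integrable (lborel \<Otimes>\<^sub>M lborel) (\<lambda>(\<xi>, z). m \<xi> * (cos (\<xi> \<bullet> z) * corr f v z))"
  proof (rule lborel_pair.Fubini_integrable)
    show "integrable lborel (\<lambda>\<xi>. LBINT z. norm (case (\<xi>, z) of (\<xi>, z) \<Rightarrow> m \<xi> * (cos (\<xi> \<bullet> z) * corr f v z)))"
    proof (rule bi_integrable_bound[OF integrable_mult_right[OF integrable_abs[OF m], of "LBINT x. \<bar>corr f v x\<bar>"]])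
      have "\<bar>\<integral>z. \<bar>m \<xi> * (cos (\<xi> \<bullet> z) * corr f v z)\<bar> \<partial>lborel\<bar> \<le> \<bar>(LBINT x. \<bar>corr f v x\<bar>) * \<bar>m \<xi>\<bar>\<bar>" for \<xi>
      proof -
        have "(LBINT z. \<bar>m \<xi> * (cos (\<xi> \<bullet> z) * corr f v z)\<bar>) \<le> (LBINT z. \<bar>m \<xi>\<bar> * \<bar>corr f v z\<bar>)"
          by (rule integral_mono[OF integrable_abs[OF integrable_mult_right[OF c]] integrable_mult_right[OF integrable_abs[OF R]]])
            (auto simp: abs_mult intro!: mult_left_mono mult_left_le_one_le)
        then show ?thesis by (simp add: mult.commute abs_mult)
      qed
      then show "AE \<xi> in lborel. norm (LBINT z. norm (case (\<xi>, z) of (\<xi>, z) \<Rightarrow> m \<xi> * (cos (\<xi> \<bullet> z) * corr f v z)))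
        \<le> norm ((LBINT x. \<bar>corr f v x\<bar>) * \<bar>m \<xi>\<bar>)" by simp
    qed measurable
    show "AE \<xi> in lborel. integrable lborel (\<lambda>z. case (\<xi>, z) of (\<xi>, z) \<Rightarrow> m \<xi> * (cos (\<xi> \<bullet> z) * corr f v z))"
      using c by simp
  qed measurable
  have e: "(LBINT z. m \<xi> * (cos (\<xi> \<bullet> z) * corr f v z)) = m \<xi> * (FT f \<xi> \<bullet> FT v \<xi>)" for \<xi>
    by (simp add: FT_inner[OF f v])
  show "integrable lborel (\<lambda>\<xi>. m \<xi> * (FT f \<xi> \<bullet> FT v \<xi>))"
    using lborel_pair.integrable_fst[OF J] unfolding e .
  have "(LBINT \<xi>. m \<xi> * (FT f \<xi> \<bullet> FT v \<xi>)) = (LBINT z. \<integral>\<xi>. m \<xi> * (cos (\<xi> \<bullet> z) * corr f v z) \<partial>lborel)"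
    using lborel_pair.Fubini_integral[OF J] unfolding e by simp
  then show "(LBINT \<xi>. m \<xi> * (FT f \<xi> \<bullet> FT v \<xi>)) = (LBINT z. (LBINT \<xi>. m \<xi> * cos (\<xi> \<bullet> z)) * corr f v z)"
    by (simp only: mult.assoc[symmetric] integral_mult_left_zero)
qed

lemma sqi_lborel_reflect:
  assumes "sq2 f" shows "sq2 (\<lambda>w. f (x - w :: vec3))"
  unfolding sqi_def
proof
  have [measurable]: "f \<in> bmeas" using assms by auto
  show "(\<lambda>w. f (x - w)) \<in> borel_measurable lborel" by measurable
  show "integrable lborel (\<lambda>w. (norm (f (x - w)))\<^sup>2)"
    using integrable_dilation[OF _ integrable_shift[OF sqi_integrable_sq[OF assms], of x], of "-1"] by simp
qed

lemma corr_le: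
  assumes f: "sq2 f" and v: "sq2 v"
  shows "\<bar>corr f v z\<bar> \<le> nl2 f * nl2 v"
  using l2_Cauchy_Schwarz[OF v sqi_lborel_shift(1)[OF f, of "-z"]] sqi_lborel_shift(2)[OF f, of "-z"]
  by (simp add: corr_def mult.commute)

lemma corr_tendsto:
  assumes f: "sq2 f" and v: "sq2 v" and h: "h \<longlonglongrightarrow> 0"
  shows "(\<lambda>n. corr f v (h n)) \<longlonglongrightarrow> (LBINT x. f x * v x)"
proof -
  have "(\<lambda>n. - h n) \<longlonglongrightarrow> 0" using tendsto_minus[OF h] by simp
  then have "(\<lambda>n. nl2 (\<lambda>x. f (x + - h n) - f x)) \<longlonglongrightarrow> 0"
    using W.translation_continuous[of f "\<lambda>n. - h n"] f by (simp add: W_M W_per)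
  from l2_inner_tendsto[where f="\<lambda>_. v" and f'=v, OF v v _ sqi_lborel_shift(1)[OF f] f this]
  show ?thesis by (simp add: corr_def l2n_def mult.commute)
qed

abbreviation gc :: real where "gc \<equiv> sqrt (2 * pi) ^ 3"

lemma gauss_integral: "(LBINT x. gauss x) = gc"
  using gauss_transform(2)[of 0] by (simp add: gauss_def)

context
  fixes f v :: "vec3 \<Rightarrow> real"
  assumes f: "integrable lborel f" "sq2 f" and v: "integrable lborel v" "sq2 v"
begin

lemma gauss_corr_integrable: "integrable lborel (\<lambda>h. gauss h * corr f v (s *\<^sub>R h))"
proof (rule bi_integrable_bound[OF integrable_mult_right[OF gauss_transform(1), of "nl2 f * nl2 v"]])
  have [measurable]: "corr f v \<in> bmeas" using corr_integrable[OF f(1) v(1)] by auto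
  show "(\<lambda>h. gauss h * corr f v (s *\<^sub>R h)) \<in> borel_measurable lborel" by measurable
  show "AE h in lborel. norm (gauss h * corr f v (s *\<^sub>R h)) \<le> norm (nl2 f * nl2 v * gauss h)"
    using mult_left_mono[OF corr_le[OF f(2) v(2)] gauss_bounds(1)] by (simp add: abs_mult gauss_bounds mult.commute)
qed

text \<open>The weight makes the frequency integral absolutely convergent; on the other side it
  becomes a Gaussian average of the correlation that concentrates at 0 as s tends to 0.\<close>

lemma FT_gauss:
  assumes s: "0 < s"
  shows "integrable lborel (\<lambda>\<xi>. gauss (s *\<^sub>R \<xi>) * (FT f \<xi> \<bullet> FT v \<xi>))"
    "(LBINT \<xi>. gauss (s *\<^sub>R \<xi>) * (FT f \<xi> \<bullet> FT v \<xi>)) = gc * (LBINT h. gauss h * corr f v (s *\<^sub>R h))"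
proof -
  have gi: "integrable lborel (\<lambda>\<xi>. gauss (s *\<^sub>R \<xi>))"
    using integrable_dilation[OF _ gauss_transform(1), of s] s by simp
  note w = FT_weighted[OF f(1) v(1) gi]
  have [measurable]: "corr f v \<in> bmeas" using corr_integrable[OF f(1) v(1)] by auto
  show "integrable lborel (\<lambda>\<xi>. gauss (s *\<^sub>R \<xi>) * (FT f \<xi> \<bullet> FT v \<xi>))" by (rule w(1))
  have "(LBINT \<xi>. gauss (s *\<^sub>R \<xi>) * (FT f \<xi> \<bullet> FT v \<xi>))
    = (LBINT z. (gc * gauss ((1 / s) *\<^sub>R z) / s ^ 3) * corr f v z)"
    unfolding w(2) gauss_scaled_transform[OF s] ..
  also have "\<dots> = s ^ 3 * (LBINT h. gc / s ^ 3 * (gauss h * corr f v (s *\<^sub>R h)))"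
    using s by (subst integral_dilation[of s]) (auto simp: mult.assoc)
  also have "\<dots> = gc * (LBINT h. gauss h * corr f v (s *\<^sub>R h))"
    unfolding integral_mult_right_zero using s by simp
  finally show "(LBINT \<xi>. gauss (s *\<^sub>R \<xi>) * (FT f \<xi> \<bullet> FT v \<xi>)) = gc * (LBINT h. gauss h * corr f v (s *\<^sub>R h))" .
qed

end

definition rs :: "nat \<Rightarrow> real" where "rs n = inverse (real (Suc n))"

lemma rs: "0 < rs n" "rs \<longlonglongrightarrow> 0"
  unfolding rs_def[abs_def] by (simp, rule LIMSEQ_inverse_real_of_nat)

lemma gauss_rs_tendsto: "(\<lambda>n. gauss (rs n *\<^sub>R x)) \<longlonglongrightarrow> 1"
proof -
  have "(\<lambda>n. exp (- (norm (rs n *\<^sub>R x))\<^sup>2 / 2)) \<longlonglongrightarrow> exp (- (norm (0 *\<^sub>R x))\<^sup>2 / 2)"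
    by (intro tendsto_intros rs) simp
  then show ?thesis by (simp add: gauss_def)
qed

text \<open>The Gaussian weight is removed by Fatou, since the correlation is bounded by the product
  of the norms. The resulting membership in L2 supplies the majorant for
  \<open>FT_parseval\<close>.\<close>

lemma FT_bessel:
  assumes f: "integrable lborel f" "sq2 f"
  shows "sq2 (FT f)" "nl2 (FT f) \<le> gc * nl2 f"
proof -
  have [measurable]: "f \<in> bmeas" using f by auto
  let ?g = "\<lambda>n \<xi>. sqrt (gauss (rs n *\<^sub>R \<xi>)) *\<^sub>R FT f \<xi>"
  have sq: "(norm (?g n \<xi>))\<^sup>2 = gauss (rs n *\<^sub>R \<xi>) * (FT f \<xi> \<bullet> FT f \<xi>)" for n \<xi>
    by (simp add: power_mult_distrib gauss_bounds power2_norm_eq_inner)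
  have s: "sq2 (?g n)" for n
    unfolding sqi_def sq using FT_gauss(1)[OF f f rs(1)[of n]] by simp
  have b: "nl2 (?g n) \<le> gc * nl2 f" for n
  proof (rule power2_le_imp_le)
    have "(nl2 (?g n))\<^sup>2 = gc * (LBINT h. gauss h * corr f f (rs n *\<^sub>R h))"
      unfolding l2n_sq sq by (rule FT_gauss(2)[OF f f rs(1)])
    also have "\<dots> \<le> gc * (LBINT h. gauss h * (nl2 f * nl2 f))"
      by (intro mult_left_mono integral_mono gauss_corr_integrable[OF f f] integrable_mult_left gauss_transform(1)
          gauss_bounds order_trans[OF abs_ge_self corr_le[OF f(2) f(2)]]) simp
    also have "\<dots> = (gc * nl2 f)\<^sup>2"
      by (simp add: gauss_integral power2_eq_square)
    finally show "(nl2 (?g n))\<^sup>2 \<le> (gc * nl2 f)\<^sup>2" .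
  qed simp
  have l: "(\<lambda>n. ?g n \<xi>) \<longlonglongrightarrow> FT f \<xi>" for \<xi>
  proof -
    have "(\<lambda>n. ?g n \<xi>) \<longlonglongrightarrow> sqrt 1 *\<^sub>R FT f \<xi>" by (intro tendsto_intros gauss_rs_tendsto)
    then show ?thesis by simp
  qed
  have l': "AE \<xi> in lborel. (\<lambda>n. ?g n \<xi>) \<longlonglongrightarrow> FT f \<xi>" using l by simp
  have m: "FT f \<in> borel_measurable lborel" by simp
  show "sq2 (FT f)" "nl2 (FT f) \<le> gc * nl2 f"
    by (rule sqi_fatou[OF s b l' m])+
qed

text \<open>Both sides are limits as the Gaussian weight tends to 1, on the right by continuity of
  the correlation at 0. One factor \<open>gc\<close> comes from the transform of the Gaussian, the
  other from its mass.\<close>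

lemma FT_parseval:
  assumes f: "integrable lborel f" "sq2 f" and v: "integrable lborel v" "sq2 v"
  shows "(LBINT \<xi>. FT f \<xi> \<bullet> FT v \<xi>) = gc\<^sup>2 * (LBINT x. f x * v x)"
proof (rule LIMSEQ_unique)
  note i = sqi_integrable_inner[OF FT_bessel(1)[OF f] FT_bessel(1)[OF v]]
  have [measurable]: "f \<in> bmeas" "v \<in> bmeas" using f v by auto
  have [measurable]: "corr f v \<in> bmeas" using corr_integrable[OF f(1) v(1)] by auto
  show "(\<lambda>n. LBINT \<xi>. gauss (rs n *\<^sub>R \<xi>) * (FT f \<xi> \<bullet> FT v \<xi>)) \<longlonglongrightarrow> (LBINT \<xi>. FT f \<xi> \<bullet> FT v \<xi>)"
  proof (rule integral_dominated_convergence[where w="\<lambda>\<xi>. \<bar>FT f \<xi> \<bullet> FT v \<xi>\<bar>"])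
    show "AE \<xi> in lborel. (\<lambda>n. gauss (rs n *\<^sub>R \<xi>) * (FT f \<xi> \<bullet> FT v \<xi>)) \<longlonglongrightarrow> FT f \<xi> \<bullet> FT v \<xi>"
      using tendsto_mult_right[OF gauss_rs_tendsto] by (intro AE_I2) simp
    show "AE \<xi> in lborel. norm (gauss (rs n *\<^sub>R \<xi>) * (FT f \<xi> \<bullet> FT v \<xi>)) \<le> \<bar>FT f \<xi> \<bullet> FT v \<xi>\<bar>" for n
      by (auto simp: abs_mult gauss_bounds intro!: AE_I2 mult_left_le_one_le)
  qed (use i in simp_all)
  have "(\<lambda>n. gc * (LBINT h. gauss h * corr f v (rs n *\<^sub>R h))) \<longlonglongrightarrow> gc * (LBINT h. gauss h * (LBINT x. f x * v x))"
  proof (intro tendsto_mult tendsto_const integral_dominated_convergence[where w="\<lambda>h. gauss h * (nl2 f * nl2 v)"])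
    show "AE h in lborel. (\<lambda>n. gauss h * corr f v (rs n *\<^sub>R h)) \<longlonglongrightarrow> gauss h * (LBINT x. f x * v x)"
    proof (intro AE_I2 tendsto_mult tendsto_const corr_tendsto f v)
      show "(\<lambda>n. rs n *\<^sub>R h) \<longlonglongrightarrow> 0" for h :: vec3 using tendsto_scaleR[OF rs(2) tendsto_const, of h] by simp
    qed
    show "AE h in lborel. norm (gauss h * corr f v (rs n *\<^sub>R h)) \<le> gauss h * (nl2 f * nl2 v)" for n
      using mult_left_mono[OF corr_le[OF f(2) v(2)] gauss_bounds(1)] by (simp add: abs_mult gauss_bounds)
  qed (use gauss_transform(1) in simp_all)
  then show "(\<lambda>n. LBINT \<xi>. gauss (rs n *\<^sub>R \<xi>) * (FT f \<xi> \<bullet> FT v \<xi>)) \<longlonglongrightarrow> gc\<^sup>2 * (LBINT x. f x * v x)"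
    unfolding FT_gauss(2)[OF f v rs(1)] by (simp add: gauss_integral power2_eq_square mult.assoc)
qed

text \<open>Integration by parts against cut-offs that tend to 1 while their derivatives tend to 0
  boundedly.\<close>

lemma acl_integral_zero:
  assumes a: "acl j w g" and w: "integrable lborel w" and g: "integrable lborel g"
  shows "(LBINT x. g x) = 0"
proof -
  obtain \<zeta> :: "nat \<Rightarrow> vec3 \<Rightarrow> real" and \<zeta>' :: "nat \<Rightarrow> 3 \<Rightarrow> vec3 \<Rightarrow> real" and B :: real where z:
    "\<And>n j. cderiv j (\<zeta> n) (\<zeta>' n j)" "\<And>n. bsupp (\<zeta> n)" "\<And>n j. bsupp (\<zeta>' n j)"
    "\<And>n x. \<bar>\<zeta> n x\<bar> \<le> B" "\<And>n j x. \<bar>\<zeta>' n j x\<bar> \<le> B"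
    "\<And>x. (\<lambda>n. \<zeta> n x) \<longlonglongrightarrow> 1" "\<And>j x. (\<lambda>n. \<zeta>' n j x) \<longlonglongrightarrow> 0"
    and [measurable]: "\<And>n. \<zeta> n \<in> bmeas" "\<And>n j. \<zeta>' n j \<in> bmeas"
    by (rule bump_cutoffs) blast
  have [measurable]: "w \<in> bmeas" "g \<in> bmeas" using w g by auto
  have lim: "(\<lambda>n. LBINT x. p x * \<eta> n x) \<longlonglongrightarrow> (LBINT x. p x * l)"
    if p: "integrable lborel p" and [measurable]: "\<And>n. \<eta> n \<in> bmeas"
      and b: "\<And>n x. \<bar>\<eta> n x\<bar> \<le> B" and l: "\<And>x. (\<lambda>n. \<eta> n x) \<longlonglongrightarrow> l" for p :: "vec3 \<Rightarrow> real" and \<eta> l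
  proof (rule integral_dominated_convergence[where w="\<lambda>x. \<bar>p x\<bar> * B"])
    have [measurable]: "p \<in> bmeas" using p by auto
    show "(\<lambda>x. p x * l) \<in> borel_measurable lborel" "\<And>n. (\<lambda>x. p x * \<eta> n x) \<in> borel_measurable lborel" by measurable
    show "integrable lborel (\<lambda>x. \<bar>p x\<bar> * B)" using p by simp
    show "AE x in lborel. norm (p x * \<eta> n x) \<le> \<bar>p x\<bar> * B" for n using b by (simp add: abs_mult mult_left_mono)
  qed (intro AE_I2 tendsto_mult tendsto_const l)
  have "(\<lambda>n. LBINT x. w x * \<zeta>' n j x) \<longlonglongrightarrow> (LBINT x. w x * 0)"
    by (rule lim[OF w _ z(5) z(7)]) measurable
  moreover have "(\<lambda>n. - (LBINT x. g x * \<zeta> n x)) \<longlonglongrightarrow> - (LBINT x. g x * 1)"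
    by (intro tendsto_minus lim[OF g _ z(4) z(6)]) measurable
  ultimately show ?thesis
    using LIMSEQ_unique unfolding acl_by_parts[OF a z(1-3)] by fastforce
qed

text \<open>The derivatives of cos (\<xi> . x) v and sin (\<xi> . x) v integrate to zero, which
  relates real and imaginary parts crosswise. Only the modulus is kept, as this is all the frequency
  estimate uses.\<close>

lemma FT_derivative:
  assumes a: "acl j v g" and v: "integrable lborel v" and g: "integrable lborel g"
  shows "norm (FT g \<xi>) = \<bar>\<xi> $ j\<bar> * norm (FT v \<xi>)"
proof -
  have [measurable]: "v \<in> bmeas" "g \<in> bmeas" using v g by auto
  have ax: "\<xi> \<bullet> axis j 1 = \<xi> $ j" by (simp add: inner_axis)
  have D: "((\<lambda>s. \<xi> \<bullet> (x + s *\<^sub>R axis j 1)) has_real_derivative \<xi> $ j) (at 0)" for x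
    by (auto intro!: derivative_eq_intros simp: inner_add_right ax)
  have c: "cderiv j (\<lambda>x. cos (\<xi> \<bullet> x)) (\<lambda>x. - (\<xi> $ j) * sin (\<xi> \<bullet> x))"
    unfolding cderiv_def by (auto intro!: continuous_intros derivative_eq_intros simp: inner_add_right ax)
  have s: "cderiv j (\<lambda>x. sin (\<xi> \<bullet> x)) (\<lambda>x. \<xi> $ j * cos (\<xi> \<bullet> x))"
    unfolding cderiv_def by (auto intro!: continuous_intros derivative_eq_intros simp: inner_add_right ax)
  have i: "integrable lborel (\<lambda>x. cos (\<xi> \<bullet> x) * p x)" "integrable lborel (\<lambda>x. sin (\<xi> \<bullet> x) * p x)"
    if p: "integrable lborel p" for p :: "vec3 \<Rightarrow> real"
  proof -
    have [measurable]: "p \<in> bmeas" using p by auto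
    show "integrable lborel (\<lambda>x. cos (\<xi> \<bullet> x) * p x)" "integrable lborel (\<lambda>x. sin (\<xi> \<bullet> x) * p x)"
      by (rule bi_integrable_bound[OF p]; simp add: abs_mult mult_left_le_one_le)+
  qed
  have RI: "Re (FT p \<xi>) = (LBINT x. cos (\<xi> \<bullet> x) * p x)" "Im (FT p \<xi>) = (LBINT x. sin (\<xi> \<bullet> x) * p x)"
    if p: "integrable lborel p" for p
    unfolding FT_def integral_Re[OF FT_integrable[OF p], symmetric] integral_Im[OF FT_integrable[OF p], symmetric]
    by (simp_all add: mult.commute)
  have "(LBINT x. cos (\<xi> \<bullet> x) * g x + - (\<xi> $ j) * sin (\<xi> \<bullet> x) * v x) = 0"
    by (rule acl_integral_zero[OF acl_mult[OF a c] i(1)[OF v]]) (simp add: mult.assoc i v g)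
  then have 1: "Re (FT g \<xi>) = \<xi> $ j * Im (FT v \<xi>)"
    unfolding RI[OF v] RI[OF g] by (simp add: mult.assoc i v g)
  have "(LBINT x. sin (\<xi> \<bullet> x) * g x + \<xi> $ j * cos (\<xi> \<bullet> x) * v x) = 0"
    by (rule acl_integral_zero[OF acl_mult[OF a s] i(2)[OF v]]) (simp add: mult.assoc i v g)
  then have 2: "Im (FT g \<xi>) = - (\<xi> $ j * Re (FT v \<xi>))"
    unfolding RI[OF v] RI[OF g] by (simp add: mult.assoc i v g)
  have "(norm (FT g \<xi>))\<^sup>2 = (\<bar>\<xi> $ j\<bar> * norm (FT v \<xi>))\<^sup>2"
    unfolding power_mult_distrib cmod_power2 1 2 by (simp add: power_mult_distrib algebra_simps)
  then show ?thesis by (simp add: power2_eq_iff_nonneg)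
qed

lemma sqi_norm:
  assumes f: "sqi M f" shows "sqi M (\<lambda>x. norm (f x))"
  unfolding sqi_def real_norm_def abs_norm_cancel
proof
  have [measurable]: "f \<in> borel_measurable M" by (rule sqi_measurable[OF f])
  show "(\<lambda>x. norm (f x)) \<in> borel_measurable M" by measurable
qed (rule sqi_integrable_sq[OF f])

section \<open>The box multiplier and its kernel\<close>

lemma freq_box_borel [measurable]: "freq_box \<epsilon> \<in> sets borel"
  unfolding freq_box_def by measurable

lemma emeasure_freq_box: "emeasure lborel (freq_box 1) < \<infinity>"
proof -
  have "freq_box 1 \<subseteq> cbox (- (\<chi> i. pi)) (\<chi> i. pi)"
    by (auto simp: freq_box_def mem_box_cart less_imp_le)
  then have "emeasure lborel (freq_box 1) \<le> emeasure lborel (cbox (- (\<chi> i. pi)) (\<chi> i. pi :: real^3))"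
    by (rule emeasure_mono) simp
  also have "\<dots> < \<infinity>" by (rule emeasure_lborel_cbox_finite)
  finally show ?thesis .
qed

abbreviation ibox :: "vec3 \<Rightarrow> real" where "ibox \<equiv> indicator (freq_box 1)"

lemma ibox_l12: "integrable lborel ibox" "sq2 ibox"
proof -
  show i: "integrable lborel ibox" using emeasure_freq_box by (intro integrable_real_indicator) auto
  have "(norm (ibox x))\<^sup>2 = ibox x" for x by (auto split: split_indicator)
  then show "sq2 ibox" unfolding sqi_def using i by simp
qed

abbreviation K1 :: "vec3 \<Rightarrow> real" where "K1 \<equiv> Xi_kernel 1"

lemma gc_sq: "gc\<^sup>2 = (2 * pi) ^ 3"
proof -
  have "gc\<^sup>2 = (sqrt (2 * pi) ^ 2) ^ 3" by (simp only: power_mult[symmetric] mult.commute)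
  then show ?thesis by simp
qed

lemma K1_eq: "K1 z = (1 / gc\<^sup>2) * (LBINT \<xi>. ibox \<xi> * cos (\<xi> \<bullet> z))"
  unfolding gc_sq Xi_kernel_def set_lebesgue_integral_def by simp

lemma K1_FT: "K1 z = (1 / gc\<^sup>2) * Re (FT ibox z)"
  unfolding FT_def integral_Re[OF FT_integrable[OF ibox_l12(1)], symmetric] K1_eq by (simp add: inner_commute)

lemma K1_measurable [measurable]: "K1 \<in> bmeas"
  unfolding K1_FT[abs_def] by measurable

text \<open>The kernel is a product of sinc functions, square integrable but not integrable. Being a
  multiple of a transform it inherits membership in L2, so the integral defining \<open>xi\<close>
  converges for every L2 function.\<close>

lemma K1_sqi: "sq2 K1"
proof (rule sqi_bound(1)[OF _ FT_bessel(1)[OF ibox_l12], where C="1 / gc\<^sup>2"])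
  show "AE z in lborel. norm (K1 z) \<le> 1 / gc\<^sup>2 * norm (FT ibox z)"
    unfolding K1_FT using abs_Re_le_cmod by (intro AE_I2) (simp add: abs_mult divide_right_mono)
qed simp_all

lemma K1_bounded: "\<bar>K1 z\<bar> \<le> (LBINT \<xi>. ibox \<xi>) / gc\<^sup>2"
proof -
  have "\<bar>\<integral>\<xi>. ibox \<xi> * cos (\<xi> \<bullet> z) \<partial>lborel\<bar> \<le> (LBINT \<xi>. \<bar>ibox \<xi> * cos (\<xi> \<bullet> z)\<bar>)"
    by (rule integral_abs_bound)
  also have "\<dots> \<le> (LBINT \<xi>. ibox \<xi>)"
  proof (rule integral_mono[OF integrable_abs ibox_l12(1)])
    show "integrable lborel (\<lambda>\<xi>. ibox \<xi> * cos (\<xi> \<bullet> z))"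
      by (rule bi_integrable_bound[OF ibox_l12(1)]) (auto simp: abs_mult intro!: mult_left_le)
    show "\<bar>ibox \<xi> * cos (\<xi> \<bullet> z)\<bar> \<le> ibox \<xi>" for \<xi> by (simp add: abs_mult mult_left_le)
  qed
  finally show ?thesis unfolding K1_eq by (simp add: abs_mult divide_right_mono)
qed

definition xi :: "(vec3 \<Rightarrow> real) \<Rightarrow> vec3 \<Rightarrow> real" where
  "xi f x = (LBINT w. K1 (x - w) * f w)"

lemma xi_integrable: "sq2 f \<Longrightarrow> integrable lborel (\<lambda>w. K1 (x - w) * f w)"
  by (rule sqi_integrable_mult[OF sqi_lborel_reflect[OF K1_sqi]])

lemma xi_measurable [measurable]:
  assumes [measurable]: "f \<in> bmeas" shows "xi f \<in> bmeas"
  unfolding xi_def[abs_def] by measurable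

lemma xi_diff: "sq2 f \<Longrightarrow> sq2 g \<Longrightarrow> xi (\<lambda>x. f x - g x) x = xi f x - xi g x"
  unfolding xi_def by (simp add: right_diff_distrib xi_integrable)

context
  fixes f v :: "vec3 \<Rightarrow> real"
  assumes f: "integrable lborel f" "sq2 f" and v: "integrable lborel v" "sq2 v"
begin

text \<open>On the Fourier side \<open>xi\<close> is multiplication by the indicator of the box;
  this weak form is what the error estimate needs.\<close>

lemma xi_pairing: "gc\<^sup>2 * (LBINT x. v x * xi f x) = (LBINT \<xi>. FT f \<xi> \<bullet> (ibox \<xi> *\<^sub>R FT v \<xi>))"
proof -
  have "(LBINT \<xi>. FT f \<xi> \<bullet> (ibox \<xi> *\<^sub>R FT v \<xi>)) = (LBINT \<xi>. ibox \<xi> * (FT f \<xi> \<bullet> FT v \<xi>))" by simp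
  also have "\<dots> = (LBINT z. gc\<^sup>2 * (K1 z * corr f v z))"
    unfolding FT_weighted(2)[OF f(1) v(1) ibox_l12(1)] K1_eq by simp
  also have "\<dots> = gc\<^sup>2 * (LBINT z. K1 z * corr f v z)" by (rule integral_mult_right_zero)
  also have "\<dots> = gc\<^sup>2 * (LBINT x. v x * xi f x)"
    unfolding corr_fubini(2)[OF f(1) v(1) K1_measurable K1_bounded] xi_def ..
  finally show ?thesis ..
qed

lemma FT_cutoff:
  assumes "S \<in> sets borel"
  shows "sq2 (\<lambda>\<xi>. indicator S \<xi> *\<^sub>R FT v \<xi>)" "nl2 (\<lambda>\<xi>. indicator S \<xi> *\<^sub>R FT v \<xi>) \<le> gc * nl2 v"
proof -
  have [measurable]: "v \<in> bmeas" using v by auto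
  have m: "(\<lambda>\<xi>. indicator S \<xi> *\<^sub>R FT v \<xi>) \<in> borel_measurable lborel" using assms by measurable
  have b: "AE \<xi> in lborel. norm (indicator S \<xi> *\<^sub>R FT v \<xi>) \<le> 1 * norm (FT v \<xi>)"
    by (auto split: split_indicator)
  note s = sqi_bound[OF m FT_bessel(1)[OF v] b]
  show "sq2 (\<lambda>\<xi>. indicator S \<xi> *\<^sub>R FT v \<xi>)" by (rule s(1)) simp
  show "nl2 (\<lambda>\<xi>. indicator S \<xi> *\<^sub>R FT v \<xi>) \<le> gc * nl2 v"
    using s(2) FT_bessel(2)[OF v] by simp
qed

lemma xi_pairing_le: "\<bar>\<integral>x. v x * xi f x \<partial>lborel\<bar> \<le> nl2 f * nl2 v"
proof -
  have "gc\<^sup>2 * \<bar>\<integral>x. v x * xi f x \<partial>lborel\<bar> = \<bar>\<integral>\<xi>. FT f \<xi> \<bullet> (ibox \<xi> *\<^sub>R FT v \<xi>) \<partial>lborel\<bar>"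
    unfolding xi_pairing[symmetric] by (simp add: abs_mult)
  also have "\<dots> \<le> nl2 (FT f) * nl2 (\<lambda>\<xi>. ibox \<xi> *\<^sub>R FT v \<xi>)"
    by (rule l2_Cauchy_Schwarz[OF FT_bessel(1)[OF f] FT_cutoff(1)]) measurable
  also have "\<dots> \<le> (gc * nl2 f) * (gc * nl2 v)"
    by (intro mult_mono FT_bessel(2)[OF f] FT_cutoff(2)) simp_all
  also have "\<dots> = gc\<^sup>2 * (nl2 f * nl2 v)" by (simp add: power2_eq_square)
  finally show ?thesis by (rule mult_left_le_imp_le) simp
qed

text \<open>The error lives on frequencies outside the box. There some component has modulus at
  least pi, hence at least 1, so the transform of v is dominated by that of the corresponding
  derivative.\<close>

lemma xi_error_l1:
  assumes g: "\<And>j. integrable lborel (g j)" "\<And>j. sq2 (g j)" and a: "\<And>j. acl j v (g j)"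
  shows "\<bar>(LBINT x. v x * f x) - (LBINT x. v x * xi f x)\<bar> \<le> nl2 f * (\<Sum>j\<in>UNIV. nl2 (g j))"
proof -
  have [measurable]: "v \<in> bmeas" using v by auto
  let ?o = "\<lambda>\<xi>. indicator (- freq_box 1) \<xi> *\<^sub>R FT v \<xi>"
  have o: "sq2 ?o" by (rule FT_cutoff(1)) measurable
  have i: "sq2 (\<lambda>\<xi>. ibox \<xi> *\<^sub>R FT v \<xi>)" by (rule FT_cutoff(1)) measurable
  note fs = FT_bessel(1)[OF f] and vs = FT_bessel(1)[OF v] and gs = FT_bessel(1)[OF g(1) g(2)]
  have on: "nl2 ?o \<le> gc * (\<Sum>j\<in>UNIV. nl2 (g j))"
  proof -
    have sn: "sq2 (\<lambda>\<xi>. norm (FT (g j) \<xi>))" for j by (rule sqi_norm[OF gs])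
    have nn: "nl2 (\<lambda>\<xi>. norm (FT (g j) \<xi>)) = nl2 (FT (g j))" for j by (simp add: l2n_def)
    have le: "norm (?o \<xi>) \<le> 1 * norm (\<Sum>j\<in>UNIV. norm (FT (g j) \<xi>))" for \<xi>
    proof (cases "\<xi> \<in> freq_box 1")
      case False
      then obtain j where j: "\<not> (- pi \<le> \<xi> $ j \<and> \<xi> $ j < pi)" by (auto simp: freq_box_def)
      then have "1 \<le> \<bar>\<xi> $ j\<bar>" using pi_gt3 by auto
      then have "1 * norm (FT v \<xi>) \<le> norm (FT (g j) \<xi>)"
        unfolding FT_derivative[OF a[of j] v(1) g(1)] by (rule mult_right_mono) simp
      also have "\<dots> \<le> (\<Sum>j\<in>UNIV. norm (FT (g j) \<xi>))" by (rule member_le_sum) auto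
      finally show ?thesis using False by (simp add: sum_nonneg)
    qed simp
    have "nl2 ?o \<le> 1 * nl2 (\<lambda>\<xi>. \<Sum>j\<in>UNIV. norm (FT (g j) \<xi>))"
      by (rule sqi_bound(2)[OF sqi_measurable[OF o] sqi_sum[OF sn] AE_I2[OF le]]) simp
    also have "\<dots> \<le> (\<Sum>j\<in>UNIV. nl2 (\<lambda>\<xi>. norm (FT (g j) \<xi>)))"
      using l2n_sum[of UNIV lborel "\<lambda>j \<xi>. norm (FT (g j) \<xi>)"] sn by simp
    also have "\<dots> \<le> (\<Sum>j\<in>UNIV. gc * nl2 (g j))"
      unfolding nn by (intro sum_mono FT_bessel(2) g)
    finally show ?thesis by (simp add: sum_distrib_left)
  qed
  have "gc\<^sup>2 * ((LBINT x. v x * f x) - (LBINT x. v x * xi f x))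
    = (LBINT \<xi>. FT f \<xi> \<bullet> FT v \<xi>) - (LBINT \<xi>. FT f \<xi> \<bullet> (ibox \<xi> *\<^sub>R FT v \<xi>))"
    unfolding right_diff_distrib xi_pairing FT_parseval[OF f v] by (simp add: mult.commute)
  also have "\<dots> = (LBINT \<xi>. FT f \<xi> \<bullet> FT v \<xi> - FT f \<xi> \<bullet> (ibox \<xi> *\<^sub>R FT v \<xi>))"
    by (rule bi_integral_diff[symmetric]) (intro sqi_integrable_inner fs vs i)+
  also have "\<dots> = (LBINT \<xi>. FT f \<xi> \<bullet> ?o \<xi>)"
    by (intro bi_integral_cong refl) (simp split: split_indicator)
  finally have e: "gc\<^sup>2 * ((LBINT x. v x * f x) - (LBINT x. v x * xi f x)) = (LBINT \<xi>. FT f \<xi> \<bullet> ?o \<xi>)" .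
  have "gc\<^sup>2 * \<bar>(LBINT x. v x * f x) - (LBINT x. v x * xi f x)\<bar> = \<bar>\<integral>\<xi>. FT f \<xi> \<bullet> ?o \<xi> \<partial>lborel\<bar>"
    unfolding e[symmetric] by (simp add: abs_mult)
  also have "\<dots> \<le> nl2 (FT f) * nl2 ?o" by (rule l2_Cauchy_Schwarz[OF fs o])
  also have "\<dots> \<le> (gc * nl2 f) * (gc * (\<Sum>j\<in>UNIV. nl2 (g j)))"
    by (intro mult_mono FT_bessel(2)[OF f] on) simp_all
  also have "\<dots> = gc\<^sup>2 * (nl2 f * (\<Sum>j\<in>UNIV. nl2 (g j)))" by (simp add: power2_eq_square)
  finally show ?thesis by (rule mult_left_le_imp_le) simp
qed

end

lemma l2n_mult_tendsto_zero:
  fixes f :: "vec3 \<Rightarrow> real"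
  assumes f: "sq2 f" and [measurable]: "\<And>n. \<eta> n \<in> bmeas"
    and b: "\<And>n x. \<bar>\<eta> n x\<bar> \<le> B" and l: "\<And>x. (\<lambda>n. \<eta> n x) \<longlonglongrightarrow> 0"
  shows "(\<lambda>n. nl2 (\<lambda>x. \<eta> n x * f x)) \<longlonglongrightarrow> 0"
proof (rule l2n_dominated[OF sqi_scaleR[OF f, of B]])
  have [measurable]: "f \<in> bmeas" using sqi_measurable[OF f] by simp
  show "(\<lambda>x. \<eta> n x * f x) \<in> borel_measurable lborel" for n by measurable
  show "AE x in lborel. norm (\<eta> n x * f x) \<le> norm (B *\<^sub>R f x)" for n
    using mult_right_mono[OF order_trans[OF b abs_ge_self]] by (simp add: abs_mult)
  show "AE x in lborel. (\<lambda>n. \<eta> n x * f x) \<longlonglongrightarrow> 0"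
    using tendsto_mult_left_zero[OF l] by simp
qed

lemma sqi_bsupp_integrable:
  fixes f :: "vec3 \<Rightarrow> real"
  assumes f: "sq2 f" and R: "\<And>x. f x \<noteq> 0 \<Longrightarrow> norm x \<le> R"
  shows "integrable lborel f"
proof -
  from sqi_integrable_mult[OF f sqi_indicator_cball[of R]] have "integrable lborel (\<lambda>x. f x * iball R x)" .
  moreover have "f x * iball R x = f x" for x using R[of x] by (cases "f x = 0") auto
  ultimately show ?thesis by simp
qed

definition trunc :: "nat \<Rightarrow> (vec3 \<Rightarrow> real) \<Rightarrow> vec3 \<Rightarrow> real" where
  "trunc n f x = iball (real n) x * f x"

lemma trunc_l12:
  assumes f: "sq2 f"
  shows "sq2 (trunc n f)" "nl2 (trunc n f) \<le> nl2 f" "integrable lborel (trunc n f)"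
proof -
  have [measurable]: "f \<in> bmeas" using f by auto
  have b: "AE x in lborel. norm (trunc n f x) \<le> 1 * norm (f x)"
    by (auto simp: trunc_def split: split_indicator)
  have m: "trunc n f \<in> borel_measurable lborel" unfolding trunc_def[abs_def] by measurable
  show s: "sq2 (trunc n f)" by (rule sqi_bound(1)[OF m f b]) simp
  show "nl2 (trunc n f) \<le> nl2 f" using sqi_bound(2)[OF m f b] by simp
  show "integrable lborel (trunc n f)"
    by (rule sqi_bsupp_integrable[OF s, of "real n"]) (auto simp: trunc_def split: split_indicator_asm)
qed

lemma trunc_tendsto:
  assumes f: "sq2 f" shows "(\<lambda>n. nl2 (\<lambda>x. trunc n f x - f x)) \<longlonglongrightarrow> 0"
proof -
  have "(\<lambda>n. nl2 (\<lambda>x. (iball (real n) x - 1) * f x)) \<longlonglongrightarrow> 0"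
  proof (rule l2n_mult_tendsto_zero[OF f, where B=1])
    show "(\<lambda>n. iball (real n) x - 1 :: real) \<longlonglongrightarrow> 0" for x :: vec3
      using tendsto_diff[OF indicator_cball_tendsto tendsto_const, of x 1] by simp
  qed (auto split: split_indicator)
  then show ?thesis by (simp add: trunc_def left_diff_distrib)
qed

text \<open>Duality with the image itself: cut the image of a truncation to a ball, pair it with
  itself, and cancel one norm. Fatou then removes the cut-offs.\<close>

lemma xi_l2:
  assumes f: "sq2 f"
  shows "sq2 (xi f)" "nl2 (xi f) \<le> nl2 f"
proof -
  have [measurable]: "f \<in> bmeas" using f by auto
  have [measurable]: "trunc n f \<in> bmeas" for n using trunc_l12(1)[OF f, of n] by auto
  let ?B = "(LBINT \<xi>. ibox \<xi>) / gc\<^sup>2"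
  let ?g = "\<lambda>n x. iball (real n) x * xi (trunc n f) x"
  have g: "sq2 (?g n)" for n
  proof (rule sqi_bound(1))
    show "sq2 (indicator (cball (0::vec3) (real n)) :: _ \<Rightarrow> real)" by (rule sqi_indicator_cball)
    have "\<bar>xi (trunc n f) x\<bar> \<le> ?B * (LBINT w. \<bar>trunc n f w\<bar>)" for x
    proof -
      have "\<bar>xi (trunc n f) x\<bar> \<le> (LBINT w. \<bar>K1 (x - w) * trunc n f w\<bar>)"
        unfolding xi_def by (rule integral_abs_bound)
      also have "\<dots> \<le> (LBINT w. ?B * \<bar>trunc n f w\<bar>)"
        by (rule integral_mono[OF integrable_abs[OF xi_integrable[OF trunc_l12(1)[OF f]]]
              integrable_mult_right[OF integrable_abs[OF trunc_l12(3)[OF f]]]])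
          (simp only: abs_mult mult_right_mono[OF K1_bounded] abs_ge_zero)
      finally show ?thesis by simp
    qed
    then show "AE x in lborel. norm (?g n x) \<le> (?B * (LBINT w. \<bar>trunc n f w\<bar>)) * norm (iball (real n) x :: real)"
      by (auto split: split_indicator)
    show "0 \<le> ?B * (LBINT w. \<bar>trunc n f w\<bar>)" by simp
  qed measurable
  have gi: "integrable lborel (?g n)" for n
    by (rule sqi_bsupp_integrable[OF g, of _ "real n"]) (auto split: split_indicator_asm)
  have b: "nl2 (?g n) \<le> nl2 f" for n
  proof -
    have "(nl2 (?g n))\<^sup>2 = (LBINT x. ?g n x * xi (trunc n f) x)"
      unfolding l2n_sq by (intro bi_integral_cong refl) (simp add: power2_eq_square split: split_indicator)
    also have "\<dots> \<le> nl2 (trunc n f) * nl2 (?g n)"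
      by (rule order_trans[OF abs_ge_self xi_pairing_le]) (intro trunc_l12 f g gi)+
    finally have "nl2 (?g n) * nl2 (?g n) \<le> nl2 f * nl2 (?g n)"
      using mult_right_mono[OF trunc_l12(2)[OF f, of n] l2n_nonneg[of lborel "?g n"]] by (simp only: power2_eq_square)
    then show ?thesis using l2n_nonneg[of lborel "?g n"] l2n_nonneg[of lborel f]
      by (cases "nl2 (?g n) = 0") auto
  qed
  have l: "(\<lambda>n. ?g n x) \<longlonglongrightarrow> xi f x" for x
  proof -
    have "(\<lambda>n. xi (trunc n f) x) \<longlonglongrightarrow> xi f x"
      unfolding xi_def
    proof (rule integral_dominated_convergence[where w="\<lambda>w. \<bar>K1 (x - w) * f w\<bar>"])
      show "integrable lborel (\<lambda>w. \<bar>K1 (x - w) * f w\<bar>)" by (rule integrable_abs[OF xi_integrable[OF f]])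
      show "AE w in lborel. (\<lambda>n. K1 (x - w) * trunc n f w) \<longlonglongrightarrow> K1 (x - w) * f w"
      proof (rule AE_I2)
        fix w
        have "(\<lambda>n. K1 (x - w) * trunc n f w) \<longlonglongrightarrow> K1 (x - w) * (1 * f w)"
          unfolding trunc_def by (intro tendsto_intros indicator_cball_tendsto)
        then show "(\<lambda>n. K1 (x - w) * trunc n f w) \<longlonglongrightarrow> K1 (x - w) * f w" by simp
      qed
      show "AE w in lborel. norm (K1 (x - w) * trunc n f w) \<le> \<bar>K1 (x - w) * f w\<bar>" for n
        by (auto simp: trunc_def split: split_indicator)
    qed measurable
    from tendsto_mult[OF indicator_cball_tendsto this, of x] show ?thesis by simp
  qed
  have l': "AE x in lborel. (\<lambda>n. ?g n x) \<longlonglongrightarrow> xi f x" using l by simp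
  have m: "xi f \<in> borel_measurable lborel" by simp
  show "sq2 (xi f)" "nl2 (xi f) \<le> nl2 f"
    by (rule sqi_fatou[OF g b l' m])+
qed

lemma xi_tendsto:
  assumes f: "\<And>n. sq2 (f n)" "sq2 f'" and l: "(\<lambda>n. nl2 (\<lambda>x. f n x - f' x)) \<longlonglongrightarrow> 0"
  shows "(\<lambda>n. nl2 (\<lambda>x. xi (f n) x - xi f' x)) \<longlonglongrightarrow> 0"
proof (rule tendsto_sandwich[OF _ _ tendsto_const l])
  show "\<forall>\<^sub>F n in sequentially. nl2 (\<lambda>x. xi (f n) x - xi f' x) \<le> nl2 (\<lambda>x. f n x - f' x)"
    unfolding xi_diff[OF f, symmetric] by (intro always_eventually allI xi_l2(2) sqi_diff f)
qed simp

text \<open>Removes integrability from \<open>xi_error_l1\<close>: f is truncated and v multiplied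
  by smooth cut-offs. The extra product-rule term vanishes in L2 in the limit.\<close>

lemma xi_error:
  assumes f: "sq2 f" and v: "sq2 v" and g: "\<And>j. sq2 (g j)" and a: "\<And>j. acl j v (g j)"
  shows "\<bar>\<integral>x. v x * (f x - xi f x) \<partial>lborel\<bar> \<le> nl2 f * (\<Sum>j\<in>UNIV. nl2 (g j))"
proof -
  obtain \<zeta> :: "nat \<Rightarrow> vec3 \<Rightarrow> real" and \<zeta>' :: "nat \<Rightarrow> 3 \<Rightarrow> vec3 \<Rightarrow> real" and B :: real where z:
    "\<And>n j. cderiv j (\<zeta> n) (\<zeta>' n j)" "\<And>n. bsupp (\<zeta> n)" "\<And>n j. bsupp (\<zeta>' n j)"
    "\<And>n x. \<bar>\<zeta> n x\<bar> \<le> B" "\<And>n j x. \<bar>\<zeta>' n j x\<bar> \<le> B"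
    "\<And>x. (\<lambda>n. \<zeta> n x) \<longlonglongrightarrow> 1" "\<And>j x. (\<lambda>n. \<zeta>' n j x) \<longlonglongrightarrow> 0"
    and [measurable]: "\<And>n. \<zeta> n \<in> bmeas" "\<And>n j. \<zeta>' n j \<in> bmeas"
    by (rule bump_cutoffs) blast
  have ms: "sq2 (\<lambda>x. \<zeta> n x * p x)" "sq2 (\<lambda>x. \<zeta>' n j x * p x)" if "sq2 p" for p n j
    unfolding real_scaleR_def[symmetric]
    by (rule sqi_bounded_mult[OF that _ z(4)], measurable) (rule sqi_bounded_mult[OF that _ z(5)], measurable)
  have si: "integrable lborel (\<lambda>x. \<eta> x * p x)"
    if p: "sq2 (\<lambda>x. \<eta> x * p x)" and b: "bsupp \<eta>" for \<eta> p :: "vec3 \<Rightarrow> real"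
  proof -
    obtain R where R: "\<And>x. \<eta> x \<noteq> 0 \<Longrightarrow> norm x \<le> R" using b by (auto simp: bsupp_def)
    show ?thesis by (rule sqi_bsupp_integrable[OF p, of R]) (use R in auto)
  qed
  let ?v = "\<lambda>n x. \<zeta> n x * v x" and ?g = "\<lambda>n j x. \<zeta> n x * g j x + \<zeta>' n j x * v x"
  have gs: "sq2 (?g n j)" for n j by (intro sqi_add ms v g)
  have gi: "integrable lborel (?g n j)" for n j
    by (intro bi_integrable_add si ms v g z)
  have le: "\<bar>(LBINT x. ?v n x * trunc n f x) - (LBINT x. ?v n x * xi (trunc n f) x)\<bar>
    \<le> nl2 f * (\<Sum>j\<in>UNIV. nl2 (?g n j))" for n
  proof -
    have "\<bar>(LBINT x. ?v n x * trunc n f x) - (LBINT x. ?v n x * xi (trunc n f) x)\<bar>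
      \<le> nl2 (trunc n f) * (\<Sum>j\<in>UNIV. nl2 (?g n j))"
      by (rule xi_error_l1[OF trunc_l12(3,1)[OF f] si[OF ms(1)[OF v] z(2)] ms(1)[OF v] gi gs acl_mult[OF a z(1)]])
    also have "\<dots> \<le> nl2 f * (\<Sum>j\<in>UNIV. nl2 (?g n j))"
      by (intro mult_right_mono trunc_l12 f sum_nonneg) simp
    finally show ?thesis .
  qed
  have cut: "(\<lambda>n. nl2 (\<lambda>x. \<zeta> n x * p x - p x)) \<longlonglongrightarrow> 0" if p: "sq2 p" for p
  proof -
    have "(\<lambda>n. nl2 (\<lambda>x. (\<zeta> n x - 1) * p x)) \<longlonglongrightarrow> 0"
    proof (rule l2n_mult_tendsto_zero[OF p, where B="B + 1"])
      show "\<bar>\<zeta> n x - 1\<bar> \<le> B + 1" for n x using z(4)[of n x] by linarith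
      show "(\<lambda>n. \<zeta> n x - 1) \<longlonglongrightarrow> 0" for x using tendsto_diff[OF z(6) tendsto_const, of x 1] by simp
    qed measurable
    then show ?thesis by (simp add: left_diff_distrib)
  qed
  have cut': "(\<lambda>n. nl2 (\<lambda>x. \<zeta>' n j x * p x)) \<longlonglongrightarrow> 0" if p: "sq2 p" for p j
    by (rule l2n_mult_tendsto_zero[OF p _ z(5) z(7)]) measurable
  have gl: "(\<lambda>n. nl2 (g j) + nl2 (\<lambda>x. \<zeta> n x * g j x - g j x) + nl2 (\<lambda>x. \<zeta>' n j x * v x)) \<longlonglongrightarrow> nl2 (g j) + 0 + 0" for j
    by (intro tendsto_add tendsto_const cut cut' g v)
  have gle: "nl2 (?g n j) \<le> nl2 (g j) + nl2 (\<lambda>x. \<zeta> n x * g j x - g j x) + nl2 (\<lambda>x. \<zeta>' n j x * v x)" for n j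
    using l2n_triangle[OF g[of j] sqi_diff[OF ms(1)[OF g[of j], of n] g[of j]]]
      l2n_triangle[OF ms(1)[OF g[of j], of n] ms(2)[OF v, of n j]] by simp
  have lim1: "(\<lambda>n. LBINT x. ?v n x * trunc n f x) \<longlonglongrightarrow> (LBINT x. v x * f x)"
    using l2_inner_tendsto[OF ms(1)[OF v] v cut[OF v] trunc_l12(1)[OF f] f trunc_tendsto[OF f]] by simp
  have lim2: "(\<lambda>n. LBINT x. ?v n x * xi (trunc n f) x) \<longlonglongrightarrow> (LBINT x. v x * xi f x)"
    using l2_inner_tendsto[OF ms(1)[OF v] v cut[OF v] xi_l2(1)[OF trunc_l12(1)[OF f]] xi_l2(1)[OF f]
        xi_tendsto[OF trunc_l12(1)[OF f] f trunc_tendsto[OF f]]] by simp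
  have "\<bar>(LBINT x. v x * f x) - (LBINT x. v x * xi f x)\<bar> \<le> nl2 f * (\<Sum>j\<in>UNIV. nl2 (g j) + 0 + 0)"
  proof (rule tendsto_le[OF sequentially_bot])
    show "(\<lambda>n. nl2 f * (\<Sum>j\<in>UNIV. nl2 (g j) + nl2 (\<lambda>x. \<zeta> n x * g j x - g j x) + nl2 (\<lambda>x. \<zeta>' n j x * v x)))
      \<longlonglongrightarrow> nl2 f * (\<Sum>j\<in>UNIV. nl2 (g j) + 0 + 0)"
      by (intro tendsto_mult tendsto_const tendsto_sum gl)
    show "(\<lambda>n. \<bar>(LBINT x. ?v n x * trunc n f x) - (LBINT x. ?v n x * xi (trunc n f) x)\<bar>)
      \<longlonglongrightarrow> \<bar>(LBINT x. v x * f x) - (LBINT x. v x * xi f x)\<bar>"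
      by (intro tendsto_rabs tendsto_diff lim1 lim2)
    show "\<forall>\<^sub>F n in sequentially. \<bar>(LBINT x. ?v n x * trunc n f x) - (LBINT x. ?v n x * xi (trunc n f) x)\<bar>
      \<le> nl2 f * (\<Sum>j\<in>UNIV. nl2 (g j) + nl2 (\<lambda>x. \<zeta> n x * g j x - g j x) + nl2 (\<lambda>x. \<zeta>' n j x * v x))"
      by (intro always_eventually allI order_trans[OF le] mult_left_mono sum_mono gle l2n_nonneg)
  qed
  then show ?thesis
    using sqi_integrable_mult[OF v f] sqi_integrable_mult[OF v xi_l2(1)[OF f]] by (simp add: right_diff_distrib)
qed

lemma Xi_nth: "sq2 f \<Longrightarrow> Xi 1 f x $ i = xi (\<lambda>x. f x $ i) x"
proof -
  assume f: "sq2 f"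
  have i: "integrable lborel (\<lambda>w. K1 (x - w) *\<^sub>R f w)"
  proof -
    note xi_integrable[OF sqi_norm[OF f], of x]
    moreover have [measurable]: "f \<in> bmeas" using f by auto
    ultimately show ?thesis
      by (intro bi_integrable_bound[where g="\<lambda>w. K1 (x - w) *\<^sub>R f w"]) auto
  qed
  show ?thesis
    unfolding Xi_def xi_def using integral_bounded_linear[OF bounded_linear_vec_nth i, of i] by simp
qed

text \<open>The factor 9 counts three components and three directions. The third estimate has the
  form of the data hypothesis in \<open>scaled_estimate\<close>, with c0 = 9.\<close>

proposition Xi_estimates:
  assumes f: "sq2 f"
  shows "sq2 (Xi 1 f)" "nl2 (Xi 1 f) \<le> nl2 f"
    "W.sob v H \<Longrightarrow> \<bar>\<integral>x. (f x - Xi 1 f x) \<bullet> v x \<partial>lborel\<bar> \<le> 9 * nl2 f * nl2 H"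
proof -
  note fi = sqi_nth[OF f]
  have n: "(\<lambda>x. Xi 1 f x $ i) = xi (\<lambda>x. f x $ i)" for i by (rule ext) (rule Xi_nth[OF f])
  show s: "sq2 (Xi 1 f)" by (rule sqi_vecI) (unfold n, rule xi_l2(1)[OF fi])
  show "nl2 (Xi 1 f) \<le> nl2 f"
  proof (rule power2_le_imp_le)
    show "(nl2 (Xi 1 f))\<^sup>2 \<le> (nl2 f)\<^sup>2"
      unfolding l2n_vec_sq[OF s] l2n_vec_sq[OF f] n by (intro sum_mono power_mono xi_l2(2) fi l2n_nonneg)
  qed simp
  assume w: "W.sob v H"
  note vs = W_sobD[OF w]
  have a: "acl j (\<lambda>x. v x $ i) (\<lambda>x. H x $ i $ j)" for i j
    using w unfolding W_sob_iff H1_def weak_grad_acl by blast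
  have le: "\<bar>\<integral>x. v x $ i * (f x $ i - xi (\<lambda>x. f x $ i) x) \<partial>lborel\<bar> \<le> 3 * nl2 f * nl2 H" for i
  proof -
    have "\<bar>\<integral>x. v x $ i * (f x $ i - xi (\<lambda>x. f x $ i) x) \<partial>lborel\<bar>
      \<le> nl2 (\<lambda>x. f x $ i) * (\<Sum>j\<in>UNIV. nl2 (\<lambda>x. H x $ i $ j))"
      by (rule xi_error[OF fi sqi_nth[OF vs(1)] sqi_nth[OF sqi_nth[OF vs(2)]] a])
    also have "\<dots> \<le> nl2 f * (\<Sum>j\<in>(UNIV::3 set). nl2 H)"
      by (intro mult_mono sum_mono l2n_nth[OF f] order_trans[OF l2n_nth[OF sqi_nth[OF vs(2)]] l2n_nth[OF vs(2)]]
          sum_nonneg l2n_nonneg)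
    finally show ?thesis by simp
  qed
  have e: "(f x - Xi 1 f x) \<bullet> v x = (\<Sum>i\<in>UNIV. v x $ i * (f x $ i - xi (\<lambda>x. f x $ i) x))" for x
    by (simp add: inner_vec_def Xi_nth[OF f] mult.commute)
  have "(LBINT x. (f x - Xi 1 f x) \<bullet> v x) = (\<Sum>i\<in>UNIV. LBINT x. v x $ i * (f x $ i - xi (\<lambda>x. f x $ i) x))"
    unfolding e by (rule bi_integral_sum)
      (intro sqi_integrable_mult sqi_nth[OF vs(1)] sqi_diff fi xi_l2(1)[OF fi])
  then have "\<bar>\<integral>x. (f x - Xi 1 f x) \<bullet> v x \<partial>lborel\<bar> \<le> (\<Sum>i\<in>UNIV. \<bar>\<integral>x. v x $ i * (f x $ i - xi (\<lambda>x. f x $ i) x) \<partial>lborel\<bar>)"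
    by (simp only: sum_abs)
  also have "\<dots> \<le> (\<Sum>i\<in>(UNIV::3 set). 3 * nl2 f * nl2 H)" by (intro sum_mono le)
  finally show "\<bar>\<integral>x. (f x - Xi 1 f x) \<bullet> v x \<partial>lborel\<bar> \<le> 9 * nl2 f * nl2 H" by simp
qed

section \<open>Dilations and the theorem\<close>

context
  fixes s :: real
  assumes s: "0 < s"
begin

lemma AE_dilation:
  assumes "AE x::vec3 in lborel. Q x" shows "AE x in lborel. Q (s *\<^sub>R x)"
proof -
  obtain N where N: "{x \<in> space lborel. \<not> Q x} \<subseteq> N" "emeasure lborel N = 0" "N \<in> sets lborel"
    by (rule AE_E[OF assms])
  have "(\<integral>\<^sup>+x. indicator N (s *\<^sub>R x) \<partial>lborel) = (0::ennreal)"
    using nn_integral_dilation[of s "indicator N"] s N by simp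
  then have "AE x in lborel. indicator N (s *\<^sub>R x) = (0::ennreal)"
    using N(3) by (subst (asm) nn_integral_0_iff_AE) auto
  then show ?thesis
  proof eventually_elim
    case (elim x) then show ?case using N(1) by (auto split: split_indicator_asm)
  qed
qed

lemma sqi_dilation:
  assumes f: "sq2 f"
  shows "sq2 (\<lambda>x::vec3. f (s *\<^sub>R x))" "(nl2 f)\<^sup>2 = s ^ 3 * (nl2 (\<lambda>x::vec3. f (s *\<^sub>R x)))\<^sup>2"
proof -
  have [measurable]: "f \<in> bmeas" using sqi_measurable[OF f] by simp
  have "integrable lborel (\<lambda>x. (norm (f (s *\<^sub>R x)))\<^sup>2)"
    using integrable_dilation[OF _ sqi_integrable_sq[OF f], of s] s by simp
  then show "sq2 (\<lambda>x::vec3. f (s *\<^sub>R x))" unfolding sqi_def by simp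
  show "(nl2 f)\<^sup>2 = s ^ 3 * (nl2 (\<lambda>x::vec3. f (s *\<^sub>R x)))\<^sup>2"
    unfolding l2n_sq using s by (subst integral_dilation[of s]) auto
qed

lemma loc_int_dilation:
  assumes g: "loc_int g" shows "loc_int (\<lambda>x. g (s *\<^sub>R x))"
proof (rule loc_intI)
  have [measurable]: "g \<in> bmeas" by (rule loc_int_measurable[OF g])
  show "(\<lambda>x. g (s *\<^sub>R x)) \<in> bmeas" by measurable
  fix R
  have "integrable lborel (\<lambda>x. g (s *\<^sub>R x) * iball (s * R) (s *\<^sub>R x))"
    using integrable_dilation[OF _ loc_int_cball[OF g, of "s * R"], of s] s by simp
  moreover have "iball (s * R) (s *\<^sub>R x) = (iball R x :: real)" for x :: vec3
    using s by (simp add: indicator_def)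
  ultimately show "integrable lborel (\<lambda>x. g (s *\<^sub>R x) * iball R x)" by simp
qed

lemma acl_dilation:
  assumes a: "acl j w g" shows "acl j (\<lambda>x. w (s *\<^sub>R x)) (\<lambda>x. s * g (s *\<^sub>R x))"
  unfolding acl_def
proof (intro conjI allI)
  show "loc_int (\<lambda>x. w (s *\<^sub>R x))" "loc_int (\<lambda>x. s * g (s *\<^sub>R x))"
    using a by (auto simp: acl_def intro: loc_int_dilation loc_int_cmult)
  fix h
  have "AE x in lborel. w (x + (s * h) *\<^sub>R axis j 1) - w x = s * h * av unif01 (seg j (s * h)) g x"
    using a unfolding acl_def by blast
  from AE_dilation[OF this]
  show "AE x in lborel. w (s *\<^sub>R (x + h *\<^sub>R axis j 1)) - w (s *\<^sub>R x) = h * av unif01 (seg j h) (\<lambda>x. s * g (s *\<^sub>R x)) x"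
    by (simp add: av_def scaleR_add_right ac_simps)
qed

lemma sob_dilation:
  assumes v: "W.sob v H" shows "W.sob (\<lambda>x. v (s *\<^sub>R x)) (\<lambda>x. s *\<^sub>R H (s *\<^sub>R x))"
proof (rule W_sobI)
  note vs = W_sobD[OF v]
  show "sq2 (\<lambda>x. v (s *\<^sub>R x))" by (rule sqi_dilation(1)[OF vs(1)])
  show "sq2 (\<lambda>x. s *\<^sub>R H (s *\<^sub>R x))" by (rule sqi_scaleR[OF sqi_dilation(1)[OF vs(2)]])
  show "weak_grad (\<lambda>x. v (s *\<^sub>R x)) (\<lambda>x. s *\<^sub>R H (s *\<^sub>R x))"
    unfolding weak_grad_acl
  proof (intro allI)
    fix i j
    have "acl j (\<lambda>x. v x $ i) (\<lambda>x. H x $ i $ j)" using vs(3) by (simp add: weak_grad_acl)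
    from acl_dilation[OF this]
    show "acl j (\<lambda>x. v (s *\<^sub>R x) $ i) (\<lambda>x. (s *\<^sub>R H (s *\<^sub>R x)) $ i $ j)" by simp
  qed
qed

end

lemma Xi_kernel_dilation:
  assumes e: "0 < \<epsilon>" shows "Xi_kernel \<epsilon> (\<epsilon> *\<^sub>R z) = K1 z / \<epsilon> ^ 3"
proof -
  have b: "indicator (freq_box \<epsilon>) ((1 / \<epsilon>) *\<^sub>R \<xi>) = (indicator (freq_box 1) \<xi> :: real)" for \<xi>
    using e by (simp add: freq_box_def indicator_def divide_simps)
  have "Xi_kernel \<epsilon> (\<epsilon> *\<^sub>R z) = 1 / (2 * pi) ^ 3 * (LBINT \<xi>. indicator (freq_box \<epsilon>) \<xi> * cos (\<xi> \<bullet> (\<epsilon> *\<^sub>R z)))"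
    by (simp add: Xi_kernel_def set_lebesgue_integral_def)
  also have "(LBINT \<xi>. indicator (freq_box \<epsilon>) \<xi> * cos (\<xi> \<bullet> (\<epsilon> *\<^sub>R z)))
    = \<bar>1 / \<epsilon>\<bar> ^ 3 *\<^sub>R (LBINT \<xi>. indicator (freq_box \<epsilon>) ((1 / \<epsilon>) *\<^sub>R \<xi>) * cos (((1 / \<epsilon>) *\<^sub>R \<xi>) \<bullet> (\<epsilon> *\<^sub>R z)))"
    by (rule integral_dilation) (use e in simp_all)
  also have "\<dots> = (LBINT \<xi>. indicator (freq_box 1) \<xi> * cos (\<xi> \<bullet> z)) / \<epsilon> ^ 3"
    unfolding b using e by (simp add: power_divide)
  finally show ?thesis by (simp add: Xi_kernel_def set_lebesgue_integral_def)
qed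

lemma Xi_dilation:
  assumes e: "0 < \<epsilon>" and f: "sq2 f"
  shows "Xi \<epsilon> f (\<epsilon> *\<^sub>R y) = Xi 1 (\<lambda>x. f (\<epsilon> *\<^sub>R x)) y"
proof -
  have [measurable]: "f \<in> bmeas" using sqi_measurable[OF f] by simp
  have k: "Xi_kernel \<epsilon> z = K1 ((1 / \<epsilon>) *\<^sub>R z) / \<epsilon> ^ 3" for z
    using Xi_kernel_dilation[OF e, of "(1 / \<epsilon>) *\<^sub>R z"] e by simp
  have "Xi \<epsilon> f (\<epsilon> *\<^sub>R y) = \<bar>\<epsilon>\<bar> ^ 3 *\<^sub>R (LBINT w. Xi_kernel \<epsilon> (\<epsilon> *\<^sub>R y - \<epsilon> *\<^sub>R w) *\<^sub>R f (\<epsilon> *\<^sub>R w))"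
    unfolding Xi_def by (rule integral_dilation) (use e in \<open>simp, unfold k, measurable\<close>)
  also have "\<dots> = \<bar>\<epsilon>\<bar> ^ 3 *\<^sub>R (LBINT w. (1 / \<epsilon> ^ 3) *\<^sub>R (K1 (y - w) *\<^sub>R f (\<epsilon> *\<^sub>R w)))"
    unfolding scaleR_diff_right[symmetric] Xi_kernel_dilation[OF e] by simp
  also have "\<dots> = Xi 1 (\<lambda>x. f (\<epsilon> *\<^sub>R x)) y"
    using e unfolding Xi_def integral_scaleR_right by simp
  finally show ?thesis .
qed

text \<open>The substitution x = \<epsilon> y multiplies every integral by \<epsilon>^3, and each of
  the two gradients contributes 1/\<epsilon>. The test function is dilated in the opposite
  direction, so the rescaled equation holds for arbitrary v.\<close>

lemma resolvent_dilation:
  assumes e: "0 < \<epsilon>" and f: "f \<in> bmeas" and u: "W.sob u G"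
    and T[measurable]: "\<And>i k j l. (\<lambda>y. T y i k j l) \<in> bmeas"
    and eq: "\<And>v H. W.sob v H \<Longrightarrow> c * (LBINT x. tform (T ((1 / \<epsilon>) *\<^sub>R x)) (G x) (H x)) + (LBINT x. u x \<bullet> v x) = (LBINT x. f x \<bullet> v x)"
    and v: "W.sob v H"
  shows "c / \<epsilon>\<^sup>2 * W.bil T (\<lambda>x. \<epsilon> *\<^sub>R G (\<epsilon> *\<^sub>R x)) H + (LBINT x. u (\<epsilon> *\<^sub>R x) \<bullet> v x) = (LBINT x. f (\<epsilon> *\<^sub>R x) \<bullet> v x)"
proof -
  note us = W_sobD[OF u] and vs = W_sobD[OF v]
  have [measurable]: "u \<in> bmeas" "G \<in> bmeas" "v \<in> bmeas"
    "H \<in> bmeas" "f \<in> bmeas"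
    using sqi_measurable[OF us(1)] sqi_measurable[OF us(2)] sqi_measurable[OF vs(1)] sqi_measurable[OF vs(2)] f by simp_all
  let ?H = "\<lambda>x. (1 / \<epsilon>) *\<^sub>R H ((1 / \<epsilon>) *\<^sub>R x)"
  have E: "c * (LBINT x. tform (T ((1 / \<epsilon>) *\<^sub>R x)) (G x) (?H x)) + (LBINT x. u x \<bullet> v ((1 / \<epsilon>) *\<^sub>R x))
    = (LBINT x. f x \<bullet> v ((1 / \<epsilon>) *\<^sub>R x))"
    by (rule eq[OF sob_dilation[OF _ v]]) (use e in simp)
  have lin: "tform S (a *\<^sub>R X) Z = a * tform S X Z" "tform S X (a *\<^sub>R Z) = a * tform S X Z" for S a X Z
    using linear_cmul[OF tform_linear_maps(1)[of S]] linear_cmul[OF tform_linear_maps(2)[of S]] by simp_all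
  have m: "(\<lambda>x. tform (T ((1 / \<epsilon>) *\<^sub>R x)) (G x) (?H x)) \<in> bmeas"
    unfolding tform_sum symm_nth by measurable
  have 1: "(LBINT x. tform (T ((1 / \<epsilon>) *\<^sub>R x)) (G x) (?H x)) = \<epsilon> ^ 3 * (W.bil T (\<lambda>x. \<epsilon> *\<^sub>R G (\<epsilon> *\<^sub>R x)) H / \<epsilon>\<^sup>2)"
  proof -
    have "(LBINT x. tform (T ((1 / \<epsilon>) *\<^sub>R x)) (G x) (?H x)) = \<epsilon> ^ 3 * (LBINT x. (1 / \<epsilon>\<^sup>2) * tform (T x) (\<epsilon> *\<^sub>R G (\<epsilon> *\<^sub>R x)) (H x))"
      by (subst integral_dilation[OF _ m, of \<epsilon>]) (use e in \<open>auto simp: lin power2_eq_square\<close>)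
    then show ?thesis unfolding integral_mult_right_zero by (simp add: W.bil_def W_M)
  qed
  have 2: "(LBINT x. p x \<bullet> v ((1 / \<epsilon>) *\<^sub>R x)) = \<epsilon> ^ 3 * (LBINT x. p (\<epsilon> *\<^sub>R x) \<bullet> v x)"
    if [measurable]: "p \<in> bmeas" for p
    using e by (subst integral_dilation[of \<epsilon>]) auto
  have "\<epsilon> ^ 3 * (c / \<epsilon>\<^sup>2 * W.bil T (\<lambda>x. \<epsilon> *\<^sub>R G (\<epsilon> *\<^sub>R x)) H + (LBINT x. u (\<epsilon> *\<^sub>R x) \<bullet> v x))
    = \<epsilon> ^ 3 * (LBINT x. f (\<epsilon> *\<^sub>R x) \<bullet> v x)"
    using E unfolding 1 2[OF \<open>u \<in> bmeas\<close>] 2[OF \<open>f \<in> bmeas\<close>]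
    by (simp add: algebra_simps)
  then show ?thesis using e by simp
qed

section \<open>Symmetry of the form and the resolvents as chosen solutions\<close>

lemma sum_swap4: "(\<Sum>i\<in>I. \<Sum>j\<in>J. \<Sum>k\<in>K. \<Sum>l\<in>L. F i j k l) = (\<Sum>k\<in>K. \<Sum>l\<in>L. \<Sum>i\<in>I. \<Sum>j\<in>J. F i j k l)"
proof -
  have "(\<Sum>i\<in>I. \<Sum>j\<in>J. \<Sum>k\<in>K. \<Sum>l\<in>L. F i j k l) = (\<Sum>i\<in>I. \<Sum>k\<in>K. \<Sum>j\<in>J. \<Sum>l\<in>L. F i j k l)"
    by (intro sum.cong refl sum.swap)
  also have "\<dots> = (\<Sum>k\<in>K. \<Sum>i\<in>I. \<Sum>j\<in>J. \<Sum>l\<in>L. F i j k l)" by (rule sum.swap)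
  also have "\<dots> = (\<Sum>k\<in>K. \<Sum>i\<in>I. \<Sum>l\<in>L. \<Sum>j\<in>J. F i j k l)" by (intro sum.cong refl sum.swap)
  also have "\<dots> = (\<Sum>k\<in>K. \<Sum>l\<in>L. \<Sum>i\<in>I. \<Sum>j\<in>J. F i j k l)" by (intro sum.cong refl sum.swap)
  finally show ?thesis .
qed

lemma tform_symmetric:
  assumes "\<And>i k j l. T i k j l = T k i l j"
  shows "tform T \<xi> \<zeta> = tform T \<zeta> \<xi>"
proof -
  have "tform T \<xi> \<zeta> = (\<Sum>i\<in>UNIV. \<Sum>j\<in>UNIV. \<Sum>k\<in>UNIV. \<Sum>l\<in>UNIV. T i k j l * symm \<xi> $ k $ l * symm \<zeta> $ i $ j)"
    by (simp add: tform_sum sum_distrib_right)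
  also have "\<dots> = (\<Sum>k\<in>UNIV. \<Sum>l\<in>UNIV. \<Sum>i\<in>UNIV. \<Sum>j\<in>UNIV. T i k j l * symm \<xi> $ k $ l * symm \<zeta> $ i $ j)"
    by (rule sum_swap4)
  also have "\<dots> = (\<Sum>k\<in>UNIV. \<Sum>l\<in>UNIV. \<Sum>i\<in>UNIV. \<Sum>j\<in>UNIV. T k i l j * symm \<zeta> $ i $ j * symm \<xi> $ k $ l)"
    by (intro sum.cong refl) (use assms in \<open>simp add: ac_simps\<close>)
  also have "\<dots> = tform T \<zeta> \<xi>" by (simp add: tform_sum sum_distrib_right)
  finally show ?thesis .
qed

text \<open>\<open>res_eps\<close> and \<open>res_hom\<close> keep the first component of a chosen
  pair; this recovers a gradient that belongs to it.\<close>

lemma some_pair: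
  assumes "\<exists>u G. Q u G"
  obtains G where "Q (fst (SOME (u, G). Q u G)) G"
proof -
  have "\<exists>p. case p of (u, G) \<Rightarrow> Q u G" using assms by auto
  from someI_ex[OF this] show ?thesis
    by (intro that[of "snd (SOME (u, G). Q u G)"]) (rule iffD1[OF case_prod_beta])
qed

lemma res_eps_solution:
  assumes ell: "elliptic \<nu> A" and e: "0 < \<epsilon>" and f: "sq2 f"
  obtains G where "W.sob (res_eps A \<epsilon> \<gamma> f) G"
    "\<And>v H. W.sob v H \<Longrightarrow> \<epsilon> powr (-\<gamma>) * (LBINT x. tform (A ((1 / \<epsilon>) *\<^sub>R x)) (G x) (H x))
      + (LBINT x. res_eps A \<epsilon> \<gamma> f x \<bullet> v x) = (LBINT x. f x \<bullet> v x)"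
proof -
  have el: "elliptic \<nu> (\<lambda>x. A ((1 / \<epsilon>) *\<^sub>R x))"
    unfolding elliptic_def
  proof (intro conjI allI)
    fix i k j l
    have [measurable]: "(\<lambda>y. A y i k j l) \<in> bmeas" using ell by (simp add: elliptic_def)
    show "(\<lambda>y. A ((1 / \<epsilon>) *\<^sub>R y) i k j l) \<in> bmeas" by measurable
  qed (use ell in \<open>auto simp: elliptic_def\<close>)
  have "\<exists>u G. W.sob u G \<and> (\<forall>v H. W.sob v H \<longrightarrow> \<epsilon> powr (-\<gamma>) * W.bil (\<lambda>x. A ((1 / \<epsilon>) *\<^sub>R x)) G H
      + (LBINT x. u x \<bullet> v x) = (LBINT x. f x \<bullet> v x))"
    using W.exists_resolvent[OF el, of f "\<epsilon> powr (-\<gamma>)"] f e by (simp add: W_M)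
  then have ex: "\<exists>u G. H1 u G \<and> (\<forall>v H. H1 v H \<longrightarrow>
        \<epsilon> powr (-\<gamma>) * (LBINT x. frob (tapply (A ((1/\<epsilon>) *\<^sub>R x)) (symm (G x))) (symm (H x)))
        + (LBINT x. u x \<bullet> v x) = (LBINT x. f x \<bullet> v x))"
    unfolding W_sob_iff W.bil_def W_M tform_def .
  obtain G where "H1 (res_eps A \<epsilon> \<gamma> f) G \<and> (\<forall>v H. H1 v H \<longrightarrow>
        \<epsilon> powr (-\<gamma>) * (LBINT x. frob (tapply (A ((1/\<epsilon>) *\<^sub>R x)) (symm (G x))) (symm (H x)))
        + (LBINT x. res_eps A \<epsilon> \<gamma> f x \<bullet> v x) = (LBINT x. f x \<bullet> v x))"
    using some_pair[OF ex] unfolding res_eps_def .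
  then show ?thesis by (intro that[of G]) (auto simp: W_sob_iff tform_def)
qed

lemma res_hom_solution:
  assumes ell: "elliptic \<nu> A" and per: "Y.per A" and e: "0 < \<epsilon>" and f: "sq2 f"
  obtains G where "W.sob (res_hom A \<epsilon> \<gamma> f) G"
    "\<And>v H. W.sob v H \<Longrightarrow> \<epsilon> powr (-\<gamma>) * (LBINT x. tform (hom_tensor A) (G x) (H x))
      + (LBINT x. res_hom A \<epsilon> \<gamma> f x \<bullet> v x) = (LBINT x. f x \<bullet> v x)"
proof -
  have "\<exists>u G. W.sob u G \<and> (\<forall>v H. W.sob v H \<longrightarrow> \<epsilon> powr (-\<gamma>) * W.bil (\<lambda>_. hom_tensor A) G H
      + (LBINT x. u x \<bullet> v x) = (LBINT x. f x \<bullet> v x))"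
    using W.exists_resolvent[OF elliptic_hom[OF ell per], of f "\<epsilon> powr (-\<gamma>)"] f e by (simp add: W_M)
  then have ex: "\<exists>u G. H1 u G \<and> (\<forall>v H. H1 v H \<longrightarrow>
        \<epsilon> powr (-\<gamma>) * (LBINT x. Ahom A (symm (G x)) (symm (H x)))
        + (LBINT x. u x \<bullet> v x) = (LBINT x. f x \<bullet> v x))"
    unfolding W_sob_iff W.bil_def W_M tform_hom_tensor[OF ell per] hform_def[OF ell per] .
  obtain G where "H1 (res_hom A \<epsilon> \<gamma> f) G \<and> (\<forall>v H. H1 v H \<longrightarrow>
        \<epsilon> powr (-\<gamma>) * (LBINT x. Ahom A (symm (G x)) (symm (H x)))
        + (LBINT x. res_hom A \<epsilon> \<gamma> f x \<bullet> v x) = (LBINT x. f x \<bullet> v x))"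
    using some_pair[OF ex] unfolding res_hom_def .
  then show ?thesis by (intro that[of G]) (auto simp: W_sob_iff tform_hom_tensor[OF ell per] hform_def[OF ell per])
qed

lemma resolvent_estimate:
  assumes ell: "elliptic \<nu> A" and per: "Y.per A"
  shows "\<exists>C\<ge>0. \<forall>\<epsilon>>0. \<forall>\<gamma> f. sq2 f \<longrightarrow>
    sq2 (\<lambda>x. res_eps A \<epsilon> \<gamma> f x - res_hom A \<epsilon> \<gamma> (Xi \<epsilon> f) x) \<and>
    nl2 (\<lambda>x. res_eps A \<epsilon> \<gamma> f x - res_hom A \<epsilon> \<gamma> (Xi \<epsilon> f) x) \<le> C * \<epsilon> powr ((\<gamma> + 2) / 2) * nl2 f"
proof -
  obtain C where C: "0 \<le> C" and est: "\<forall>\<tau> f F u G u0 G0. 0 < \<tau> \<longrightarrow> sq2 f \<longrightarrow> sq2 F \<longrightarrow> nl2 F \<le> nl2 f \<longrightarrow>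
    (\<forall>v H. W.sob v H \<longrightarrow> \<bar>\<integral>x. (f x - F x) \<bullet> v x \<partial>lborel\<bar> \<le> 9 * nl2 f * nl2 H) \<longrightarrow>
    W.sob u G \<longrightarrow> (\<forall>v H. W.sob v H \<longrightarrow> \<tau> * W.bil A G H + (LBINT x. u x \<bullet> v x) = (LBINT x. f x \<bullet> v x)) \<longrightarrow>
    W.sob u0 G0 \<longrightarrow> (\<forall>v H. W.sob v H \<longrightarrow> \<tau> * W.bil (\<lambda>_. hom_tensor A) G0 H + (LBINT x. u0 x \<bullet> v x) = (LBINT x. F x \<bullet> v x)) \<longrightarrow>
    nl2 (\<lambda>x. u x - u0 x) \<le> C * nl2 f / sqrt \<tau>"
    using scaled_estimate[OF ell per, of 9, OF zero_le_numeral] by (elim exE conjE) (rule that)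
  have "sq2 (\<lambda>x. res_eps A \<epsilon> \<gamma> f x - res_hom A \<epsilon> \<gamma> (Xi \<epsilon> f) x) \<and>
    nl2 (\<lambda>x. res_eps A \<epsilon> \<gamma> f x - res_hom A \<epsilon> \<gamma> (Xi \<epsilon> f) x) \<le> C * \<epsilon> powr ((\<gamma> + 2) / 2) * nl2 f"
    if e: "0 < \<epsilon>" and f: "sq2 f" for \<epsilon> \<gamma> f
  proof -
    let ?u = "res_eps A \<epsilon> \<gamma> f" and ?F = "Xi \<epsilon> f" and ?f = "\<lambda>x. f (\<epsilon> *\<^sub>R x)"
    let ?w = "res_hom A \<epsilon> \<gamma> ?F"
    have i: "0 < 1 / \<epsilon>" using e by simp
    have fs: "sq2 ?f" by (rule sqi_dilation(1)[OF e f])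
    have Fd: "(\<lambda>x. ?F (\<epsilon> *\<^sub>R x)) = Xi 1 ?f" by (rule ext) (rule Xi_dilation[OF e f])
    have F: "sq2 ?F"
    proof -
      have "?F = (\<lambda>x. Xi 1 ?f ((1 / \<epsilon>) *\<^sub>R x))" unfolding Fd[symmetric] using e by simp
      then show ?thesis using sqi_dilation(1)[OF i Xi_estimates(1)[OF fs]] by simp
    qed
    obtain G where G: "W.sob ?u G" "\<And>v H. W.sob v H \<Longrightarrow> \<epsilon> powr (-\<gamma>) * (LBINT x. tform (A ((1 / \<epsilon>) *\<^sub>R x)) (G x) (H x))
      + (LBINT x. ?u x \<bullet> v x) = (LBINT x. f x \<bullet> v x)"
      by (rule res_eps_solution[OF ell e f, where \<gamma>=\<gamma>]) (rule that)
    obtain G0 where G0: "W.sob ?w G0" "\<And>v H. W.sob v H \<Longrightarrow> \<epsilon> powr (-\<gamma>) * (LBINT x. tform (hom_tensor A) (G0 x) (H x))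
      + (LBINT x. ?w x \<bullet> v x) = (LBINT x. ?F x \<bullet> v x)"
      by (rule res_hom_solution[OF ell per e F, where \<gamma>=\<gamma>]) (rule that)
    \<comment> \<open>The coefficient produced by \<open>resolvent_dilation\<close>; its inverse
      square root is the claimed rate.\<close>
    define \<tau> where "\<tau> = \<epsilon> powr (-\<gamma>) / \<epsilon>\<^sup>2"
    have \<tau>: "0 < \<tau>" using e by (simp add: \<tau>_def)
    have Tm: "(\<lambda>y. A y i k j l) \<in> bmeas" for i k j l using ell by (simp add: elliptic_def)
    have fm: "f \<in> bmeas" "?F \<in> bmeas"
      using sqi_measurable[OF f] sqi_measurable[OF F] by simp_all
    have eq: "\<tau> * W.bil A (\<lambda>x. \<epsilon> *\<^sub>R G (\<epsilon> *\<^sub>R x)) H + (LBINT x. ?u (\<epsilon> *\<^sub>R x) \<bullet> v x) = (LBINT x. ?f x \<bullet> v x)"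
      if "W.sob v H" for v H unfolding \<tau>_def by (rule resolvent_dilation[OF e fm(1) G(1) Tm G(2) that])
    have eq0: "\<tau> * W.bil (\<lambda>_. hom_tensor A) (\<lambda>x. \<epsilon> *\<^sub>R G0 (\<epsilon> *\<^sub>R x)) H + (LBINT x. ?w (\<epsilon> *\<^sub>R x) \<bullet> v x) = (LBINT x. Xi 1 ?f x \<bullet> v x)"
      if "W.sob v H" for v H unfolding \<tau>_def Fd[symmetric]
      by (rule resolvent_dilation[where T="\<lambda>_. hom_tensor A", OF e fm(2) G0(1) _ G0(2) that]) simp
    have "nl2 (\<lambda>x. ?u (\<epsilon> *\<^sub>R x) - ?w (\<epsilon> *\<^sub>R x)) \<le> C * nl2 ?f / sqrt \<tau>"
      by (rule est[rule_format, OF \<tau> fs Xi_estimates(1,2)[OF fs] Xi_estimates(3)[OF fs]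
            sob_dilation[OF e G(1)] eq sob_dilation[OF e G0(1)] eq0])
    also have "\<dots> = C * \<epsilon> powr ((\<gamma> + 2) / 2) * nl2 ?f"
    proof -
      let ?p = "\<epsilon> powr ((\<gamma> + 2) / 2)"
      have "?p\<^sup>2 = \<epsilon> powr (\<gamma> + 2)"
        unfolding power2_eq_square powr_add[symmetric] by simp
      also have "\<dots> = \<epsilon> powr \<gamma> * \<epsilon>\<^sup>2" using e powr_numeral[of \<epsilon> Num.num.One] by (simp add: powr_add)
      finally have "?p\<^sup>2 * \<tau> = 1" using e by (simp add: \<tau>_def powr_minus)
      then have "sqrt (?p\<^sup>2 * \<tau>) = 1" by (simp only: real_sqrt_one)
      then have "?p * sqrt \<tau> = 1" by (simp only: real_sqrt_mult real_sqrt_abs abs_of_nonneg[OF powr_ge_zero])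
      then have "1 / sqrt \<tau> = ?p" using \<tau> by (simp add: field_simps)
      then show ?thesis by (simp only: divide_inverse mult_1_left) (simp only: ac_simps)
    qed
    finally have le: "nl2 (\<lambda>x. ?u (\<epsilon> *\<^sub>R x) - ?w (\<epsilon> *\<^sub>R x)) \<le> C * \<epsilon> powr ((\<gamma> + 2) / 2) * nl2 ?f" .
    have d: "sq2 (\<lambda>x. ?u x - ?w x)" by (intro sqi_diff W_sobD(1)[OF G(1)] W_sobD(1)[OF G0(1)])
    \<comment> \<open>Under the dilation the difference and f pick up the same power of \<epsilon>,
      which therefore cancels.\<close>
    have "nl2 (\<lambda>x. ?u x - ?w x) \<le> C * \<epsilon> powr ((\<gamma> + 2) / 2) * nl2 f"
    proof (rule power2_le_imp_le)
      have "(nl2 (\<lambda>x. ?u x - ?w x))\<^sup>2 \<le> \<epsilon> ^ 3 * (C * \<epsilon> powr ((\<gamma> + 2) / 2) * nl2 ?f)\<^sup>2"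
        unfolding sqi_dilation(2)[OF e d] using e by (intro mult_left_mono power_mono le l2n_nonneg) simp
      also have "\<dots> = (C * \<epsilon> powr ((\<gamma> + 2) / 2) * nl2 f)\<^sup>2"
        unfolding power_mult_distrib sqi_dilation(2)[OF e f] by simp
      finally show "(nl2 (\<lambda>x. ?u x - ?w x))\<^sup>2 \<le> (C * \<epsilon> powr ((\<gamma> + 2) / 2) * nl2 f)\<^sup>2" .
    qed (use C in simp)
    with d show ?thesis ..
  qed
  then show ?thesis by (intro exI[of _ C] conjI allI impI C) simp_all
qed

theorem theorem6p6:
  fixes A :: "vec3 \<Rightarrow> tensor4" and \<nu> :: real
  assumes A_periodic: "\<forall>y n. n \<in> lattice \<longrightarrow> A (y + n) = A y"
    and A_meas: "\<forall>i k j l. (\<lambda>y. A y i k j l) \<in> borel_measurable lborel"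
    and A_bdd: "\<forall>i k j l. \<exists>M. AE y in lborel. \<bar>A y i k j l\<bar> \<le> M"
    and A_sym1: "\<forall>y i k j l. A y i k j l = A y j k i l"
    and A_sym2: "\<forall>y i k j l. A y i k j l = A y k i l j"
    and nu_pos: "0 < \<nu>"
    and A_ell: "\<forall>y \<xi>. transpose \<xi> = \<xi> \<longrightarrow>
                   \<nu> * frob \<xi> \<xi> \<le> frob (tapply (A y) \<xi>) \<xi> \<and>
                   frob (tapply (A y) \<xi>) \<xi> \<le> frob \<xi> \<xi> / \<nu>"
  shows "\<exists>\<epsilon>0>0. \<exists>C>0. \<forall>\<epsilon>. 0 < \<epsilon> \<and> \<epsilon> < \<epsilon>0 \<longrightarrow>
           (\<forall>\<gamma>::real. \<gamma> > -2 \<longrightarrow> (\<forall>f. L2 f \<longrightarrow>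
              (\<integral>\<^sup>+ x. ennreal ((norm (res_eps A \<epsilon> \<gamma> f x - res_hom A \<epsilon> \<gamma> (Xi \<epsilon> f) x))\<^sup>2) \<partial>lborel)
                \<le> ennreal ((C * \<epsilon> powr ((\<gamma> + 2) / 2))\<^sup>2)
                    * (\<integral>\<^sup>+ x. ennreal ((norm (f x))\<^sup>2) \<partial>lborel)))"
proof -
  have ell: "elliptic \<nu> A"
    unfolding elliptic_def
  proof (intro conjI allI)
    show "(\<lambda>y. A y i k j l) \<in> bmeas" for i k j l using A_meas by simp
    show "tform (A y) \<xi> \<zeta> = tform (A y) \<zeta> \<xi>" for y \<xi> \<zeta>
      by (rule tform_symmetric) (rule A_sym2[rule_format])
    show "\<nu> * (norm (symm \<xi>))\<^sup>2 \<le> tform (A y) \<xi> \<xi>" "tform (A y) \<xi> \<xi> \<le> (norm (symm \<xi>))\<^sup>2 / \<nu>" for y \<xi>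
      using A_ell[rule_format, OF symm_transpose, of \<xi> y] unfolding tform_def power2_norm_eq_inner frob_inner by blast+
  qed (rule nu_pos)
  have per: "Y.per A" unfolding Y_per periodic_def using A_periodic by blast
  obtain C where C: "0 \<le> C" and est: "\<forall>\<epsilon>>0. \<forall>\<gamma> f. sq2 f \<longrightarrow>
    sq2 (\<lambda>x. res_eps A \<epsilon> \<gamma> f x - res_hom A \<epsilon> \<gamma> (Xi \<epsilon> f) x) \<and>
    nl2 (\<lambda>x. res_eps A \<epsilon> \<gamma> f x - res_hom A \<epsilon> \<gamma> (Xi \<epsilon> f) x) \<le> C * \<epsilon> powr ((\<gamma> + 2) / 2) * nl2 f"
    using resolvent_estimate[OF ell per] by (elim exE conjE) (rule that)
  show ?thesis
  \<comment> \<open>The constant \<open>C\<close> is only known to be nonnegative, hence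
    \<open>C + 1\<close>.\<close>
  proof (rule exI[of _ 1], intro exI[of _ "C + 1"] conjI allI impI)
    fix \<epsilon> \<gamma> :: real and f :: "vec3 \<Rightarrow> vec3" assume e: "0 < \<epsilon> \<and> \<epsilon> < 1" and "-2 < \<gamma>" and f: "L2 f"
    then have fs: "sq2 f" by (simp add: sqi_lborel_iff)
    let ?d = "\<lambda>x. res_eps A \<epsilon> \<gamma> f x - res_hom A \<epsilon> \<gamma> (Xi \<epsilon> f) x"
    have d: "sq2 ?d" "nl2 ?d \<le> C * \<epsilon> powr ((\<gamma> + 2) / 2) * nl2 f"
      using est[rule_format, OF conjunct1[OF e] fs] by blast+
    note d(2)
    also have "C * \<epsilon> powr ((\<gamma> + 2) / 2) * nl2 f \<le> (C + 1) * \<epsilon> powr ((\<gamma> + 2) / 2) * nl2 f"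
      by (intro mult_right_mono) auto
    finally have "(nl2 ?d)\<^sup>2 \<le> ((C + 1) * \<epsilon> powr ((\<gamma> + 2) / 2) * nl2 f)\<^sup>2"
      by (rule power_mono) simp
    then show "(\<integral>\<^sup>+ x. ennreal ((norm (?d x))\<^sup>2) \<partial>lborel)
      \<le> ennreal (((C + 1) * \<epsilon> powr ((\<gamma> + 2) / 2))\<^sup>2) * (\<integral>\<^sup>+ x. ennreal ((norm (f x))\<^sup>2) \<partial>lborel)"
      unfolding nn_sqi[OF d(1)] nn_sqi[OF fs]
      by (simp add: ennreal_mult[symmetric] power_mult_distrib ennreal_leI)
  qed (use C in auto)
qed

end
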